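(* Suppose $q$ is not a root of unity. Let $\alpha,\beta,\alpha',\beta'\in\mathbb{K}^\times$, let $\mathbb{K}_{\alpha,\beta}$, $\mathbb{K}_{\alpha',\beta'}$ be the corresponding simple $\mathbb{K}[g^{\pm1},h^{\pm1}]$-modules, and let $V_{\varepsilon,n}$ be a finite-dimensional simple $U_q(\mathfrak{sl}(2))$-module ($\varepsilon=\pm1$, $n\in\mathbb{Z}_{\ge0}$). Put $$M:=V_{\varepsilon,n}\otimes\mathbb{K}_{\alpha,\beta}\cong V_{\varepsilon,n,\alpha,\beta},\qquad M':=V_{\varepsilon,n}\otimes\mathbb{K}_{\alpha',\beta'}\cong V_{\varepsilon,n,\alpha',\beta'}.$$ Then the assignment $V_{\varepsilon,n}\otimes-$ is an isomorphism of vector spaces from $\mathrm{Ext}^1_{\mathbb{K}[g^{\pm1},h^{\pm1}]}(\mathbb{K}_{\alpha',\beta'},\mathbb{K}_{\alpha,\beta})$ to $\mathrm{Ext}^1_{U_{g,h}}(M',M)$. Moreover, for $\varepsilon,\varepsilon'\in\{\pm1\}$, $m,n\in\mathbb{Z}_{\ge0}$ and $\alpha,\beta,\alpha',\beta'\in\mathbb{K}^\times$, one has $\mathrm{Ext}^1_{U_{g,h}}(V_{\varepsilon,m,\alpha,\beta},V_{\varepsilon',n,\alpha',\beta'})=0$ provided that $(\varepsilon,m,\alpha,\beta)\neq(\varepsilon',n,\alpha',\beta')$.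
   Context: $\mathbb{K}$ is an algebraically closed field of characteristic zero, and $q\in\mathbb{K}$ is nonzero with $q^2\neq 1$. $U_{g,h}$ is the unital associative $\mathbb{K}$-algebra generated by $E,F,K^{\pm1},g^{\pm1},h^{\pm1}$ with relations: $KK^{-1}=K^{-1}K=gg^{-1}=g^{-1}g=hh^{-1}=h^{-1}h=1$; $g$ and $h$ commute with each other and with $E,F,K$; $KEK^{-1}=q^2E$; $KFK^{-1}=q^{-2}F$; $EF-FE=\frac{K-K^{-1}g^2}{q-q^{-1}}$. All modules are left modules. $U_q(\mathfrak{sl}(2))$ is the $\mathbb{K}$-algebra generated by $E',F',K'^{\pm1}$ with $K'E'K'^{-1}=q^2E'$, $K'F'K'^{-1}=q^{-2}F'$, $E'F'-F'E'=\frac{K'-K'^{-1}}{q-q^{-1}}$. There is an algebra isomorphism $U_{g,h}\cong U_q(\mathfrak{sl}(2))\otimes\mathbb{K}[g^{\pm1},h^{\pm1}]$ given by $E\mapsto E'\otimes g$, $F\mapsto F'\otimes1$, $K\mapsto K'\otimes g$, $g\mapsto1\otimes g$, $h\mapsto1\otimes h$. If $V$ is a $U_q(\mathfrak{sl}(2))$-module and $N$ a $\mathbb{K}[g^{\pm1},h^{\pm1}]$-module, $V\otimes N$ is a $U_{g,h}$-module via this isomorphism; the assignment $V\otimes-$ sends the class of a short exact sequence $0\to N_1\xrightarrow{\varphi} N\xrightarrow{\psi} N_2\to0$ to the class of $0\to V\otimes N_1\xrightarrow{\mathrm{id}\otimes\varphi} V\otimes N\xrightarrow{\mathrm{id}\otimes\psi}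 V\otimes N_2\to0$. $\mathbb{K}_{\alpha,\beta}$ is the one-dimensional $\mathbb{K}[g^{\pm1},h^{\pm1}]$-module on which $g$ acts by $\alpha$ and $h$ by $\beta$. With $[m]=\frac{q^m-q^{-m}}{q-q^{-1}}$, $V_{\varepsilon,n}$ is the $(n+1)$-dimensional simple $U_q(\mathfrak{sl}(2))$-module with basis $v_0,\dots,v_n$ and $K'v_p=\varepsilon q^{n-2p}v_p$, $F'v_p=[p+1]v_{p+1}$ ($p<n$), $F'v_n=0$, $E'v_p=\varepsilon[n-p+1]v_{p-1}$ ($p\ge1$), $E'v_0=0$. $V_{\varepsilon,n,\alpha,\beta}$ is the $(n+1)$-dimensional simple $U_{g,h}$-module generated by a vector $v\ne0$ with $Ev=0$, $Kv=\varepsilon\alpha q^nv$, $gv=\alpha v$, $hv=\beta v$. *)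

theory Defs
  imports
    "HOL-Computational_Algebra.Polynomial"
    "HOL-Library.Poly_Mapping"
    "HOL-Library.Product_Plus"
    "HOL-Algebra.QuotRing"
    "HOL-Algebra.Module"
begin

section \<open>Algebras over a field and their left modules\<close>

text \<open>
  A \<open>'k\<close>-algebra is an associative unital ring (in the sense of HOL-Algebra) together with its
  structure map \<open>scal\<close> from the field into the centre. Left modules over an algebra or over a
  ring use the record \<^type>\<open>module\<close>; the locale of the same name cannot be used since it demands
  a commutative ring. The ring fields \<open>mult\<close> and \<open>one\<close> of a module record carry no information.
\<close>

record ('k, 'a) kalgebra = "'a ring" +
  scal :: "'k \<Rightarrow> 'a"

locale left_module = R?: ring R + M?: abelian_group M
  for R (structure) and M :: "('a, 'm, 'z) module_scheme" (structure) +
  assumes lsmult_closed: "\<lbrakk>a \<in> carrier R; x \<in> carrier M\<rbrakk> \<Longrightarrow> a \<odot>\<^bsub>M\<^esub> x \<in> carrier M"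
    and lsmult_l_distr: "\<lbrakk>a \<in> carrier R; b \<in> carrier R; x \<in> carrier M\<rbrakk> \<Longrightarrow>
      (a \<oplus>\<^bsub>R\<^esub> b) \<odot>\<^bsub>M\<^esub> x = a \<odot>\<^bsub>M\<^esub> x \<oplus>\<^bsub>M\<^esub> b \<odot>\<^bsub>M\<^esub> x"
    and lsmult_r_distr: "\<lbrakk>a \<in> carrier R; x \<in> carrier M; y \<in> carrier M\<rbrakk> \<Longrightarrow>
      a \<odot>\<^bsub>M\<^esub> (x \<oplus>\<^bsub>M\<^esub> y) = a \<odot>\<^bsub>M\<^esub> x \<oplus>\<^bsub>M\<^esub> a \<odot>\<^bsub>M\<^esub> y"
    and lsmult_assoc: "\<lbrakk>a \<in> carrier R; b \<in> carrier R; x \<in> carrier M\<rbrakk> \<Longrightarrow>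
      (a \<otimes>\<^bsub>R\<^esub> b) \<odot>\<^bsub>M\<^esub> x = a \<odot>\<^bsub>M\<^esub> (b \<odot>\<^bsub>M\<^esub> x)"
    and lsmult_one: "x \<in> carrier M \<Longrightarrow> \<one>\<^bsub>R\<^esub> \<odot>\<^bsub>M\<^esub> x = x"

definition module_hom ::
  "('a, 'r) ring_scheme \<Rightarrow> ('a, 'm) module \<Rightarrow> ('a, 'n) module \<Rightarrow> ('m \<Rightarrow> 'n) \<Rightarrow> bool" where
  "module_hom R M N f \<longleftrightarrow>
     f \<in> carrier M \<rightarrow> carrier N \<and>
     (\<forall>x\<in>carrier M. \<forall>y\<in>carrier M. f (x \<oplus>\<^bsub>M\<^esub> y) = f x \<oplus>\<^bsub>N\<^esub> f y) \<and>
     (\<forall>a\<in>carrier R. \<forall>x\<in>carrier M. f (a \<odot>\<^bsub>M\<^esub> x) = a \<odot>\<^bsub>N\<^esub> f x)"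

definition module_iso ::
  "('a, 'r) ring_scheme \<Rightarrow> ('a, 'm) module \<Rightarrow> ('a, 'n) module \<Rightarrow> ('m \<Rightarrow> 'n) \<Rightarrow> bool" where
  "module_iso R M N f \<longleftrightarrow> module_hom R M N f \<and> bij_betw f (carrier M) (carrier N)"

definition isomorphic_modules ::
  "('a, 'r) ring_scheme \<Rightarrow> ('a, 'm) module \<Rightarrow> ('a, 'n) module \<Rightarrow> bool" where
  "isomorphic_modules R M N \<longleftrightarrow> (\<exists>f. module_iso R M N f)"

definition simple_module :: "('a, 'r) ring_scheme \<Rightarrow> ('a, 'm) module \<Rightarrow> bool" where
  "simple_module R M \<longleftrightarrow> left_module R M \<and> carrier M \<noteq> {\<zero>\<^bsub>M\<^esub>} \<and>
     (\<forall>H. submodule H R M \<longrightarrow> H = {\<zero>\<^bsub>M\<^esub>} \<or> H = carrier M)"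

definition module_span :: "('a, 'r) ring_scheme \<Rightarrow> ('a, 'm) module \<Rightarrow> 'm set \<Rightarrow> 'm set" where
  "module_span R M S = \<Inter>{H. submodule H R M \<and> S \<subseteq> H}"

definition direct_sum :: "('a, 'm) module \<Rightarrow> ('a, 'n) module \<Rightarrow> ('a, 'm \<times> 'n) module" where
  "direct_sum M N = \<lparr>carrier = carrier M \<times> carrier N, monoid.mult = undefined, one = undefined,
     zero = (\<zero>\<^bsub>M\<^esub>, \<zero>\<^bsub>N\<^esub>), add = (\<lambda>(x, y) (x', y'). (x \<oplus>\<^bsub>M\<^esub> x', y \<oplus>\<^bsub>N\<^esub> y')),
     smult = (\<lambda>a (x, y). (a \<odot>\<^bsub>M\<^esub> x, a \<odot>\<^bsub>N\<^esub> y))\<rparr>"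

definition quotient_module :: "('a, 'm) module \<Rightarrow> 'm set \<Rightarrow> ('a, 'm set) module" where
  "quotient_module M D = \<lparr>carrier = a_rcosets\<^bsub>M\<^esub> D, monoid.mult = undefined, one = undefined,
     zero = D, add = set_add M, smult = (\<lambda>a C. \<Union>x\<in>C. D +>\<^bsub>M\<^esub> (a \<odot>\<^bsub>M\<^esub> x))\<rparr>"

definition field_ring :: "'k::field ring" where
  "field_ring = \<lparr>carrier = UNIV, monoid.mult = (*), one = 1, zero = 0, add = (+)\<rparr>"

definition vspace :: "('k, 'a) kalgebra \<Rightarrow> ('a, 'm) module \<Rightarrow> ('k, 'm) module" where
  "vspace A M = \<lparr>carrier = carrier M, monoid.mult = undefined, one = undefined,
     zero = \<zero>\<^bsub>M\<^esub>, add = add M, smult = (\<lambda>c x. scal A c \<odot>\<^bsub>M\<^esub> x)\<rparr>"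

definition has_dimension :: "('k::field, 'm) module \<Rightarrow> nat \<Rightarrow> bool" where
  "has_dimension W d \<longleftrightarrow> (\<exists>b \<in> {..<d} \<rightarrow> carrier W. \<forall>x\<in>carrier W.
     \<exists>!c. c \<in> {..<d} \<rightarrow>\<^sub>E UNIV \<and> x = (\<Oplus>\<^bsub>W\<^esub>i\<in>{..<d}. c i \<odot>\<^bsub>W\<^esub> b i))"


section \<open>The vector space of extensions\<close>

text \<open>
  A triple \<open>(X, \<phi>, \<psi>)\<close> is a short exact sequence \<open>0 \<rightarrow> Q \<rightarrow> X \<rightarrow> P \<rightarrow> 0\<close>, representing
  an element of \<open>Ext\<^sup>1(P, Q)\<close>. Only the values of \<open>\<phi>\<close> and \<open>\<psi>\<close> on the carriers matter.
\<close>

type_synonym ('a, 'q, 'x, 'p) ses = "('a, 'x) module \<times> ('q \<Rightarrow> 'x) \<times> ('x \<Rightarrow> 'p)"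

definition is_extension ::
  "('a, 'r) ring_scheme \<Rightarrow> ('a, 'p) module \<Rightarrow> ('a, 'q) module \<Rightarrow> ('a, 'q, 'x, 'p) ses \<Rightarrow> bool" where
  "is_extension R P Q = (\<lambda>(X, \<phi>, \<psi>).
     left_module R X \<and> module_hom R Q X \<phi> \<and> module_hom R X P \<psi> \<and>
     inj_on \<phi> (carrier Q) \<and>
     \<phi> ` carrier Q = {x \<in> carrier X. \<psi> x = \<zero>\<^bsub>P\<^esub>} \<and>
     \<psi> ` carrier X = carrier P)"

definition ext_equiv ::
  "('a, 'r) ring_scheme \<Rightarrow> ('a, 'p) module \<Rightarrow> ('a, 'q) module \<Rightarrow>
   ('a, 'q, 'x, 'p) ses \<Rightarrow> ('a, 'q, 'y, 'p) ses \<Rightarrow> bool" where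
  "ext_equiv R P Q = (\<lambda>(X, \<phi>, \<psi>) (Y, \<phi>', \<psi>'). \<exists>\<theta>. module_iso R X Y \<theta> \<and>
     (\<forall>z\<in>carrier Q. \<theta> (\<phi> z) = \<phi>' z) \<and> (\<forall>x\<in>carrier X. \<psi>' (\<theta> x) = \<psi> x))"

text \<open>
  The equivalence class of an extension with an arbitrary middle type \<open>'x\<close> is cut down to those
  members whose middle module lives on the type \<open>'q \<times> 'p\<close>. This makes all classes elements of one
  type, and nothing is lost: over a field, the middle term of an extension is as a vector space
  isomorphic to the direct sum of \<open>Q\<close> and \<open>P\<close>, so every extension is equivalent to one on
  \<open>'q \<times> 'p\<close>.
\<close>

type_synonym ('a, 'q, 'p) ext_class = "('a, 'q, 'q \<times> 'p, 'p) ses set"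

definition ext_class ::
  "('a, 'r) ring_scheme \<Rightarrow> ('a, 'p) module \<Rightarrow> ('a, 'q) module \<Rightarrow>
   ('a, 'q, 'x, 'p) ses \<Rightarrow> ('a, 'q, 'p) ext_class" where
  "ext_class R P Q \<xi> = {\<eta>. is_extension R P Q \<eta> \<and> ext_equiv R P Q \<xi> \<eta>}"

text \<open>
  The Baer sum of two extensions is the pullback of the two middle terms over \<open>P\<close>, modulo the
  antidiagonal copy of \<open>Q\<close>.
\<close>

definition baer_sum ::
  "('a, 'q) module \<Rightarrow> ('a, 'q, 'x, 'p) ses \<Rightarrow> ('a, 'q, 'y, 'p) ses \<Rightarrow>
   ('a, 'q, ('x \<times> 'y) set, 'p) ses" where
  "baer_sum Q = (\<lambda>(X, \<phi>, \<psi>) (Y, \<phi>', \<psi>').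
     let G = (direct_sum X Y)\<lparr>carrier := {(x, y). x \<in> carrier X \<and> y \<in> carrier Y \<and> \<psi> x = \<psi>' y}\<rparr>;
         D = (\<lambda>z. (\<phi> z, \<ominus>\<^bsub>Y\<^esub> \<phi>' z)) ` carrier Q
     in (quotient_module G D,
         \<lambda>z. D +>\<^bsub>G\<^esub> (\<phi> z, \<zero>\<^bsub>Y\<^esub>),
         \<lambda>C. \<psi> (fst (SOME w. w \<in> C))))"

text \<open>A scalar \<open>c\<close> acts by pullback along the endomorphism \<open>c\<close> of \<open>P\<close>.\<close>

definition ext_scale ::
  "('k, 'a) kalgebra \<Rightarrow> ('a, 'p) module \<Rightarrow> 'k \<Rightarrow> ('a, 'q, 'x, 'p) ses \<Rightarrow>
   ('a, 'q, 'x \<times> 'p, 'p) ses" where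
  "ext_scale A P c = (\<lambda>(X, \<phi>, \<psi>).
     ((direct_sum X P)\<lparr>carrier :=
         {(x, p). x \<in> carrier X \<and> p \<in> carrier P \<and> \<psi> x = scal A c \<odot>\<^bsub>P\<^esub> p}\<rparr>,
      \<lambda>z. (\<phi> z, \<zero>\<^bsub>P\<^esub>),
      snd))"

definition split_ext :: "('a, 'p) module \<Rightarrow> ('a, 'q) module \<Rightarrow> ('a, 'q, 'q \<times> 'p, 'p) ses" where
  "split_ext P Q = (direct_sum Q P, \<lambda>z. (z, \<zero>\<^bsub>P\<^esub>), snd)"

definition Ext1 ::
  "('k, 'a) kalgebra \<Rightarrow> ('a, 'p) module \<Rightarrow> ('a, 'q) module \<Rightarrow>
   ('k, ('a, 'q, 'p) ext_class) module" where
  "Ext1 A P Q = \<lparr>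
     carrier = {ext_class A P Q \<xi> |\<xi> :: ('a, 'q, 'q \<times> 'p, 'p) ses. is_extension A P Q \<xi>},
     monoid.mult = undefined, one = undefined,
     zero = ext_class A P Q (split_ext P Q),
     add = (\<lambda>C D. \<Union>\<xi>\<in>C. \<Union>\<eta>\<in>D. ext_class A P Q (baer_sum Q \<xi> \<eta>)),
     smult = (\<lambda>c C. \<Union>\<xi>\<in>C. ext_class A P Q (ext_scale A P c \<xi>))\<rparr>"


section \<open>Algebras given by generators and relations\<close>

datatype 'x word = Word (letters: "'x list")

instantiation word :: (type) monoid_add
begin

definition zero_word :: "'x word" where "zero_word = Word []"

definition plus_word :: "'x word \<Rightarrow> 'x word \<Rightarrow> 'x word" where
  "plus_word v w = Word (letters v @ letters w)"

instance
  by standard (simp_all add: zero_word_def plus_word_def)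

end

text \<open>
  The monoid algebra of a monoid \<open>'m\<close>; for \<open>'m = 'x word\<close> it is the free associative algebra on
  \<open>'x\<close>, and for \<open>'m = int \<times> int\<close> the algebra of Laurent polynomials in two variables.
\<close>

definition monoid_algebra :: "('k, 'm::monoid_add \<Rightarrow>\<^sub>0 'k::field) kalgebra" where
  "monoid_algebra = \<lparr>carrier = UNIV, monoid.mult = (*), one = 1, zero = 0, add = (+),
     scal = Poly_Mapping.single 0\<rparr>"

type_synonym ('x, 'k) free_alg = "'x word \<Rightarrow>\<^sub>0 'k"

definition var :: "'x \<Rightarrow> ('x, 'k::field) free_alg" where
  "var x = Poly_Mapping.single (Word [x]) 1"

definition const :: "'k::field \<Rightarrow> ('x, 'k) free_alg" where
  "const c = Poly_Mapping.single 0 c"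

definition presented_algebra ::
  "('x, 'k::field) free_alg set \<Rightarrow> ('k, ('x, 'k) free_alg set) kalgebra" where
  "presented_algebra S =
     (let I = Idl\<^bsub>monoid_algebra\<^esub> S; Q = monoid_algebra Quot I
      in \<lparr>carrier = carrier Q, monoid.mult = monoid.mult Q, one = \<one>\<^bsub>Q\<^esub>,
          zero = \<zero>\<^bsub>Q\<^esub>, add = add Q, scal = (\<lambda>c. I +>\<^bsub>monoid_algebra\<^esub> const c)\<rparr>)"

definition generator ::
  "('x, 'k::field) free_alg set \<Rightarrow> 'x \<Rightarrow> ('x, 'k) free_alg set" where
  "generator S x = Idl\<^bsub>monoid_algebra\<^esub> S +>\<^bsub>monoid_algebra\<^esub> var x"

text \<open>
  The module over a presented algebra which is afforded by a vector space \<open>W\<close> and linear operators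
  \<open>\<rho> x\<close>, one for each generator \<open>x\<close>. It is meant for operators that satisfy the
  defining relations; then the choice of the representative is immaterial.
\<close>

definition free_action ::
  "('k::field, 'm) module \<Rightarrow> ('x \<Rightarrow> 'm \<Rightarrow> 'm) \<Rightarrow> ('x, 'k) free_alg \<Rightarrow> 'm \<Rightarrow> 'm" where
  "free_action W \<rho> p v =
     (\<Oplus>\<^bsub>W\<^esub>w\<in>Poly_Mapping.keys p. Poly_Mapping.lookup p w \<odot>\<^bsub>W\<^esub> foldr \<rho> (letters w) v)"

definition module_of_operators ::
  "('k::field, 'm) module \<Rightarrow> ('x \<Rightarrow> 'm \<Rightarrow> 'm) \<Rightarrow> (('x, 'k) free_alg set, 'm) module" where
  "module_of_operators W \<rho> = \<lparr>carrier = carrier W, monoid.mult = undefined, one = undefined,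
     zero = \<zero>\<^bsub>W\<^esub>, add = add W, smult = (\<lambda>u. free_action W \<rho> (SOME p. p \<in> u))\<rparr>"


section \<open>Tensor products of vector spaces\<close>

definition free_space :: "'s set \<Rightarrow> ('k::field, 's \<Rightarrow>\<^sub>0 'k) module" where
  "free_space S = \<lparr>carrier = {p. Poly_Mapping.keys p \<subseteq> S},
     monoid.mult = undefined, one = undefined, zero = 0, add = (+),
     smult = (\<lambda>c. Poly_Mapping.map ((*) c))\<rparr>"

definition bilinear_relations ::
  "('k::field, 'v) module \<Rightarrow> ('k, 'w) module \<Rightarrow> ('v \<times> 'w \<Rightarrow>\<^sub>0 'k) set" where
  "bilinear_relations V W =
     {Poly_Mapping.single (v \<oplus>\<^bsub>V\<^esub> v', w) 1 - Poly_Mapping.single (v, w) 1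
        - Poly_Mapping.single (v', w) 1 |v v' w.
        v \<in> carrier V \<and> v' \<in> carrier V \<and> w \<in> carrier W} \<union>
     {Poly_Mapping.single (v, w \<oplus>\<^bsub>W\<^esub> w') 1 - Poly_Mapping.single (v, w) 1
        - Poly_Mapping.single (v, w') 1 |v w w'.
        v \<in> carrier V \<and> w \<in> carrier W \<and> w' \<in> carrier W} \<union>
     {Poly_Mapping.single (c \<odot>\<^bsub>V\<^esub> v, w) 1 - Poly_Mapping.single (v, w) c |c v w.
        v \<in> carrier V \<and> w \<in> carrier W} \<union>
     {Poly_Mapping.single (v, c \<odot>\<^bsub>W\<^esub> w) 1 - Poly_Mapping.single (v, w) c |c v w.
        v \<in> carrier V \<and> w \<in> carrier W}"

definition tensor_null ::
  "('k::field, 'v) module \<Rightarrow> ('k, 'w) module \<Rightarrow> ('v \<times> 'w \<Rightarrow>\<^sub>0 'k) set" where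
  "tensor_null V W =
     module_span field_ring (free_space (carrier V \<times> carrier W)) (bilinear_relations V W)"

definition tensor_space ::
  "('k::field, 'v) module \<Rightarrow> ('k, 'w) module \<Rightarrow> ('k, ('v \<times> 'w \<Rightarrow>\<^sub>0 'k) set) module" where
  "tensor_space V W = quotient_module (free_space (carrier V \<times> carrier W)) (tensor_null V W)"

text \<open>
  \<open>tensor_map V' W' f s\<close> is the map \<open>f \<otimes> s\<close> with values in \<open>V' \<otimes> W'\<close>; its source need not be
  mentioned, as it acts on the members of a coset by \<open>(v, w) \<mapsto> (f v, s w)\<close>.
\<close>

definition tensor_map ::
  "('k::field, 'v2) module \<Rightarrow> ('k, 'w2) module \<Rightarrow> ('v1 \<Rightarrow> 'v2) \<Rightarrow> ('w1 \<Rightarrow> 'w2) \<Rightarrow>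
   ('v1 \<times> 'w1 \<Rightarrow>\<^sub>0 'k) set \<Rightarrow> ('v2 \<times> 'w2 \<Rightarrow>\<^sub>0 'k) set" where
  "tensor_map V' W' f s C = (\<Union>p\<in>C.
     tensor_null V' W' +>\<^bsub>free_space (carrier V' \<times> carrier W')\<^esub>
       (\<Sum>x\<in>Poly_Mapping.keys p.
          Poly_Mapping.single (map_prod f s x) (Poly_Mapping.lookup p x)))"


section \<open>The algebras \<open>U\<^sub>q(sl(2))\<close>, \<open>U\<^sub>g\<^sub>,\<^sub>h\<close> and the Laurent polynomials\<close>

datatype sl2_gen = E_sl2 | F_sl2 | K_sl2 | Kinv_sl2

definition sl2_relations :: "'k::field \<Rightarrow> (sl2_gen, 'k) free_alg set" where
  "sl2_relations q =
    (let e = var E_sl2; f = var F_sl2; k = var K_sl2; k' = var Kinv_sl2 in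
     {k * k' - 1, k' * k - 1,
      k * e * k' - const (q\<^sup>2) * e,
      k * f * k' - const (inverse (q\<^sup>2)) * f,
      e * f - f * e - const (inverse (q - inverse q)) * (k - k')})"

abbreviation Uq :: "'k::field \<Rightarrow> ('k, (sl2_gen, 'k) free_alg set) kalgebra" where
  "Uq q \<equiv> presented_algebra (sl2_relations q)"

datatype gh_gen = E_gh | F_gh | K_gh | Kinv_gh | g_gh | ginv_gh | h_gh | hinv_gh

definition gh_relations :: "'k::field \<Rightarrow> (gh_gen, 'k) free_alg set" where
  "gh_relations q =
    (let X = var in
     {X K_gh * X Kinv_gh - 1, X Kinv_gh * X K_gh - 1,
      X g_gh * X ginv_gh - 1, X ginv_gh * X g_gh - 1,
      X h_gh * X hinv_gh - 1, X hinv_gh * X h_gh - 1,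
      X g_gh * X h_gh - X h_gh * X g_gh,
      X g_gh * X E_gh - X E_gh * X g_gh, X g_gh * X F_gh - X F_gh * X g_gh, X g_gh * X K_gh - X K_gh * X g_gh,
      X h_gh * X E_gh - X E_gh * X h_gh, X h_gh * X F_gh - X F_gh * X h_gh, X h_gh * X K_gh - X K_gh * X h_gh,
      X K_gh * X E_gh * X Kinv_gh - const (q\<^sup>2) * X E_gh,
      X K_gh * X F_gh * X Kinv_gh - const (inverse (q\<^sup>2)) * X F_gh,
      X E_gh * X F_gh - X F_gh * X E_gh - const (inverse (q - inverse q)) * (X K_gh - X Kinv_gh * (X g_gh)\<^sup>2)})"

abbreviation Ugh :: "'k::field \<Rightarrow> ('k, (gh_gen, 'k) free_alg set) kalgebra" where
  "Ugh q \<equiv> presented_algebra (gh_relations q)"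

type_synonym 'k laurent = "int \<times> int \<Rightarrow>\<^sub>0 'k"

abbreviation Laurent :: "('k::field, 'k laurent) kalgebra" where
  "Laurent \<equiv> monoid_algebra"

abbreviation laurent_monom :: "int \<Rightarrow> int \<Rightarrow> 'k::field laurent" where
  "laurent_monom i j \<equiv> Poly_Mapping.single (i, j) 1"


section \<open>The modules\<close>

definition K_module :: "'k::field \<Rightarrow> 'k \<Rightarrow> ('k laurent, 'k) module" where
  "K_module \<alpha> \<beta> = \<lparr>carrier = UNIV, monoid.mult = undefined, one = undefined, zero = 0, add = (+),
     smult = (\<lambda>p x. (\<Sum>(i, j)\<in>Poly_Mapping.keys p.
       Poly_Mapping.lookup p (i, j) * \<alpha> powi i * \<beta> powi j) * x)\<rparr>"

definition qint :: "'k::field \<Rightarrow> nat \<Rightarrow> 'k" where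
  "qint q m = (q ^ m - inverse q ^ m) / (q - inverse q)"

text \<open>
  \<open>V\<^sub>\<epsilon>\<^sub>,\<^sub>n\<close> is realised on the functions \<open>nat \<Rightarrow> 'k\<close> supported on \<open>{..n}\<close>, with the basis
  \<open>v\<^sub>p = basis_vec p\<close>; the operators extend the prescribed values on the basis linearly.
\<close>

definition basis_vec :: "nat \<Rightarrow> nat \<Rightarrow> 'k::field" where
  "basis_vec p = (\<lambda>i. if i = p then 1 else 0)"

definition coord_space :: "nat \<Rightarrow> ('k::field, nat \<Rightarrow> 'k) module" where
  "coord_space n = \<lparr>carrier = {u. \<forall>i>n. u i = 0}, monoid.mult = undefined, one = undefined,
     zero = (\<lambda>_. 0), add = (\<lambda>u w i. u i + w i), smult = (\<lambda>c u i. c * u i)\<rparr>"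

fun V_operator :: "'k::field \<Rightarrow> 'k \<Rightarrow> nat \<Rightarrow> sl2_gen \<Rightarrow> (nat \<Rightarrow> 'k) \<Rightarrow> nat \<Rightarrow> 'k" where
  "V_operator q \<epsilon> n K_sl2 u =
     (\<lambda>i. \<Sum>p\<le>n. u p * (\<epsilon> * q powi (int n - 2 * int p)) * basis_vec p i)"
| "V_operator q \<epsilon> n Kinv_sl2 u =
     (\<lambda>i. \<Sum>p\<le>n. u p * inverse (\<epsilon> * q powi (int n - 2 * int p)) * basis_vec p i)"
| "V_operator q \<epsilon> n F_sl2 u = (\<lambda>i. \<Sum>p<n. u p * qint q (p + 1) * basis_vec (p + 1) i)"
| "V_operator q \<epsilon> n E_sl2 u = (\<lambda>i. \<Sum>p=1..n. u p * (\<epsilon> * qint q (n - p + 1)) * basis_vec (p - 1) i)"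

definition V_module ::
  "'k::field \<Rightarrow> 'k \<Rightarrow> nat \<Rightarrow> ((sl2_gen, 'k) free_alg set, nat \<Rightarrow> 'k) module" where
  "V_module q \<epsilon> n = module_of_operators (coord_space n) (V_operator q \<epsilon> n)"

text \<open>
  The \<open>U\<^sub>g\<^sub>,\<^sub>h\<close>-module \<open>V \<otimes> N\<close>: via the isomorphism of \<open>U\<^sub>g\<^sub>,\<^sub>h\<close> with
  \<open>U\<^sub>q(sl(2)) \<otimes> \<K>[g, g\<^sup>-\<^sup>1, h, h\<^sup>-\<^sup>1]\<close> the generators act as \<open>E' \<otimes> g\<close>, \<open>F' \<otimes> 1\<close>, \<open>K' \<otimes> g\<close>,
  \<open>1 \<otimes> g\<close>, \<open>1 \<otimes> h\<close>.
\<close>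

fun tensor_operator ::
  "'k::field \<Rightarrow> ((sl2_gen, 'k) free_alg set, 'v) module \<Rightarrow> ('k laurent, 'n) module \<Rightarrow> gh_gen \<Rightarrow>
   ('v \<times> 'n \<Rightarrow>\<^sub>0 'k) set \<Rightarrow> ('v \<times> 'n \<Rightarrow>\<^sub>0 'k) set" where
  "tensor_operator q V N x =
    (let X = (\<lambda>y v. generator (sl2_relations q) y \<odot>\<^bsub>V\<^esub> v);
         L = (\<lambda>i j z. laurent_monom i j \<odot>\<^bsub>N\<^esub> z);
         T = tensor_map (vspace (Uq q) V) (vspace Laurent N)
     in case x of
          E_gh \<Rightarrow> T (X E_sl2) (L 1 0)
        | F_gh \<Rightarrow> T (X F_sl2) id
        | K_gh \<Rightarrow> T (X K_sl2) (L 1 0)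
        | Kinv_gh \<Rightarrow> T (X Kinv_sl2) (L (-1) 0)
        | g_gh \<Rightarrow> T id (L 1 0)
        | ginv_gh \<Rightarrow> T id (L (-1) 0)
        | h_gh \<Rightarrow> T id (L 0 1)
        | hinv_gh \<Rightarrow> T id (L 0 (-1)))"

definition tensor_module ::
  "'k::field \<Rightarrow> ((sl2_gen, 'k) free_alg set, 'v) module \<Rightarrow> ('k laurent, 'n) module \<Rightarrow>
   ((gh_gen, 'k) free_alg set, ('v \<times> 'n \<Rightarrow>\<^sub>0 'k) set) module" where
  "tensor_module q V N =
     module_of_operators (tensor_space (vspace (Uq q) V) (vspace Laurent N)) (tensor_operator q V N)"

text \<open>
  The assignment \<open>V \<otimes> -\<close> on short exact sequences \<open>0 \<rightarrow> N\<^sub>1 \<rightarrow> N \<rightarrow> N\<^sub>2 \<rightarrow> 0\<close>, and on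
  their classes.
\<close>

definition tensor_ses ::
  "'k::field \<Rightarrow> ((sl2_gen, 'k) free_alg set, 'v) module \<Rightarrow>
   ('k laurent, 'n2) module \<Rightarrow> ('k laurent, 'n1) module \<Rightarrow> ('k laurent, 'n1, 'n, 'n2) ses \<Rightarrow>
   ((gh_gen, 'k) free_alg set, ('v \<times> 'n1 \<Rightarrow>\<^sub>0 'k) set, ('v \<times> 'n \<Rightarrow>\<^sub>0 'k) set, ('v \<times> 'n2 \<Rightarrow>\<^sub>0 'k) set) ses"
  where
  "tensor_ses q V N2 N1 = (\<lambda>(N, \<phi>, \<psi>).
     (tensor_module q V N,
      tensor_map (vspace (Uq q) V) (vspace Laurent N) id \<phi>,
      tensor_map (vspace (Uq q) V) (vspace Laurent N2) id \<psi>))"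

definition tensor_ext ::
  "'k::field \<Rightarrow> ((sl2_gen, 'k) free_alg set, 'v) module \<Rightarrow>
   ('k laurent, 'n2) module \<Rightarrow> ('k laurent, 'n1) module \<Rightarrow> ('k laurent, 'n1, 'n2) ext_class \<Rightarrow>
   ((gh_gen, 'k) free_alg set, ('v \<times> 'n1 \<Rightarrow>\<^sub>0 'k) set, ('v \<times> 'n2 \<Rightarrow>\<^sub>0 'k) set) ext_class" where
  "tensor_ext q V N2 N1 C =
     (\<Union>\<xi>\<in>C. ext_class (Ugh q) (tensor_module q V N2) (tensor_module q V N1) (tensor_ses q V N2 N1 \<xi>))"

text \<open>\<open>is_V_gh q \<epsilon> n \<alpha> \<beta> M\<close>: the module \<open>M\<close> is (a copy of) \<open>V\<^sub>\<epsilon>\<^sub>,\<^sub>n\<^sub>,\<^sub>\<alpha>\<^sub>,\<^sub>\<beta>\<close>.\<close>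

definition is_V_gh ::
  "'k::field \<Rightarrow> 'k \<Rightarrow> nat \<Rightarrow> 'k \<Rightarrow> 'k \<Rightarrow> ((gh_gen, 'k) free_alg set, 'm) module \<Rightarrow> bool" where
  "is_V_gh q \<epsilon> n \<alpha> \<beta> M \<longleftrightarrow>
     simple_module (Ugh q) M \<and> has_dimension (vspace (Ugh q) M) (n + 1) \<and>
     (let X = generator (gh_relations q); c = scal (Ugh q) in
      \<exists>v\<in>carrier M. v \<noteq> \<zero>\<^bsub>M\<^esub> \<and> module_span (Ugh q) M {v} = carrier M \<and>
        X E_gh \<odot>\<^bsub>M\<^esub> v = \<zero>\<^bsub>M\<^esub> \<and>
        X K_gh \<odot>\<^bsub>M\<^esub> v = c (\<epsilon> * \<alpha> * q ^ n) \<odot>\<^bsub>M\<^esub> v \<and>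
        X g_gh \<odot>\<^bsub>M\<^esub> v = c \<alpha> \<odot>\<^bsub>M\<^esub> v \<and>
        X h_gh \<odot>\<^bsub>M\<^esub> v = c \<beta> \<odot>\<^bsub>M\<^esub> v)"

end

theory Submission
  imports Defs
begin

text \<open>
  The proof rests on an invariant of an extension \<open>0 \<rightarrow> Q \<rightarrow> X \<rightarrow> P \<rightarrow> 0\<close>. A linear section \<open>s\<close> fails to
  commute with the generators of the algebra by maps \<open>d i\<close> from \<open>P\<close> to \<open>Q\<close>, and this cocycle determines the
  extension up to equivalence (\<open>ext_equiv_if_same_cocycle\<close>). Cocycles of a Baer sum are sums of cocycles,
  and scalar multiples have multiples as cocycles (\<open>baer_sum_extension\<close>, \<open>ext_scale_extension\<close>). Computing
  with extensions thus becomes computing with the values of cocycles on generators.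

  An extension of \<open>\<K>\<^sub>\<alpha>\<^sub>'\<^sub>,\<^sub>\<beta>\<^sub>'\<close> by \<open>\<K>\<^sub>\<alpha>\<^sub>,\<^sub>\<beta>\<close> has as cocycle a pair of scalars \<open>(a, a2)\<close>, the off-diagonal entries of
  \<open>g\<close> and \<open>h\<close>. As \<open>g\<close> and \<open>h\<close> commute, \<open>(\<beta>' - \<beta>) a = (\<alpha>' - \<alpha>) a2\<close>; every such pair occurs
  (\<open>laurent_cocycle_realized\<close>), and changing the section adds a multiple of \<open>(\<alpha> - \<alpha>', \<beta> - \<beta>')\<close>
  (\<open>laurent_cocycle_shift\<close>).

  The extensions of \<open>M'\<close> by \<open>M\<close> over \<open>U\<^sub>g\<^sub>,\<^sub>h\<close> are governed by the same pairs. The key step is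
  \<open>highest_weight_lift\<close>: the highest weight vector of \<open>M'\<close> lifts to a vector of \<open>X\<close> that is killed by \<open>E\<close> and
  by \<open>F\<^sup>n\<^sup>+\<^sup>1\<close> and is an eigenvector of \<open>K g\<^sup>-\<^sup>1\<close>. This is the complete reducibility of \<open>U\<^sub>q(sl(2))\<close>-modules, in
  the only case that occurs. The images of this vector under powers of \<open>F\<close> form a section whose cocycle is
  described by two scalars \<open>a\<close> and \<open>a2\<close> (\<open>cocycle_exists\<close>); they satisfy the same relation
  (\<open>cocycle_relation\<close>) and are determined up to the same multiples (\<open>cocycle_unique\<close>). The functor
  \<open>V\<^sub>\<epsilon>\<^sub>,\<^sub>n \<otimes> -\<close> preserves the pair \<open>(a, a2)\<close> (\<open>tensor_ses_cocycle\<close>). So it is linear, injective and surjective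
  on classes (\<open>tensor_ext_iso\<close>).

  For the vanishing statement, \<open>g\<close>, \<open>h\<close> and the Casimir element act on every module by module maps. On
  \<open>V\<^sub>\<epsilon>\<^sub>,\<^sub>n\<^sub>,\<^sub>\<alpha>\<^sub>,\<^sub>\<beta>\<close> they are the scalars \<open>\<alpha>\<close>, \<open>\<beta>\<close> and a nonzero multiple of \<open>\<alpha> (\<epsilon> q\<^sup>n\<^sup>+\<^sup>1 + \<epsilon> q\<^sup>-\<^sup>n\<^sup>-\<^sup>1)\<close>, from which
  all parameters can be recovered. If one of these elements acts by different scalars on the two ends, the
  corresponding eigenspaces split the extension (\<open>split_if_different_scalars\<close>).
\<close>

section \<open>Left modules\<close>

context left_module
begin

lemma lsmult_r_null: "a \<in> carrier R \<Longrightarrow> a \<odot>\<^bsub>M\<^esub> \<zero>\<^bsub>M\<^esub> = \<zero>\<^bsub>M\<^esub>"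
  using lsmult_r_distr[of a "\<zero>\<^bsub>M\<^esub>" "\<zero>\<^bsub>M\<^esub>"] lsmult_closed[of a "\<zero>\<^bsub>M\<^esub>"]
  by (simp del: M.r_zero M.l_zero add: M.add.l_cancel_one' M.l_zero[OF M.zero_closed])

lemma lsmult_l_null: "x \<in> carrier M \<Longrightarrow> \<zero>\<^bsub>R\<^esub> \<odot>\<^bsub>M\<^esub> x = \<zero>\<^bsub>M\<^esub>"
  using lsmult_l_distr[of "\<zero>\<^bsub>R\<^esub>" "\<zero>\<^bsub>R\<^esub>" x] lsmult_closed[of "\<zero>\<^bsub>R\<^esub>" x]
  by (simp add: M.add.l_cancel_one')

lemma lsmult_r_minus:
  assumes "a \<in> carrier R" "x \<in> carrier M"
  shows "a \<odot>\<^bsub>M\<^esub> (\<ominus>\<^bsub>M\<^esub> x) = \<ominus>\<^bsub>M\<^esub> (a \<odot>\<^bsub>M\<^esub> x)"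
proof -
  have "a \<odot>\<^bsub>M\<^esub> (\<ominus>\<^bsub>M\<^esub> x) \<oplus>\<^bsub>M\<^esub> a \<odot>\<^bsub>M\<^esub> x = \<zero>\<^bsub>M\<^esub>"
    using assms lsmult_r_distr[of a "\<ominus>\<^bsub>M\<^esub> x" x] by (simp add: M.l_neg lsmult_r_null)
  then show ?thesis
    using assms by (metis M.minus_equality M.add.inv_closed lsmult_closed)
qed

lemma lsmult_r_diff:
  "\<lbrakk>a \<in> carrier R; x \<in> carrier M; y \<in> carrier M\<rbrakk> \<Longrightarrow>
    a \<odot>\<^bsub>M\<^esub> (x \<ominus>\<^bsub>M\<^esub> y) = a \<odot>\<^bsub>M\<^esub> x \<ominus>\<^bsub>M\<^esub> a \<odot>\<^bsub>M\<^esub> y"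
  by (simp add: M.minus_eq lsmult_r_distr lsmult_r_minus)

lemma diff_eq_zero_iff:
  "\<lbrakk>x \<in> carrier M; y \<in> carrier M\<rbrakk> \<Longrightarrow> x \<ominus>\<^bsub>M\<^esub> y = \<zero>\<^bsub>M\<^esub> \<longleftrightarrow> x = y"
  by (metis M.add.inv_closed M.minus_eq M.minus_equality M.minus_minus M.r_neg)

lemma add_diff_cancel:
  "\<lbrakk>x \<in> carrier M; y \<in> carrier M\<rbrakk> \<Longrightarrow> x \<oplus>\<^bsub>M\<^esub> (y \<ominus>\<^bsub>M\<^esub> x) = y"
  by (simp add: M.minus_eq M.a_comm[of x] M.a_assoc M.l_neg)

lemma lsmult_finsum:
  "\<lbrakk>a \<in> carrier R; finite I; f \<in> I \<rightarrow> carrier M\<rbrakk> \<Longrightarrow>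
    a \<odot>\<^bsub>M\<^esub> (\<Oplus>\<^bsub>M\<^esub>i\<in>I. f i) = (\<Oplus>\<^bsub>M\<^esub>i\<in>I. a \<odot>\<^bsub>M\<^esub> f i)"
proof (induction I arbitrary: f rule: infinite_finite_induct)
  case (insert x F)
  then show ?case by (simp add: Pi_iff lsmult_r_distr lsmult_closed M.finsum_closed)
qed (auto simp: lsmult_r_null)

lemma submoduleI:
  assumes sub: "H \<subseteq> carrier M" and zero: "\<zero>\<^bsub>M\<^esub> \<in> H"
    and add: "\<And>x y. \<lbrakk>x \<in> H; y \<in> H\<rbrakk> \<Longrightarrow> x \<oplus>\<^bsub>M\<^esub> y \<in> H"
    and smult: "\<And>a x. \<lbrakk>a \<in> carrier R; x \<in> H\<rbrakk> \<Longrightarrow> a \<odot>\<^bsub>M\<^esub> x \<in> H"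
  shows "submodule H R M"
proof -
  have "\<ominus>\<^bsub>M\<^esub> x \<in> H" if "x \<in> H" for x
  proof -
    have x: "x \<in> carrier M" using that sub by auto
    have "(\<ominus>\<^bsub>R\<^esub> \<one>\<^bsub>R\<^esub>) \<odot>\<^bsub>M\<^esub> x \<oplus>\<^bsub>M\<^esub> x = \<zero>\<^bsub>M\<^esub>"
      using lsmult_l_distr[of "\<ominus>\<^bsub>R\<^esub> \<one>\<^bsub>R\<^esub>" "\<one>\<^bsub>R\<^esub>" x] x
      by (simp add: R.l_neg lsmult_l_null lsmult_one)
    then have "\<ominus>\<^bsub>M\<^esub> x = (\<ominus>\<^bsub>R\<^esub> \<one>\<^bsub>R\<^esub>) \<odot>\<^bsub>M\<^esub> x"
      using x by (intro M.minus_equality) (auto intro: lsmult_closed)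
    then show ?thesis using smult[of "\<ominus>\<^bsub>R\<^esub> \<one>\<^bsub>R\<^esub>" x] that by simp
  qed
  then show ?thesis
    using assms by (intro submodule.intro subgroup.intro submodule_axioms.intro)
      (auto simp: a_inv_def[symmetric])
qed

end

lemma submoduleD:
  assumes "submodule H R M"
  shows "H \<subseteq> carrier M" "\<zero>\<^bsub>M\<^esub> \<in> H"
    and "\<And>x y. \<lbrakk>x \<in> H; y \<in> H\<rbrakk> \<Longrightarrow> x \<oplus>\<^bsub>M\<^esub> y \<in> H"
    and "\<And>x. x \<in> H \<Longrightarrow> \<ominus>\<^bsub>M\<^esub> x \<in> H"
    and "\<And>a x. \<lbrakk>a \<in> carrier R; x \<in> H\<rbrakk> \<Longrightarrow> a \<odot>\<^bsub>M\<^esub> x \<in> H"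
proof -
  interpret submodule H R M by fact
  show "H \<subseteq> carrier M" "\<zero>\<^bsub>M\<^esub> \<in> H" using subset one_closed by auto
  show "\<And>x y. \<lbrakk>x \<in> H; y \<in> H\<rbrakk> \<Longrightarrow> x \<oplus>\<^bsub>M\<^esub> y \<in> H" using m_closed by auto
  show "\<And>x. x \<in> H \<Longrightarrow> \<ominus>\<^bsub>M\<^esub> x \<in> H" using m_inv_closed by (auto simp: a_inv_def)
  show "\<And>a x. \<lbrakk>a \<in> carrier R; x \<in> H\<rbrakk> \<Longrightarrow> a \<odot>\<^bsub>M\<^esub> x \<in> H" by simp
qed

lemma submodule_span:
  assumes "left_module R M" "S \<subseteq> carrier M"
  shows "submodule (module_span R M S) R M" and "S \<subseteq> module_span R M S"
    and "\<And>H. submodule H R M \<Longrightarrow> S \<subseteq> H \<Longrightarrow> module_span R M S \<subseteq> H"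
proof -
  interpret left_module R M by fact
  have c: "submodule (carrier M) R M"
    by (rule submoduleI) (auto intro: lsmult_closed)
  then show "submodule (module_span R M S) R M"
    using assms by (intro submoduleI) (auto simp: module_span_def intro: submoduleD subsetD[OF submoduleD(1)])
qed (auto simp: module_span_def)

lemma module_homD:
  assumes "module_hom R M N f"
  shows "x \<in> carrier M \<Longrightarrow> f x \<in> carrier N"
    and "\<lbrakk>x \<in> carrier M; y \<in> carrier M\<rbrakk> \<Longrightarrow> f (x \<oplus>\<^bsub>M\<^esub> y) = f x \<oplus>\<^bsub>N\<^esub> f y"
    and "\<lbrakk>a \<in> carrier R; x \<in> carrier M\<rbrakk> \<Longrightarrow> f (a \<odot>\<^bsub>M\<^esub> x) = a \<odot>\<^bsub>N\<^esub> f x"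
  using assms by (auto simp: module_hom_def)

lemma additive_zero_minus:
  assumes M: "abelian_group M" and N: "abelian_group N"
    and f: "f \<in> carrier M \<rightarrow> carrier N"
    and add: "\<And>x y. \<lbrakk>x \<in> carrier M; y \<in> carrier M\<rbrakk> \<Longrightarrow> f (x \<oplus>\<^bsub>M\<^esub> y) = f x \<oplus>\<^bsub>N\<^esub> f y"
  shows "f \<zero>\<^bsub>M\<^esub> = \<zero>\<^bsub>N\<^esub>"
    and "x \<in> carrier M \<Longrightarrow> f (\<ominus>\<^bsub>M\<^esub> x) = \<ominus>\<^bsub>N\<^esub> f x"
    and "\<lbrakk>x \<in> carrier M; y \<in> carrier M\<rbrakk> \<Longrightarrow> f (x \<ominus>\<^bsub>M\<^esub> y) = f x \<ominus>\<^bsub>N\<^esub> f y"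
proof -
  interpret M: abelian_group M by fact
  interpret N: abelian_group N by fact
  have c: "f x \<in> carrier N" if "x \<in> carrier M" for x using f that by auto
  show z: "f \<zero>\<^bsub>M\<^esub> = \<zero>\<^bsub>N\<^esub>"
    using add[of "\<zero>\<^bsub>M\<^esub>" "\<zero>\<^bsub>M\<^esub>"] c[of "\<zero>\<^bsub>M\<^esub>"] by (simp add: N.add.l_cancel_one')
  show m: "f (\<ominus>\<^bsub>M\<^esub> x) = \<ominus>\<^bsub>N\<^esub> f x" if "x \<in> carrier M" for x
    using add[of "\<ominus>\<^bsub>M\<^esub> x" x] z that c
    by (intro N.minus_equality[symmetric]) (auto simp: M.l_neg)
  show "f (x \<ominus>\<^bsub>M\<^esub> y) = f x \<ominus>\<^bsub>N\<^esub> f y" if "x \<in> carrier M" "y \<in> carrier M" for x y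
    using that by (simp add: M.minus_eq N.minus_eq add m)
qed

lemma module_hom_zero_minus:
  assumes "left_module R M" "left_module R N" and f: "module_hom R M N f"
  shows "f \<zero>\<^bsub>M\<^esub> = \<zero>\<^bsub>N\<^esub>"
    and "x \<in> carrier M \<Longrightarrow> f (\<ominus>\<^bsub>M\<^esub> x) = \<ominus>\<^bsub>N\<^esub> f x"
    and "\<lbrakk>x \<in> carrier M; y \<in> carrier M\<rbrakk> \<Longrightarrow> f (x \<ominus>\<^bsub>M\<^esub> y) = f x \<ominus>\<^bsub>N\<^esub> f y"
proof -
  interpret M: left_module R M by fact
  interpret N: left_module R N by fact
  note * = additive_zero_minus[OF M.M.abelian_group_axioms N.M.abelian_group_axioms, of f]
  have "f \<in> carrier M \<rightarrow> carrier N" using f by (auto simp: module_hom_def)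
  from *[OF this module_homD(2)[OF f]]
  show "f \<zero>\<^bsub>M\<^esub> = \<zero>\<^bsub>N\<^esub>" "x \<in> carrier M \<Longrightarrow> f (\<ominus>\<^bsub>M\<^esub> x) = \<ominus>\<^bsub>N\<^esub> f x"
    "\<lbrakk>x \<in> carrier M; y \<in> carrier M\<rbrakk> \<Longrightarrow> f (x \<ominus>\<^bsub>M\<^esub> y) = f x \<ominus>\<^bsub>N\<^esub> f y" by auto
qed

text \<open>
  Submodules, and modules whose structure is transported along a bijection, are both obtained by
  pulling the module axioms back along an injection that respects the operations.
\<close>

lemma left_module_pullback:
  assumes X: "left_module R X"
    and f: "f \<in> carrier Y \<rightarrow> carrier X" and inj: "inj_on f (carrier Y)"
    and zero: "\<zero>\<^bsub>Y\<^esub> \<in> carrier Y" "f \<zero>\<^bsub>Y\<^esub> = \<zero>\<^bsub>X\<^esub>"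
    and add: "\<And>x y. \<lbrakk>x \<in> carrier Y; y \<in> carrier Y\<rbrakk> \<Longrightarrow> x \<oplus>\<^bsub>Y\<^esub> y \<in> carrier Y"
      "\<And>x y. \<lbrakk>x \<in> carrier Y; y \<in> carrier Y\<rbrakk> \<Longrightarrow> f (x \<oplus>\<^bsub>Y\<^esub> y) = f x \<oplus>\<^bsub>X\<^esub> f y"
    and smult: "\<And>a x. \<lbrakk>a \<in> carrier R; x \<in> carrier Y\<rbrakk> \<Longrightarrow> a \<odot>\<^bsub>Y\<^esub> x \<in> carrier Y"
      "\<And>a x. \<lbrakk>a \<in> carrier R; x \<in> carrier Y\<rbrakk> \<Longrightarrow> f (a \<odot>\<^bsub>Y\<^esub> x) = a \<odot>\<^bsub>X\<^esub> f x"
  shows "left_module R Y"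
proof -
  interpret X: left_module R X by fact
  have c: "f x \<in> carrier X" if "x \<in> carrier Y" for x using f that by auto
  have eq: "x = y" if "f x = f y" "x \<in> carrier Y" "y \<in> carrier Y" for x y
    using inj that by (auto dest: inj_onD)
  have neg: "\<exists>y\<in>carrier Y. y \<oplus>\<^bsub>Y\<^esub> x = \<zero>\<^bsub>Y\<^esub>" if x: "x \<in> carrier Y" for x
  proof
    let ?y = "(\<ominus>\<^bsub>R\<^esub> \<one>\<^bsub>R\<^esub>) \<odot>\<^bsub>Y\<^esub> x"
    show y: "?y \<in> carrier Y" using x smult(1) by simp
    have "f (?y \<oplus>\<^bsub>Y\<^esub> x) = (\<ominus>\<^bsub>R\<^esub> \<one>\<^bsub>R\<^esub> \<oplus>\<^bsub>R\<^esub> \<one>\<^bsub>R\<^esub>) \<odot>\<^bsub>X\<^esub> f x"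
      using x y c by (simp add: add smult X.lsmult_l_distr X.lsmult_one)
    then show "?y \<oplus>\<^bsub>Y\<^esub> x = \<zero>\<^bsub>Y\<^esub>"
      using x y c by (intro eq) (auto simp: X.R.l_neg X.lsmult_l_null zero add)
  qed
  have "abelian_group Y"
    by (rule abelian_groupI)
      (auto intro!: eq neg zero(1) add(1) simp: add zero c X.M.a_ac X.M.l_zero)
  then show ?thesis
    by (auto intro!: left_module.intro left_module_axioms.intro eq
        simp: X.R.ring_axioms add smult c X.lsmult_l_distr X.lsmult_r_distr X.lsmult_assoc X.lsmult_one)
qed

lemma left_module_submodule:
  assumes "left_module R X" "submodule H R X"
  shows "left_module R (X\<lparr>carrier := H\<rparr>)"
  using submoduleD[OF assms(2)]
  by (intro left_module_pullback[OF assms(1), of id]) auto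

definition transported_module :: "('a, 'x) module \<Rightarrow> 'y set \<Rightarrow> ('y \<Rightarrow> 'x) \<Rightarrow> ('a, 'y) module" where
  "transported_module X S f = \<lparr>carrier = S, monoid.mult = undefined, one = undefined,
     zero = inv_into S f \<zero>\<^bsub>X\<^esub>, add = (\<lambda>x y. inv_into S f (f x \<oplus>\<^bsub>X\<^esub> f y)),
     smult = (\<lambda>a x. inv_into S f (a \<odot>\<^bsub>X\<^esub> f x))\<rparr>"

lemma transported_module:
  assumes X: "left_module R X" and f: "bij_betw f S (carrier X)"
  shows "left_module R (transported_module X S f)" "module_iso R (transported_module X S f) X f"
proof -
  interpret X: left_module R X by fact
  have c: "f x \<in> carrier X" if "x \<in> S" for x using f that by (auto simp: bij_betw_def)
  have i: "inv_into S f x \<in> S" "f (inv_into S f x) = x" if "x \<in> carrier X" for x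
    using f that by (auto simp: bij_betw_def intro: inv_into_into f_inv_into_f)
  have inj: "inj_on f S" using f by (auto simp: bij_betw_def)
  show "left_module R (transported_module X S f)"
    by (rule left_module_pullback[OF X, of f])
      (auto simp: transported_module_def c i inj X.lsmult_closed)
  show "module_iso R (transported_module X S f) X f"
    using f by (auto simp: module_iso_def module_hom_def transported_module_def c i X.lsmult_closed)
qed

lemma left_module_direct_sum:
  assumes "left_module R M" "left_module R N"
  shows "left_module R (direct_sum M N)"
proof -
  interpret M: left_module R M by fact
  interpret N: left_module R N by fact
  have neg: "\<exists>y\<in>carrier (direct_sum M N). y \<oplus>\<^bsub>direct_sum M N\<^esub> x = \<zero>\<^bsub>direct_sum M N\<^esub>"
    if "x \<in> carrier (direct_sum M N)" for x
    using that by (intro bexI[of _ "(\<ominus>\<^bsub>M\<^esub> fst x, \<ominus>\<^bsub>N\<^esub> snd x)"])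
      (auto simp: direct_sum_def M.M.l_neg N.M.l_neg)
  have "abelian_group (direct_sum M N)"
    by (rule abelian_groupI[OF _ _ _ _ _ neg]) (auto simp: direct_sum_def M.M.a_ac N.M.a_ac)
  then show ?thesis
    by (auto intro!: left_module.intro left_module_axioms.intro simp: M.R.ring_axioms)
      (auto simp: direct_sum_def M.lsmult_closed N.lsmult_closed M.lsmult_l_distr N.lsmult_l_distr
        M.lsmult_r_distr N.lsmult_r_distr M.lsmult_assoc N.lsmult_assoc M.lsmult_one N.lsmult_one)
qed

subsection \<open>Quotients\<close>

text \<open>Baer sums and tensor products pick an arbitrary member of a coset; the last two facts
  compare it with a given one.\<close>

lemma quotient_module:
  assumes X: "left_module R X" and D: "submodule D R X"
  shows "left_module R (quotient_module X D)"
    and "module_hom R X (quotient_module X D) (\<lambda>x. D +>\<^bsub>X\<^esub> x)"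
    and "(\<lambda>x. D +>\<^bsub>X\<^esub> x) ` carrier X = carrier (quotient_module X D)"
    and "\<And>x y. \<lbrakk>x \<in> carrier X; y \<in> carrier X\<rbrakk> \<Longrightarrow>
      D +>\<^bsub>X\<^esub> x = D +>\<^bsub>X\<^esub> y \<longleftrightarrow> x \<ominus>\<^bsub>X\<^esub> y \<in> D"
    and "\<And>x. x \<in> carrier X \<Longrightarrow> x \<in> D +>\<^bsub>X\<^esub> x"
    and "\<And>x y. \<lbrakk>x \<in> carrier X; y \<in> D +>\<^bsub>X\<^esub> x\<rbrakk> \<Longrightarrow> y \<in> carrier X \<and> y \<ominus>\<^bsub>X\<^esub> x \<in> D"
proof -
  interpret X: left_module R X by fact
  interpret D: submodule D R X by fact
  interpret D: abelian_subgroup D X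
    by (rule abelian_subgroupI2[OF X.M.a_comm_group D.subgroup_axioms])
  let ?Q = "quotient_module X D"
  show self: "x \<in> D +>\<^bsub>X\<^esub> x" if "x \<in> carrier X" for x
    by (rule D.a_rcos_self[OF that])
  show mem: "y \<in> carrier X \<and> y \<ominus>\<^bsub>X\<^esub> x \<in> D" if "x \<in> carrier X" "y \<in> D +>\<^bsub>X\<^esub> x" for x y
    using D.a_elemrcos_carrier[OF that] D.a_rcos_module_imp[OF that] by (simp add: X.M.minus_eq)
  show eq: "D +>\<^bsub>X\<^esub> x = D +>\<^bsub>X\<^esub> y \<longleftrightarrow> x \<ominus>\<^bsub>X\<^esub> y \<in> D"
    if "x \<in> carrier X" "y \<in> carrier X" for x y
    using D.a_rcos_module[of y x] D.a_repr_independence'[of x y] self that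
    by (metis X.M.minus_eq)
  have carr: "carrier ?Q = (\<lambda>x. D +>\<^bsub>X\<^esub> x) ` carrier X"
    by (auto simp: quotient_module_def A_RCOSETS_def')
  then show "(\<lambda>x. D +>\<^bsub>X\<^esub> x) ` carrier X = carrier ?Q" by simp
  have add: "(D +>\<^bsub>X\<^esub> x) \<oplus>\<^bsub>?Q\<^esub> (D +>\<^bsub>X\<^esub> y) = D +>\<^bsub>X\<^esub> (x \<oplus>\<^bsub>X\<^esub> y)"
    if "x \<in> carrier X" "y \<in> carrier X" for x y
    using that by (simp add: quotient_module_def D.a_rcos_sum)
  have smult: "a \<odot>\<^bsub>?Q\<^esub> (D +>\<^bsub>X\<^esub> x) = D +>\<^bsub>X\<^esub> (a \<odot>\<^bsub>X\<^esub> x)"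
    if a: "a \<in> carrier R" and x: "x \<in> carrier X" for a x
  proof -
    have "D +>\<^bsub>X\<^esub> (a \<odot>\<^bsub>X\<^esub> y) = D +>\<^bsub>X\<^esub> (a \<odot>\<^bsub>X\<^esub> x)" if "y \<in> D +>\<^bsub>X\<^esub> x" for y
      using mem[OF x that] a x D.smult_closed[of a "y \<ominus>\<^bsub>X\<^esub> x"]
      by (subst eq) (auto simp: X.lsmult_closed X.lsmult_r_diff)
    then have "(\<Union>y\<in>D +>\<^bsub>X\<^esub> x. D +>\<^bsub>X\<^esub> (a \<odot>\<^bsub>X\<^esub> y)) = (\<Union>y\<in>D +>\<^bsub>X\<^esub> x. D +>\<^bsub>X\<^esub> (a \<odot>\<^bsub>X\<^esub> x))"
      by (rule SUP_cong[OF refl])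
    also have "\<dots> = D +>\<^bsub>X\<^esub> (a \<odot>\<^bsub>X\<^esub> x)" using self[OF x] by blast
    finally show ?thesis by (simp add: quotient_module_def)
  qed
  have zero: "\<zero>\<^bsub>?Q\<^esub> = D +>\<^bsub>X\<^esub> \<zero>\<^bsub>X\<^esub>"
    using D.a_rcos_const[OF D.zero_closed] by (simp add: quotient_module_def)
  have neg: "\<exists>E\<in>carrier ?Q. E \<oplus>\<^bsub>?Q\<^esub> C = \<zero>\<^bsub>?Q\<^esub>" if C: "C \<in> carrier ?Q" for C
  proof -
    from C obtain x where x: "x \<in> carrier X" "C = D +>\<^bsub>X\<^esub> x" by (auto simp: carr)
    show ?thesis
      by (rule bexI[of _ "D +>\<^bsub>X\<^esub> (\<ominus>\<^bsub>X\<^esub> x)"]) (simp_all add: x carr add zero X.M.l_neg)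
  qed
  have "abelian_group ?Q"
    by (rule abelian_groupI[OF _ _ _ _ _ neg]) (auto simp: carr add zero X.M.a_ac)
  then show "left_module R ?Q"
    by (auto intro!: left_module.intro left_module_axioms.intro simp: X.R.ring_axioms)
      (auto simp: carr add smult X.lsmult_closed X.lsmult_l_distr X.lsmult_r_distr
        X.lsmult_assoc X.lsmult_one)
  show "module_hom R X ?Q (\<lambda>x. D +>\<^bsub>X\<^esub> x)"
    by (auto simp: module_hom_def carr add smult)
qed

section \<open>Extensions and their cocycles\<close>

locale kalg = ring A for A :: "('k::field, 'a) kalgebra" (structure) +
  assumes scal_closed [simp, intro]: "scal A c \<in> carrier A"
    and scal_add: "scal A (c + d) = scal A c \<oplus> scal A d"
    and scal_mult: "scal A (c * d) = scal A c \<otimes> scal A d"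
    and scal_one: "scal A 1 = \<one>"
    and scal_central: "a \<in> carrier A \<Longrightarrow> scal A c \<otimes> a = a \<otimes> scal A c"

text \<open>Closure under inverses of units is built in, so that the inverses of \<open>K\<close>, \<open>g\<close> and \<open>h\<close> need
  not be listed among the generators.\<close>

definition generated_by :: "('k, 'a) kalgebra \<Rightarrow> ('i \<Rightarrow> 'a) \<Rightarrow> 'i set \<Rightarrow> bool" where
  "generated_by A \<gamma> I \<longleftrightarrow> \<gamma> ` I \<subseteq> carrier A \<and>
     (\<forall>H \<subseteq> carrier A. \<gamma> ` I \<subseteq> H \<longrightarrow> range (scal A) \<subseteq> H \<longrightarrow>
        (\<forall>a\<in>H. \<forall>b\<in>H. a \<oplus>\<^bsub>A\<^esub> b \<in> H \<and> a \<otimes>\<^bsub>A\<^esub> b \<in> H) \<longrightarrow>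
        (\<forall>a\<in>H. \<forall>b\<in>carrier A. a \<otimes>\<^bsub>A\<^esub> b = \<one>\<^bsub>A\<^esub> \<longrightarrow> b \<otimes>\<^bsub>A\<^esub> a = \<one>\<^bsub>A\<^esub> \<longrightarrow> b \<in> H) \<longrightarrow>
        H = carrier A)"

lemma generated_byD:
  assumes "generated_by A \<gamma> I" "a \<in> carrier A"
    and "\<And>i. i \<in> I \<Longrightarrow> Pr (\<gamma> i)" "\<And>c. Pr (scal A c)"
    and "\<And>a b. \<lbrakk>a \<in> carrier A; b \<in> carrier A; Pr a; Pr b\<rbrakk> \<Longrightarrow> Pr (a \<oplus>\<^bsub>A\<^esub> b)"
    and "\<And>a b. \<lbrakk>a \<in> carrier A; b \<in> carrier A; Pr a; Pr b\<rbrakk> \<Longrightarrow> Pr (a \<otimes>\<^bsub>A\<^esub> b)"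
    and "\<And>a b. \<lbrakk>a \<in> carrier A; b \<in> carrier A; Pr a; a \<otimes>\<^bsub>A\<^esub> b = \<one>\<^bsub>A\<^esub>; b \<otimes>\<^bsub>A\<^esub> a = \<one>\<^bsub>A\<^esub>\<rbrakk> \<Longrightarrow> Pr b"
    and "kalg A"
  shows "Pr a"
proof -
  interpret kalg A by fact
  let ?H = "{a \<in> carrier A. Pr a}"
  have \<gamma>: "\<gamma> ` I \<subseteq> carrier A"
    using assms(1) unfolding generated_by_def by (rule conjunct1)
  have "?H \<subseteq> carrier A \<longrightarrow> \<gamma> ` I \<subseteq> ?H \<longrightarrow> range (scal A) \<subseteq> ?H \<longrightarrow>
        (\<forall>a\<in>?H. \<forall>b\<in>?H. a \<oplus>\<^bsub>A\<^esub> b \<in> ?H \<and> a \<otimes>\<^bsub>A\<^esub> b \<in> ?H) \<longrightarrow>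
        (\<forall>a\<in>?H. \<forall>b\<in>carrier A. a \<otimes>\<^bsub>A\<^esub> b = \<one>\<^bsub>A\<^esub> \<longrightarrow> b \<otimes>\<^bsub>A\<^esub> a = \<one>\<^bsub>A\<^esub> \<longrightarrow> b \<in> ?H) \<longrightarrow>
        ?H = carrier A"
    using assms(1) unfolding generated_by_def by (rule conjunct2[THEN spec])
  moreover have "?H \<subseteq> carrier A" by blast
  moreover have "\<gamma> ` I \<subseteq> ?H" using \<gamma> assms(3) by blast
  moreover have "range (scal A) \<subseteq> ?H" using assms(4) by auto
  moreover have "\<forall>a\<in>?H. \<forall>b\<in>?H. a \<oplus>\<^bsub>A\<^esub> b \<in> ?H \<and> a \<otimes>\<^bsub>A\<^esub> b \<in> ?H"
    using assms(5,6) by simp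
  moreover have "\<forall>a\<in>?H. \<forall>b\<in>carrier A. a \<otimes>\<^bsub>A\<^esub> b = \<one>\<^bsub>A\<^esub> \<longrightarrow> b \<otimes>\<^bsub>A\<^esub> a = \<one>\<^bsub>A\<^esub> \<longrightarrow> b \<in> ?H"
    using assms(7) by blast
  ultimately have "?H = carrier A" by blast
  then show ?thesis using assms(2) by blast
qed

text \<open>An additive map commuting with a unit commutes with its inverse; this is why it suffices to
  control a module map on generators up to inverses.\<close>

lemma module_hom_generators:
  assumes A: "kalg A" and gen: "generated_by A \<gamma> I"
    and M: "left_module A M" and N: "left_module A N"
    and f: "f \<in> carrier M \<rightarrow> carrier N"
    and add: "\<And>x y. \<lbrakk>x \<in> carrier M; y \<in> carrier M\<rbrakk> \<Longrightarrow> f (x \<oplus>\<^bsub>M\<^esub> y) = f x \<oplus>\<^bsub>N\<^esub> f y"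
    and scal: "\<And>c x. x \<in> carrier M \<Longrightarrow> f (scal A c \<odot>\<^bsub>M\<^esub> x) = scal A c \<odot>\<^bsub>N\<^esub> f x"
    and gam: "\<And>i x. \<lbrakk>i \<in> I; x \<in> carrier M\<rbrakk> \<Longrightarrow> f (\<gamma> i \<odot>\<^bsub>M\<^esub> x) = \<gamma> i \<odot>\<^bsub>N\<^esub> f x"
  shows "module_hom A M N f"
proof -
  interpret kalg A by fact
  interpret M: left_module A M by fact
  interpret N: left_module A N by fact
  have c: "f x \<in> carrier N" if "x \<in> carrier M" for x using f that by auto
  have "\<forall>x\<in>carrier M. f (a \<odot>\<^bsub>M\<^esub> x) = a \<odot>\<^bsub>N\<^esub> f x" if a: "a \<in> carrier A" for a
  proof (rule generated_byD[OF gen a _ _ _ _ _ A])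
    fix a b
    assume ab: "a \<in> carrier A" "b \<in> carrier A" "a \<otimes>\<^bsub>A\<^esub> b = \<one>\<^bsub>A\<^esub>" "b \<otimes>\<^bsub>A\<^esub> a = \<one>\<^bsub>A\<^esub>"
      and IH: "\<forall>x\<in>carrier M. f (a \<odot>\<^bsub>M\<^esub> x) = a \<odot>\<^bsub>N\<^esub> f x"
    show "\<forall>x\<in>carrier M. f (b \<odot>\<^bsub>M\<^esub> x) = b \<odot>\<^bsub>N\<^esub> f x"
    proof
      fix x assume x: "x \<in> carrier M"
      have "f (b \<odot>\<^bsub>M\<^esub> x) = (b \<otimes>\<^bsub>A\<^esub> a) \<odot>\<^bsub>N\<^esub> f (b \<odot>\<^bsub>M\<^esub> x)"
        using x ab c M.lsmult_closed N.lsmult_one by simp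
      also have "\<dots> = b \<odot>\<^bsub>N\<^esub> (a \<odot>\<^bsub>N\<^esub> f (b \<odot>\<^bsub>M\<^esub> x))"
        using x ab c M.lsmult_closed N.lsmult_assoc by blast
      also have "a \<odot>\<^bsub>N\<^esub> f (b \<odot>\<^bsub>M\<^esub> x) = f ((a \<otimes>\<^bsub>A\<^esub> b) \<odot>\<^bsub>M\<^esub> x)"
        using x ab IH M.lsmult_closed M.lsmult_assoc by metis
      also have "\<dots> = f x" using ab x M.lsmult_one by simp
      finally show "f (b \<odot>\<^bsub>M\<^esub> x) = b \<odot>\<^bsub>N\<^esub> f x" .
    qed
  qed (auto simp: gam scal M.lsmult_l_distr N.lsmult_l_distr add M.lsmult_assoc N.lsmult_assoc
      M.lsmult_closed c)
  then show ?thesis using f add by (auto simp: module_hom_def)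
qed

subsection \<open>Equivalence classes of extensions\<close>

lemma is_extensionD:
  assumes "is_extension R P Q (X, \<phi>, \<psi>)"
  shows "left_module R X" "module_hom R Q X \<phi>" "module_hom R X P \<psi>" "inj_on \<phi> (carrier Q)"
    and "z \<in> carrier Q \<Longrightarrow> \<psi> (\<phi> z) = \<zero>\<^bsub>P\<^esub>"
    and "\<lbrakk>x \<in> carrier X; \<psi> x = \<zero>\<^bsub>P\<^esub>\<rbrakk> \<Longrightarrow> \<exists>z\<in>carrier Q. x = \<phi> z"
    and "p \<in> carrier P \<Longrightarrow> \<exists>x\<in>carrier X. \<psi> x = p"
proof -
  have *: "\<phi> ` carrier Q = {x \<in> carrier X. \<psi> x = \<zero>\<^bsub>P\<^esub>}" "\<psi> ` carrier X = carrier P"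
    using assms by (auto simp: is_extension_def)
  show "left_module R X" "module_hom R Q X \<phi>" "module_hom R X P \<psi>" "inj_on \<phi> (carrier Q)"
    using assms by (auto simp: is_extension_def)
  show "\<psi> (\<phi> z) = \<zero>\<^bsub>P\<^esub>" if "z \<in> carrier Q"
    using *(1) imageI[OF that, of \<phi>] by simp
  show "\<exists>z\<in>carrier Q. x = \<phi> z" if "x \<in> carrier X" "\<psi> x = \<zero>\<^bsub>P\<^esub>"
  proof -
    have "x \<in> \<phi> ` carrier Q" using that by (simp add: *(1))
    then show ?thesis by blast
  qed
  show "\<exists>x\<in>carrier X. \<psi> x = p" if "p \<in> carrier P"
    using that *(2)[symmetric] by auto
qed

lemma is_extensionI:
  assumes "left_module R X" "module_hom R Q X \<phi>" "module_hom R X P \<psi>" "inj_on \<phi> (carrier Q)"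
    and "\<And>z. z \<in> carrier Q \<Longrightarrow> \<psi> (\<phi> z) = \<zero>\<^bsub>P\<^esub>"
    and "\<And>x. \<lbrakk>x \<in> carrier X; \<psi> x = \<zero>\<^bsub>P\<^esub>\<rbrakk> \<Longrightarrow> \<exists>z\<in>carrier Q. x = \<phi> z"
    and "\<And>p. p \<in> carrier P \<Longrightarrow> \<exists>x\<in>carrier X. \<psi> x = p"
  shows "is_extension R P Q (X, \<phi>, \<psi>)"
proof -
  have "\<phi> ` carrier Q = {x \<in> carrier X. \<psi> x = \<zero>\<^bsub>P\<^esub>}"
    using assms(5,6) module_homD(1)[OF assms(2)] by fast
  moreover have "\<psi> ` carrier X = carrier P"
    using assms(7) module_homD(1)[OF assms(3)] by fast
  ultimately show ?thesis using assms(1-4) by (simp add: is_extension_def)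
qed

lemma extension_decomposition:
  assumes ext: "is_extension R P Q (X, \<phi>, \<psi>)" and P: "left_module R P" and Q: "left_module R Q"
    and s: "s \<in> carrier P \<rightarrow> carrier X" "\<And>p. p \<in> carrier P \<Longrightarrow> \<psi> (s p) = p"
  shows "bij_betw (\<lambda>(z, p). \<phi> z \<oplus>\<^bsub>X\<^esub> s p) (carrier Q \<times> carrier P) (carrier X)"
    and "\<lbrakk>z \<in> carrier Q; p \<in> carrier P\<rbrakk> \<Longrightarrow> \<psi> (\<phi> z \<oplus>\<^bsub>X\<^esub> s p) = p"
proof -
  note D = is_extensionD[OF ext]
  interpret X: left_module R X by (rule D(1))
  interpret P: left_module R P by (rule P)
  interpret Q: left_module R Q by (rule Q)
  have sc: "s p \<in> carrier X" if "p \<in> carrier P" for p using s that by auto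
  note hc = module_homD[OF D(2)] module_homD[OF D(3)]
  show psi: "\<psi> (\<phi> z \<oplus>\<^bsub>X\<^esub> s p) = p" if "z \<in> carrier Q" "p \<in> carrier P" for z p
    using that by (simp add: hc sc D s)
  have inj: "inj_on (\<lambda>(z, p). \<phi> z \<oplus>\<^bsub>X\<^esub> s p) (carrier Q \<times> carrier P)"
  proof (rule inj_onI, clarify)
    fix z p z' p'
    assume *: "z \<in> carrier Q" "p \<in> carrier P" "z' \<in> carrier Q" "p' \<in> carrier P"
      and eq: "\<phi> z \<oplus>\<^bsub>X\<^esub> s p = \<phi> z' \<oplus>\<^bsub>X\<^esub> s p'"
    have "p = p'" using psi[of z p] psi[of z' p'] * eq by simp
    then have "\<phi> z = \<phi> z'" using eq * by (simp add: hc sc X.M.add.right_cancel)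
    then show "z = z' \<and> p = p'" using \<open>p = p'\<close> D(4) * by (auto dest: inj_onD)
  qed
  have "x \<in> (\<lambda>(z, p). \<phi> z \<oplus>\<^bsub>X\<^esub> s p) ` (carrier Q \<times> carrier P)" if x: "x \<in> carrier X" for x
  proof -
    have px: "\<psi> x \<in> carrier P" using hc x by auto
    have "\<psi> (x \<ominus>\<^bsub>X\<^esub> s (\<psi> x)) = \<zero>\<^bsub>P\<^esub>"
      using x px by (simp add: module_hom_zero_minus[OF D(1) P D(3)] sc s P.diff_eq_zero_iff)
    then obtain z where z: "z \<in> carrier Q" "x \<ominus>\<^bsub>X\<^esub> s (\<psi> x) = \<phi> z"
      using D(6)[of "x \<ominus>\<^bsub>X\<^esub> s (\<psi> x)"] x px sc by auto
    then have "x = \<phi> z \<oplus>\<^bsub>X\<^esub> s (\<psi> x)"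
      using X.add_diff_cancel[of "s (\<psi> x)" x] x px sc hc by (simp add: X.M.a_comm)
    then show ?thesis using z px by (auto intro!: image_eqI[of _ _ "(z, \<psi> x)"])
  qed
  then show "bij_betw (\<lambda>(z, p). \<phi> z \<oplus>\<^bsub>X\<^esub> s p) (carrier Q \<times> carrier P) (carrier X)"
    using inj by (auto simp: bij_betw_def hc sc)
qed

lemma module_hom_comp:
  "\<lbrakk>module_hom R L M f; module_hom R M N g\<rbrakk> \<Longrightarrow> module_hom R L N (g \<circ> f)"
  unfolding module_hom_def by (auto simp: Pi_iff)

lemma module_iso_inverse:
  assumes X: "left_module R X" and f: "module_iso R X Y f"
  shows "module_iso R Y X (inv_into (carrier X) f)"
proof -
  interpret X: left_module R X by fact
  have bij: "bij_betw f (carrier X) (carrier Y)" and hom: "module_hom R X Y f"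
    using f by (auto simp: module_iso_def)
  let ?g = "inv_into (carrier X) f"
  have g: "?g y \<in> carrier X" "f (?g y) = y" if "y \<in> carrier Y" for y
    using that bij by (auto simp: bij_betw_def inv_into_into f_inv_into_f)
  have gf: "?g (f x) = x" if "x \<in> carrier X" for x
    using that bij by (simp add: bij_betw_def)
  have "?g (x \<oplus>\<^bsub>Y\<^esub> y) = ?g x \<oplus>\<^bsub>X\<^esub> ?g y" if "x \<in> carrier Y" "y \<in> carrier Y" for x y
    using gf[of "?g x \<oplus>\<^bsub>X\<^esub> ?g y"] that g module_homD(2)[OF hom] by simp
  moreover have "?g (a \<odot>\<^bsub>Y\<^esub> x) = a \<odot>\<^bsub>X\<^esub> ?g x" if "a \<in> carrier R" "x \<in> carrier Y" for a x
    using gf[of "a \<odot>\<^bsub>X\<^esub> ?g x"] that g module_homD(3)[OF hom] by (simp add: X.lsmult_closed)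
  ultimately show ?thesis
    using g bij_betw_inv_into[OF bij] by (auto simp: module_iso_def module_hom_def)
qed

lemma ext_equiv_sym:
  assumes "is_extension R P Q \<xi>" "is_extension R P Q \<eta>" "ext_equiv R P Q \<xi> \<eta>"
  shows "ext_equiv R P Q \<eta> \<xi>"
proof -
  obtain X \<phi> \<psi> Y \<phi>' \<psi>' where [simp]: "\<xi> = (X, \<phi>, \<psi>)" "\<eta> = (Y, \<phi>', \<psi>')" by (metis prod_cases3)
  obtain \<theta> where iso: "module_iso R X Y \<theta>" and eq: "\<forall>z\<in>carrier Q. \<theta> (\<phi> z) = \<phi>' z"
    "\<forall>x\<in>carrier X. \<psi>' (\<theta> x) = \<psi> x" using assms(3) by (auto simp: ext_equiv_def)
  note D = is_extensionD[OF assms(1)[simplified]] is_extensionD[OF assms(2)[simplified]]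
  let ?g = "inv_into (carrier X) \<theta>"
  have bij: "bij_betw \<theta> (carrier X) (carrier Y)" using iso by (simp add: module_iso_def)
  have "?g (\<phi>' z) = \<phi> z" if "z \<in> carrier Q" for z
    using that eq(1) bij module_homD(1)[OF D(2)] by (metis bij_betw_def inv_into_f_f)
  moreover have "\<psi> (?g y) = \<psi>' y" if "y \<in> carrier Y" for y
    using that eq(2) bij by (metis bij_betw_def f_inv_into_f inv_into_into)
  ultimately show ?thesis
    using module_iso_inverse[OF D(1) iso] by (auto simp: ext_equiv_def)
qed

lemma ext_equiv_trans:
  assumes "ext_equiv R P Q \<xi> \<eta>" "ext_equiv R P Q \<eta> \<zeta>"
  shows "ext_equiv R P Q \<xi> \<zeta>"
proof -
  obtain X \<phi> \<psi> Y \<phi>' \<psi>' Z \<phi>'' \<psi>'' where [simp]: "\<xi> = (X, \<phi>, \<psi>)" "\<eta> = (Y, \<phi>', \<psi>')"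
    "\<zeta> = (Z, \<phi>'', \<psi>'')" by (metis prod_cases3)
  obtain f g where fg: "module_iso R X Y f" "\<forall>z\<in>carrier Q. f (\<phi> z) = \<phi>' z"
    "\<forall>x\<in>carrier X. \<psi>' (f x) = \<psi> x"
    "module_iso R Y Z g" "\<forall>z\<in>carrier Q. g (\<phi>' z) = \<phi>'' z" "\<forall>x\<in>carrier Y. \<psi>'' (g x) = \<psi>' x"
    using assms by (auto simp: ext_equiv_def)
  have c: "f x \<in> carrier Y" if "x \<in> carrier X" for x
    using fg(1) that by (auto simp: module_iso_def module_hom_def)
  have "bij_betw (g \<circ> f) (carrier X) (carrier Z)"
    using fg(1,4) unfolding module_iso_def by (blast intro: bij_betw_trans)
  moreover have "module_hom R X Z (g \<circ> f)"
    using fg(1,4) c unfolding module_iso_def module_hom_def by (auto simp: Pi_iff)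
  ultimately have "module_iso R X Z (g \<circ> f)" by (simp add: module_iso_def)
  with c show ?thesis using fg by (auto simp: ext_equiv_def intro!: exI[of _ "g \<circ> f"])
qed

lemma ext_equiv_refl: "ext_equiv R P Q \<xi> \<xi>"
  by (cases \<xi>) (auto simp: ext_equiv_def module_iso_def module_hom_def intro!: exI[of _ id])

lemma ext_class_eq:
  assumes "is_extension R P Q \<xi>" "is_extension R P Q \<eta>" "ext_equiv R P Q \<xi> \<eta>"
  shows "ext_class R P Q \<xi> = ext_class R P Q \<eta>"
  unfolding ext_class_def
  using ext_equiv_trans[OF assms(3)] ext_equiv_trans[OF ext_equiv_sym[OF assms]] by blast

lemma ext_class_self: "is_extension R P Q \<xi> \<Longrightarrow> \<xi> \<in> ext_class R P Q \<xi>"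
  by (simp add: ext_class_def ext_equiv_refl)

text \<open>The middle term of an extension is, as a set, the product of its ends; transporting the module
  structure along such a bijection represents every class on the type \<open>'q \<times> 'p\<close>.\<close>

lemma ext_class_nonempty:
  fixes \<xi> :: "('a, 'q, 'x, 'p) ses"
  assumes ext: "is_extension R P Q \<xi>" and P: "left_module R P" and Q: "left_module R Q"
  obtains \<eta> :: "('a, 'q, 'q \<times> 'p, 'p) ses"
  where "is_extension R P Q \<eta>" "ext_equiv R P Q \<xi> \<eta>" "ext_class R P Q \<xi> = ext_class R P Q \<eta>"
proof -
  obtain X \<phi> \<psi> where [simp]: "\<xi> = (X, \<phi>, \<psi>)" by (metis prod_cases3)
  note D = is_extensionD[OF ext[simplified]]
  obtain s where s: "\<forall>p\<in>carrier P. s p \<in> carrier X \<and> \<psi> (s p) = p" using D(7) by metis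
  let ?S = "carrier Q \<times> carrier P"
  have "bij_betw (\<lambda>(z, p). \<phi> z \<oplus>\<^bsub>X\<^esub> s p) ?S (carrier X)"
    by (rule extension_decomposition[OF ext[simplified] P Q]) (use s in auto)
  then obtain f where bij: "bij_betw f ?S (carrier X)" by blast
  let ?Y = "transported_module X ?S f"
  let ?g = "inv_into ?S f"
  note Y = transported_module[OF D(1) bij]
  have carrY: "carrier ?Y = ?S" by (simp add: transported_module_def)
  have iso: "module_iso R X ?Y ?g"
    using module_iso_inverse[OF Y] by (simp add: carrY)
  have fg: "?g x \<in> ?S" "f (?g x) = x" if "x \<in> carrier X" for x
    using bij that by (auto simp: bij_betw_def intro: inv_into_into f_inv_into_f)
  have gf: "?g (f y) = y" if "y \<in> ?S" for y
    using bij that by (simp add: bij_betw_def)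
  have fS: "f y \<in> carrier X" if "y \<in> ?S" for y
    using bij that by (auto simp: bij_betw_def)
  have g_bij: "bij_betw ?g (carrier X) ?S" and g_hom: "module_hom R X ?Y ?g"
    and f_hom: "module_hom R ?Y X f"
    using iso Y(2) by (auto simp: module_iso_def carrY)
  define \<eta> where "\<eta> = (?Y, ?g \<circ> \<phi>, \<psi> \<circ> f)"
  have "is_extension R P Q \<eta>"
    unfolding \<eta>_def
  proof (rule is_extensionI)
    show "module_hom R Q ?Y (?g \<circ> \<phi>)" "module_hom R ?Y P (\<psi> \<circ> f)"
      using module_hom_comp[OF D(2) g_hom] module_hom_comp[OF f_hom D(3)] by auto
    show "inj_on (?g \<circ> \<phi>) (carrier Q)"
      using D(4) g_bij module_homD(1)[OF D(2)]
      by (intro comp_inj_on) (auto simp: bij_betw_def intro: inj_on_subset)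
    show "(\<psi> \<circ> f) ((?g \<circ> \<phi>) z) = \<zero>\<^bsub>P\<^esub>" if "z \<in> carrier Q" for z
      using that D(5) fg module_homD(1)[OF D(2)] by simp
    show "\<exists>z\<in>carrier Q. y = (?g \<circ> \<phi>) z" if "y \<in> carrier ?Y" "(\<psi> \<circ> f) y = \<zero>\<^bsub>P\<^esub>" for y
    proof -
      have "f y \<in> carrier X" "\<psi> (f y) = \<zero>\<^bsub>P\<^esub>" using that fS by (simp_all add: carrY)
      then obtain z where "z \<in> carrier Q" "f y = \<phi> z" using D(6) by blast
      then show ?thesis using gf[of y] that by (metis carrY comp_apply)
    qed
    show "\<exists>y\<in>carrier ?Y. (\<psi> \<circ> f) y = p" if "p \<in> carrier P" for p
      using that D(7)[of p] fg by (metis carrY comp_apply)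
  qed (rule Y(1))
  moreover have "ext_equiv R P Q \<xi> \<eta>"
    using iso fg by (auto simp: ext_equiv_def \<eta>_def intro!: exI[of _ ?g])
  ultimately show thesis using that ext_class_eq[OF ext] by blast
qed

lemma (in left_module) minus_zero': "\<ominus>\<^bsub>M\<^esub> \<zero>\<^bsub>M\<^esub> = \<zero>\<^bsub>M\<^esub>"
  using M.minus_equality[of "\<zero>\<^bsub>M\<^esub>" "\<zero>\<^bsub>M\<^esub>"] by simp

subsection \<open>Cocycles\<close>

definition linear_section ::
  "('k, 'a) kalgebra \<Rightarrow> ('a, 'p) module \<Rightarrow> ('a, 'x) module \<Rightarrow> ('x \<Rightarrow> 'p) \<Rightarrow> ('p \<Rightarrow> 'x) \<Rightarrow> bool" where
  "linear_section A P X \<psi> s \<longleftrightarrow> s \<in> carrier P \<rightarrow> carrier X \<and>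
     (\<forall>p\<in>carrier P. \<forall>p'\<in>carrier P. s (p \<oplus>\<^bsub>P\<^esub> p') = s p \<oplus>\<^bsub>X\<^esub> s p') \<and>
     (\<forall>c. \<forall>p\<in>carrier P. s (scal A c \<odot>\<^bsub>P\<^esub> p) = scal A c \<odot>\<^bsub>X\<^esub> s p) \<and>
     (\<forall>p\<in>carrier P. \<psi> (s p) = p)"

text \<open>The failure \<open>d\<close> of a linear section \<open>s\<close> to be a module map, recorded on generators \<open>\<gamma> i\<close> of the
  algebra only: for other algebra elements it is determined by these values. Another section changes \<open>d\<close>
  by a coboundary, so an extension has many cocycles.\<close>

definition has_cocycle ::
  "('k, 'a) kalgebra \<Rightarrow> ('i \<Rightarrow> 'a) \<Rightarrow> 'i set \<Rightarrow> ('a, 'p) module \<Rightarrow> ('a, 'q) module \<Rightarrow>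
   ('i \<Rightarrow> 'p \<Rightarrow> 'q) \<Rightarrow> ('a, 'q, 'x, 'p) ses \<Rightarrow> bool" where
  "has_cocycle A \<gamma> I P Q d = (\<lambda>(X, \<phi>, \<psi>). \<exists>s. linear_section A P X \<psi> s \<and>
     (\<forall>i\<in>I. \<forall>p\<in>carrier P. d i p \<in> carrier Q \<and> \<gamma> i \<odot>\<^bsub>X\<^esub> s p = s (\<gamma> i \<odot>\<^bsub>P\<^esub> p) \<oplus>\<^bsub>X\<^esub> \<phi> (d i p)))"

lemma linear_sectionD:
  assumes "linear_section A P X \<psi> s"
  shows "p \<in> carrier P \<Longrightarrow> s p \<in> carrier X"
    and "\<lbrakk>p \<in> carrier P; p' \<in> carrier P\<rbrakk> \<Longrightarrow> s (p \<oplus>\<^bsub>P\<^esub> p') = s p \<oplus>\<^bsub>X\<^esub> s p'"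
    and "p \<in> carrier P \<Longrightarrow> s (scal A c \<odot>\<^bsub>P\<^esub> p) = scal A c \<odot>\<^bsub>X\<^esub> s p"
    and "p \<in> carrier P \<Longrightarrow> \<psi> (s p) = p"
  using assms by (auto simp: linear_section_def)

lemma has_cocycleE:
  assumes "has_cocycle A \<gamma> I P Q d (X, \<phi>, \<psi>)"
  obtains s where "linear_section A P X \<psi> s"
    and "\<forall>i\<in>I. \<forall>p\<in>carrier P. d i p \<in> carrier Q"
    and "\<forall>i\<in>I. \<forall>p\<in>carrier P. \<gamma> i \<odot>\<^bsub>X\<^esub> s p = s (\<gamma> i \<odot>\<^bsub>P\<^esub> p) \<oplus>\<^bsub>X\<^esub> \<phi> (d i p)"
  using assms unfolding has_cocycle_def by auto

locale ext_setting = kalg A for A :: "('k::field, 'a) kalgebra" (structure) +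
  fixes \<gamma> :: "'i \<Rightarrow> 'a" and I :: "'i set"
    and P :: "('a, 'p) module" and Q :: "('a, 'q) module"
  assumes gen: "generated_by A \<gamma> I"
    and P_module: "left_module A P" and Q_module: "left_module A Q"
begin

lemma gamma_closed: "i \<in> I \<Longrightarrow> \<gamma> i \<in> carrier A"
  using gen by (auto simp: generated_by_def)

text \<open>If sections of two extensions have the same failure to commute with the generators, then
  matching \<open>\<phi> z + s p\<close> with \<open>\<phi>' z + s' p\<close> is compatible with the generators.\<close>

lemma ext_equiv_if_same_cocycle:
  assumes xi: "is_extension A P Q (X, \<phi>, \<psi>)" and eta: "is_extension A P Q (Y, \<phi>', \<psi>')"
    and c: "has_cocycle A \<gamma> I P Q d (X, \<phi>, \<psi>)" and c': "has_cocycle A \<gamma> I P Q d (Y, \<phi>', \<psi>')"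
  shows "ext_equiv A P Q (X, \<phi>, \<psi>) (Y, \<phi>', \<psi>')"
proof -
  note D = is_extensionD[OF xi] and D' = is_extensionD[OF eta]
  interpret X: left_module A X by (rule D(1))
  interpret Y: left_module A Y by (rule D'(1))
  interpret P: left_module A P by (rule P_module)
  interpret Q: left_module A Q by (rule Q_module)
  obtain s where s: "linear_section A P X \<psi> s"
    and d_ex: "\<forall>i\<in>I. \<forall>p\<in>carrier P. d i p \<in> carrier Q"
    and sg_ex: "\<forall>i\<in>I. \<forall>p\<in>carrier P. \<gamma> i \<odot>\<^bsub>X\<^esub> s p = s (\<gamma> i \<odot>\<^bsub>P\<^esub> p) \<oplus>\<^bsub>X\<^esub> \<phi> (d i p)"
    by (rule has_cocycleE[OF c])
  note d = d_ex[rule_format] and sg = sg_ex[rule_format]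
  obtain s' where s': "linear_section A P Y \<psi>' s'"
    and d_ex': "\<forall>i\<in>I. \<forall>p\<in>carrier P. d i p \<in> carrier Q"
    and sg_ex': "\<forall>i\<in>I. \<forall>p\<in>carrier P. \<gamma> i \<odot>\<^bsub>Y\<^esub> s' p = s' (\<gamma> i \<odot>\<^bsub>P\<^esub> p) \<oplus>\<^bsub>Y\<^esub> \<phi>' (d i p)"
    by (rule has_cocycleE[OF c'])
  note d' = d_ex'[rule_format] and sg' = sg_ex'[rule_format]
  note S = linear_sectionD[OF s] and S' = linear_sectionD[OF s']
  note F = module_homD[OF D(2)] and F' = module_homD[OF D'(2)]
  have sP: "s \<in> carrier P \<rightarrow> carrier X" "s' \<in> carrier P \<rightarrow> carrier Y" using S S' by auto
  let ?S = "carrier Q \<times> carrier P"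
  define f where "f = (\<lambda>(z, p). \<phi> z \<oplus>\<^bsub>X\<^esub> s p)"
  define f' where "f' = (\<lambda>(z, p). \<phi>' z \<oplus>\<^bsub>Y\<^esub> s' p)"
  have bij: "bij_betw f ?S (carrier X)"
    unfolding f_def by (rule extension_decomposition(1)[OF xi P_module Q_module sP(1) S(4)])
  have bij': "bij_betw f' ?S (carrier Y)"
    unfolding f'_def by (rule extension_decomposition(1)[OF eta P_module Q_module sP(2) S'(4)])
  define \<theta> where "\<theta> = f' \<circ> inv_into ?S f"
  have \<theta>: "\<theta> (\<phi> z \<oplus>\<^bsub>X\<^esub> s p) = \<phi>' z \<oplus>\<^bsub>Y\<^esub> s' p" if "z \<in> carrier Q" "p \<in> carrier P" for z p
  proof -
    have "inv_into ?S f (f (z, p)) = (z, p)" using bij that by (simp add: bij_betw_def)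
    then show ?thesis by (simp add: \<theta>_def f_def f'_def)
  qed
  have dec: "\<exists>z\<in>carrier Q. \<exists>p\<in>carrier P. x = \<phi> z \<oplus>\<^bsub>X\<^esub> s p" if "x \<in> carrier X" for x
  proof -
    have "x \<in> f ` ?S" using bij that by (simp add: bij_betw_def)
    then show ?thesis by (auto simp: f_def)
  qed
  have bij_th: "bij_betw \<theta> (carrier X) (carrier Y)"
    unfolding \<theta>_def using bij_betw_trans[OF bij_betw_inv_into[OF bij] bij'] .
  have th_closed: "\<theta> \<in> carrier X \<rightarrow> carrier Y" using bij_th by (auto simp: bij_betw_def)
  have hom: "module_hom A X Y \<theta>"
  proof (rule module_hom_generators[OF kalg_axioms gen D(1) D'(1) th_closed])
    fix x y assume xX: "x \<in> carrier X" "y \<in> carrier X"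
    then obtain z p w r where zp: "z \<in> carrier Q" "p \<in> carrier P" "w \<in> carrier Q" "r \<in> carrier P"
      and xy: "x = \<phi> z \<oplus>\<^bsub>X\<^esub> s p" "y = \<phi> w \<oplus>\<^bsub>X\<^esub> s r"
      using dec[OF xX(1)] dec[OF xX(2)] by blast
    have "x \<oplus>\<^bsub>X\<^esub> y = \<phi> (z \<oplus>\<^bsub>Q\<^esub> w) \<oplus>\<^bsub>X\<^esub> s (p \<oplus>\<^bsub>P\<^esub> r)"
      using zp by (simp add: xy F S X.M.a_ac)
    then have "\<theta> (x \<oplus>\<^bsub>X\<^esub> y) = \<phi>' (z \<oplus>\<^bsub>Q\<^esub> w) \<oplus>\<^bsub>Y\<^esub> s' (p \<oplus>\<^bsub>P\<^esub> r)"
      using zp by (simp add: \<theta>)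
    also have "\<dots> = \<theta> x \<oplus>\<^bsub>Y\<^esub> \<theta> y" using zp by (simp add: xy \<theta> F' S' Y.M.a_ac)
    finally show "\<theta> (x \<oplus>\<^bsub>X\<^esub> y) = \<theta> x \<oplus>\<^bsub>Y\<^esub> \<theta> y" .
  next
    fix k x assume xX: "x \<in> carrier X"
    then obtain z p where zp: "z \<in> carrier Q" "p \<in> carrier P" and x: "x = \<phi> z \<oplus>\<^bsub>X\<^esub> s p"
      using dec[OF xX] by blast
    have "scal A k \<odot>\<^bsub>X\<^esub> x = \<phi> (scal A k \<odot>\<^bsub>Q\<^esub> z) \<oplus>\<^bsub>X\<^esub> s (scal A k \<odot>\<^bsub>P\<^esub> p)"
      using zp by (simp add: x F S X.lsmult_r_distr)
    then show "\<theta> (scal A k \<odot>\<^bsub>X\<^esub> x) = scal A k \<odot>\<^bsub>Y\<^esub> \<theta> x"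
      using zp by (simp add: x \<theta> F' S' Y.lsmult_r_distr P.lsmult_closed Q.lsmult_closed)
  next
    fix i x assume i: "i \<in> I" and xX: "x \<in> carrier X"
    then obtain z p where zp: "z \<in> carrier Q" "p \<in> carrier P" and x: "x = \<phi> z \<oplus>\<^bsub>X\<^esub> s p"
      using dec[OF xX] by blast
    note cl = zp d[OF i zp(2)] gamma_closed[OF i] P.lsmult_closed[OF gamma_closed[OF i] zp(2)]
      Q.lsmult_closed[OF gamma_closed[OF i] zp(1)]
    have "\<gamma> i \<odot>\<^bsub>X\<^esub> x = \<phi> (\<gamma> i \<odot>\<^bsub>Q\<^esub> z) \<oplus>\<^bsub>X\<^esub> (s (\<gamma> i \<odot>\<^bsub>P\<^esub> p) \<oplus>\<^bsub>X\<^esub> \<phi> (d i p))"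
      using cl by (simp add: x F(1,3) S(1) X.lsmult_r_distr sg[OF i])
    also have "\<dots> = \<phi> (\<gamma> i \<odot>\<^bsub>Q\<^esub> z \<oplus>\<^bsub>Q\<^esub> d i p) \<oplus>\<^bsub>X\<^esub> s (\<gamma> i \<odot>\<^bsub>P\<^esub> p)"
      using cl by (simp add: F(1,2) S(1) X.M.a_ac)
    finally have "\<theta> (\<gamma> i \<odot>\<^bsub>X\<^esub> x) = \<phi>' (\<gamma> i \<odot>\<^bsub>Q\<^esub> z \<oplus>\<^bsub>Q\<^esub> d i p) \<oplus>\<^bsub>Y\<^esub> s' (\<gamma> i \<odot>\<^bsub>P\<^esub> p)"
      using cl by (simp add: \<theta>)
    also have "\<dots> = \<gamma> i \<odot>\<^bsub>Y\<^esub> \<phi>' z \<oplus>\<^bsub>Y\<^esub> (s' (\<gamma> i \<odot>\<^bsub>P\<^esub> p) \<oplus>\<^bsub>Y\<^esub> \<phi>' (d i p))"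
      using cl by (simp add: F'(1,2) F'(3)[symmetric] S'(1) Y.M.a_ac)
    also have "\<dots> = \<gamma> i \<odot>\<^bsub>Y\<^esub> \<theta> x"
      using cl by (simp add: x \<theta> F'(1) S'(1) Y.lsmult_r_distr sg'[OF i])
    finally show "\<theta> (\<gamma> i \<odot>\<^bsub>X\<^esub> x) = \<gamma> i \<odot>\<^bsub>Y\<^esub> \<theta> x" .
  qed
  have s0: "s \<zero>\<^bsub>P\<^esub> = \<zero>\<^bsub>X\<^esub>"
    by (rule additive_zero_minus(1)[OF P.M.abelian_group_axioms X.M.abelian_group_axioms sP(1) S(2)])
  have s0': "s' \<zero>\<^bsub>P\<^esub> = \<zero>\<^bsub>Y\<^esub>"
    by (rule additive_zero_minus(1)[OF P.M.abelian_group_axioms Y.M.abelian_group_axioms sP(2) S'(2)])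
  have "\<theta> (\<phi> z) = \<phi>' z" if "z \<in> carrier Q" for z
    using \<theta>[of z "\<zero>\<^bsub>P\<^esub>"] that F F' by (simp add: s0 s0')
  moreover have "\<psi>' (\<theta> x) = \<psi> x" if xX: "x \<in> carrier X" for x
  proof -
    obtain z p where zp: "z \<in> carrier Q" "p \<in> carrier P" and x: "x = \<phi> z \<oplus>\<^bsub>X\<^esub> s p"
      using dec[OF xX] by blast
    show ?thesis
      using extension_decomposition(2)[OF xi P_module Q_module sP(1) S(4) zp]
        extension_decomposition(2)[OF eta P_module Q_module sP(2) S'(4) zp]
      by (simp add: x \<theta>[OF zp])
  qed
  ultimately show ?thesis
    using hom bij_th by (auto simp: ext_equiv_def module_iso_def intro!: exI[of _ \<theta>])
qed

text \<open>An equivalence maps a section of one extension to a section of the other.\<close>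

lemma has_cocycle_transfer:
  assumes xi: "is_extension A P Q (X, \<phi>, \<psi>)" and eq: "ext_equiv A P Q (X, \<phi>, \<psi>) (Y, \<phi>', \<psi>')"
    and c: "has_cocycle A \<gamma> I P Q d (X, \<phi>, \<psi>)"
  shows "has_cocycle A \<gamma> I P Q d (Y, \<phi>', \<psi>')"
proof -
  note D = is_extensionD[OF xi]
  interpret P: left_module A P by (rule P_module)
  obtain \<theta> where \<theta>: "module_hom A X Y \<theta>" "\<forall>z\<in>carrier Q. \<theta> (\<phi> z) = \<phi>' z"
    "\<forall>x\<in>carrier X. \<psi>' (\<theta> x) = \<psi> x" using eq by (auto simp: ext_equiv_def module_iso_def)
  note T = module_homD[OF \<theta>(1)]
  obtain s where s: "linear_section A P X \<psi> s"
    and d_ex: "\<forall>i\<in>I. \<forall>p\<in>carrier P. d i p \<in> carrier Q"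
    and sg_ex: "\<forall>i\<in>I. \<forall>p\<in>carrier P. \<gamma> i \<odot>\<^bsub>X\<^esub> s p = s (\<gamma> i \<odot>\<^bsub>P\<^esub> p) \<oplus>\<^bsub>X\<^esub> \<phi> (d i p)"
    by (rule has_cocycleE[OF c])
  note d = d_ex[rule_format] and sg = sg_ex[rule_format]
  note S = linear_sectionD[OF s]
  have "linear_section A P Y \<psi>' (\<theta> \<circ> s)"
    using \<theta> by (auto simp: linear_section_def S T)
  moreover have "\<gamma> i \<odot>\<^bsub>Y\<^esub> \<theta> (s p) = \<theta> (s (\<gamma> i \<odot>\<^bsub>P\<^esub> p)) \<oplus>\<^bsub>Y\<^esub> \<phi>' (d i p)"
    if "i \<in> I" "p \<in> carrier P" for i p
  proof -
    have "\<gamma> i \<odot>\<^bsub>Y\<^esub> \<theta> (s p) = \<theta> (s (\<gamma> i \<odot>\<^bsub>P\<^esub> p) \<oplus>\<^bsub>X\<^esub> \<phi> (d i p))"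
      using that by (simp add: T(3)[symmetric] gamma_closed S sg d)
    then show ?thesis
      using that d[OF that] \<theta>(2) by (simp add: T gamma_closed S module_homD[OF D(2)] P.lsmult_closed)
  qed
  ultimately show ?thesis
    using d by (auto simp: has_cocycle_def intro!: exI[of _ "\<theta> \<circ> s"])
qed

lemma split_ext_is_extension: "is_extension A P Q (split_ext P Q)"
proof -
  interpret P: left_module A P by (rule P_module)
  interpret Q: left_module A Q by (rule Q_module)
  show ?thesis
    unfolding split_ext_def
    by (rule is_extensionI[OF left_module_direct_sum[OF Q_module P_module]])
      (auto simp: direct_sum_def module_hom_def P.lsmult_r_null intro!: inj_onI)
qed

text \<open>A section that is a module map has the cocycle \<open>0\<close>, as has the split extension.\<close>

lemma split_if_hom_section:
  assumes xi: "is_extension A P Q (X, \<phi>, \<psi>)"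
    and s: "module_hom A P X s" "\<And>p. p \<in> carrier P \<Longrightarrow> \<psi> (s p) = p"
  shows "ext_equiv A P Q (split_ext P Q) (X, \<phi>, \<psi>)"
proof -
  note D = is_extensionD[OF xi]
  interpret P: left_module A P by (rule P_module)
  interpret Q: left_module A Q by (rule Q_module)
  interpret X: left_module A X by (rule D(1))
  have "has_cocycle A \<gamma> I P Q (\<lambda>_ _. \<zero>\<^bsub>Q\<^esub>) (X, \<phi>, \<psi>)"
    using module_hom_zero_minus(1)[OF Q_module D(1,2)] s(2)
    by (auto simp: has_cocycle_def linear_section_def module_homD[OF s(1)] gamma_closed
        P.lsmult_closed X.lsmult_closed intro!: exI[of _ s])
  moreover have "has_cocycle A \<gamma> I P Q (\<lambda>_ _. \<zero>\<^bsub>Q\<^esub>) (split_ext P Q)"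
    by (auto simp: has_cocycle_def linear_section_def split_ext_def direct_sum_def gamma_closed
        P.lsmult_closed Q.lsmult_r_null intro!: exI[of _ "\<lambda>p. (\<zero>\<^bsub>Q\<^esub>, p)"])
  ultimately show ?thesis
    using ext_equiv_if_same_cocycle[OF split_ext_is_extension[unfolded split_ext_def] xi]
    by (simp add: split_ext_def)
qed

subsection \<open>Scalar multiples and Baer sums\<close>

text \<open>In the pullback along \<open>c\<close>, the vectors \<open>(s (c p), p)\<close> form a section.\<close>

lemma ext_scale_extension:
  assumes xi: "is_extension A P Q (X, \<phi>, \<psi>)"
  shows "is_extension A P Q (ext_scale A P c (X, \<phi>, \<psi>))"
    and "has_cocycle A \<gamma> I P Q d (X, \<phi>, \<psi>) \<Longrightarrow>
      has_cocycle A \<gamma> I P Q (\<lambda>i p. d i (scal A c \<odot>\<^bsub>P\<^esub> p)) (ext_scale A P c (X, \<phi>, \<psi>))"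
proof -
  note D = is_extensionD[OF xi]
  interpret P: left_module A P by (rule P_module)
  interpret Q: left_module A Q by (rule Q_module)
  interpret X: left_module A X by (rule D(1))
  note F = module_homD[OF D(2)] and G = module_homD[OF D(3)]
  let ?H = "{(x, p). x \<in> carrier X \<and> p \<in> carrier P \<and> \<psi> x = scal A c \<odot>\<^bsub>P\<^esub> p}"
  have sum: "left_module A (direct_sum X P)" by (rule left_module_direct_sum[OF D(1) P_module])
  interpret S: left_module A "direct_sum X P" by (rule sum)
  have comm: "a \<odot>\<^bsub>P\<^esub> (scal A c \<odot>\<^bsub>P\<^esub> p) = scal A c \<odot>\<^bsub>P\<^esub> (a \<odot>\<^bsub>P\<^esub> p)"
    if "a \<in> carrier A" "p \<in> carrier P" for a p
    using that by (simp add: P.lsmult_assoc[symmetric] scal_central)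
  have psi0: "\<psi> \<zero>\<^bsub>X\<^esub> = \<zero>\<^bsub>P\<^esub>" by (rule module_hom_zero_minus(1)[OF D(1) P_module D(3)])
  have phi0: "\<phi> \<zero>\<^bsub>Q\<^esub> = \<zero>\<^bsub>X\<^esub>" by (rule module_hom_zero_minus(1)[OF Q_module D(1,2)])
  have "submodule ?H A (direct_sum X P)"
    by (rule S.submoduleI)
      (auto simp: direct_sum_def psi0 P.lsmult_r_null G P.lsmult_r_distr X.lsmult_closed
        P.lsmult_closed comm)
  then have mod: "left_module A ((direct_sum X P)\<lparr>carrier := ?H\<rparr>)"
    by (rule left_module_submodule[OF sum])
  have surj: "\<exists>x. x \<in> carrier X \<and> \<psi> x = scal A c \<odot>\<^bsub>P\<^esub> p" if "p \<in> carrier P" for p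
    using D(7)[of "scal A c \<odot>\<^bsub>P\<^esub> p"] that P.lsmult_closed by auto
  show "is_extension A P Q (ext_scale A P c (X, \<phi>, \<psi>))"
    unfolding ext_scale_def prod.case
    by (rule is_extensionI[OF mod])
      (use D(6) surj in \<open>auto simp: direct_sum_def module_hom_def F D(5) P.lsmult_r_null phi0
        intro!: inj_onI dest: inj_onD[OF D(4)]\<close>)
  assume c: "has_cocycle A \<gamma> I P Q d (X, \<phi>, \<psi>)"
  obtain s where s: "linear_section A P X \<psi> s"
    and d_ex: "\<forall>i\<in>I. \<forall>p\<in>carrier P. d i p \<in> carrier Q"
    and sg_ex: "\<forall>i\<in>I. \<forall>p\<in>carrier P. \<gamma> i \<odot>\<^bsub>X\<^esub> s p = s (\<gamma> i \<odot>\<^bsub>P\<^esub> p) \<oplus>\<^bsub>X\<^esub> \<phi> (d i p)"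
    by (rule has_cocycleE[OF c])
  note d = d_ex[rule_format] and sg = sg_ex[rule_format]
  note S = linear_sectionD[OF s]
  have cc: "scal A c \<odot>\<^bsub>X\<^esub> (scal A k \<odot>\<^bsub>X\<^esub> x) = scal A k \<odot>\<^bsub>X\<^esub> (scal A c \<odot>\<^bsub>X\<^esub> x)" if "x \<in> carrier X" for k x
    using that scal_central[of "scal A k" c] by (simp add: X.lsmult_assoc[symmetric])
  show "has_cocycle A \<gamma> I P Q (\<lambda>i p. d i (scal A c \<odot>\<^bsub>P\<^esub> p)) (ext_scale A P c (X, \<phi>, \<psi>))"
    unfolding has_cocycle_def ext_scale_def prod.case
  proof (intro exI[of _ "\<lambda>p. (s (scal A c \<odot>\<^bsub>P\<^esub> p), p)"] conjI ballI)
    show "linear_section A P ((direct_sum X P)\<lparr>carrier := ?H\<rparr>) snd (\<lambda>p. (s (scal A c \<odot>\<^bsub>P\<^esub> p), p))"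
      by (auto simp: linear_section_def direct_sum_def S P.lsmult_closed P.lsmult_r_distr comm
          X.lsmult_r_distr X.lsmult_closed G cc)
    fix i p assume ip: "i \<in> I" "p \<in> carrier P"
    show "d i (scal A c \<odot>\<^bsub>P\<^esub> p) \<in> carrier Q" using ip d P.lsmult_closed by simp
    show "\<gamma> i \<odot>\<^bsub>(direct_sum X P)\<lparr>carrier := ?H\<rparr>\<^esub> (s (scal A c \<odot>\<^bsub>P\<^esub> p), p) =
      (s (scal A c \<odot>\<^bsub>P\<^esub> (\<gamma> i \<odot>\<^bsub>P\<^esub> p)), \<gamma> i \<odot>\<^bsub>P\<^esub> p)
        \<oplus>\<^bsub>(direct_sum X P)\<lparr>carrier := ?H\<rparr>\<^esub> (\<phi> (d i (scal A c \<odot>\<^bsub>P\<^esub> p)), \<zero>\<^bsub>P\<^esub>)"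
      using sg[OF ip(1), of "scal A c \<odot>\<^bsub>P\<^esub> p"] ip
      by (simp add: direct_sum_def P.lsmult_closed gamma_closed comm)
  qed
qed

text \<open>The section \<open>p \<mapsto> (s p, s' p)\<close> of the fibre product fails by the pair \<open>(d i p, d' i p)\<close>. Modulo the
  antidiagonal, the second component can be shifted to the first, which adds the two cocycles.\<close>

lemma baer_sum_extension:
  assumes xi: "is_extension A P Q (X, \<phi>, \<psi>)" and eta: "is_extension A P Q (Y, \<phi>', \<psi>')"
  shows "is_extension A P Q (baer_sum Q (X, \<phi>, \<psi>) (Y, \<phi>', \<psi>'))"
    and "\<lbrakk>has_cocycle A \<gamma> I P Q d (X, \<phi>, \<psi>); has_cocycle A \<gamma> I P Q d' (Y, \<phi>', \<psi>')\<rbrakk> \<Longrightarrow>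
      has_cocycle A \<gamma> I P Q (\<lambda>i p. d i p \<oplus>\<^bsub>Q\<^esub> d' i p) (baer_sum Q (X, \<phi>, \<psi>) (Y, \<phi>', \<psi>'))"
proof -
  note D = is_extensionD[OF xi] and D' = is_extensionD[OF eta]
  interpret P: left_module A P by (rule P_module)
  interpret Q: left_module A Q by (rule Q_module)
  interpret X: left_module A X by (rule D(1))
  interpret Y: left_module A Y by (rule D'(1))
  note F = module_homD[OF D(2)] and G = module_homD[OF D(3)]
  note F' = module_homD[OF D'(2)] and G' = module_homD[OF D'(3)]
  note Z = module_hom_zero_minus[OF D(1) P_module D(3)] module_hom_zero_minus[OF Q_module D(1,2)]
    module_hom_zero_minus[OF D'(1) P_module D'(3)] module_hom_zero_minus[OF Q_module D'(1,2)]
  define H where "H = {(x, y). x \<in> carrier X \<and> y \<in> carrier Y \<and> \<psi> x = \<psi>' y}"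
  define B where "B = (direct_sum X Y)\<lparr>carrier := H\<rparr>"
  define E where "E = (\<lambda>z. (\<phi> z, \<ominus>\<^bsub>Y\<^esub> \<phi>' z)) ` carrier Q"
  define W where "W = quotient_module B E"
  have baer: "baer_sum Q (X, \<phi>, \<psi>) (Y, \<phi>', \<psi>') =
    (W, \<lambda>z. E +>\<^bsub>B\<^esub> (\<phi> z, \<zero>\<^bsub>Y\<^esub>), \<lambda>C. \<psi> (fst (SOME w. w \<in> C)))"
    by (simp add: baer_sum_def Let_def B_def H_def E_def W_def)
  have sum: "left_module A (direct_sum X Y)" by (rule left_module_direct_sum[OF D(1) D'(1)])
  interpret S: left_module A "direct_sum X Y" by (rule sum)
  have "submodule H A (direct_sum X Y)"
    by (rule S.submoduleI) (auto simp: H_def direct_sum_def Z G G' X.lsmult_closed Y.lsmult_closed)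
  then have B: "left_module A B" unfolding B_def by (rule left_module_submodule[OF sum])
  interpret B: left_module A B by (rule B)
  have Bsimps: "carrier B = H" "(x, y) \<oplus>\<^bsub>B\<^esub> (x', y') = (x \<oplus>\<^bsub>X\<^esub> x', y \<oplus>\<^bsub>Y\<^esub> y')"
    "a \<odot>\<^bsub>B\<^esub> (x, y) = (a \<odot>\<^bsub>X\<^esub> x, a \<odot>\<^bsub>Y\<^esub> y)" "\<zero>\<^bsub>B\<^esub> = (\<zero>\<^bsub>X\<^esub>, \<zero>\<^bsub>Y\<^esub>)" for x x' y y' a
    by (simp_all add: B_def direct_sum_def)
  have Bminus: "(x, y) \<ominus>\<^bsub>B\<^esub> (x', y') = (x \<ominus>\<^bsub>X\<^esub> x', y \<ominus>\<^bsub>Y\<^esub> y')" if "(x, y) \<in> H" "(x', y') \<in> H" for x x' y y'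
  proof -
    have "module_hom A B X fst" "module_hom A B Y snd"
      by (auto simp: module_hom_def Bsimps H_def)
    from module_hom_zero_minus(3)[OF B D(1) this(1)] module_hom_zero_minus(3)[OF B D'(1) this(2)]
    have "fst ((x, y) \<ominus>\<^bsub>B\<^esub> (x', y')) = x \<ominus>\<^bsub>X\<^esub> x'" "snd ((x, y) \<ominus>\<^bsub>B\<^esub> (x', y')) = y \<ominus>\<^bsub>Y\<^esub> y'"
      using that by (simp_all add: Bsimps)
    then show ?thesis by (metis prod.collapse)
  qed
  have "submodule E A B"
  proof (rule B.submoduleI)
    show "E \<subseteq> carrier B" by (auto simp: E_def Bsimps H_def F F' D(5) D'(5) Z P.minus_zero')
    show "\<zero>\<^bsub>B\<^esub> \<in> E" by (auto simp: E_def Bsimps Z Y.minus_zero' intro!: image_eqI[of _ _ "\<zero>\<^bsub>Q\<^esub>"])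
    show "x \<oplus>\<^bsub>B\<^esub> y \<in> E" if xy: "x \<in> E" "y \<in> E" for x y
    proof -
      obtain z w where zw: "z \<in> carrier Q" "x = (\<phi> z, \<ominus>\<^bsub>Y\<^esub> \<phi>' z)"
        "w \<in> carrier Q" "y = (\<phi> w, \<ominus>\<^bsub>Y\<^esub> \<phi>' w)" using xy unfolding E_def by blast
      then show ?thesis unfolding E_def
        by (intro image_eqI[of _ _ "z \<oplus>\<^bsub>Q\<^esub> w"]) (simp_all add: Bsimps F F' Y.M.minus_add)
    qed
    show "a \<odot>\<^bsub>B\<^esub> x \<in> E" if a: "a \<in> carrier A" and x: "x \<in> E" for a x
    proof -
      obtain z where z: "z \<in> carrier Q" "x = (\<phi> z, \<ominus>\<^bsub>Y\<^esub> \<phi>' z)"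
        using x unfolding E_def by blast
      then show ?thesis unfolding E_def using a
        by (intro image_eqI[of _ _ "a \<odot>\<^bsub>Q\<^esub> z"])
          (simp_all add: Bsimps F F' Y.lsmult_r_minus Q.lsmult_closed)
    qed
  qed
  note W = quotient_module[OF B this, folded W_def]
  interpret W: left_module A W by (rule W(1))
  define \<pi> where "\<pi> = (\<lambda>w. E +>\<^bsub>B\<^esub> w)"
  have \<pi>_hom: "module_hom A B W \<pi>" using W(2) by (simp add: \<pi>_def)
  note \<pi> = module_homD[OF \<pi>_hom, unfolded Bsimps(1)]
  have \<pi>_surj: "\<exists>x y. (x, y) \<in> H \<and> C = \<pi> (x, y)" if "C \<in> carrier W" for C
  proof -
    have "C \<in> \<pi> ` H" using that W(3) by (simp add: \<pi>_def Bsimps(1))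
    then show ?thesis by auto
  qed
  have \<pi>_eq: "\<pi> (x, y) = \<pi> (x', y') \<longleftrightarrow> (x \<ominus>\<^bsub>X\<^esub> x', y \<ominus>\<^bsub>Y\<^esub> y') \<in> E"
    if "(x, y) \<in> H" "(x', y') \<in> H" for x y x' y'
    using W(4)[of "(x, y)" "(x', y')"] that by (simp add: \<pi>_def Bsimps(1) Bminus)
  have psi_E: "\<psi> x = \<zero>\<^bsub>P\<^esub>" if "(x, y) \<in> E" for x y using that by (auto simp: E_def D(5))
  let ?f = "\<lambda>z. \<pi> (\<phi> z, \<zero>\<^bsub>Y\<^esub>)" and ?g = "\<lambda>C. \<psi> (fst (SOME w. w \<in> C))"
  have g: "?g (\<pi> (x, y)) = \<psi> x" if xy: "(x, y) \<in> H" for x y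
  proof -
    obtain x' y' where w: "(SOME w. w \<in> \<pi> (x, y)) = (x', y')" by fastforce
    have "(x, y) \<in> \<pi> (x, y)" using W(5)[of "(x, y)"] xy by (simp add: \<pi>_def Bsimps(1))
    then have "(x', y') \<in> \<pi> (x, y)" by (metis w someI)
    then have "(x', y') \<in> H" "(x' \<ominus>\<^bsub>X\<^esub> x, y' \<ominus>\<^bsub>Y\<^esub> y) \<in> E"
      using W(6)[of "(x, y)" "(x', y')"] xy by (auto simp: \<pi>_def Bsimps(1) Bminus)
    then have "\<psi> x' = \<psi> x" using psi_E[of "x' \<ominus>\<^bsub>X\<^esub> x"] xy
      by (auto simp: H_def Z P.diff_eq_zero_iff G G')
    then show ?thesis by (simp add: w)
  qed
  have inH: "(\<phi> z, \<zero>\<^bsub>Y\<^esub>) \<in> H" if "z \<in> carrier Q" for z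
    using that by (auto simp: H_def F D(5) Z)
  have g_closed: "?g C \<in> carrier P" if "C \<in> carrier W" for C
    using \<pi>_surj[OF that] by (auto simp: g simp del: fst_conv) (auto simp: H_def G G')
  show "is_extension A P Q (baer_sum Q (X, \<phi>, \<psi>) (Y, \<phi>', \<psi>'))"
    unfolding baer \<pi>_def[symmetric]
  proof (rule is_extensionI[OF W(1)])
    show "module_hom A Q W ?f"
      by (auto simp: module_hom_def \<pi> inH \<pi>(2,3)[symmetric] Bsimps F Y.lsmult_r_null)
    have "?g (C \<oplus>\<^bsub>W\<^esub> C') = ?g C \<oplus>\<^bsub>P\<^esub> ?g C'" if C: "C \<in> carrier W" "C' \<in> carrier W" for C C'
    proof -
      obtain x y x' y' where xy: "(x, y) \<in> H" "C = \<pi> (x, y)" "(x', y') \<in> H" "C' = \<pi> (x', y')"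
        using \<pi>_surj[OF C(1)] \<pi>_surj[OF C(2)] by blast
      have "(x \<oplus>\<^bsub>X\<^esub> x', y \<oplus>\<^bsub>Y\<^esub> y') \<in> H" using xy by (auto simp: H_def G G')
      then show ?thesis using xy g[OF xy(1)] g[OF xy(3)]
        by (simp add: \<pi>(2)[symmetric] Bsimps g) (simp add: H_def G G')
    qed
    moreover have "?g (a \<odot>\<^bsub>W\<^esub> C) = a \<odot>\<^bsub>P\<^esub> ?g C" if C: "a \<in> carrier A" "C \<in> carrier W" for a C
    proof -
      obtain x y where xy: "(x, y) \<in> H" "C = \<pi> (x, y)"
        using \<pi>_surj[OF C(2)] by blast
      have "(a \<odot>\<^bsub>X\<^esub> x, a \<odot>\<^bsub>Y\<^esub> y) \<in> H"
        using xy C by (auto simp: H_def G G' X.lsmult_closed Y.lsmult_closed)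
      then show ?thesis using xy g[OF xy(1)] C
        by (simp add: \<pi>(3)[symmetric] Bsimps g) (simp add: H_def G G')
    qed
    ultimately show "module_hom A W P ?g" using g_closed by (auto simp: module_hom_def)
    show "inj_on ?f (carrier Q)"
    proof (rule inj_onI)
      fix z z' assume z: "z \<in> carrier Q" "z' \<in> carrier Q" and "?f z = ?f z'"
      then have "(\<phi> z \<ominus>\<^bsub>X\<^esub> \<phi> z', \<zero>\<^bsub>Y\<^esub> \<ominus>\<^bsub>Y\<^esub> \<zero>\<^bsub>Y\<^esub>) \<in> E" by (simp add: \<pi>_eq inH)
      then obtain w where w: "w \<in> carrier Q" "\<phi> z \<ominus>\<^bsub>X\<^esub> \<phi> z' = \<phi> w" "\<zero>\<^bsub>Y\<^esub> = \<ominus>\<^bsub>Y\<^esub> \<phi>' w"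
        by (auto simp: E_def Y.M.minus_eq Y.minus_zero')
      then have "\<phi>' w = \<zero>\<^bsub>Y\<^esub>" using F'(1)[OF w(1)] by (metis Y.M.minus_minus Y.minus_zero')
      then have "\<phi>' w = \<phi>' \<zero>\<^bsub>Q\<^esub>" by (simp add: Z)
      then have "w = \<zero>\<^bsub>Q\<^esub>" using inj_onD[OF D'(4)] w(1) by blast
      then have "\<phi> z \<ominus>\<^bsub>X\<^esub> \<phi> z' = \<zero>\<^bsub>X\<^esub>" using w(2) by (simp add: Z)
      then have "\<phi> z = \<phi> z'" using z by (simp add: X.diff_eq_zero_iff F)
      then show "z = z'" using z inj_onD[OF D(4)] by blast
    qed
    show "?g (?f z) = \<zero>\<^bsub>P\<^esub>" if "z \<in> carrier Q" for z
      using that by (simp add: g inH D(5) del: fst_conv)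
    show "\<exists>z\<in>carrier Q. C = ?f z" if C: "C \<in> carrier W" "?g C = \<zero>\<^bsub>P\<^esub>" for C
    proof -
      obtain x y where xy: "(x, y) \<in> H" "C = \<pi> (x, y)" using \<pi>_surj[OF C(1)] by blast
      then have "\<psi> x = \<zero>\<^bsub>P\<^esub>" "\<psi>' y = \<zero>\<^bsub>P\<^esub>" using C g[OF xy(1)] by (auto simp: H_def)
      then obtain z z' where z: "z \<in> carrier Q" "z' \<in> carrier Q" "x = \<phi> z" "y = \<phi>' z'"
        using xy D(6)[of x] D'(6)[of y] by (auto simp: H_def)
      have "C = ?f (z \<oplus>\<^bsub>Q\<^esub> z')"
        unfolding xy(2)
      proof (subst \<pi>_eq)
        show "(x \<ominus>\<^bsub>X\<^esub> \<phi> (z \<oplus>\<^bsub>Q\<^esub> z'), y \<ominus>\<^bsub>Y\<^esub> \<zero>\<^bsub>Y\<^esub>) \<in> E"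
          unfolding E_def
        proof (rule image_eqI[of _ _ "\<ominus>\<^bsub>Q\<^esub> z'"])
          show "(x \<ominus>\<^bsub>X\<^esub> \<phi> (z \<oplus>\<^bsub>Q\<^esub> z'), y \<ominus>\<^bsub>Y\<^esub> \<zero>\<^bsub>Y\<^esub>) = (\<phi> (\<ominus>\<^bsub>Q\<^esub> z'), \<ominus>\<^bsub>Y\<^esub> \<phi>' (\<ominus>\<^bsub>Q\<^esub> z'))"
            using z F(1) F'(1)
            by (simp add: F(2) Z X.M.minus_eq Y.M.minus_eq X.M.minus_add X.M.a_assoc[symmetric] X.M.r_neg)
        qed (use z in auto)
      qed (use xy z inH in auto)
      then show ?thesis using z by auto
    qed
    show "\<exists>C\<in>carrier W. ?g C = p" if p: "p \<in> carrier P" for p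
    proof -
      obtain x y where "x \<in> carrier X" "\<psi> x = p" "y \<in> carrier Y" "\<psi>' y = p"
        using D(7)[OF p] D'(7)[OF p] by auto
      then show ?thesis using g[of x y] \<pi>(1)[of "(x, y)"] by (auto simp: H_def)
    qed
  qed
  assume c: "has_cocycle A \<gamma> I P Q d (X, \<phi>, \<psi>)" and c': "has_cocycle A \<gamma> I P Q d' (Y, \<phi>', \<psi>')"
  obtain s where s: "linear_section A P X \<psi> s"
    and d_ex: "\<forall>i\<in>I. \<forall>p\<in>carrier P. d i p \<in> carrier Q"
    and sg_ex: "\<forall>i\<in>I. \<forall>p\<in>carrier P. \<gamma> i \<odot>\<^bsub>X\<^esub> s p = s (\<gamma> i \<odot>\<^bsub>P\<^esub> p) \<oplus>\<^bsub>X\<^esub> \<phi> (d i p)"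
    by (rule has_cocycleE[OF c])
  note d = d_ex[rule_format] and sg = sg_ex[rule_format]
  obtain s' where s': "linear_section A P Y \<psi>' s'"
    and d_ex': "\<forall>i\<in>I. \<forall>p\<in>carrier P. d' i p \<in> carrier Q"
    and sg_ex': "\<forall>i\<in>I. \<forall>p\<in>carrier P. \<gamma> i \<odot>\<^bsub>Y\<^esub> s' p = s' (\<gamma> i \<odot>\<^bsub>P\<^esub> p) \<oplus>\<^bsub>Y\<^esub> \<phi>' (d' i p)"
    by (rule has_cocycleE[OF c'])
  note d' = d_ex'[rule_format] and sg' = sg_ex'[rule_format]
  note S = linear_sectionD[OF s] and S' = linear_sectionD[OF s']
  have sH: "(s p, s' p) \<in> H" if "p \<in> carrier P" for p using that by (auto simp: H_def S S')
  show "has_cocycle A \<gamma> I P Q (\<lambda>i p. d i p \<oplus>\<^bsub>Q\<^esub> d' i p) (baer_sum Q (X, \<phi>, \<psi>) (Y, \<phi>', \<psi>'))"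
    unfolding baer \<pi>_def[symmetric] has_cocycle_def prod.case
  proof (intro exI[of _ "\<lambda>p. \<pi> (s p, s' p)"] conjI ballI)
    show "linear_section A P W ?g (\<lambda>p. \<pi> (s p, s' p))"
      by (auto simp: linear_section_def \<pi> sH g \<pi>(2,3)[symmetric] Bsimps S S' simp del: fst_conv)
    fix i p assume ip: "i \<in> I" "p \<in> carrier P"
    show "d i p \<oplus>\<^bsub>Q\<^esub> d' i p \<in> carrier Q" using d d' ip by simp
    have gp: "\<gamma> i \<odot>\<^bsub>P\<^esub> p \<in> carrier P" using ip gamma_closed P.lsmult_closed by auto
    note cl = d[OF ip] d'[OF ip] S(1)[OF gp] S'(1)[OF gp] F(1)[OF d[OF ip]] F'(1)[OF d'[OF ip]]
      F(1)[OF d'[OF ip]]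
    have "\<gamma> i \<odot>\<^bsub>W\<^esub> \<pi> (s p, s' p) = \<pi> (s (\<gamma> i \<odot>\<^bsub>P\<^esub> p) \<oplus>\<^bsub>X\<^esub> \<phi> (d i p), s' (\<gamma> i \<odot>\<^bsub>P\<^esub> p) \<oplus>\<^bsub>Y\<^esub> \<phi>' (d' i p))"
      using ip sH by (simp add: \<pi>(3)[symmetric] gamma_closed Bsimps sg sg')
    also have "\<dots> = \<pi> (s (\<gamma> i \<odot>\<^bsub>P\<^esub> p) \<oplus>\<^bsub>X\<^esub> \<phi> (d i p \<oplus>\<^bsub>Q\<^esub> d' i p), s' (\<gamma> i \<odot>\<^bsub>P\<^esub> p))"
    proof (subst \<pi>_eq)
      show "(s (\<gamma> i \<odot>\<^bsub>P\<^esub> p) \<oplus>\<^bsub>X\<^esub> \<phi> (d i p), s' (\<gamma> i \<odot>\<^bsub>P\<^esub> p) \<oplus>\<^bsub>Y\<^esub> \<phi>' (d' i p)) \<in> H"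
        "(s (\<gamma> i \<odot>\<^bsub>P\<^esub> p) \<oplus>\<^bsub>X\<^esub> \<phi> (d i p \<oplus>\<^bsub>Q\<^esub> d' i p), s' (\<gamma> i \<odot>\<^bsub>P\<^esub> p)) \<in> H"
        using cl gp by (simp_all add: H_def G G' D(5) D'(5) S S' F)
      have "(s (\<gamma> i \<odot>\<^bsub>P\<^esub> p) \<oplus>\<^bsub>X\<^esub> \<phi> (d i p)) \<ominus>\<^bsub>X\<^esub> (s (\<gamma> i \<odot>\<^bsub>P\<^esub> p) \<oplus>\<^bsub>X\<^esub> \<phi> (d i p \<oplus>\<^bsub>Q\<^esub> d' i p))
        = \<phi> (\<ominus>\<^bsub>Q\<^esub> d' i p)"
        using cl by (simp add: F(2) Z X.M.minus_eq X.M.minus_add X.M.a_ac X.M.r_neg X.M.r_neg1 X.M.r_neg2)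
      moreover have "s' (\<gamma> i \<odot>\<^bsub>P\<^esub> p) \<oplus>\<^bsub>Y\<^esub> \<phi>' (d' i p) \<ominus>\<^bsub>Y\<^esub> s' (\<gamma> i \<odot>\<^bsub>P\<^esub> p) = \<ominus>\<^bsub>Y\<^esub> \<phi>' (\<ominus>\<^bsub>Q\<^esub> d' i p)"
        using cl by (simp add: Z Y.M.minus_eq Y.M.a_comm[of "s' _"] Y.M.a_assoc Y.M.r_neg)
      ultimately show "(s (\<gamma> i \<odot>\<^bsub>P\<^esub> p) \<oplus>\<^bsub>X\<^esub> \<phi> (d i p) \<ominus>\<^bsub>X\<^esub> (s (\<gamma> i \<odot>\<^bsub>P\<^esub> p) \<oplus>\<^bsub>X\<^esub> \<phi> (d i p \<oplus>\<^bsub>Q\<^esub> d' i p)),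
        s' (\<gamma> i \<odot>\<^bsub>P\<^esub> p) \<oplus>\<^bsub>Y\<^esub> \<phi>' (d' i p) \<ominus>\<^bsub>Y\<^esub> s' (\<gamma> i \<odot>\<^bsub>P\<^esub> p)) \<in> E"
        using cl by (auto simp: E_def intro!: image_eqI[of _ _ "\<ominus>\<^bsub>Q\<^esub> d' i p"])
    qed
    also have "\<dots> = \<pi> (s (\<gamma> i \<odot>\<^bsub>P\<^esub> p), s' (\<gamma> i \<odot>\<^bsub>P\<^esub> p)) \<oplus>\<^bsub>W\<^esub> ?f (d i p \<oplus>\<^bsub>Q\<^esub> d' i p)"
      using cl gp by (simp add: \<pi>(2)[symmetric] sH inH Bsimps)
    finally show "\<gamma> i \<odot>\<^bsub>W\<^esub> \<pi> (s p, s' p) =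
      \<pi> (s (\<gamma> i \<odot>\<^bsub>P\<^esub> p), s' (\<gamma> i \<odot>\<^bsub>P\<^esub> p)) \<oplus>\<^bsub>W\<^esub> ?f (d i p \<oplus>\<^bsub>Q\<^esub> d' i p)" .
  qed
qed

end

lemma has_cocycle_cong:
  assumes "has_cocycle A \<gamma> I P Q d \<xi>" "\<And>i p. \<lbrakk>i \<in> I; p \<in> carrier P\<rbrakk> \<Longrightarrow> d i p = d' i p"
  shows "has_cocycle A \<gamma> I P Q d' \<xi>"
proof -
  obtain X \<phi> \<psi> where "\<xi> = (X, \<phi>, \<psi>)" by (metis prod_cases3)
  then show ?thesis using assms by (auto simp: has_cocycle_def)
qed

context ext_setting
begin

lemma ext_class_eqI:
  assumes xi: "is_extension A P Q \<xi>" and eta: "is_extension A P Q \<eta>"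
    and c: "has_cocycle A \<gamma> I P Q d \<xi>" and c': "has_cocycle A \<gamma> I P Q d' \<eta>"
    and eq: "\<And>i p. \<lbrakk>i \<in> I; p \<in> carrier P\<rbrakk> \<Longrightarrow> d i p = d' i p"
  shows "ext_class A P Q \<xi> = ext_class A P Q \<eta>"
proof -
  obtain X \<phi> \<psi> Y \<phi>' \<psi>' where e: "\<xi> = (X, \<phi>, \<psi>)" "\<eta> = (Y, \<phi>', \<psi>')" by (metis prod_cases3)
  show ?thesis
    using ext_class_eq[OF xi eta] ext_equiv_if_same_cocycle[OF xi[unfolded e] eta[unfolded e]
      has_cocycle_cong[OF c eq, unfolded e] c'[unfolded e]] unfolding e by blast
qed

lemma ext_class_memberD:
  assumes xi: "is_extension A P Q \<xi>" and eta: "\<eta> \<in> ext_class A P Q \<xi>"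
  shows "is_extension A P Q \<eta>" "ext_class A P Q \<eta> = ext_class A P Q \<xi>"
    and "has_cocycle A \<gamma> I P Q d \<xi> \<Longrightarrow> has_cocycle A \<gamma> I P Q d \<eta>"
proof -
  have eta': "is_extension A P Q \<eta>" "ext_equiv A P Q \<xi> \<eta>" using eta by (auto simp: ext_class_def)
  then show "is_extension A P Q \<eta>" "ext_class A P Q \<eta> = ext_class A P Q \<xi>"
    using ext_class_eq[OF xi eta'] by simp_all
  show "has_cocycle A \<gamma> I P Q d \<xi> \<Longrightarrow> has_cocycle A \<gamma> I P Q d \<eta>"
    using has_cocycle_transfer xi eta' by (cases \<xi>, cases \<eta>) blast
qed

lemma ext_class_inhabited:
  assumes xi: "is_extension A P Q \<xi>" shows "ext_class A P Q \<xi> \<noteq> {}"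
  by (rule ext_class_nonempty[OF xi P_module Q_module]) (auto dest: ext_class_self)

lemma Ext1_carrier: "is_extension A P Q \<xi> \<Longrightarrow> ext_class A P Q \<xi> \<in> carrier (Ext1 A P Q)"
  by (rule ext_class_nonempty[OF _ P_module Q_module, of \<xi>]) (auto simp: Ext1_def)

lemma baer_sum_cocycle:
  assumes "is_extension A P Q \<xi>" "is_extension A P Q \<eta>"
  shows "is_extension A P Q (baer_sum Q \<xi> \<eta>)"
    and "\<lbrakk>has_cocycle A \<gamma> I P Q d \<xi>; has_cocycle A \<gamma> I P Q d' \<eta>\<rbrakk> \<Longrightarrow>
      has_cocycle A \<gamma> I P Q (\<lambda>i p. d i p \<oplus>\<^bsub>Q\<^esub> d' i p) (baer_sum Q \<xi> \<eta>)"
  using assms baer_sum_extension by (cases \<xi>, cases \<eta>, blast)+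

lemma ext_scale_cocycle:
  assumes "is_extension A P Q \<xi>"
  shows "is_extension A P Q (ext_scale A P c \<xi>)"
    and "has_cocycle A \<gamma> I P Q d \<xi> \<Longrightarrow>
      has_cocycle A \<gamma> I P Q (\<lambda>i p. d i (scal A c \<odot>\<^bsub>P\<^esub> p)) (ext_scale A P c \<xi>)"
  using assms ext_scale_extension by (cases \<xi>, blast)+

text \<open>The operations of \<open>Ext1\<close> range over all representatives; cocycles show that the choice does not
  matter.\<close>

lemma Ext1_add:
  assumes xi: "is_extension A P Q \<xi>" and eta: "is_extension A P Q \<eta>"
    and c: "has_cocycle A \<gamma> I P Q d \<xi>" and c': "has_cocycle A \<gamma> I P Q d' \<eta>"
  shows "ext_class A P Q \<xi> \<oplus>\<^bsub>Ext1 A P Q\<^esub> ext_class A P Q \<eta> = ext_class A P Q (baer_sum Q \<xi> \<eta>)"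
proof -
  have "ext_class A P Q (baer_sum Q \<xi>' \<eta>') = ext_class A P Q (baer_sum Q \<xi> \<eta>)"
    if m: "\<xi>' \<in> ext_class A P Q \<xi>" "\<eta>' \<in> ext_class A P Q \<eta>" for \<xi>' \<eta>'
  proof (rule ext_class_eqI)
    note M = ext_class_memberD[OF xi m(1)] ext_class_memberD[OF eta m(2)]
    show "is_extension A P Q (baer_sum Q \<xi>' \<eta>')" "is_extension A P Q (baer_sum Q \<xi> \<eta>)"
      by (rule baer_sum_cocycle(1)[OF M(1,4)], rule baer_sum_cocycle(1)[OF xi eta])
    show "has_cocycle A \<gamma> I P Q (\<lambda>i p. d i p \<oplus>\<^bsub>Q\<^esub> d' i p) (baer_sum Q \<xi>' \<eta>')"
      by (rule baer_sum_cocycle(2)[OF M(1,4) M(3)[OF c] M(6)[OF c']])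
    show "has_cocycle A \<gamma> I P Q (\<lambda>i p. d i p \<oplus>\<^bsub>Q\<^esub> d' i p) (baer_sum Q \<xi> \<eta>)"
      by (rule baer_sum_cocycle(2)[OF xi eta c c'])
  qed simp
  then show ?thesis using ext_class_inhabited[OF xi] ext_class_inhabited[OF eta] by (simp add: Ext1_def)
qed

lemma Ext1_smult:
  assumes xi: "is_extension A P Q \<xi>" and c: "has_cocycle A \<gamma> I P Q d \<xi>"
  shows "k \<odot>\<^bsub>Ext1 A P Q\<^esub> ext_class A P Q \<xi> = ext_class A P Q (ext_scale A P k \<xi>)"
proof -
  have "ext_class A P Q (ext_scale A P k \<xi>') = ext_class A P Q (ext_scale A P k \<xi>)"
    if m: "\<xi>' \<in> ext_class A P Q \<xi>" for \<xi>'
  proof (rule ext_class_eqI)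
    note M = ext_class_memberD[OF xi m(1)]
    show "is_extension A P Q (ext_scale A P k \<xi>')" "is_extension A P Q (ext_scale A P k \<xi>)"
      by (rule ext_scale_cocycle(1)[OF M(1)], rule ext_scale_cocycle(1)[OF xi])
    show "has_cocycle A \<gamma> I P Q (\<lambda>i p. d i (scal A k \<odot>\<^bsub>P\<^esub> p)) (ext_scale A P k \<xi>')"
      by (rule ext_scale_cocycle(2)[OF M(1) M(3)[OF c]])
    show "has_cocycle A \<gamma> I P Q (\<lambda>i p. d i (scal A k \<odot>\<^bsub>P\<^esub> p)) (ext_scale A P k \<xi>)"
      by (rule ext_scale_cocycle(2)[OF xi c])
  qed simp
  then show ?thesis using ext_class_inhabited[OF xi] by (simp add: Ext1_def)
qed

end

context ext_setting
begin

text \<open>An endomorphism of the middle term that kills \<open>Q\<close> and induces the identity of \<open>P\<close> takes the same value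
  on all preimages of a vector of \<open>P\<close>, and so factors through a section.\<close>

lemma split_if_retraction:
  assumes xi: "is_extension A P Q (X, \<phi>, \<psi>)" and T: "module_hom A X X T"
    and TQ: "\<And>z. z \<in> carrier Q \<Longrightarrow> T (\<phi> z) = \<zero>\<^bsub>X\<^esub>" and TP: "\<And>x. x \<in> carrier X \<Longrightarrow> \<psi> (T x) = \<psi> x"
  shows "ext_equiv A P Q (split_ext P Q) (X, \<phi>, \<psi>)"
proof -
  note D = is_extensionD[OF xi]
  interpret X: left_module A X by (rule D(1))
  interpret P: left_module A P by (rule P_module)
  note T' = module_homD[OF T] and G = module_homD[OF D(3)]
  have "\<exists>x. p \<in> carrier P \<longrightarrow> x \<in> carrier X \<and> \<psi> x = p" for p using D(7) by blast
  then obtain l where l: "\<And>p. p \<in> carrier P \<Longrightarrow> l p \<in> carrier X" "\<And>p. p \<in> carrier P \<Longrightarrow> \<psi> (l p) = p" by metis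
  have Tl: "T x = T (l (\<psi> x))" if x: "x \<in> carrier X" for x
  proof -
    have c: "\<psi> x \<in> carrier P" "l (\<psi> x) \<in> carrier X" using x G l by auto
    have "\<psi> (x \<ominus>\<^bsub>X\<^esub> l (\<psi> x)) = \<zero>\<^bsub>P\<^esub>"
      using x c l by (simp add: module_hom_zero_minus(3)[OF D(1) P_module D(3)] P.diff_eq_zero_iff)
    then obtain z where "z \<in> carrier Q" "x \<ominus>\<^bsub>X\<^esub> l (\<psi> x) = \<phi> z" using D(6)[of "x \<ominus>\<^bsub>X\<^esub> l (\<psi> x)"] x c by auto
    then have "T (x \<ominus>\<^bsub>X\<^esub> l (\<psi> x)) = \<zero>\<^bsub>X\<^esub>" using TQ by simp
    then show ?thesis
      using x c T' by (simp add: module_hom_zero_minus(3)[OF D(1) D(1) T] X.diff_eq_zero_iff)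
  qed
  have "module_hom A P X (\<lambda>p. T (l p))"
    unfolding module_hom_def
  proof (intro conjI ballI Pi_I)
    fix p assume p: "p \<in> carrier P"
    show "T (l p) \<in> carrier X" using p l T' by simp
    show "T (l (p \<oplus>\<^bsub>P\<^esub> p')) = T (l p) \<oplus>\<^bsub>X\<^esub> T (l p')" if "p' \<in> carrier P" for p'
      using Tl[of "l p \<oplus>\<^bsub>X\<^esub> l p'"] p that l T' G by simp
    show "T (l (a \<odot>\<^bsub>P\<^esub> p)) = a \<odot>\<^bsub>X\<^esub> T (l p)" if "a \<in> carrier A" for a
      using Tl[of "a \<odot>\<^bsub>X\<^esub> l p"] p that l T' G by (simp add: X.lsmult_closed)
  qed
  then show ?thesis by (rule split_if_hom_section[OF xi]) (simp add: TP l)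
qed

end

section \<open>Monoid algebras and algebras given by generators and relations\<close>

subsection \<open>Linear extension\<close>

lemma field_ring_simps [simp]:
  "carrier field_ring = UNIV" "a \<oplus>\<^bsub>field_ring\<^esub> b = a + b" "a \<otimes>\<^bsub>field_ring\<^esub> b = a * b"
  "\<one>\<^bsub>field_ring\<^esub> = 1" "\<zero>\<^bsub>field_ring\<^esub> = 0"
  by (simp_all add: field_ring_def)

lemma ring_field_ring: "ring (field_ring :: 'k::field ring)"
proof (rule ringI)
  show "abelian_group (field_ring :: 'k ring)"
    by (rule abelian_groupI) (auto simp: field_ring_def add.assoc add.commute intro: exI[of _ "- _"])
  show "monoid (field_ring :: 'k ring)"
    by (rule monoidI) (auto simp: field_ring_def mult.assoc)
qed (auto simp: field_ring_def algebra_simps)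

lemma lookup_map_mult: "Poly_Mapping.lookup (Poly_Mapping.map ((*) (c::'k::field)) p) x = c * Poly_Mapping.lookup p x"
  by (simp add: Poly_Mapping.map.rep_eq when_def)

lemma poly_mapping_keys_induct [consumes 1, case_names zero single add]:
  fixes p :: "'x \<Rightarrow>\<^sub>0 'k::monoid_add"
  assumes "Poly_Mapping.keys p \<subseteq> S" "Pr 0"
    and "\<And>x c. x \<in> S \<Longrightarrow> Pr (Poly_Mapping.single x c)"
    and "\<And>p r. \<lbrakk>Poly_Mapping.keys p \<subseteq> S; Poly_Mapping.keys r \<subseteq> S; Pr p; Pr r\<rbrakk> \<Longrightarrow> Pr (p + r)"
  shows "Pr p"
  using assms(1)
proof (induction p rule: Poly_Mapping.update_induct)
  case (update f a b)
  have eq: "Poly_Mapping.update a b f = f + Poly_Mapping.single a b"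
    using update(1) by (intro poly_mapping_eqI)
      (auto simp: Poly_Mapping.lookup_update lookup_add lookup_single when_def in_keys_iff)
  have "a \<in> S" "Poly_Mapping.keys f \<subseteq> S"
    using update(1,2,4) by (auto simp: Poly_Mapping.keys_update)
  then show ?case unfolding eq
    using update(3) by (intro assms(3,4)) (auto simp: update(2))
qed (rule assms(2))

lemma poly_mapping_add_induct [case_names zero single add]:
  fixes p :: "'x \<Rightarrow>\<^sub>0 'k::monoid_add"
  assumes "Pr 0" "\<And>x c. Pr (Poly_Mapping.single x c)" "\<And>p r. \<lbrakk>Pr p; Pr r\<rbrakk> \<Longrightarrow> Pr (p + r)"
  shows "Pr p"
  by (rule poly_mapping_keys_induct[of p UNIV]) (auto intro: assms)

text \<open>The linear extension of \<open>f\<close> from the basis \<open>'x\<close>. The action of a free algebra, the action of a monoid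
  algebra and the linear maps out of a tensor product all have this form.\<close>

definition lin_ext :: "('k, 'w) module \<Rightarrow> ('x \<Rightarrow> 'w) \<Rightarrow> ('x \<Rightarrow>\<^sub>0 'k::zero) \<Rightarrow> 'w" where
  "lin_ext W f p = (\<Oplus>\<^bsub>W\<^esub>x\<in>Poly_Mapping.keys p. Poly_Mapping.lookup p x \<odot>\<^bsub>W\<^esub> f x)"

locale vec = left_module field_ring W for W :: "('k::field, 'w) module"
begin

lemma vclosed [simp, intro]: "v \<in> carrier W \<Longrightarrow> c \<odot>\<^bsub>W\<^esub> v \<in> carrier W"
  using lsmult_closed by simp

lemma vl_distr: "v \<in> carrier W \<Longrightarrow> (c + d) \<odot>\<^bsub>W\<^esub> v = c \<odot>\<^bsub>W\<^esub> v \<oplus>\<^bsub>W\<^esub> d \<odot>\<^bsub>W\<^esub> v"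
  using lsmult_l_distr[of c d v] by simp

lemma vr_distr: "\<lbrakk>v \<in> carrier W; w \<in> carrier W\<rbrakk> \<Longrightarrow> c \<odot>\<^bsub>W\<^esub> (v \<oplus>\<^bsub>W\<^esub> w) = c \<odot>\<^bsub>W\<^esub> v \<oplus>\<^bsub>W\<^esub> c \<odot>\<^bsub>W\<^esub> w"
  using lsmult_r_distr by simp

lemma vassoc: "v \<in> carrier W \<Longrightarrow> c \<odot>\<^bsub>W\<^esub> (d \<odot>\<^bsub>W\<^esub> v) = (c * d) \<odot>\<^bsub>W\<^esub> v"
  using lsmult_assoc[of c d v] by simp

lemma vone [simp]: "v \<in> carrier W \<Longrightarrow> 1 \<odot>\<^bsub>W\<^esub> v = v"
  using lsmult_one by simp

lemma vzero [simp]: "v \<in> carrier W \<Longrightarrow> 0 \<odot>\<^bsub>W\<^esub> v = \<zero>\<^bsub>W\<^esub>"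
  using lsmult_l_null by simp

lemma vr_null [simp]: "c \<odot>\<^bsub>W\<^esub> \<zero>\<^bsub>W\<^esub> = \<zero>\<^bsub>W\<^esub>"
  using lsmult_r_null by simp

lemma vneg: assumes "v \<in> carrier W" shows "(- 1) \<odot>\<^bsub>W\<^esub> v = \<ominus>\<^bsub>W\<^esub> v"
proof -
  have "(- 1) \<odot>\<^bsub>W\<^esub> v \<oplus>\<^bsub>W\<^esub> v = \<zero>\<^bsub>W\<^esub>" using vl_distr[of v "- 1" 1] assms by simp
  then show ?thesis using assms by (intro M.minus_equality[symmetric]) auto
qed

lemma lin_ext_superset:
  assumes "finite S" "Poly_Mapping.keys p \<subseteq> S" "\<And>x. x \<in> S \<Longrightarrow> f x \<in> carrier W"
  shows "lin_ext W f p = (\<Oplus>\<^bsub>W\<^esub>x\<in>S. Poly_Mapping.lookup p x \<odot>\<^bsub>W\<^esub> f x)"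
  unfolding lin_ext_def
  by (rule M.add.finprod_mono_neutral_cong_left[OF assms(1,2)])
    (use assms(3) in \<open>auto simp: in_keys_iff\<close>)

lemma lin_ext_closed [simp]:
  assumes "\<And>x. x \<in> Poly_Mapping.keys p \<Longrightarrow> f x \<in> carrier W" shows "lin_ext W f p \<in> carrier W"
  unfolding lin_ext_def using assms by (intro M.finsum_closed) auto

lemma lin_ext_add:
  assumes "\<And>x. x \<in> Poly_Mapping.keys p \<union> Poly_Mapping.keys r \<Longrightarrow> f x \<in> carrier W"
  shows "lin_ext W f (p + r) = lin_ext W f p \<oplus>\<^bsub>W\<^esub> lin_ext W f r"
proof -
  let ?S = "Poly_Mapping.keys p \<union> Poly_Mapping.keys r"
  have "lin_ext W f (p + r) = (\<Oplus>\<^bsub>W\<^esub>x\<in>?S. (Poly_Mapping.lookup p x + Poly_Mapping.lookup r x) \<odot>\<^bsub>W\<^esub> f x)"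
    using lin_ext_superset[OF _ Poly_Mapping.keys_add assms] by (simp add: lookup_add)
  also have "\<dots> = (\<Oplus>\<^bsub>W\<^esub>x\<in>?S. Poly_Mapping.lookup p x \<odot>\<^bsub>W\<^esub> f x \<oplus>\<^bsub>W\<^esub> Poly_Mapping.lookup r x \<odot>\<^bsub>W\<^esub> f x)"
    using assms by (intro M.finsum_cong') (auto simp: vl_distr)
  also have "\<dots> = (\<Oplus>\<^bsub>W\<^esub>x\<in>?S. Poly_Mapping.lookup p x \<odot>\<^bsub>W\<^esub> f x) \<oplus>\<^bsub>W\<^esub> (\<Oplus>\<^bsub>W\<^esub>x\<in>?S. Poly_Mapping.lookup r x \<odot>\<^bsub>W\<^esub> f x)"
    using assms by (intro M.finsum_addf) auto
  also have "\<dots> = lin_ext W f p \<oplus>\<^bsub>W\<^esub> lin_ext W f r"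
    using lin_ext_superset[of ?S p f] lin_ext_superset[of ?S r f] assms by simp
  finally show ?thesis .
qed

lemma lin_ext_single [simp]:
  "f x \<in> carrier W \<Longrightarrow> lin_ext W f (Poly_Mapping.single x c) = c \<odot>\<^bsub>W\<^esub> f x"
  using lin_ext_superset[of "{x}" "Poly_Mapping.single x c" f] by (simp add: M.finsum_insert)

lemma lin_ext_zero [simp]: "lin_ext W f 0 = \<zero>\<^bsub>W\<^esub>"
  by (simp add: lin_ext_def)

lemma lin_ext_map:
  assumes "\<And>x. x \<in> Poly_Mapping.keys p \<Longrightarrow> f x \<in> carrier W"
  shows "lin_ext W f (Poly_Mapping.map ((*) c) p) = c \<odot>\<^bsub>W\<^esub> lin_ext W f p"
proof -
  have "lin_ext W f (Poly_Mapping.map ((*) c) p) =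
    (\<Oplus>\<^bsub>W\<^esub>x\<in>Poly_Mapping.keys p. c \<odot>\<^bsub>W\<^esub> (Poly_Mapping.lookup p x \<odot>\<^bsub>W\<^esub> f x))"
  proof (subst lin_ext_superset[of "Poly_Mapping.keys p"])
    show "Poly_Mapping.keys (Poly_Mapping.map ((*) c) p) \<subseteq> Poly_Mapping.keys p"
      by (auto simp: in_keys_iff lookup_map_mult)
  qed (use assms in \<open>auto simp: lookup_map_mult vassoc intro!: M.finsum_cong'\<close>)
  then show ?thesis
    using assms lsmult_finsum[of c "Poly_Mapping.keys p"] by (auto simp: lin_ext_def)
qed

lemma lin_ext_uminus:
  assumes "\<And>x. x \<in> Poly_Mapping.keys p \<Longrightarrow> f x \<in> carrier W"
  shows "lin_ext W f (- p) = \<ominus>\<^bsub>W\<^esub> lin_ext W f p"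
proof -
  have "- p = Poly_Mapping.map ((*) (- 1)) p"
    by (intro poly_mapping_eqI) (simp add: lookup_map_mult)
  then show ?thesis using assms by (simp add: lin_ext_map vneg)
qed

lemma lin_ext_diff:
  assumes "\<And>x. x \<in> Poly_Mapping.keys p \<union> Poly_Mapping.keys r \<Longrightarrow> f x \<in> carrier W"
  shows "lin_ext W f (p - r) = lin_ext W f p \<ominus>\<^bsub>W\<^esub> lin_ext W f r"
proof -
  have "lin_ext W f (p + - r) = lin_ext W f p \<ominus>\<^bsub>W\<^esub> lin_ext W f r"
  proof (subst lin_ext_add)
    show "f x \<in> carrier W" if "x \<in> Poly_Mapping.keys p \<union> Poly_Mapping.keys (- r)" for x
      using assms that by (auto simp: in_keys_iff)
    show "lin_ext W f p \<oplus>\<^bsub>W\<^esub> lin_ext W f (- r) = lin_ext W f p \<ominus>\<^bsub>W\<^esub> lin_ext W f r"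
      using assms by (subst lin_ext_uminus) (auto simp: M.minus_eq)
  qed
  then show ?thesis by simp
qed

lemma lin_ext_cong:
  "\<lbrakk>\<And>x. x \<in> Poly_Mapping.keys p \<Longrightarrow> f x = g x; \<And>x. x \<in> Poly_Mapping.keys p \<Longrightarrow> g x \<in> carrier W\<rbrakk> \<Longrightarrow>
    lin_ext W f p = lin_ext W g p"
  unfolding lin_ext_def by (intro M.finsum_cong') auto

end

definition linear_map :: "('k, 'v) module \<Rightarrow> ('k, 'w) module \<Rightarrow> ('v \<Rightarrow> 'w) \<Rightarrow> bool" where
  "linear_map V W f \<longleftrightarrow> f \<in> carrier V \<rightarrow> carrier W \<and>
     (\<forall>x\<in>carrier V. \<forall>y\<in>carrier V. f (x \<oplus>\<^bsub>V\<^esub> y) = f x \<oplus>\<^bsub>W\<^esub> f y) \<and>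
     (\<forall>c. \<forall>x\<in>carrier V. f (c \<odot>\<^bsub>V\<^esub> x) = c \<odot>\<^bsub>W\<^esub> f x)"

lemma linear_mapD:
  assumes "linear_map V W f"
  shows "x \<in> carrier V \<Longrightarrow> f x \<in> carrier W"
    and "\<lbrakk>x \<in> carrier V; y \<in> carrier V\<rbrakk> \<Longrightarrow> f (x \<oplus>\<^bsub>V\<^esub> y) = f x \<oplus>\<^bsub>W\<^esub> f y"
    and "x \<in> carrier V \<Longrightarrow> f (c \<odot>\<^bsub>V\<^esub> x) = c \<odot>\<^bsub>W\<^esub> f x"
  using assms by (auto simp: linear_map_def)

lemma linear_lin_ext:
  assumes V: "vec V" and W: "vec W" and T: "linear_map V W T"
    and f: "\<And>x. x \<in> Poly_Mapping.keys p \<Longrightarrow> f x \<in> carrier V"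
  shows "T (lin_ext V f p) = lin_ext W (\<lambda>x. T (f x)) p"
proof -
  interpret V: vec V by fact
  interpret W: vec W by fact
  note T = linear_mapD[OF T]
  define S where "S = {x. f x \<in> carrier V}"
  have "Poly_Mapping.keys p \<subseteq> S" using f by (auto simp: S_def)
  then show ?thesis
  proof (induction p rule: poly_mapping_keys_induct)
    case zero
    then show ?case using T(3)[of "\<zero>\<^bsub>V\<^esub>" 0] T(1)[of "\<zero>\<^bsub>V\<^esub>"] by simp
  next
    case (add p r)
    then show ?case
      by (subst V.lin_ext_add, force simp: S_def, subst W.lin_ext_add, force simp: S_def T)
        (auto simp: S_def T subset_iff)
  qed (auto simp: S_def T)
qed

subsection \<open>Modules over a monoid algebra\<close>

lemma monoid_algebra_simps [simp]:
  "carrier monoid_algebra = UNIV" "p \<oplus>\<^bsub>monoid_algebra\<^esub> r = p + r" "p \<otimes>\<^bsub>monoid_algebra\<^esub> r = p * r"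
  "\<one>\<^bsub>monoid_algebra\<^esub> = 1" "\<zero>\<^bsub>monoid_algebra\<^esub> = 0"
  "scal monoid_algebra c = Poly_Mapping.single 0 c"
  by (simp_all add: monoid_algebra_def)

lemma single_zero_commute:
  fixes p :: "'m::monoid_add \<Rightarrow>\<^sub>0 'k::field"
  shows "Poly_Mapping.single 0 c * p = p * Poly_Mapping.single 0 c"
  by (induction p rule: poly_mapping_add_induct)
    (auto simp: mult_single distrib_left distrib_right mult.commute)

lemma ring_monoid_algebra: "ring (monoid_algebra :: ('k::field, 'm::monoid_add \<Rightarrow>\<^sub>0 'k) kalgebra)"
proof (rule ringI)
  show "abelian_group (monoid_algebra :: ('k, 'm \<Rightarrow>\<^sub>0 'k) kalgebra)"
  proof (rule abelian_groupI)
    fix x :: "'m \<Rightarrow>\<^sub>0 'k"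
    show "\<exists>y\<in>carrier monoid_algebra. y \<oplus>\<^bsub>monoid_algebra\<^esub> x = \<zero>\<^bsub>monoid_algebra\<^esub>"
      by (rule bexI[of _ "- x"]) simp_all
  qed (simp_all add: add_ac)
  show "monoid (monoid_algebra :: ('k, 'm \<Rightarrow>\<^sub>0 'k) kalgebra)"
    by (rule monoidI) (simp_all add: mult.assoc)
qed (simp_all add: distrib_left distrib_right)

lemma kalg_monoid_algebra: "kalg (monoid_algebra :: ('k::field, 'm::monoid_add \<Rightarrow>\<^sub>0 'k) kalgebra)"
  by (intro kalg.intro kalg_axioms.intro ring_monoid_algebra)
    (auto simp: single_add mult_single intro: single_zero_commute)

lemma lin_ext_mult:
  fixes \<rho> :: "'m::monoid_add \<Rightarrow> 'w \<Rightarrow> 'w" and W :: "('k::field, 'w) module"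
  assumes W: "vec W" and lin: "\<And>k. linear_map W W (\<rho> k)"
    and add: "\<And>k l v. v \<in> carrier W \<Longrightarrow> \<rho> (k + l) v = \<rho> k (\<rho> l v)" and v: "v \<in> carrier W"
  shows "lin_ext W (\<lambda>k. \<rho> k v) (p * r) = lin_ext W (\<lambda>k. \<rho> k (lin_ext W (\<lambda>l. \<rho> l v) r)) p"
proof -
  interpret vec W by fact
  note L = linear_mapD[OF lin]
  have c: "lin_ext W (\<lambda>l. \<rho> l v) r \<in> carrier W" for r using v L by simp
  have "lin_ext W (\<lambda>k. \<rho> k v) (Poly_Mapping.single l c * r) = c \<odot>\<^bsub>W\<^esub> \<rho> l (lin_ext W (\<lambda>l. \<rho> l v) r)"
    for l c
  proof (induction r rule: poly_mapping_add_induct)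
    case zero
    then show ?case using L(3)[of "\<zero>\<^bsub>W\<^esub>" l 0] L(1)[of "\<zero>\<^bsub>W\<^esub>" l] by simp
  next
    case (single x d)
    then show ?case using v by (simp add: mult_single L add vassoc)
  next
    case (add p r)
    then show ?case using v by (simp add: distrib_left lin_ext_add L c vr_distr)
  qed
  then show ?thesis
    by (induction p rule: poly_mapping_add_induct) (use v c L in \<open>auto simp: distrib_right lin_ext_add\<close>)
qed

lemma left_module_monoid_algebra:
  fixes \<rho> :: "'m::monoid_add \<Rightarrow> 'w \<Rightarrow> 'w" and W :: "('k::field, 'w) module"
    and M :: "('m \<Rightarrow>\<^sub>0 'k, 'w) module"
  assumes W: "vec W" and lin: "\<And>k. linear_map W W (\<rho> k)"
    and zero: "\<And>v. v \<in> carrier W \<Longrightarrow> \<rho> 0 v = v"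
    and add: "\<And>k l v. v \<in> carrier W \<Longrightarrow> \<rho> (k + l) v = \<rho> k (\<rho> l v)"
    and M: "carrier M = carrier W" "add M = add W" "\<zero>\<^bsub>M\<^esub> = \<zero>\<^bsub>W\<^esub>"
      "\<And>p v. v \<in> carrier W \<Longrightarrow> p \<odot>\<^bsub>M\<^esub> v = lin_ext W (\<lambda>k. \<rho> k v) p"
  shows "left_module monoid_algebra M"
proof -
  interpret vec W by fact
  note L = linear_mapD[OF lin]
  have "\<exists>w\<in>carrier M. w \<oplus>\<^bsub>M\<^esub> v = \<zero>\<^bsub>M\<^esub>" if "v \<in> carrier M" for v
    using that by (intro bexI[of _ "\<ominus>\<^bsub>W\<^esub> v"]) (simp_all add: M M.l_neg)
  then have "abelian_group M"
    by (intro abelian_groupI) (simp_all add: M M.a_ac)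
  moreover have "p \<odot>\<^bsub>M\<^esub> (v \<oplus>\<^bsub>M\<^esub> w) = p \<odot>\<^bsub>M\<^esub> v \<oplus>\<^bsub>M\<^esub> p \<odot>\<^bsub>M\<^esub> w" if "v \<in> carrier W" "w \<in> carrier W" for p v w
    by (induction p rule: poly_mapping_add_induct)
      (use that in \<open>auto simp: M L lin_ext_add vr_distr M.a_ac\<close>)
  moreover have "lin_ext W (\<lambda>k. \<rho> k v) 1 = v" if "v \<in> carrier W" for v
    using lin_ext_single[of "\<lambda>k. \<rho> k v" 0 1] that L zero by simp
  ultimately show ?thesis
    by (intro left_module.intro left_module_axioms.intro ring_monoid_algebra)
      (simp_all add: M L lin_ext_add lin_ext_mult[OF W lin add] zero)
qed

subsection \<open>Presented algebras\<close>

text \<open>The class of \<open>p\<close> in the algebra presented by \<open>S\<close>. All computations in that algebra are made with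
  representatives in the free algebra.\<close>

definition pres :: "('x, 'k::field) free_alg set \<Rightarrow> ('x, 'k) free_alg \<Rightarrow> ('x, 'k) free_alg set" where
  "pres S p = Idl\<^bsub>monoid_algebra\<^esub> S +>\<^bsub>monoid_algebra\<^esub> p"

lemma generator_pres: "generator S x = pres S (var x)"
  by (simp add: generator_def pres_def)

lemma
  fixes S :: "('x, 'k::field) free_alg set"
  shows presented_carrier [simp]: "carrier (presented_algebra S) = range (pres S)"
    and pres_add [simp]: "pres S p \<oplus>\<^bsub>presented_algebra S\<^esub> pres S r = pres S (p + r)"
    and pres_mult [simp]: "pres S p \<otimes>\<^bsub>presented_algebra S\<^esub> pres S r = pres S (p * r)"
    and presented_one [simp]: "\<one>\<^bsub>presented_algebra S\<^esub> = pres S 1"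
    and presented_zero [simp]: "\<zero>\<^bsub>presented_algebra S\<^esub> = pres S 0"
    and presented_scal [simp]: "scal (presented_algebra S) c = pres S (const c)"
    and pres_eq_iff: "pres S p = pres S r \<longleftrightarrow> p - r \<in> Idl\<^bsub>monoid_algebra\<^esub> S"
    and mem_pres_iff: "p \<in> pres S r \<longleftrightarrow> p - r \<in> Idl\<^bsub>monoid_algebra\<^esub> S"
proof -
  let ?R = "monoid_algebra :: ('k, ('x, 'k) free_alg) kalgebra"
  interpret R: ring ?R by (rule ring_monoid_algebra)
  interpret I: ideal "Idl\<^bsub>?R\<^esub> S" ?R by (rule R.genideal_ideal) simp
  have neg: "\<ominus>\<^bsub>?R\<^esub> r = - r" for r by (rule R.minus_equality) simp_all
  show mem: "p \<in> pres S r \<longleftrightarrow> p - r \<in> Idl\<^bsub>monoid_algebra\<^esub> S" for p r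
    using I.a_rcos_module[of r p] by (simp add: pres_def neg)
  show "pres S p = pres S r \<longleftrightarrow> p - r \<in> Idl\<^bsub>monoid_algebra\<^esub> S"
    using mem[of p r] I.a_repr_independence'[of p r] I.a_rcos_self[of p] unfolding pres_def
    by auto
  show "carrier (presented_algebra S) = range (pres S)"
    by (auto simp: presented_algebra_def Let_def FactRing_def A_RCOSETS_def' pres_def)
  show "pres S p \<oplus>\<^bsub>presented_algebra S\<^esub> pres S r = pres S (p + r)"
    using I.a_rcos_sum[of p r] by (simp add: presented_algebra_def Let_def FactRing_def pres_def)
  show "pres S p \<otimes>\<^bsub>presented_algebra S\<^esub> pres S r = pres S (p * r)"
    using I.rcoset_mult_add[of p r] by (simp add: presented_algebra_def Let_def FactRing_def pres_def)
  show "\<zero>\<^bsub>presented_algebra S\<^esub> = pres S 0"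
    using I.a_rcos_const[of 0] I.zero_closed by (simp add: presented_algebra_def Let_def FactRing_def pres_def)
qed (simp_all add: presented_algebra_def Let_def FactRing_def pres_def)

lemma pres_relation:
  fixes S :: "('x, 'k::field) free_alg set"
  shows "r \<in> S \<Longrightarrow> pres S r = pres S 0"
proof -
  interpret R: ring "monoid_algebra :: ('k, ('x, 'k) free_alg) kalgebra" by (rule ring_monoid_algebra)
  show "r \<in> S \<Longrightarrow> pres S r = pres S 0"
    using R.genideal_self[of S] by (auto simp: pres_eq_iff)
qed

lemma const_mult: "const (c * d) = const c * const d" and const_add: "const (c + d) = const c + const d"
  and const_one: "const 1 = 1" and const_commute: "const c * p = p * const c"
  by (auto simp: const_def mult_single single_add intro: single_zero_commute)

lemma kalg_presented_algebra: "kalg (presented_algebra S)"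
proof (intro kalg.intro kalg_axioms.intro ringI)
  show "abelian_group (presented_algebra S)"
  proof (rule abelian_groupI)
    fix u assume "u \<in> carrier (presented_algebra S)"
    then obtain p where "u = pres S p" by auto
    then show "\<exists>v\<in>carrier (presented_algebra S). v \<oplus>\<^bsub>presented_algebra S\<^esub> u = \<zero>\<^bsub>presented_algebra S\<^esub>"
      by (intro bexI[of _ "pres S (- p)"]) simp_all
  qed (auto simp: add_ac)
  show "monoid (presented_algebra S)"
    by (rule monoidI) (auto simp: mult.assoc)
next
  fix u c assume "u \<in> carrier (presented_algebra S)"
  then obtain p where "u = pres S p" by auto
  then show "scal (presented_algebra S) c \<otimes>\<^bsub>presented_algebra S\<^esub> u =
    u \<otimes>\<^bsub>presented_algebra S\<^esub> scal (presented_algebra S) c"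
    using const_commute[of c p] by simp
qed (auto simp: distrib_left distrib_right const_mult const_add const_one)

lemma free_alg_induct [case_names var const add mult]:
  fixes p :: "('x, 'k::field) free_alg"
  assumes var: "\<And>x. Pr (var x)" and const: "\<And>c. Pr (const c)"
    and add: "\<And>p r. \<lbrakk>Pr p; Pr r\<rbrakk> \<Longrightarrow> Pr (p + r)" and mult: "\<And>p r. \<lbrakk>Pr p; Pr r\<rbrakk> \<Longrightarrow> Pr (p * r)"
  shows "Pr p"
proof (induction p rule: poly_mapping_add_induct)
  case zero
  show ?case using const[of 0] by (simp add: const_def)
next
  case (single w c)
  have "Pr (Poly_Mapping.single (Word xs) (1::'k))" for xs :: "'x list"
  proof (induction xs)
    case Nil
    show ?case using const[of 1] by (simp add: const_def zero_word_def)
  next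
    case (Cons x xs)
    have "Poly_Mapping.single (Word (x # xs)) (1::'k) = var x * Poly_Mapping.single (Word xs) 1"
      by (simp add: var_def mult_single plus_word_def)
    then show ?case using mult[OF var Cons] by simp
  qed
  from mult[OF const[of c] this[of "letters w"]] show ?case
    by (simp add: const_def mult_single)
qed (rule add)

lemma generated_by_generators:
  assumes "\<And>x. x \<notin> I \<Longrightarrow> \<exists>y\<in>I. var y * var x - 1 \<in> S \<and> var x * var y - 1 \<in> S"
  shows "generated_by (presented_algebra S) (generator S) I"
  unfolding generated_by_def
proof (intro conjI allI impI)
  let ?A = "presented_algebra S"
  show "generator S ` I \<subseteq> carrier ?A" by (auto simp: generator_pres)
  fix H assume H: "H \<subseteq> carrier ?A" "generator S ` I \<subseteq> H" "range (scal ?A) \<subseteq> H"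
    "\<forall>a\<in>H. \<forall>b\<in>H. a \<oplus>\<^bsub>?A\<^esub> b \<in> H \<and> a \<otimes>\<^bsub>?A\<^esub> b \<in> H"
    "\<forall>a\<in>H. \<forall>b\<in>carrier ?A. a \<otimes>\<^bsub>?A\<^esub> b = \<one>\<^bsub>?A\<^esub> \<longrightarrow> b \<otimes>\<^bsub>?A\<^esub> a = \<one>\<^bsub>?A\<^esub> \<longrightarrow> b \<in> H"
  have "pres S p \<in> H" for p
  proof (induction p rule: free_alg_induct)
    case (var x)
    show ?case
    proof (cases "x \<in> I")
      case False
      then obtain y where y: "y \<in> I" "var y * var x - 1 \<in> S" "var x * var y - 1 \<in> S"
        using assms by blast
      have "pres S (var y * var x) = pres S 1" "pres S (var x * var y) = pres S 1"
        using pres_relation[OF y(2)] pres_relation[OF y(3)] by (simp_all add: pres_eq_iff)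
      moreover have "pres S (var y) \<in> H" using H(2) y(1) by (auto simp: generator_pres)
      ultimately show ?thesis using H(5) by (auto)
    qed (use H(2) in \<open>auto simp: generator_pres\<close>)
  next
    case (const c)
    then show ?case using H(3) by auto
  next
    case (add p r)
    then show ?case using H(4) by (metis pres_add)
  next
    case (mult p r)
    then show ?case using H(4) by (metis pres_mult)
  qed
  then show "H = carrier ?A" using H(1) by auto
qed

subsection \<open>Modules given by operators\<close>

lemma vec_vspace:
  assumes A: "kalg A" and M: "left_module A M"
  shows "vec (vspace A M)"
proof -
  interpret kalg A by fact
  interpret M: left_module A M by fact
  have "\<exists>y\<in>carrier M. y \<oplus>\<^bsub>M\<^esub> x = \<zero>\<^bsub>M\<^esub>" if "x \<in> carrier M" for x
    using that by (intro bexI[of _ "\<ominus>\<^bsub>M\<^esub> x"]) (simp_all add: M.M.l_neg)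
  then have "abelian_group (vspace A M)"
    by (intro abelian_groupI) (simp_all add: vspace_def M.M.a_ac)
  then show ?thesis
    unfolding vec_def
    by (intro left_module.intro left_module_axioms.intro ring_field_ring)
      (simp_all add: vspace_def M.lsmult_closed M.lsmult_r_distr M.lsmult_l_distr scal_add scal_mult
        M.lsmult_assoc scal_one M.lsmult_one)
qed

lemma vspace_simps [simp]:
  "carrier (vspace A M) = carrier M" "add (vspace A M) = add M" "\<zero>\<^bsub>vspace A M\<^esub> = \<zero>\<^bsub>M\<^esub>"
  "c \<odot>\<^bsub>vspace A M\<^esub> x = scal A c \<odot>\<^bsub>M\<^esub> x"
  by (simp_all add: vspace_def)

locale operators = vec W for W :: "('k::field, 'w) module" +
  fixes \<rho> :: "'x \<Rightarrow> 'w \<Rightarrow> 'w"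
  assumes linear: "linear_map W W (\<rho> x)"
begin

lemma linear_foldr: "linear_map W W (foldr \<rho> xs)"
  by (induction xs) (use linear in \<open>auto simp: linear_map_def Pi_iff\<close>)

lemma free_action_lin_ext: "free_action W \<rho> p v = lin_ext W (\<lambda>w. foldr \<rho> (letters w) v) p"
  by (simp add: free_action_def lin_ext_def)

lemma free_action_simps:
  assumes v: "v \<in> carrier W"
  shows "free_action W \<rho> p v \<in> carrier W"
    and "free_action W \<rho> (p + r) v = free_action W \<rho> p v \<oplus>\<^bsub>W\<^esub> free_action W \<rho> r v"
    and "free_action W \<rho> (p - r) v = free_action W \<rho> p v \<ominus>\<^bsub>W\<^esub> free_action W \<rho> r v"
    and "free_action W \<rho> (p * r) v = free_action W \<rho> p (free_action W \<rho> r v)"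
    and "free_action W \<rho> (var x) v = \<rho> x v" and "free_action W \<rho> (const c) v = c \<odot>\<^bsub>W\<^esub> v"
    and "free_action W \<rho> 1 v = v" and "free_action W \<rho> 0 v = \<zero>\<^bsub>W\<^esub>"
proof -
  note L = linear_mapD[OF linear_foldr]
  show "free_action W \<rho> p v \<in> carrier W"
    "free_action W \<rho> (p + r) v = free_action W \<rho> p v \<oplus>\<^bsub>W\<^esub> free_action W \<rho> r v"
    "free_action W \<rho> (p - r) v = free_action W \<rho> p v \<ominus>\<^bsub>W\<^esub> free_action W \<rho> r v"
    "free_action W \<rho> 0 v = \<zero>\<^bsub>W\<^esub>"
    using v L by (simp_all add: free_action_lin_ext lin_ext_add lin_ext_diff)
  show "free_action W \<rho> (p * r) v = free_action W \<rho> p (free_action W \<rho> r v)"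
    unfolding free_action_lin_ext
    by (rule lin_ext_mult[of W "\<lambda>w. foldr \<rho> (letters w)"])
      (simp_all add: linear_foldr plus_word_def v vec_axioms)
  show "free_action W \<rho> (var x) v = \<rho> x v" using v linear_mapD[OF linear]
    by (simp add: free_action_lin_ext var_def)
  show c: "free_action W \<rho> (const c) v = c \<odot>\<^bsub>W\<^esub> v" for c using v
    by (simp add: free_action_lin_ext const_def zero_word_def)
  show "free_action W \<rho> 1 v = v" using c[of 1] v by (simp add: const_one)
qed

lemma free_action_linear: "linear_map W W (free_action W \<rho> p)"
proof (induction p rule: free_alg_induct)
  case (add p r)
  note L = linear_mapD[OF add(1)] linear_mapD[OF add(2)]
  then show ?case by (auto simp: linear_map_def free_action_simps M.a_ac vr_distr)
next
  case (mult p r)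
  note L = linear_mapD[OF mult(1)] linear_mapD[OF mult(2)]
  then show ?case by (auto simp: linear_map_def free_action_simps)
qed (use linear_mapD[OF linear] in
    \<open>auto simp: linear_map_def free_action_simps vr_distr vassoc mult.commute\<close>)

text \<open>The elements of the free algebra that act as zero form an ideal, which contains the ideal
  generated by \<open>S\<close> as soon as it contains \<open>S\<close>.\<close>

lemma module_of_operators:
  assumes rel: "\<And>r v. \<lbrakk>r \<in> S; v \<in> carrier W\<rbrakk> \<Longrightarrow> free_action W \<rho> r v = \<zero>\<^bsub>W\<^esub>"
  shows "left_module (presented_algebra S) (module_of_operators W \<rho>)"
    and "v \<in> carrier W \<Longrightarrow> pres S p \<odot>\<^bsub>module_of_operators W \<rho>\<^esub> v = free_action W \<rho> p v"
    and "carrier (module_of_operators W \<rho>) = carrier W" "add (module_of_operators W \<rho>) = add W"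
    and "\<zero>\<^bsub>module_of_operators W \<rho>\<^esub> = \<zero>\<^bsub>W\<^esub>"
proof -
  let ?R = "monoid_algebra :: ('k, ('x, 'k) free_alg) kalgebra"
  let ?J = "{r. \<forall>v\<in>carrier W. free_action W \<rho> r v = \<zero>\<^bsub>W\<^esub>}"
  interpret R: ring ?R by (rule ring_monoid_algebra)
  have neg: "\<ominus>\<^bsub>?R\<^esub> r = - r" for r by (rule R.minus_equality) simp_all
  have zero: "free_action W \<rho> p \<zero>\<^bsub>W\<^esub> = \<zero>\<^bsub>W\<^esub>" for p
    using linear_mapD(3)[OF free_action_linear, of "\<zero>\<^bsub>W\<^esub>" p 0]
      linear_mapD(1)[OF free_action_linear, of "\<zero>\<^bsub>W\<^esub>" p] by simp
  have "ideal ?J ?R"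
  proof (rule idealI[OF R.ring_axioms])
    have "free_action W \<rho> (- p) v = \<zero>\<^bsub>W\<^esub>" if "v \<in> carrier W" "free_action W \<rho> p v = \<zero>\<^bsub>W\<^esub>" for p v
      using free_action_simps(3)[OF that(1), of 0 p] that
      by (simp add: free_action_simps M.minus_eq minus_zero')
    then show "subgroup ?J (add_monoid ?R)"
      by (intro subgroup.intro) (auto simp: free_action_simps neg[unfolded a_inv_def, simplified])
  qed (auto simp: free_action_simps zero)
  then have "Idl\<^bsub>?R\<^esub> S \<subseteq> ?J"
    using rel by (intro R.genideal_minimal) auto
  note sub = this
  have eq: "free_action W \<rho> p v = free_action W \<rho> r v" if "p \<in> pres S r" "v \<in> carrier W" for p r v
  proof -
    have "free_action W \<rho> (p - r) v = \<zero>\<^bsub>W\<^esub>"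
      using that sub by (auto simp: mem_pres_iff)
    then show ?thesis
      using that(2) by (simp add: free_action_simps diff_eq_zero_iff)
  qed
  have self: "p \<in> pres S p" for p
    using R.genideal_ideal[of S] by (simp add: mem_pres_iff additive_subgroup.zero_closed[OF ideal.axioms(1), of _ ?R, simplified])
  show carr: "carrier (module_of_operators W \<rho>) = carrier W" "add (module_of_operators W \<rho>) = add W"
    "\<zero>\<^bsub>module_of_operators W \<rho>\<^esub> = \<zero>\<^bsub>W\<^esub>" by (simp_all add: module_of_operators_def)
  show smult: "pres S p \<odot>\<^bsub>module_of_operators W \<rho>\<^esub> v = free_action W \<rho> p v" if "v \<in> carrier W" for p v
    using eq[OF someI[of "\<lambda>p'. p' \<in> pres S p", OF self] that] by (simp add: module_of_operators_def)
  have "\<exists>w\<in>carrier (module_of_operators W \<rho>). w \<oplus>\<^bsub>module_of_operators W \<rho>\<^esub> v = \<zero>\<^bsub>module_of_operators W \<rho>\<^esub>"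
    if "v \<in> carrier (module_of_operators W \<rho>)" for v
    using that by (intro bexI[of _ "\<ominus>\<^bsub>W\<^esub> v"]) (simp_all add: carr M.l_neg)
  then have ab: "abelian_group (module_of_operators W \<rho>)"
    by (intro abelian_groupI) (simp_all add: carr M.a_ac)
  interpret A: kalg "presented_algebra S" by (rule kalg_presented_algebra)
  show "left_module (presented_algebra S) (module_of_operators W \<rho>)"
    by (intro left_module.intro left_module_axioms.intro ab A.ring_axioms)
      (auto simp: carr smult free_action_simps linear_mapD[OF free_action_linear])
qed

end

section \<open>Tensor products\<close>

lemma free_space_simps [simp]:
  "carrier (free_space S) = {p. Poly_Mapping.keys p \<subseteq> S}" "p \<oplus>\<^bsub>free_space S\<^esub> r = p + r"
  "\<zero>\<^bsub>free_space S\<^esub> = 0" "c \<odot>\<^bsub>free_space S\<^esub> p = Poly_Mapping.map ((*) c) p"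
  by (simp_all add: free_space_def)

lemma keys_add_subset: "\<lbrakk>Poly_Mapping.keys p \<subseteq> S; Poly_Mapping.keys r \<subseteq> S\<rbrakk> \<Longrightarrow> Poly_Mapping.keys (p + r) \<subseteq> S"
  using Poly_Mapping.keys_add[of p r] by blast

lemma keys_minus_subset:
  fixes p r :: "'x \<Rightarrow>\<^sub>0 'k::ab_group_add"
  shows "\<lbrakk>Poly_Mapping.keys p \<subseteq> S; Poly_Mapping.keys r \<subseteq> S\<rbrakk> \<Longrightarrow> Poly_Mapping.keys (p - r) \<subseteq> S"
  unfolding subset_iff in_keys_iff lookup_minus by (metis diff_zero)

lemma keys_single_subset: "x \<in> S \<Longrightarrow> Poly_Mapping.keys (Poly_Mapping.single x c) \<subseteq> S"
  by simp

lemma vec_free_space: "vec (free_space S :: ('k::field, 's \<Rightarrow>\<^sub>0 'k) module)"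
  unfolding vec_def
proof (intro left_module.intro left_module_axioms.intro ring_field_ring)
  show "abelian_group (free_space S :: ('k, 's \<Rightarrow>\<^sub>0 'k) module)"
  proof (rule abelian_groupI)
    fix p :: "'s \<Rightarrow>\<^sub>0 'k" assume p: "p \<in> carrier (free_space S)"
    then have "- p \<in> carrier (free_space S)" by (auto simp: in_keys_iff subset_iff)
    then show "\<exists>r\<in>carrier (free_space S). r \<oplus>\<^bsub>free_space S\<^esub> p = \<zero>\<^bsub>free_space S\<^esub>"
      by (rule bexI[rotated]) simp
  qed (simp_all add: keys_add_subset add_ac)
qed (auto simp: lookup_map_mult lookup_add algebra_simps in_keys_iff subset_iff intro!: poly_mapping_eqI)

lemma free_space_minus: "\<lbrakk>Poly_Mapping.keys p \<subseteq> S; Poly_Mapping.keys r \<subseteq> S\<rbrakk> \<Longrightarrow> p \<ominus>\<^bsub>free_space S\<^esub> r = p - r"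
proof -
  interpret vec "free_space S" by (rule vec_free_space)
  assume "Poly_Mapping.keys p \<subseteq> S" "Poly_Mapping.keys r \<subseteq> S"
  moreover from this have "- r = \<ominus>\<^bsub>free_space S\<^esub> r"
    by (intro M.minus_equality[symmetric]) (auto simp: in_keys_iff subset_iff)
  ultimately show ?thesis by (simp add: M.minus_eq)
qed

lemma linear_map_zero:
  assumes "vec V" "vec W" "linear_map V W f"
  shows "f \<zero>\<^bsub>V\<^esub> = \<zero>\<^bsub>W\<^esub>"
proof -
  interpret V: vec V by fact
  interpret W: vec W by fact
  show ?thesis using linear_mapD(3)[OF assms(3), of "\<zero>\<^bsub>V\<^esub>" 0] linear_mapD(1)[OF assms(3), of "\<zero>\<^bsub>V\<^esub>"]
    by simp
qed

locale tensor = V: vec V + W: vec W for V :: "('k::field, 'v) module" and W :: "('k, 'w) module"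
begin

abbreviation FS where "FS \<equiv> free_space (carrier V \<times> carrier W)"
abbreviation T where "T \<equiv> tensor_space V W"

definition ten :: "'v \<Rightarrow> 'w \<Rightarrow> ('v \<times> 'w \<Rightarrow>\<^sub>0 'k) set" where
  "ten v w = tensor_null V W +>\<^bsub>FS\<^esub> Poly_Mapping.single (v, w) 1"

sublocale FS: vec FS by (rule vec_free_space)

lemma relations_in_FS: "bilinear_relations V W \<subseteq> carrier FS"
proof
  fix t assume "t \<in> bilinear_relations V W"
  then show "t \<in> carrier FS"
    unfolding bilinear_relations_def free_space_simps mem_Collect_eq
    by (elim UnE CollectE exE conjE; hypsubst; intro keys_minus_subset keys_single_subset; simp)
qed

lemma null_submodule: "submodule (tensor_null V W) field_ring FS"
  and relations_in_null: "bilinear_relations V W \<subseteq> tensor_null V W"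
  unfolding tensor_null_def
  using submodule_span[OF FS.left_module_axioms relations_in_FS] by auto

lemmas null_quotient = quotient_module[OF FS.left_module_axioms null_submodule, folded tensor_space_def]

sublocale T: vec T
  unfolding vec_def by (rule null_quotient(1))

lemma coset_linear: "linear_map FS T (\<lambda>p. tensor_null V W +>\<^bsub>FS\<^esub> p)"
  using null_quotient(2) by (simp add: linear_map_def module_hom_def)

lemma coset_surj: "C \<in> carrier T \<Longrightarrow> \<exists>p. Poly_Mapping.keys p \<subseteq> carrier V \<times> carrier W \<and> C = tensor_null V W +>\<^bsub>FS\<^esub> p"
proof -
  assume "C \<in> carrier T"
  then have "C \<in> (\<lambda>p. tensor_null V W +>\<^bsub>FS\<^esub> p) ` {p. Poly_Mapping.keys p \<subseteq> carrier V \<times> carrier W}"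
    using null_quotient(3) by simp
  then show ?thesis by blast
qed

lemma coset_mem: "\<lbrakk>Poly_Mapping.keys p \<subseteq> carrier V \<times> carrier W; r \<in> tensor_null V W +>\<^bsub>FS\<^esub> p\<rbrakk> \<Longrightarrow>
    Poly_Mapping.keys r \<subseteq> carrier V \<times> carrier W \<and> r - p \<in> tensor_null V W"
  using null_quotient(6)[of p r] by (auto simp: free_space_minus)

lemma ten_closed [simp, intro]: "\<lbrakk>v \<in> carrier V; w \<in> carrier W\<rbrakk> \<Longrightarrow> ten v w \<in> carrier T"
  unfolding ten_def using linear_mapD(1)[OF coset_linear] by simp

lemma single_coset:
  assumes "v \<in> carrier V" "w \<in> carrier W"
  shows "tensor_null V W +>\<^bsub>FS\<^esub> Poly_Mapping.single (v, w) c = c \<odot>\<^bsub>T\<^esub> ten v w"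
  using linear_mapD(3)[OF coset_linear, of "Poly_Mapping.single (v, w) 1" c] assms
  by (simp add: ten_def)

lemma coset_lin_ext:
  assumes "Poly_Mapping.keys p \<subseteq> carrier V \<times> carrier W"
  shows "tensor_null V W +>\<^bsub>FS\<^esub> p = lin_ext T (case_prod ten) p"
  using assms
proof (induction p rule: poly_mapping_keys_induct)
  case zero
  show ?case
    using linear_map_zero[OF FS.vec_axioms T.vec_axioms coset_linear] by simp
next
  case (single x c)
  then show ?case by (cases x) (simp add: single_coset)
next
  case (add p r)
  then show ?case
    using linear_mapD(2)[OF coset_linear, of p r] by (subst T.lin_ext_add) auto
qed

lemma relation_ten:
  assumes "p - r \<in> bilinear_relations V W" "Poly_Mapping.keys p \<subseteq> carrier V \<times> carrier W"
    "Poly_Mapping.keys r \<subseteq> carrier V \<times> carrier W"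
  shows "lin_ext T (case_prod ten) p = lin_ext T (case_prod ten) r"
  using null_quotient(4)[of p r] relations_in_null assms
  by (auto simp: coset_lin_ext free_space_minus)

lemma ten_bilinear:
  shows "\<lbrakk>v \<in> carrier V; v' \<in> carrier V; w \<in> carrier W\<rbrakk> \<Longrightarrow> ten (v \<oplus>\<^bsub>V\<^esub> v') w = ten v w \<oplus>\<^bsub>T\<^esub> ten v' w"
    and "\<lbrakk>v \<in> carrier V; w \<in> carrier W; w' \<in> carrier W\<rbrakk> \<Longrightarrow> ten v (w \<oplus>\<^bsub>W\<^esub> w') = ten v w \<oplus>\<^bsub>T\<^esub> ten v w'"
    and "\<lbrakk>v \<in> carrier V; w \<in> carrier W\<rbrakk> \<Longrightarrow> ten (c \<odot>\<^bsub>V\<^esub> v) w = c \<odot>\<^bsub>T\<^esub> ten v w"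
    and "\<lbrakk>v \<in> carrier V; w \<in> carrier W\<rbrakk> \<Longrightarrow> ten v (c \<odot>\<^bsub>W\<^esub> w) = c \<odot>\<^bsub>T\<^esub> ten v w"
proof -
  let ?s = "\<lambda>v w. Poly_Mapping.single (v, w) (1::'k)"
  have k: "Poly_Mapping.keys (?s a b + ?s c d) \<subseteq> carrier V \<times> carrier W"
    "lin_ext T (case_prod ten) (?s a b + ?s c d) = ten a b \<oplus>\<^bsub>T\<^esub> ten c d"
    if "a \<in> carrier V" "b \<in> carrier W" "c \<in> carrier V" "d \<in> carrier W" for a b c d
    using that by (simp add: keys_add_subset) (subst T.lin_ext_add, use that in auto)
  show "ten (v \<oplus>\<^bsub>V\<^esub> v') w = ten v w \<oplus>\<^bsub>T\<^esub> ten v' w"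
    if v: "v \<in> carrier V" "v' \<in> carrier V" "w \<in> carrier W"
  proof -
    have "?s (v \<oplus>\<^bsub>V\<^esub> v') w - (?s v w + ?s v' w) \<in> bilinear_relations V W"
      unfolding bilinear_relations_def diff_diff_eq[symmetric] using v by blast
    from relation_ten[OF this] show ?thesis using v k by simp
  qed
  show "ten v (w \<oplus>\<^bsub>W\<^esub> w') = ten v w \<oplus>\<^bsub>T\<^esub> ten v w'"
    if v: "v \<in> carrier V" "w \<in> carrier W" "w' \<in> carrier W"
  proof -
    have "?s v (w \<oplus>\<^bsub>W\<^esub> w') - (?s v w + ?s v w') \<in> bilinear_relations V W"
      unfolding bilinear_relations_def diff_diff_eq[symmetric] using v by blast
    from relation_ten[OF this] show ?thesis using v k by simp
  qed
  assume v: "v \<in> carrier V" and w: "w \<in> carrier W"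
  have "?s (c \<odot>\<^bsub>V\<^esub> v) w - Poly_Mapping.single (v, w) c \<in> bilinear_relations V W"
    unfolding bilinear_relations_def using v w by blast
  from relation_ten[OF this] show "ten (c \<odot>\<^bsub>V\<^esub> v) w = c \<odot>\<^bsub>T\<^esub> ten v w"
    using v w by simp
  have "?s v (c \<odot>\<^bsub>W\<^esub> w) - Poly_Mapping.single (v, w) c \<in> bilinear_relations V W"
    unfolding bilinear_relations_def using v w by blast
  from relation_ten[OF this] show "ten v (c \<odot>\<^bsub>W\<^esub> w) = c \<odot>\<^bsub>T\<^esub> ten v w"
    using v w by simp
qed

text \<open>Every element of the tensor space is a linear combination of pure tensors.\<close>

lemma tensor_linear_eq:
  assumes U: "vec U" and f: "linear_map T U f" and g: "linear_map T U g"
    and eq: "\<And>v w. \<lbrakk>v \<in> carrier V; w \<in> carrier W\<rbrakk> \<Longrightarrow> f (ten v w) = g (ten v w)"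
    and C: "C \<in> carrier T"
  shows "f C = g C"
proof -
  interpret U: vec U by fact
  obtain p where p: "Poly_Mapping.keys p \<subseteq> carrier V \<times> carrier W" "C = tensor_null V W +>\<^bsub>FS\<^esub> p"
    using coset_surj[OF C] by blast
  then have C': "C = lin_ext T (case_prod ten) p" by (simp add: coset_lin_ext)
  have *: "(case_prod ten) x \<in> carrier T" if "x \<in> Poly_Mapping.keys p" for x
    using that p by auto
  have "f C = lin_ext U (\<lambda>x. f (case_prod ten x)) p"
    unfolding C' by (rule linear_lin_ext[OF T.vec_axioms U f *])
  also have "\<dots> = lin_ext U (\<lambda>x. g (case_prod ten x)) p"
    by (rule U.lin_ext_cong) (use p * linear_mapD(1)[OF g] in \<open>auto simp: eq\<close>)
  also have "\<dots> = g C"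
    unfolding C' by (rule linear_lin_ext[OF T.vec_axioms U g *, symmetric])
  finally show ?thesis .
qed

definition tlift :: "('k, 'u) module \<Rightarrow> ('v \<Rightarrow> 'w \<Rightarrow> 'u) \<Rightarrow> ('v \<times> 'w \<Rightarrow>\<^sub>0 'k) set \<Rightarrow> 'u" where
  "tlift U B C = lin_ext U (case_prod B) (SOME p. p \<in> C)"

text \<open>The linear extension of \<open>B\<close> vanishes on the bilinear relations, and therefore takes the same value on
  all members of a coset.\<close>

lemma tensor_universal:
  assumes U: "vec U"
    and l: "\<And>w. w \<in> carrier W \<Longrightarrow> linear_map V U (\<lambda>v. B v w)"
    and r: "\<And>v. v \<in> carrier V \<Longrightarrow> linear_map W U (B v)"
  shows "linear_map T U (tlift U B)"
    and "\<lbrakk>v \<in> carrier V; w \<in> carrier W\<rbrakk> \<Longrightarrow> tlift U B (ten v w) = B v w"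
    and "\<lbrakk>C \<in> carrier T; p \<in> C\<rbrakk> \<Longrightarrow> tlift U B C = lin_ext U (case_prod B) p"
proof -
  interpret U: vec U by fact
  note L = linear_mapD[OF l] and R = linear_mapD[OF r]
  have c: "case_prod B x \<in> carrier U" if "x \<in> carrier V \<times> carrier W" for x
    using that R(1) by auto
  have lin: "linear_map FS U (lin_ext U (case_prod B))"
    unfolding linear_map_def free_space_simps
  proof (intro conjI ballI allI Pi_I; clarify)
    fix p r :: "'v \<times> 'w \<Rightarrow>\<^sub>0 'k" and a :: 'k assume p: "Poly_Mapping.keys p \<subseteq> carrier V \<times> carrier W"
    show "lin_ext U (case_prod B) p \<in> carrier U" using p c by (intro U.lin_ext_closed) blast
    show "lin_ext U (case_prod B) (Poly_Mapping.map ((*) a) p) = a \<odot>\<^bsub>U\<^esub> lin_ext U (case_prod B) p"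
      using p c by (intro U.lin_ext_map) blast
    assume "Poly_Mapping.keys r \<subseteq> carrier V \<times> carrier W"
    then show "lin_ext U (case_prod B) (p + r) = lin_ext U (case_prod B) p \<oplus>\<^bsub>U\<^esub> lin_ext U (case_prod B) r"
      using p c by (intro U.lin_ext_add) blast
  qed
  note E = linear_mapD[OF lin]
  let ?K = "{p \<in> carrier FS. lin_ext U (case_prod B) p = \<zero>\<^bsub>U\<^esub>}"
  have "submodule ?K field_ring FS"
  proof (rule FS.submoduleI)
    show "p \<oplus>\<^bsub>FS\<^esub> r \<in> ?K" if "p \<in> ?K" "r \<in> ?K" for p r
      using that E(2)[of p r] keys_add_subset[of p _ r] by simp
    show "a \<odot>\<^bsub>FS\<^esub> p \<in> ?K" if "p \<in> ?K" for p a
      using that E(3)[of p a] FS.vclosed[of p a] by simp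
    show "?K \<subseteq> carrier FS" by blast
  qed simp_all
  moreover have "bilinear_relations V W \<subseteq> ?K"
  proof
    fix t assume t: "t \<in> bilinear_relations V W"
    have diff: "lin_ext U (case_prod B) (p - r) = lin_ext U (case_prod B) p \<ominus>\<^bsub>U\<^esub> lin_ext U (case_prod B) r"
      if "Poly_Mapping.keys p \<subseteq> carrier V \<times> carrier W" "Poly_Mapping.keys r \<subseteq> carrier V \<times> carrier W" for p r
      using that c by (intro U.lin_ext_diff) auto
    have sk: "Poly_Mapping.keys (Poly_Mapping.single (v, w) a) \<subseteq> carrier V \<times> carrier W"
      if "v \<in> carrier V" "w \<in> carrier W" for v w and a :: 'k using that by simp
    have cancel: "(x \<oplus>\<^bsub>U\<^esub> y) \<ominus>\<^bsub>U\<^esub> x \<ominus>\<^bsub>U\<^esub> y = \<zero>\<^bsub>U\<^esub>" if "x \<in> carrier U" "y \<in> carrier U" for x y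
    proof -
      have "(x \<oplus>\<^bsub>U\<^esub> y) \<ominus>\<^bsub>U\<^esub> x = y"
        using that by (simp add: U.M.minus_eq U.M.a_comm[of x y] U.M.a_assoc U.M.r_neg)
      then show ?thesis using that by (simp add: U.M.minus_eq U.M.r_neg)
    qed
    have "lin_ext U (case_prod B) t = \<zero>\<^bsub>U\<^esub>"
      using t unfolding bilinear_relations_def
      by (elim UnE CollectE exE conjE)
        (simp_all add: diff keys_minus_subset sk L R cancel U.diff_eq_zero_iff del: keys_single)
    then show "t \<in> ?K" using t relations_in_FS by blast
  qed
  ultimately have null: "tensor_null V W \<subseteq> ?K"
    unfolding tensor_null_def by (intro submodule_span(3)[OF FS.left_module_axioms relations_in_FS])
  have wd: "lin_ext U (case_prod B) r = lin_ext U (case_prod B) p"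
    if p: "Poly_Mapping.keys p \<subseteq> carrier V \<times> carrier W" and rp: "r \<in> tensor_null V W +>\<^bsub>FS\<^esub> p" for p r
  proof -
    have "Poly_Mapping.keys r \<subseteq> carrier V \<times> carrier W" "r - p \<in> tensor_null V W"
      using coset_mem[OF p rp] by auto
    then have "lin_ext U (case_prod B) r \<ominus>\<^bsub>U\<^esub> lin_ext U (case_prod B) p = \<zero>\<^bsub>U\<^esub>"
      using null p c by (subst U.lin_ext_diff[symmetric]) auto
    then show ?thesis using E(1) \<open>Poly_Mapping.keys r \<subseteq> _\<close> p by (simp add: U.diff_eq_zero_iff)
  qed
  have val: "tlift U B (tensor_null V W +>\<^bsub>FS\<^esub> p) = lin_ext U (case_prod B) p"
    if p: "Poly_Mapping.keys p \<subseteq> carrier V \<times> carrier W" for p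
    unfolding tlift_def by (rule wd[OF p], rule someI[of _ p], rule null_quotient(5)) (use p in simp)
  show "tlift U B (ten v w) = B v w" if "v \<in> carrier V" "w \<in> carrier W" for v w
    unfolding ten_def using that by (subst val) (auto simp: R)
  show "tlift U B C = lin_ext U (case_prod B) p" if C: "C \<in> carrier T" and p: "p \<in> C"
  proof -
    obtain r where "Poly_Mapping.keys r \<subseteq> carrier V \<times> carrier W" "C = tensor_null V W +>\<^bsub>FS\<^esub> r"
      using coset_surj[OF C] by blast
    then show ?thesis using wd val p by simp
  qed
  note Q = linear_mapD[OF coset_linear]
  show "linear_map T U (tlift U B)"
    unfolding linear_map_def
  proof (intro conjI ballI allI Pi_I)
    fix C assume C: "C \<in> carrier T"
    obtain p where p: "Poly_Mapping.keys p \<subseteq> carrier V \<times> carrier W" "C = tensor_null V W +>\<^bsub>FS\<^esub> p"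
      using coset_surj[OF C] by blast
    show "tlift U B C \<in> carrier U" using p E(1) by (simp add: val)
    show "tlift U B (a \<odot>\<^bsub>T\<^esub> C) = a \<odot>\<^bsub>U\<^esub> tlift U B C" for a
      using p E(3)[of p a] Q(3)[of p a, symmetric] FS.vclosed[of p a] by (simp add: val)
    fix D assume D: "D \<in> carrier T"
    obtain r where r: "Poly_Mapping.keys r \<subseteq> carrier V \<times> carrier W" "D = tensor_null V W +>\<^bsub>FS\<^esub> r"
      using coset_surj[OF D] by blast
    show "tlift U B (C \<oplus>\<^bsub>T\<^esub> D) = tlift U B C \<oplus>\<^bsub>U\<^esub> tlift U B D"
      using p r E(2)[of p r] Q(2)[of p r, symmetric] keys_add_subset[of p _ r] by (simp add: val)
  qed
qed

end

text \<open>The union that defines \<open>tensor_map\<close> consists of equal cosets, each of them the value of the linear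
  map that lifts \<open>(v, w) \<mapsto> f v \<otimes> s w\<close>.\<close>

lemma tensor_map:
  assumes T1: "tensor V1 W1" and T2: "tensor V2 W2"
    and f: "linear_map V1 V2 f" and s: "linear_map W1 W2 s"
  shows "linear_map (tensor_space V1 W1) (tensor_space V2 W2) (tensor_map V2 W2 f s)"
    and "\<lbrakk>v \<in> carrier V1; w \<in> carrier W1\<rbrakk> \<Longrightarrow>
      tensor_map V2 W2 f s (tensor.ten V1 W1 v w) = tensor.ten V2 W2 (f v) (s w)"
proof -
  interpret T1: tensor V1 W1 by fact
  interpret T2: tensor V2 W2 by fact
  note f = linear_mapD[OF f] and s = linear_mapD[OF s]
  let ?B = "\<lambda>v w. T2.ten (f v) (s w)"
  have L: "linear_map V1 T2.T (\<lambda>v. ?B v w)" if "w \<in> carrier W1" for w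
    using that by (simp add: linear_map_def f s T2.ten_bilinear Pi_iff T2.ten_closed)
  have R: "linear_map W1 T2.T (?B v)" if "v \<in> carrier V1" for v
    using that by (simp add: linear_map_def f s T2.ten_bilinear Pi_iff T2.ten_closed)
  have lift: "linear_map T1.T T2.T (T1.tlift T2.T ?B)"
    "\<And>v w. \<lbrakk>v \<in> carrier V1; w \<in> carrier W1\<rbrakk> \<Longrightarrow> T1.tlift T2.T ?B (T1.ten v w) = ?B v w"
    "\<And>C p. \<lbrakk>C \<in> carrier T1.T; p \<in> C\<rbrakk> \<Longrightarrow> T1.tlift T2.T ?B C = lin_ext T2.T (case_prod ?B) p"
    by (rule T1.tensor_universal[OF T2.T.vec_axioms]; simp add: L R)+
  have val: "tensor_null V2 W2 +>\<^bsub>free_space (carrier V2 \<times> carrier W2)\<^esub>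
      (\<Sum>x\<in>A. Poly_Mapping.single (map_prod f s x) (a x)) = (\<Oplus>\<^bsub>T2.T\<^esub>x\<in>A. a x \<odot>\<^bsub>T2.T\<^esub> case_prod ?B x)
     \<and> Poly_Mapping.keys (\<Sum>x\<in>A. Poly_Mapping.single (map_prod f s x) (a x)) \<subseteq> carrier V2 \<times> carrier W2"
    if "finite A" "A \<subseteq> carrier V1 \<times> carrier W1" for A a
    using that
  proof (induction A rule: finite_induct)
    case empty
    then show ?case
      using linear_map_zero[OF T2.FS.vec_axioms T2.T.vec_axioms T2.coset_linear] by simp
  next
    case (insert x F)
    obtain v w where x: "x = (v, w)" "v \<in> carrier V1" "w \<in> carrier W1" using insert.prems by auto
    have IH: "tensor_null V2 W2 +>\<^bsub>free_space (carrier V2 \<times> carrier W2)\<^esub>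
      (\<Sum>x\<in>F. Poly_Mapping.single (map_prod f s x) (a x)) = (\<Oplus>\<^bsub>T2.T\<^esub>x\<in>F. a x \<odot>\<^bsub>T2.T\<^esub> case_prod ?B x)"
      and keys: "Poly_Mapping.keys (\<Sum>x\<in>F. Poly_Mapping.single (map_prod f s x) (a x)) \<subseteq> carrier V2 \<times> carrier W2"
      using insert by auto
    have k: "Poly_Mapping.keys (Poly_Mapping.single (f v, s w) (a x)) \<subseteq> carrier V2 \<times> carrier W2"
      using x f s by simp
    have F: "(\<lambda>x. a x \<odot>\<^bsub>T2.T\<^esub> case_prod ?B x) \<in> F \<rightarrow> carrier T2.T"
      using insert.prems f s by auto
    have "(\<Oplus>\<^bsub>T2.T\<^esub>x\<in>insert x F. a x \<odot>\<^bsub>T2.T\<^esub> case_prod ?B x) =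
      a x \<odot>\<^bsub>T2.T\<^esub> case_prod ?B x \<oplus>\<^bsub>T2.T\<^esub> (\<Oplus>\<^bsub>T2.T\<^esub>x\<in>F. a x \<odot>\<^bsub>T2.T\<^esub> case_prod ?B x)"
      using insert(1,2) F x f s by (intro T2.T.M.finsum_insert) auto
    then show ?case
      using linear_mapD(2)[OF T2.coset_linear, of "Poly_Mapping.single (f v, s w) (a x)"] k keys
        IH insert(1,2) x f s T2.single_coset[of "f v" "s w" "a x"] keys_add_subset[OF k keys] by simp
  qed
  have eq: "tensor_map V2 W2 f s C = T1.tlift T2.T ?B C" if C: "C \<in> carrier T1.T" for C
  proof -
    obtain p where p: "Poly_Mapping.keys p \<subseteq> carrier V1 \<times> carrier W1"
      "C = tensor_null V1 W1 +>\<^bsub>T1.FS\<^esub> p" using T1.coset_surj[OF C] by blast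
    have "tensor_null V2 W2 +>\<^bsub>T2.FS\<^esub> (\<Sum>x\<in>Poly_Mapping.keys r.
        Poly_Mapping.single (map_prod f s x) (Poly_Mapping.lookup r x)) = T1.tlift T2.T ?B C"
      if r: "r \<in> C" for r
    proof -
      have "Poly_Mapping.keys r \<subseteq> carrier V1 \<times> carrier W1" using T1.coset_mem[OF p(1)] p(2) r by blast
      then show ?thesis
        using val[of "Poly_Mapping.keys r" "Poly_Mapping.lookup r"] lift(3)[OF C r]
        by (simp add: lin_ext_def)
    qed
    moreover have "p \<in> C" using T1.null_quotient(5)[of p] p by simp
    ultimately show ?thesis unfolding tensor_map_def by auto
  qed
  show "linear_map T1.T T2.T (tensor_map V2 W2 f s)"
    using linear_mapD[OF lift(1)] by (auto simp: linear_map_def eq)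
  show "tensor_map V2 W2 f s (T1.ten v w) = T2.ten (f v) (s w)" if "v \<in> carrier V1" "w \<in> carrier W1" for v w
    using that lift(2) by (simp add: eq T1.ten_closed)
qed

section \<open>The algebra \<open>U\<^sub>g\<^sub>,\<^sub>h\<close> acting on tensor products\<close>

locale pres_module = left_module "presented_algebra S" M
  for S :: "('x, 'k::field) free_alg set" and M :: "(('x, 'k) free_alg set, 'm) module"
begin

abbreviation act :: "('x, 'k) free_alg \<Rightarrow> 'm \<Rightarrow> 'm" where "act p m \<equiv> pres S p \<odot>\<^bsub>M\<^esub> m"

sublocale S: kalg "presented_algebra S" by (rule kalg_presented_algebra)

sublocale vs: vec "vspace (presented_algebra S) M"
  by (rule vec_vspace[OF kalg_presented_algebra left_module_axioms])

lemma act_closed [simp, intro]: "m \<in> carrier M \<Longrightarrow> act p m \<in> carrier M"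
  using lsmult_closed by simp

lemma act_linear: "\<lbrakk>m \<in> carrier M; m' \<in> carrier M\<rbrakk> \<Longrightarrow> act p (m \<oplus>\<^bsub>M\<^esub> m') = act p m \<oplus>\<^bsub>M\<^esub> act p m'"
  using lsmult_r_distr by simp

lemma act_add: "m \<in> carrier M \<Longrightarrow> act (p + r) m = act p m \<oplus>\<^bsub>M\<^esub> act r m"
  using lsmult_l_distr[of "pres S p" "pres S r" m] by simp

lemma act_mult: "m \<in> carrier M \<Longrightarrow> act (p * r) m = act p (act r m)"
  using lsmult_assoc[of "pres S p" "pres S r" m] by simp

lemma act_one [simp]: "m \<in> carrier M \<Longrightarrow> act 1 m = m"
  using lsmult_one by simp

lemma act_zero [simp]: "m \<in> carrier M \<Longrightarrow> act 0 m = \<zero>\<^bsub>M\<^esub>"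
  using lsmult_l_null by simp

lemma act_diff: "m \<in> carrier M \<Longrightarrow> act (p - r) m = act p m \<ominus>\<^bsub>M\<^esub> act r m"
proof -
  assume m: "m \<in> carrier M"
  have "act (p - r) m \<oplus>\<^bsub>M\<^esub> act r m = act p m" using act_add[OF m, of "p - r" r] by simp
  then show ?thesis using m
    by (metis M.add.inv_closed M.minus_eq M.r_neg M.a_assoc M.r_zero act_closed)
qed

lemma act_const_commute: "m \<in> carrier M \<Longrightarrow> act p (act (const c) m) = act (const c) (act p m)"
  by (metis act_mult const_commute)

lemma act_relation:
  assumes "p - r \<in> S" "m \<in> carrier M" shows "act p m = act r m"
proof -
  have "act (p - r) m = \<zero>\<^bsub>M\<^esub>" using pres_relation[OF assms(1)] assms(2) by simp
  then show ?thesis using assms(2) by (simp add: act_diff diff_eq_zero_iff)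
qed

lemma linear_act: "linear_map (vspace (presented_algebra S) M) (vspace (presented_algebra S) M) (act p)"
  by (auto simp: linear_map_def act_linear act_const_commute)

end

declare tensor_operator.simps [simp del]

lemmas sl2_relations_unfolded = sl2_relations_def[unfolded Let_def]
lemmas gh_relations_unfolded = gh_relations_def[unfolded Let_def]

locale sl2_module = pres_module "sl2_relations q" V
  for q :: "'k::field" and V :: "((sl2_gen, 'k) free_alg set, 'v) module"
begin

abbreviation X :: "sl2_gen \<Rightarrow> 'v \<Rightarrow> 'v" where "X y v \<equiv> act (var y) v"

lemma sl2_rels:
  assumes v: "v \<in> carrier V"
  shows "X K_sl2 (X Kinv_sl2 v) = v" "X Kinv_sl2 (X K_sl2 v) = v"
    and "X K_sl2 (X E_sl2 (X Kinv_sl2 v)) = act (const (q\<^sup>2)) (X E_sl2 v)"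
    and "X K_sl2 (X F_sl2 (X Kinv_sl2 v)) = act (const (inverse (q\<^sup>2))) (X F_sl2 v)"
    and "X E_sl2 (X F_sl2 v) = X F_sl2 (X E_sl2 v) \<oplus>\<^bsub>V\<^esub>
      act (const (inverse (q - inverse q))) (X K_sl2 v \<ominus>\<^bsub>V\<^esub> X Kinv_sl2 v)"
proof -
  let ?S = "sl2_relations q"
  have r: "var K_sl2 * var Kinv_sl2 - 1 \<in> ?S" "var Kinv_sl2 * var K_sl2 - 1 \<in> ?S"
    "var K_sl2 * var E_sl2 * var Kinv_sl2 - const (q\<^sup>2) * var E_sl2 \<in> ?S"
    "var K_sl2 * var F_sl2 * var Kinv_sl2 - const (inverse (q\<^sup>2)) * var F_sl2 \<in> ?S"
    "var E_sl2 * var F_sl2 - (var F_sl2 * var E_sl2 + const (inverse (q - inverse q)) * (var K_sl2 - var Kinv_sl2)) \<in> ?S"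
    by (simp_all add: sl2_relations_unfolded diff_diff_eq[symmetric])
  show "X K_sl2 (X Kinv_sl2 v) = v" "X Kinv_sl2 (X K_sl2 v) = v"
    "X K_sl2 (X E_sl2 (X Kinv_sl2 v)) = act (const (q\<^sup>2)) (X E_sl2 v)"
    "X K_sl2 (X F_sl2 (X Kinv_sl2 v)) = act (const (inverse (q\<^sup>2))) (X F_sl2 v)"
    "X E_sl2 (X F_sl2 v) = X F_sl2 (X E_sl2 v) \<oplus>\<^bsub>V\<^esub>
      act (const (inverse (q - inverse q))) (X K_sl2 v \<ominus>\<^bsub>V\<^esub> X Kinv_sl2 v)"
    using r[THEN act_relation, OF v] v by (simp_all add: act_mult act_add act_diff)
qed

end

locale laurent_module = left_module monoid_algebra N for N :: "('k::field laurent, 'n) module"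
begin

abbreviation L :: "int \<Rightarrow> int \<Rightarrow> 'n \<Rightarrow> 'n" where "L i j z \<equiv> laurent_monom i j \<odot>\<^bsub>N\<^esub> z"

sublocale vs: vec "vspace monoid_algebra N"
  by (rule vec_vspace[OF kalg_monoid_algebra left_module_axioms])

lemma L_closed [simp, intro]: "z \<in> carrier N \<Longrightarrow> L i j z \<in> carrier N"
  using lsmult_closed by simp

lemma L_L: "z \<in> carrier N \<Longrightarrow> L i j (L k l z) = L (i + k) (j + l) z"
  using lsmult_assoc[of "laurent_monom i j" "laurent_monom k l" z] by (simp add: mult_single)

lemma L_zero [simp]: "z \<in> carrier N \<Longrightarrow> L 0 0 z = z"
  using lsmult_one[of z] single_one by (metis monoid_algebra_simps(4) zero_prod_def)

lemma linear_L: "linear_map (vspace monoid_algebra N) (vspace monoid_algebra N) (L i j)"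
proof -
  have "L i j (Poly_Mapping.single 0 c \<odot>\<^bsub>N\<^esub> z) = Poly_Mapping.single 0 c \<odot>\<^bsub>N\<^esub> L i j z"
    if "z \<in> carrier N" for c z
    using lsmult_assoc[of "laurent_monom i j" "Poly_Mapping.single 0 c" z]
      lsmult_assoc[of "Poly_Mapping.single 0 c" "laurent_monom i j" z] that
    by (simp add: mult_single)
  then show ?thesis by (auto simp: linear_map_def lsmult_r_distr)
qed

end

locale gh_tensor = V: sl2_module q V + N: laurent_module N
  for q :: "'k::field" and V :: "((sl2_gen, 'k) free_alg set, 'v) module"
    and N :: "('k laurent, 'n) module"
begin

abbreviation "V0 \<equiv> vspace (Uq q) V"
abbreviation "N0 \<equiv> vspace (monoid_algebra :: ('k, 'k laurent) kalgebra) N"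

sublocale tensor V0 N0 by (intro tensor.intro V.vs.vec_axioms N.vs.vec_axioms)

abbreviation \<rho> where "\<rho> \<equiv> tensor_operator q V N"

lemma linear_id: "linear_map W W (\<lambda>x. x)" "linear_map W W id" by (auto simp: linear_map_def)

lemma operator_simps:
  "\<rho> E_gh = tensor_map V0 N0 (V.X E_sl2) (N.L 1 0)"
  "\<rho> F_gh = tensor_map V0 N0 (V.X F_sl2) id"
  "\<rho> K_gh = tensor_map V0 N0 (V.X K_sl2) (N.L 1 0)"
  "\<rho> Kinv_gh = tensor_map V0 N0 (V.X Kinv_sl2) (N.L (-1) 0)"
  "\<rho> g_gh = tensor_map V0 N0 id (N.L 1 0)"
  "\<rho> ginv_gh = tensor_map V0 N0 id (N.L (-1) 0)"
  "\<rho> h_gh = tensor_map V0 N0 id (N.L 0 1)"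
  "\<rho> hinv_gh = tensor_map V0 N0 id (N.L 0 (-1))"
  by (simp_all add: tensor_operator.simps generator_pres)

lemma linear_operator: "linear_map T T (\<rho> x)"
proof -
  note t = tensor_map(1)[OF tensor_axioms tensor_axioms]
  show ?thesis
    by (cases x) (simp_all only: operator_simps t V.linear_act N.linear_L linear_id)
qed

sublocale ops: operators T \<rho>
  by (intro operators.intro operators_axioms.intro T.vec_axioms linear_operator)

lemma operator_ten:
  assumes v: "v \<in> carrier V" and z: "z \<in> carrier N"
  shows "\<rho> E_gh (ten v z) = ten (V.X E_sl2 v) (N.L 1 0 z)" "\<rho> F_gh (ten v z) = ten (V.X F_sl2 v) z"
    "\<rho> K_gh (ten v z) = ten (V.X K_sl2 v) (N.L 1 0 z)"
    "\<rho> Kinv_gh (ten v z) = ten (V.X Kinv_sl2 v) (N.L (-1) 0 z)"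
    "\<rho> g_gh (ten v z) = ten v (N.L 1 0 z)" "\<rho> ginv_gh (ten v z) = ten v (N.L (-1) 0 z)"
    "\<rho> h_gh (ten v z) = ten v (N.L 0 1 z)" "\<rho> hinv_gh (ten v z) = ten v (N.L 0 (-1) z)"
proof -
  note t = tensor_map(2)[OF tensor_axioms tensor_axioms]
  show "\<rho> E_gh (ten v z) = ten (V.X E_sl2 v) (N.L 1 0 z)" "\<rho> F_gh (ten v z) = ten (V.X F_sl2 v) z"
    "\<rho> K_gh (ten v z) = ten (V.X K_sl2 v) (N.L 1 0 z)"
    "\<rho> Kinv_gh (ten v z) = ten (V.X Kinv_sl2 v) (N.L (-1) 0 z)"
    "\<rho> g_gh (ten v z) = ten v (N.L 1 0 z)" "\<rho> ginv_gh (ten v z) = ten v (N.L (-1) 0 z)"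
    "\<rho> h_gh (ten v z) = ten v (N.L 0 1 z)" "\<rho> hinv_gh (ten v z) = ten v (N.L 0 (-1) z)"
    unfolding operator_simps
    using v z by (subst t; simp add: V.linear_act N.linear_L linear_id)+
qed

text \<open>On pure tensors the relations of \<open>U\<^sub>g\<^sub>,\<^sub>h\<close> reduce to those of \<open>U\<^sub>q(sl(2))\<close>: the factors \<open>g\<close> that
  accompany \<open>E'\<close> and \<open>K'\<close> turn \<open>K' - K'\<^sup>-\<^sup>1\<close> into \<open>K - K\<^sup>-\<^sup>1 g\<^sup>2\<close>.\<close>

lemma gh_relations_hold:
  assumes r: "r \<in> gh_relations q" and C: "C \<in> carrier T"
  shows "free_action T \<rho> r C = \<zero>\<^bsub>T\<^esub>"
proof (rule tensor_linear_eq[OF T.vec_axioms ops.free_action_linear _ _ C])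
  show "linear_map T T (\<lambda>_. \<zero>\<^bsub>T\<^esub>)" by (auto simp: linear_map_def)
  fix v z assume "v \<in> carrier V0" "z \<in> carrier N0"
  then have v: "v \<in> carrier V" and z: "z \<in> carrier N" by simp_all
  let ?c = "inverse (q - inverse q)"
  have c: "ten v z \<in> carrier T" if "v \<in> carrier V" "z \<in> carrier N" for v z using that by simp
  have sc: "ten (pres (sl2_relations q) (const c) \<odot>\<^bsub>V\<^esub> v) z = c \<odot>\<^bsub>T\<^esub> ten v z"
    if "v \<in> carrier V" "z \<in> carrier N" for c v z
    using ten_bilinear(3)[of v z c] that by simp
  have mn: "ten (v \<ominus>\<^bsub>V\<^esub> v') z = ten v z \<ominus>\<^bsub>T\<^esub> ten v' z"
    if "v \<in> carrier V" "v' \<in> carrier V" "z \<in> carrier N" for v v' z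
    using additive_zero_minus(3)[OF V.M.abelian_group_axioms T.M.abelian_group_axioms, of "\<lambda>v. ten v z" v v']
      that ten_bilinear(1)[of _ _ z] by simp
  have ad: "ten (v \<oplus>\<^bsub>V\<^esub> v') z = ten v z \<oplus>\<^bsub>T\<^esub> ten v' z"
    if "v \<in> carrier V" "v' \<in> carrier V" "z \<in> carrier N" for v v' z
    using ten_bilinear(1)[of v v' z] that by simp
  have ef: "(x \<oplus>\<^bsub>T\<^esub> y) \<ominus>\<^bsub>T\<^esub> x \<ominus>\<^bsub>T\<^esub> y = \<zero>\<^bsub>T\<^esub>" if "x \<in> carrier T" "y \<in> carrier T" for x y
  proof -
    have "(x \<oplus>\<^bsub>T\<^esub> y) \<ominus>\<^bsub>T\<^esub> x = y"
      using that by (simp add: T.M.minus_eq T.M.a_comm[of x y] T.M.a_assoc T.M.r_neg)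
    then show ?thesis using that by (simp add: T.M.minus_eq T.M.r_neg)
  qed
  show "free_action T \<rho> r (ten v z) = \<zero>\<^bsub>T\<^esub>"
    using r v z unfolding gh_relations_unfolded
    by (elim insertE emptyE)
      (simp_all add: ops.free_action_simps operator_ten c V.sl2_rels N.L_L T.diff_eq_zero_iff
        power2_eq_square sc mn ad ef)
qed

lemmas tensor_module_facts =
  ops.module_of_operators[OF gh_relations_hold, folded tensor_module_def]

lemma tensor_module: "left_module (Ugh q) (tensor_module q V N)"
  by (rule tensor_module_facts(1))

lemma carrier_tensor_module [simp]: "carrier (tensor_module q V N) = carrier T"
  and add_tensor_module [simp]: "add (tensor_module q V N) = add T"
  and zero_tensor_module [simp]: "\<zero>\<^bsub>tensor_module q V N\<^esub> = \<zero>\<^bsub>T\<^esub>"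
  by (rule tensor_module_facts; assumption)+

lemma tensor_module_action:
  assumes "C \<in> carrier T"
  shows "pres (gh_relations q) (var x) \<odot>\<^bsub>tensor_module q V N\<^esub> C = \<rho> x C"
    and "pres (gh_relations q) (const c) \<odot>\<^bsub>tensor_module q V N\<^esub> C = c \<odot>\<^bsub>T\<^esub> C"
  using assms by (simp_all add: tensor_module_facts(2) ops.free_action_simps)

end

section \<open>Coordinates on \<open>V\<^sub>\<epsilon>\<^sub>,\<^sub>n \<otimes> N\<close>\<close>

text \<open>The eigenvalue of \<open>K'\<close> on the basis vector \<open>v\<^sub>i\<close> of \<open>V\<^sub>\<epsilon>\<^sub>,\<^sub>n\<close>.\<close>

definition weight :: "'k::field \<Rightarrow> 'k \<Rightarrow> nat \<Rightarrow> nat \<Rightarrow> 'k" where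
  "weight q \<epsilon> n i = \<epsilon> * q powi (int n - 2 * int i)"

lemma coord_space_simps [simp]:
  "carrier (coord_space n) = {u. \<forall>i>n. u i = 0}" "u \<oplus>\<^bsub>coord_space n\<^esub> w = (\<lambda>i. u i + w i)"
  "\<zero>\<^bsub>coord_space n\<^esub> = (\<lambda>_. 0)" "c \<odot>\<^bsub>coord_space n\<^esub> u = (\<lambda>i. c * u i)"
  by (simp_all add: coord_space_def)

lemma vec_coord_space: "vec (coord_space n :: ('k::field, nat \<Rightarrow> 'k) module)"
  unfolding vec_def
proof (intro left_module.intro left_module_axioms.intro ring_field_ring)
  show "abelian_group (coord_space n :: ('k, nat \<Rightarrow> 'k) module)"
  proof (rule abelian_groupI)
    fix u :: "nat \<Rightarrow> 'k" assume "u \<in> carrier (coord_space n)"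
    then show "\<exists>w\<in>carrier (coord_space n). w \<oplus>\<^bsub>coord_space n\<^esub> u = \<zero>\<^bsub>coord_space n\<^esub>"
      by (intro bexI[of _ "\<lambda>i. - u i"]) auto
  qed (auto simp: add_ac)
qed (auto simp: algebra_simps)

lemma coord_space_minus:
  fixes u w :: "nat \<Rightarrow> 'k::field"
  assumes "u \<in> carrier (coord_space n)" "w \<in> carrier (coord_space n)"
  shows "u \<ominus>\<^bsub>coord_space n\<^esub> w = (\<lambda>i. u i - w i)"
proof -
  interpret vec "coord_space n :: ('k, nat \<Rightarrow> 'k) module" by (rule vec_coord_space)
  have "\<ominus>\<^bsub>coord_space n\<^esub> w = (\<lambda>i. - w i)" using assms by (intro M.minus_equality) auto
  then show ?thesis using assms by (simp add: M.minus_eq)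
qed

lemma V_operator_coord:
  fixes u :: "nat \<Rightarrow> 'k::field"
  assumes "\<forall>i>n. u i = 0"
  shows "V_operator q \<epsilon> n K_sl2 u = (\<lambda>i. weight q \<epsilon> n i * u i)"
    and "V_operator q \<epsilon> n Kinv_sl2 u = (\<lambda>i. inverse (weight q \<epsilon> n i) * u i)"
    and "V_operator q \<epsilon> n E_sl2 u = (\<lambda>i. \<epsilon> * qint q (n - i) * u (Suc i))"
    and "V_operator q \<epsilon> n F_sl2 u = (\<lambda>i. if i = 0 \<or> i > n then 0 else qint q i * u (i - 1))"
proof -
  have sum: "(\<Sum>p\<in>A. a p * basis_vec (f p) i) = (if \<exists>p\<in>A. f p = i then a (THE p. p \<in> A \<and> f p = i) else 0)"
    if "finite A" "inj_on f A" for A :: "nat set" and a :: "nat \<Rightarrow> 'k" and f i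
  proof (cases "\<exists>p\<in>A. f p = i")
    case True
    then obtain p where p: "p \<in> A" "f p = i" by blast
    have "(THE p. p \<in> A \<and> f p = i) = p" using p that(2) by (auto dest: inj_onD)
    moreover have "(\<Sum>r\<in>A. a r * basis_vec (f r) i) = (\<Sum>r\<in>A. if r = p then a p else 0)"
      using p that(2) by (intro sum.cong) (auto simp: basis_vec_def dest: inj_onD)
    ultimately show ?thesis using that p by auto
  qed (auto simp: basis_vec_def intro!: sum.neutral)
  have k: "(\<Sum>p\<le>n. a p * basis_vec p i) = (if i \<le> n then a i else 0)" for a :: "nat \<Rightarrow> 'k" and i
    by (simp add: basis_vec_def sum.delta' if_distrib cong: if_cong)
  show "V_operator q \<epsilon> n K_sl2 u = (\<lambda>i. weight q \<epsilon> n i * u i)"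
    "V_operator q \<epsilon> n Kinv_sl2 u = (\<lambda>i. inverse (weight q \<epsilon> n i) * u i)"
    using assms by (auto simp: k weight_def fun_eq_iff)
  show "V_operator q \<epsilon> n E_sl2 u = (\<lambda>i. \<epsilon> * qint q (n - i) * u (Suc i))"
  proof
    fix i
    have "(\<Sum>p=1..n. u p * (\<epsilon> * qint q (n - p + 1)) * basis_vec (p - 1) i) =
      (\<Sum>p=1..n. if p = Suc i then u (Suc i) * (\<epsilon> * qint q (n - i)) else 0)"
      by (intro sum.cong) (auto simp: basis_vec_def Suc_diff_le)
    then show "V_operator q \<epsilon> n E_sl2 u i = \<epsilon> * qint q (n - i) * u (Suc i)"
      using assms by auto
  qed
  show "V_operator q \<epsilon> n F_sl2 u = (\<lambda>i. if i = 0 \<or> i > n then 0 else qint q i * u (i - 1))"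
  proof
    fix i
    have "(\<Sum>p<n. u p * qint q (p + 1) * basis_vec (p + 1) i) =
      (\<Sum>p<n. if p = i - 1 then (if i = 0 then 0 else u (i - 1) * qint q i) else 0)"
      by (intro sum.cong) (auto simp: basis_vec_def)
    then show "V_operator q \<epsilon> n F_sl2 u i = (if i = 0 \<or> i > n then 0 else qint q i * u (i - 1))"
      by auto
  qed
qed

declare V_operator.simps [simp del]

lemma qint_0 [simp]: "qint q 0 = 0"
  by (simp add: qint_def)

lemma weight_Suc: "q \<noteq> 0 \<Longrightarrow> weight q \<epsilon> n i = q\<^sup>2 * weight q \<epsilon> n (Suc i)"
proof -
  assume q: "q \<noteq> 0"
  have "q powi (int n - 2 * int i) = q powi (2 + (int n - 2 * int (Suc i)))" by simp
  also have "\<dots> = q\<^sup>2 * q powi (int n - 2 * int (Suc i))" using q by (subst power_int_add) auto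
  finally show ?thesis by (simp add: weight_def algebra_simps)
qed

lemma weight_eq:
  assumes "q \<noteq> 0"
  shows "weight q \<epsilon> (i + m) i = \<epsilon> * q ^ m / q ^ i"
proof -
  have "q powi (int (i + m) - 2 * int i) = q powi (int m - int i)" by (simp add: algebra_simps)
  then show ?thesis using assms by (simp add: weight_def power_int_diff)
qed

text \<open>This is the relation for \<open>E' F' - F' E'\<close>, evaluated on \<open>v\<^sub>i\<close>.\<close>

lemma qint_commutator:
  assumes q: "q \<noteq> 0" "q - inverse q \<noteq> 0" and e: "\<epsilon> * \<epsilon> = (1::'k::field)" and i: "i \<le> n"
  shows "\<epsilon> * qint q (n - i) * qint q (Suc i) = \<epsilon> * qint q i * qint q (Suc (n - i)) +
    inverse (q - inverse q) * (weight q \<epsilon> n i - inverse (weight q \<epsilon> n i))"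
proof -
  obtain m where n: "n = i + m" using i by (metis le_add_diff_inverse)
  have ie: "inverse \<epsilon> = \<epsilon>" using e by (metis inverse_unique)
  define a b d where "a = q ^ i" and "b = q ^ m" and "d = q - inverse q"
  have nz: "a \<noteq> 0" "b \<noteq> 0" "d \<noteq> 0" using q by (auto simp: a_def b_def d_def)
  have w: "weight q \<epsilon> n i = \<epsilon> * b / a" "inverse (weight q \<epsilon> n i) = \<epsilon> * a / b"
    using weight_eq[OF q(1), of \<epsilon> i m] ie by (simp_all add: n a_def b_def divide_inverse mult_ac)
  have Q: "qint q i = (a - inverse a) / d" "qint q m = (b - inverse b) / d"
    "qint q (Suc i) = (q * a - inverse (q * a)) / d" "qint q (Suc m) = (q * b - inverse (q * b)) / d"
    by (simp_all add: qint_def a_def b_def d_def power_inverse)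
  have "(b - inverse b) * (q * a - inverse (q * a)) - (a - inverse a) * (q * b - inverse (q * b)) =
    d * (b / a - a / b)"
    using nz q(1) by (simp add: d_def field_simps)
  moreover have "x / d * (y / d) = z / d * (t / d) + inverse d * w" if "x * y - z * t = d * w" for x y z t w
  proof -
    have "x * y = z * t + d * w" using that by (simp add: algebra_simps)
    have "x / d * (y / d) = (x * y) / (d * d)" by simp
    also have "\<dots> = z / d * (t / d) + inverse d * w"
      unfolding \<open>x * y = z * t + d * w\<close> using nz(3) by (simp add: field_simps)
    finally show ?thesis .
  qed
  ultimately have "(b - inverse b) / d * ((q * a - inverse (q * a)) / d) =
    (a - inverse a) / d * ((q * b - inverse (q * b)) / d) + inverse d * (b / a - a / b)" by blast
  then have "\<epsilon> * (qint q m * qint q (Suc i)) = \<epsilon> * (qint q i * qint q (Suc m) + inverse d * (b / a - a / b))"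
    unfolding Q by simp
  then show ?thesis
    by (subst w(2), subst w(1)) (simp add: n d_def[symmetric] algebra_simps)
qed

locale uq_params =
  fixes q \<epsilon> :: "'k::field" and n :: nat
  assumes q_nz: "q \<noteq> 0" and q_inv: "q - inverse q \<noteq> 0" and eps: "\<epsilon> * \<epsilon> = 1"
begin

lemma weight_nz: "weight q \<epsilon> n i \<noteq> 0"
  using q_nz eps by (auto simp: weight_def)

sublocale cs: vec "coord_space n :: ('k, nat \<Rightarrow> 'k) module" by (rule vec_coord_space)

lemma V_linear: "linear_map (coord_space n) (coord_space n) (V_operator q \<epsilon> n y)"
  by (cases y) (auto simp: linear_map_def V_operator_coord algebra_simps)

sublocale ops: operators "coord_space n :: ('k, nat \<Rightarrow> 'k) module" "V_operator q \<epsilon> n"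
  by (intro operators.intro operators_axioms.intro vec_coord_space V_linear)

lemma sl2_relations_hold:
  assumes r: "r \<in> sl2_relations q" and u: "u \<in> carrier (coord_space n)"
  shows "free_action (coord_space n) (V_operator q \<epsilon> n) r u = \<zero>\<^bsub>coord_space n\<^esub>"
proof -
  let ?V = "V_operator q \<epsilon> n"
  note c = linear_mapD(1)[OF V_linear]
  have u0: "\<forall>i>n. u i = 0" using u by simp
  have C: "\<forall>i>n. V_operator q \<epsilon> n y u i = 0" for y using c[OF u, of y] by simp
  have KK: "?V K_sl2 (?V Kinv_sl2 u) = u" "?V Kinv_sl2 (?V K_sl2 u) = u"
    using weight_nz u0 by (auto simp: V_operator_coord C)
  have KE: "?V K_sl2 (?V E_sl2 (?V Kinv_sl2 u)) = (\<lambda>i. q\<^sup>2 * ?V E_sl2 u i)"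
  proof
    fix i
    have "\<forall>i>n. ?V E_sl2 (?V Kinv_sl2 u) i = 0" using c[OF c[OF u]] by simp
    then have "?V K_sl2 (?V E_sl2 (?V Kinv_sl2 u)) i =
      weight q \<epsilon> n i * inverse (weight q \<epsilon> n (Suc i)) * (\<epsilon> * qint q (n - i) * u (Suc i))"
      using C u0 by (simp add: V_operator_coord)
    also have "weight q \<epsilon> n i * inverse (weight q \<epsilon> n (Suc i)) = q\<^sup>2"
      using weight_nz[of "Suc i"] weight_Suc[OF q_nz, of \<epsilon> n i] by simp
    finally show "?V K_sl2 (?V E_sl2 (?V Kinv_sl2 u)) i = q\<^sup>2 * ?V E_sl2 u i"
      using u0 by (simp add: V_operator_coord)
  qed
  have KF: "?V K_sl2 (?V F_sl2 (?V Kinv_sl2 u)) = (\<lambda>i. inverse (q\<^sup>2) * ?V F_sl2 u i)"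
  proof
    fix i
    have z: "\<forall>i>n. ?V F_sl2 (?V Kinv_sl2 u) i = 0" using c[OF c[OF u]] by simp
    show "?V K_sl2 (?V F_sl2 (?V Kinv_sl2 u)) i = inverse (q\<^sup>2) * ?V F_sl2 u i"
    proof (cases i)
      case 0
      then show ?thesis using C u0 z by (simp add: V_operator_coord)
    next
      case (Suc j)
      have "weight q \<epsilon> n (Suc j) * inverse (weight q \<epsilon> n j) = inverse (q\<^sup>2)"
        using weight_nz[of "Suc j"] weight_Suc[OF q_nz, of \<epsilon> n j] q_nz by (simp add: field_simps)
      then show ?thesis using Suc C u0 z by (simp add: V_operator_coord)
    qed
  qed
  have EF: "?V E_sl2 (?V F_sl2 u) = (\<lambda>i. ?V F_sl2 (?V E_sl2 u) i +
      inverse (q - inverse q) * (?V K_sl2 u i - ?V Kinv_sl2 u i))"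
  proof
    fix i
    show "?V E_sl2 (?V F_sl2 u) i = ?V F_sl2 (?V E_sl2 u) i +
      inverse (q - inverse q) * (?V K_sl2 u i - ?V Kinv_sl2 u i)"
    proof (cases "i \<le> n")
      case True
      have "?V E_sl2 (?V F_sl2 u) i = \<epsilon> * qint q (n - i) * qint q (Suc i) * u i"
        using C u0 True by (cases "i = n") (simp_all add: V_operator_coord)
      also have "\<dots> = \<epsilon> * qint q i * qint q (Suc (n - i)) * u i +
        inverse (q - inverse q) * (weight q \<epsilon> n i * u i - inverse (weight q \<epsilon> n i) * u i)"
        unfolding qint_commutator[OF q_nz q_inv eps True] by (simp add: algebra_simps)
      also have "\<epsilon> * qint q i * qint q (Suc (n - i)) * u i = ?V F_sl2 (?V E_sl2 u) i"
        using C u0 True by (cases i) (simp_all add: V_operator_coord Suc_diff_Suc)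
      finally show ?thesis using u0 by (simp add: V_operator_coord)
    next
      case False
      then show ?thesis using c[OF c[OF u]] c[OF u] by simp
    qed
  qed
  have cl: "?V y u \<in> carrier (coord_space n)" "?V y (?V z u) \<in> carrier (coord_space n)"
    "?V w (?V y (?V z u)) \<in> carrier (coord_space n)" for w y z
    using c u by blast+
  have sm: "(\<lambda>i. a i - b i) \<in> carrier (coord_space n)" "(\<lambda>i. k * a i) \<in> carrier (coord_space n)"
    if "a \<in> carrier (coord_space n)" "b \<in> carrier (coord_space n)" for a b and k :: 'k using that by simp_all
  show ?thesis
    using r u cl sm unfolding sl2_relations_unfolded
    by (elim insertE emptyE)
      (simp_all add: ops.free_action_simps coord_space_minus KK KE KF EF del: coord_space_simps(1), simp_all add: coord_space_minus KK KE KF EF)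
qed

lemma V_facts:
  shows "left_module (Uq q) (V_module q \<epsilon> n)"
    and "u \<in> carrier (coord_space n) \<Longrightarrow> pres (sl2_relations q) p \<odot>\<^bsub>V_module q \<epsilon> n\<^esub> u =
      free_action (coord_space n) (V_operator q \<epsilon> n) p u"
    and "carrier (V_module q \<epsilon> n) = carrier (coord_space n)"
    and "add (V_module q \<epsilon> n) = add (coord_space n)"
    and "\<zero>\<^bsub>V_module q \<epsilon> n\<^esub> = \<zero>\<^bsub>coord_space n\<^esub>"
  unfolding V_module_def
  by (rule ops.module_of_operators[of "sl2_relations q"]; simp only: sl2_relations_hold)+

lemma V_module: "left_module (Uq q) (V_module q \<epsilon> n)" by (rule V_facts(1))

lemma V_simps [simp]:
  "carrier (V_module q \<epsilon> n) = {u. \<forall>i>n. u i = 0}" "u \<oplus>\<^bsub>V_module q \<epsilon> n\<^esub> w = (\<lambda>i. u i + w i)"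
  "\<zero>\<^bsub>V_module q \<epsilon> n\<^esub> = (\<lambda>_. 0)"
  using V_facts(3-5) by simp_all

lemma V_action:
  assumes "\<forall>i>n. u i = 0"
  shows "pres (sl2_relations q) (var y) \<odot>\<^bsub>V_module q \<epsilon> n\<^esub> u = V_operator q \<epsilon> n y u"
    and "pres (sl2_relations q) (const c) \<odot>\<^bsub>V_module q \<epsilon> n\<^esub> u = (\<lambda>i. c * u i)"
  using assms by (simp_all add: V_facts(2) ops.free_action_simps)

lemma sl2_module: "sl2_module q (V_module q \<epsilon> n)"
  by (intro sl2_module.intro pres_module.intro V_module)

end

text \<open>A tensor product \<open>V\<^sub>\<epsilon>\<^sub>,\<^sub>n \<otimes> N\<close> is a direct sum of \<open>n + 1\<close> copies of \<open>N\<close>; \<open>\<kappa> m i\<close> is the component of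
  \<open>m\<close> along \<open>v\<^sub>i\<close>. The locale describes the action of \<open>U\<^sub>g\<^sub>,\<^sub>h\<close> in these coordinates, from which the
  later arguments proceed without reference to cosets.\<close>

locale gh_coords = M: pres_module "gh_relations q" M + N: laurent_module N
  for q \<epsilon> :: "'k::field" and n :: nat and N :: "('k laurent, 'n) module"
    and M :: "((gh_gen, 'k) free_alg set, 'm) module" and \<kappa> :: "'m \<Rightarrow> nat \<Rightarrow> 'n" +
  assumes \<kappa>_closed [simp]: "m \<in> carrier M \<Longrightarrow> \<kappa> m i \<in> carrier N"
    and \<kappa>_add: "\<lbrakk>m \<in> carrier M; m' \<in> carrier M\<rbrakk> \<Longrightarrow> \<kappa> (m \<oplus>\<^bsub>M\<^esub> m') i = \<kappa> m i \<oplus>\<^bsub>N\<^esub> \<kappa> m' i"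
    and \<kappa>_scal: "m \<in> carrier M \<Longrightarrow> \<kappa> (M.act (const c) m) i = Poly_Mapping.single 0 c \<odot>\<^bsub>N\<^esub> \<kappa> m i"
    and \<kappa>_above: "\<lbrakk>m \<in> carrier M; i > n\<rbrakk> \<Longrightarrow> \<kappa> m i = \<zero>\<^bsub>N\<^esub>"
    and \<kappa>_inj: "\<lbrakk>m \<in> carrier M; m' \<in> carrier M; \<And>i. i \<le> n \<Longrightarrow> \<kappa> m i = \<kappa> m' i\<rbrakk> \<Longrightarrow> m = m'"
    and \<kappa>_surj: "(\<And>i. i \<le> n \<Longrightarrow> f i \<in> carrier N) \<Longrightarrow> \<exists>m\<in>carrier M. \<forall>i\<le>n. \<kappa> m i = f i"
    and \<kappa>_E: "m \<in> carrier M \<Longrightarrow> \<kappa> (M.act (var E_gh) m) i =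
      Poly_Mapping.single 0 (\<epsilon> * qint q (n - i)) \<odot>\<^bsub>N\<^esub> N.L 1 0 (\<kappa> m (Suc i))"
    and \<kappa>_F0: "m \<in> carrier M \<Longrightarrow> \<kappa> (M.act (var F_gh) m) 0 = \<zero>\<^bsub>N\<^esub>"
    and \<kappa>_F: "\<lbrakk>m \<in> carrier M; i < n\<rbrakk> \<Longrightarrow> \<kappa> (M.act (var F_gh) m) (Suc i) =
      Poly_Mapping.single 0 (qint q (Suc i)) \<odot>\<^bsub>N\<^esub> \<kappa> m i"
    and \<kappa>_K: "m \<in> carrier M \<Longrightarrow> \<kappa> (M.act (var K_gh) m) i =
      Poly_Mapping.single 0 (weight q \<epsilon> n i) \<odot>\<^bsub>N\<^esub> N.L 1 0 (\<kappa> m i)"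
    and \<kappa>_g: "m \<in> carrier M \<Longrightarrow> \<kappa> (M.act (var g_gh) m) i = N.L 1 0 (\<kappa> m i)"
    and \<kappa>_h: "m \<in> carrier M \<Longrightarrow> \<kappa> (M.act (var h_gh) m) i = N.L 0 1 (\<kappa> m i)"

lemma linear_comp: "\<lbrakk>linear_map U V f; linear_map V W g\<rbrakk> \<Longrightarrow> linear_map U W (\<lambda>x. g (f x))"
  by (auto simp: linear_map_def Pi_iff)

lemma linear_finsum:
  assumes V: "vec V" and W: "vec W" and T: "linear_map V W T"
    and A: "finite A" and f: "\<And>x. x \<in> A \<Longrightarrow> f x \<in> carrier V"
  shows "T (\<Oplus>\<^bsub>V\<^esub>x\<in>A. f x) = (\<Oplus>\<^bsub>W\<^esub>x\<in>A. T (f x))"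
proof -
  interpret V: vec V by fact
  interpret W: vec W by fact
  note L = linear_mapD[OF T]
  show ?thesis using A f
  proof (induction A rule: finite_induct)
    case empty
    show ?case using linear_map_zero[OF V W T] by simp
  next
    case (insert x F)
    have "f x \<in> carrier V" "f \<in> F \<rightarrow> carrier V" "(\<lambda>x. T (f x)) \<in> F \<rightarrow> carrier W" "T (f x) \<in> carrier W"
      using insert.prems L by auto
    then show ?case using insert by (simp add: L V.M.finsum_insert W.M.finsum_insert)
  qed
qed

lemma linear_finsum_map:
  assumes W: "vec W" and A: "finite A" and f: "\<And>i. i \<in> A \<Longrightarrow> linear_map V W (f i)"
  shows "linear_map V W (\<lambda>x. \<Oplus>\<^bsub>W\<^esub>i\<in>A. f i x)"
proof -
  interpret W: vec W by fact
  note L = linear_mapD[OF f]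
  show ?thesis
    unfolding linear_map_def
  proof (intro conjI ballI allI Pi_I)
    fix x c assume x: "x \<in> carrier V"
    show "(\<Oplus>\<^bsub>W\<^esub>i\<in>A. f i x) \<in> carrier W" using x L by (intro W.M.finsum_closed) auto
    have "(\<Oplus>\<^bsub>W\<^esub>i\<in>A. f i (c \<odot>\<^bsub>V\<^esub> x)) = (\<Oplus>\<^bsub>W\<^esub>i\<in>A. c \<odot>\<^bsub>W\<^esub> f i x)"
      using x L by (intro W.M.finsum_cong') auto
    also have "\<dots> = c \<odot>\<^bsub>W\<^esub> (\<Oplus>\<^bsub>W\<^esub>i\<in>A. f i x)"
      using x L A by (intro W.lsmult_finsum[symmetric]) auto
    finally show "(\<Oplus>\<^bsub>W\<^esub>i\<in>A. f i (c \<odot>\<^bsub>V\<^esub> x)) = c \<odot>\<^bsub>W\<^esub> (\<Oplus>\<^bsub>W\<^esub>i\<in>A. f i x)" .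
    fix y assume y: "y \<in> carrier V"
    have "(\<Oplus>\<^bsub>W\<^esub>i\<in>A. f i (x \<oplus>\<^bsub>V\<^esub> y)) = (\<Oplus>\<^bsub>W\<^esub>i\<in>A. f i x \<oplus>\<^bsub>W\<^esub> f i y)"
      using x y L by (intro W.M.finsum_cong') auto
    also have "\<dots> = (\<Oplus>\<^bsub>W\<^esub>i\<in>A. f i x) \<oplus>\<^bsub>W\<^esub> (\<Oplus>\<^bsub>W\<^esub>i\<in>A. f i y)"
      using x y L by (intro W.M.finsum_addf) auto
    finally show "(\<Oplus>\<^bsub>W\<^esub>i\<in>A. f i (x \<oplus>\<^bsub>V\<^esub> y)) = (\<Oplus>\<^bsub>W\<^esub>i\<in>A. f i x) \<oplus>\<^bsub>W\<^esub> (\<Oplus>\<^bsub>W\<^esub>i\<in>A. f i y)" .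
  qed
qed

locale gh_V = uq_params q \<epsilon> n + N: laurent_module N
  for q \<epsilon> :: "'k::field" and n :: nat and N :: "('k laurent, 'n) module"
begin

sublocale gt: gh_tensor q "V_module q \<epsilon> n" N
  by (intro gh_tensor.intro sl2_module N.laurent_module_axioms)

text \<open>The linear map \<open>v \<otimes> z \<mapsto> v\<^sub>i z\<close>.\<close>

definition coord :: "((nat \<Rightarrow> 'k) \<times> 'n \<Rightarrow>\<^sub>0 'k) set \<Rightarrow> nat \<Rightarrow> 'n" where
  "coord C i = gt.tlift gt.N0 (\<lambda>v z. Poly_Mapping.single 0 (v i) \<odot>\<^bsub>N\<^esub> z) C"

lemma coord_linear: "linear_map gt.T gt.N0 (\<lambda>C. coord C i)"
  and coord_ten: "\<lbrakk>\<forall>i>n. v i = 0; z \<in> carrier N\<rbrakk> \<Longrightarrow> coord (gt.ten v z) i = Poly_Mapping.single 0 (v i) \<odot>\<^bsub>N\<^esub> z"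
proof -
  let ?B = "\<lambda>v z. Poly_Mapping.single 0 (v i) \<odot>\<^bsub>N\<^esub> z"
  have l: "linear_map gt.V0 gt.N0 (\<lambda>v. ?B v z)" if "z \<in> carrier gt.N0" for z
    using that N.vs.vclosed N.vs.vl_distr N.vs.vassoc by (auto simp: linear_map_def V_action)
  have r: "linear_map gt.N0 gt.N0 (?B v)" for v
    using N.vs.vclosed N.vs.vr_distr N.vs.vassoc by (auto simp: linear_map_def mult.commute)
  show "linear_map gt.T gt.N0 (\<lambda>C. coord C i)"
    unfolding coord_def[abs_def] by (rule gt.tensor_universal(1)[OF N.vs.vec_axioms]) (rule l r, assumption?)+
  show "coord (gt.ten v z) i = Poly_Mapping.single 0 (v i) \<odot>\<^bsub>N\<^esub> z" if "\<forall>i>n. v i = 0" "z \<in> carrier N"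
    unfolding coord_def
    by (rule gt.tensor_universal(2)[OF N.vs.vec_axioms, of ?B]) (use that l r in simp_all)
qed

lemma basis_vec_closed: "i \<le> n \<Longrightarrow> \<forall>j>n. basis_vec i j = 0"
  by (simp add: basis_vec_def)

lemma ten_basis_closed: "\<lbrakk>i \<le> n; z \<in> carrier N\<rbrakk> \<Longrightarrow> gt.ten (basis_vec i) z \<in> carrier gt.T"
  by (intro gt.ten_closed) (simp_all add: basis_vec_closed)

lemma linear_ten: "\<forall>i>n. v i = 0 \<Longrightarrow> linear_map gt.N0 gt.T (gt.ten v)"
  using gt.ten_bilinear[of v] by (auto simp: linear_map_def)

lemma ten_expand:
  assumes v: "\<forall>i>n. v i = 0" and z: "z \<in> carrier N"
  shows "gt.ten v z = (\<Oplus>\<^bsub>gt.T\<^esub>i\<in>{..n}. gt.ten (basis_vec i) (Poly_Mapping.single 0 (v i) \<odot>\<^bsub>N\<^esub> z))"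
proof -
  have zc: "Poly_Mapping.single 0 (v i) \<odot>\<^bsub>N\<^esub> z \<in> carrier N" for i using z N.vs.vclosed by simp
  have "(\<Oplus>\<^bsub>gt.T\<^esub>i\<in>{..<m}. gt.ten (basis_vec i) (Poly_Mapping.single 0 (v i) \<odot>\<^bsub>N\<^esub> z)) =
    gt.ten (\<lambda>j. if j < m then v j else 0) z" if "m \<le> Suc n" for m
    using that
  proof (induction m)
    case 0
    have "gt.ten (\<lambda>_. 0) z = \<zero>\<^bsub>gt.T\<^esub>"
      using gt.ten_bilinear(3)[of "\<lambda>_. 0" z 0] z gt.T.vzero[OF gt.ten_closed[of "\<lambda>_. 0" z]]
      by (simp add: V_action)
    then show ?case by simp
  next
    case (Suc m)
    have eq: "(\<lambda>j. if j < Suc m then v j else 0) =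
      (\<lambda>j. v m * basis_vec m j) \<oplus>\<^bsub>gt.V0\<^esub> (\<lambda>j. if j < m then v j else 0)"
      by (auto simp: basis_vec_def fun_eq_iff less_Suc_eq)
    have "gt.ten (\<lambda>j. v m * basis_vec m j) z = gt.ten (basis_vec m) (Poly_Mapping.single 0 (v m) \<odot>\<^bsub>N\<^esub> z)"
      using gt.ten_bilinear(3)[of "basis_vec m" z "v m"] gt.ten_bilinear(4)[of "basis_vec m" z "v m"] z Suc.prems
      by (simp add: V_action basis_vec_closed)
    then have "gt.ten (\<lambda>j. if j < Suc m then v j else 0) z =
      gt.ten (basis_vec m) (Poly_Mapping.single 0 (v m) \<odot>\<^bsub>N\<^esub> z) \<oplus>\<^bsub>gt.T\<^esub> gt.ten (\<lambda>j. if j < m then v j else 0) z"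
      unfolding eq using Suc.prems z by (subst gt.ten_bilinear(1)) (auto simp: basis_vec_def)
    then show ?case
      using Suc zc ten_basis_closed by (subst lessThan_Suc, subst gt.T.M.finsum_insert) auto
  qed
  from this[of "Suc n"] have "(\<Oplus>\<^bsub>gt.T\<^esub>i\<in>{..n}. gt.ten (basis_vec i) (Poly_Mapping.single 0 (v i) \<odot>\<^bsub>N\<^esub> z)) =
    gt.ten (\<lambda>j. if j < Suc n then v j else 0) z" by (simp add: lessThan_Suc_atMost)
  moreover have "(\<lambda>j. if j < Suc n then v j else 0) = v" using v by (auto simp: fun_eq_iff)
  ultimately show ?thesis by simp
qed

lemma coord_closed [simp]: "C \<in> carrier gt.T \<Longrightarrow> coord C i \<in> carrier N"
  using linear_mapD(1)[OF coord_linear] by simp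

lemma coord_expand:
  assumes C: "C \<in> carrier gt.T"
  shows "C = (\<Oplus>\<^bsub>gt.T\<^esub>i\<in>{..n}. gt.ten (basis_vec i) (coord C i))"
proof (rule gt.tensor_linear_eq[OF gt.T.vec_axioms _ _ _ C])
  show "linear_map gt.T gt.T (\<lambda>C. C)" by (simp add: linear_map_def)
  show "linear_map gt.T gt.T (\<lambda>C. \<Oplus>\<^bsub>gt.T\<^esub>i\<in>{..n}. gt.ten (basis_vec i) (coord C i))"
    by (intro linear_finsum_map[OF gt.T.vec_axioms] linear_comp[OF coord_linear linear_ten])
      (auto simp: basis_vec_def)
  fix v z assume v: "v \<in> carrier gt.V0" and z: "z \<in> carrier gt.N0"
  then show "gt.ten v z = (\<Oplus>\<^bsub>gt.T\<^esub>i\<in>{..n}. gt.ten (basis_vec i) (coord (gt.ten v z) i))"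
    by (simp add: coord_ten) (rule ten_expand, simp_all)
qed

lemma coord_surj:
  assumes f: "\<And>i. i \<le> n \<Longrightarrow> f i \<in> carrier N"
  shows "(\<Oplus>\<^bsub>gt.T\<^esub>i\<in>{..n}. gt.ten (basis_vec i) (f i)) \<in> carrier gt.T" (is ?A)
    and "j \<le> n \<Longrightarrow> coord (\<Oplus>\<^bsub>gt.T\<^esub>i\<in>{..n}. gt.ten (basis_vec i) (f i)) j = f j"
proof -
  show ?A using f by (intro gt.T.M.finsum_closed) (auto intro: ten_basis_closed)
  assume j: "j \<le> n"
  have "coord (\<Oplus>\<^bsub>gt.T\<^esub>i\<in>{..n}. gt.ten (basis_vec i) (f i)) j =
    (\<Oplus>\<^bsub>gt.N0\<^esub>i\<in>{..n}. coord (gt.ten (basis_vec i) (f i)) j)"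
    using f by (intro linear_finsum[OF gt.T.vec_axioms N.vs.vec_axioms coord_linear]) (auto intro: ten_basis_closed)
  also have "\<dots> = (\<Oplus>\<^bsub>gt.N0\<^esub>i\<in>{..n}. if j = i then f i else \<zero>\<^bsub>gt.N0\<^esub>)"
    using f N.vs.vzero N.vs.vone N.M.zero_closed
    by (intro N.vs.M.finsum_cong') (auto simp: coord_ten basis_vec_closed, auto simp: basis_vec_def)
  also have "\<dots> = f j"
    using f j by (intro N.vs.M.add.finprod_singleton) auto
  finally show "coord (\<Oplus>\<^bsub>gt.T\<^esub>i\<in>{..n}. gt.ten (basis_vec i) (f i)) j = f j" .
qed

lemma coord_operator:
  assumes C: "C \<in> carrier gt.T" and f: "linear_map gt.T gt.T f" and g: "linear_map gt.N0 gt.N0 G"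
    and eq: "\<And>v z. \<lbrakk>\<forall>i>n. v i = 0; z \<in> carrier N\<rbrakk> \<Longrightarrow>
      coord (f (gt.ten v z)) i = G (Poly_Mapping.single 0 (v j) \<odot>\<^bsub>N\<^esub> z)"
  shows "coord (f C) i = G (coord C j)"
  by (rule gt.tensor_linear_eq[OF N.vs.vec_axioms linear_comp[OF f coord_linear]
        linear_comp[OF coord_linear g] _ C])
    (simp add: eq coord_ten)

lemma gh_coords: "gh_coords q \<epsilon> n N (tensor_module q (V_module q \<epsilon> n) N) coord"
proof (intro gh_coords.intro pres_module.intro gt.tensor_module N.laurent_module_axioms
    gh_coords_axioms.intro; (unfold gt.carrier_tensor_module)?)
  let ?s = "\<lambda>c z. Poly_Mapping.single 0 c \<odot>\<^bsub>N\<^esub> z"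
  note L = linear_mapD[OF coord_linear]
  note vz = N.vs.vclosed N.vs.vzero N.vs.vr_null
  have s_lin: "linear_map gt.N0 gt.N0 (?s c)" for c
    using N.vs.vclosed N.vs.vr_distr N.vs.vassoc by (auto simp: linear_map_def mult.commute)
  have zero_lin: "linear_map gt.N0 gt.N0 (\<lambda>_. \<zero>\<^bsub>N\<^esub>)"
    using N.vs.vr_null N.vs.M.zero_closed by (auto simp: linear_map_def)
  have sL: "?s c (N.L i j z) = N.L i j (?s c z)" if "z \<in> carrier N" for c i j z
    using linear_mapD(3)[OF N.linear_L, of z] that by simp
  have ss: "?s a (?s b z) = ?s (a * b) z" if "z \<in> carrier N" for a b z
    using N.vs.vassoc[of z a b] that by simp
  have sc: "?s c z \<in> carrier N" if "z \<in> carrier N" for c z using that N.vs.vclosed by simp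
  have Vc: "\<forall>i>n. V_operator q \<epsilon> n y v i = 0" if "\<forall>i>n. v i = 0" for y v
    using linear_mapD(1)[OF V_linear, of v] that by simp
  fix m assume m: "m \<in> carrier gt.T"
  fix i
  show "coord m i \<in> carrier N" using m by simp
  show "coord (m \<oplus>\<^bsub>tensor_module q (V_module q \<epsilon> n) N\<^esub> m') i = coord m i \<oplus>\<^bsub>N\<^esub> coord m' i"
    if "m' \<in> carrier gt.T" for m' using L m that by simp
  show "coord (pres (gh_relations q) (const c) \<odot>\<^bsub>tensor_module q (V_module q \<epsilon> n) N\<^esub> m) i = ?s c (coord m i)"
    for c using L m by (simp add: gt.tensor_module_action)
  show "coord m i = \<zero>\<^bsub>N\<^esub>" if "i > n"
    using coord_operator[OF m gt.linear_id(1) zero_lin, of i] that vz by (simp add: coord_ten)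
  show "m = m'" if "m' \<in> carrier gt.T" "\<And>i. i \<le> n \<Longrightarrow> coord m i = coord m' i" for m'
  proof -
    have "(\<Oplus>\<^bsub>gt.T\<^esub>i\<in>{..n}. gt.ten (basis_vec i) (coord m i)) =
      (\<Oplus>\<^bsub>gt.T\<^esub>i\<in>{..n}. gt.ten (basis_vec i) (coord m' i))"
      using that by (intro gt.T.M.finsum_cong') (auto intro: ten_basis_closed)
    then show ?thesis using coord_expand[OF m] coord_expand[OF that(1)] by simp
  qed
  show "coord (pres (gh_relations q) (var E_gh) \<odot>\<^bsub>tensor_module q (V_module q \<epsilon> n) N\<^esub> m) i =
    ?s (\<epsilon> * qint q (n - i)) (N.L 1 0 (coord m (Suc i)))"
    unfolding gt.tensor_module_action(1)[OF m]
    by (rule coord_operator[OF m gt.linear_operator linear_comp[OF N.linear_L s_lin]])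
      (simp add: gt.operator_ten V_action coord_ten Vc sc sL ss, simp add: V_operator_coord)
  show "coord (pres (gh_relations q) (var K_gh) \<odot>\<^bsub>tensor_module q (V_module q \<epsilon> n) N\<^esub> m) i =
    ?s (weight q \<epsilon> n i) (N.L 1 0 (coord m i))"
    unfolding gt.tensor_module_action(1)[OF m]
    by (rule coord_operator[OF m gt.linear_operator linear_comp[OF N.linear_L s_lin]])
      (simp add: gt.operator_ten V_action coord_ten Vc sc sL ss, simp add: V_operator_coord)
  show "coord (pres (gh_relations q) (var F_gh) \<odot>\<^bsub>tensor_module q (V_module q \<epsilon> n) N\<^esub> m) 0 = \<zero>\<^bsub>N\<^esub>"
    unfolding gt.tensor_module_action(1)[OF m]
    by (rule coord_operator[OF m gt.linear_operator zero_lin])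
      (use vz in \<open>simp add: gt.operator_ten V_action coord_ten Vc, simp add: V_operator_coord\<close>)
  show "coord (pres (gh_relations q) (var F_gh) \<odot>\<^bsub>tensor_module q (V_module q \<epsilon> n) N\<^esub> m) (Suc i) =
    ?s (qint q (Suc i)) (coord m i)" if "i < n"
    unfolding gt.tensor_module_action(1)[OF m]
    by (rule coord_operator[OF m gt.linear_operator s_lin])
      (use that in \<open>simp add: gt.operator_ten V_action coord_ten Vc sc ss, simp add: V_operator_coord\<close>)
  show "coord (pres (gh_relations q) (var g_gh) \<odot>\<^bsub>tensor_module q (V_module q \<epsilon> n) N\<^esub> m) i = N.L 1 0 (coord m i)"
    "coord (pres (gh_relations q) (var h_gh) \<odot>\<^bsub>tensor_module q (V_module q \<epsilon> n) N\<^esub> m) i = N.L 0 1 (coord m i)"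
    unfolding gt.tensor_module_action(1)[OF m]
    by (rule coord_operator[OF m gt.linear_operator N.linear_L],
        simp add: gt.operator_ten V_action coord_ten Vc sc sL ss)+
next
  fix f assume "\<And>i. i \<le> n \<Longrightarrow> f i \<in> carrier N"
  then show "\<exists>m\<in>carrier gt.T. \<forall>i\<le>n. coord m i = f i"
    using coord_surj by (intro bexI[of _ "\<Oplus>\<^bsub>gt.T\<^esub>i\<in>{..n}. gt.ten (basis_vec i) (f i)"]) auto
qed

end

text \<open>On a pure tensor both sides are \<open>v\<^sub>i f(z)\<close>: thus \<open>id \<otimes> f\<close> is, in coordinates, \<open>f\<close> applied to every
  component.\<close>

lemma coord_tensor_map:
  assumes N1: "gh_V q \<epsilon> N1" and N2: "gh_V q \<epsilon> N2"
    and f: "linear_map (vspace monoid_algebra N1) (vspace monoid_algebra N2) f"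
    and C: "C \<in> carrier (tensor_module q (V_module q \<epsilon> n) N1)"
  defines "t \<equiv> tensor_map (vspace (Uq q) (V_module q \<epsilon> n)) (vspace Laurent N2) id f"
  shows "t C \<in> carrier (tensor_module q (V_module q \<epsilon> n) N2)"
    and "gh_V.coord N2 (t C) i = f (gh_V.coord N1 C i)"
    and "linear_map (vspace (Ugh q) (tensor_module q (V_module q \<epsilon> n) N1))
       (vspace (Ugh q) (tensor_module q (V_module q \<epsilon> n) N2)) t"
proof -
  interpret A: gh_V q \<epsilon> n N1 by fact
  interpret B: gh_V q \<epsilon> n N2 by fact
  have id: "linear_map A.gt.V0 B.gt.V0 id" by (simp add: linear_map_def)
  note t = tensor_map[OF A.gt.tensor_axioms B.gt.tensor_axioms id f, folded t_def]
  have C': "C \<in> carrier A.gt.T" using C by simp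
  show "t C \<in> carrier (tensor_module q (V_module q \<epsilon> n) N2)"
    using linear_mapD(1)[OF t(1) C'] by simp
  show "B.coord (t C) i = f (A.coord C i)"
  proof (rule A.gt.tensor_linear_eq[OF B.N.vs.vec_axioms linear_comp[OF t(1) B.coord_linear]
        linear_comp[OF A.coord_linear f] _ C'])
    fix v z assume "v \<in> carrier A.gt.V0" "z \<in> carrier A.gt.N0"
    then show "B.coord (t (A.gt.ten v z)) i = f (A.coord (A.gt.ten v z) i)"
      using linear_mapD[OF f] by (simp add: t(2) A.coord_ten B.coord_ten)
  qed
  show "linear_map (vspace (Ugh q) (tensor_module q (V_module q \<epsilon> n) N1))
       (vspace (Ugh q) (tensor_module q (V_module q \<epsilon> n) N2)) t"
    using linear_mapD[OF t(1)] by (auto simp: linear_map_def A.gt.tensor_module_action B.gt.tensor_module_action)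
qed

section \<open>Highest weight vectors\<close>

locale gh_module = pres_module "gh_relations q" X
  for q :: "'k::field" and X :: "((gh_gen, 'k) free_alg set, 'x) module"
begin

abbreviation "E \<equiv> act (var E_gh)"
abbreviation "F \<equiv> act (var F_gh)"
abbreviation "K \<equiv> act (var K_gh)"
abbreviation "Ki \<equiv> act (var Kinv_gh)"
abbreviation "g \<equiv> act (var g_gh)"
abbreviation "gi \<equiv> act (var ginv_gh)"
abbreviation "h \<equiv> act (var h_gh)"
abbreviation "hi \<equiv> act (var hinv_gh)"
abbreviation sc :: "'k \<Rightarrow> 'x \<Rightarrow> 'x" where "sc c \<equiv> act (const c)"

lemma sc_simps:
  assumes "x \<in> carrier X"
  shows "sc a (sc b x) = sc (a * b) x" "sc 1 x = x" "sc 0 x = \<zero>\<^bsub>X\<^esub>"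
    and "sc (a + b) x = sc a x \<oplus>\<^bsub>X\<^esub> sc b x" and "sc (a - b) x = sc a x \<ominus>\<^bsub>X\<^esub> sc b x"
    and "sc (- a) x = \<ominus>\<^bsub>X\<^esub> sc a x"
proof -
  show "sc a (sc b x) = sc (a * b) x" "sc 1 x = x" "sc 0 x = \<zero>\<^bsub>X\<^esub>"
    "sc (a + b) x = sc a x \<oplus>\<^bsub>X\<^esub> sc b x"
    using assms vs.vassoc[of x a b] vs.vone[of x] vs.vzero[of x] vs.vl_distr[of x a b] by simp_all
  have "const (a - b) = const a - (const b :: (gh_gen, 'k) free_alg)"
    by (simp add: const_def single_diff)
  then show "sc (a - b) x = sc a x \<ominus>\<^bsub>X\<^esub> sc b x" using assms by (simp add: act_diff)
  have "sc (-1) (sc a x) = \<ominus>\<^bsub>X\<^esub> sc a x"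
    using vs.vneg[of "sc a x"] assms vs.M.minus_equality[of _ "sc a x"]
    by (metis M.add.inv_closed M.l_neg act_closed presented_scal vspace_simps)
  then show "sc (- a) x = \<ominus>\<^bsub>X\<^esub> sc a x"
    using vs.vassoc[of x "-1" a] assms by simp
qed

lemma var_sc: "x \<in> carrier X \<Longrightarrow> act (var i) (sc c x) = sc c (act (var i) x)"
  by (rule act_const_commute)

lemma act_zero_vec [simp]: "act p \<zero>\<^bsub>X\<^esub> = \<zero>\<^bsub>X\<^esub>"
  using lsmult_r_null by simp

lemma act_minus: "\<lbrakk>x \<in> carrier X; y \<in> carrier X\<rbrakk> \<Longrightarrow> act p (x \<ominus>\<^bsub>X\<^esub> y) = act p x \<ominus>\<^bsub>X\<^esub> act p y"
  using lsmult_r_diff by simp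

lemma gh_rels:
  assumes x: "x \<in> carrier X"
  shows "K (Ki x) = x" "Ki (K x) = x" "g (gi x) = x" "gi (g x) = x" "h (hi x) = x" "hi (h x) = x"
    and "g (h x) = h (g x)" "g (E x) = E (g x)" "g (F x) = F (g x)" "g (K x) = K (g x)"
    and "h (E x) = E (h x)" "h (F x) = F (h x)" "h (K x) = K (h x)"
    and "K (E (Ki x)) = sc (q\<^sup>2) (E x)" "K (F (Ki x)) = sc (inverse (q\<^sup>2)) (F x)"
    and "E (F x) = F (E x) \<oplus>\<^bsub>X\<^esub> sc (inverse (q - inverse q)) (K x \<ominus>\<^bsub>X\<^esub> Ki (g (g x)))"
proof -
  let ?S = "gh_relations q"
  have r: "var K_gh * var Kinv_gh - 1 \<in> ?S" "var Kinv_gh * var K_gh - 1 \<in> ?S"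
    "var g_gh * var ginv_gh - 1 \<in> ?S" "var ginv_gh * var g_gh - 1 \<in> ?S"
    "var h_gh * var hinv_gh - 1 \<in> ?S" "var hinv_gh * var h_gh - 1 \<in> ?S"
    "var g_gh * var h_gh - var h_gh * var g_gh \<in> ?S"
    "var g_gh * var E_gh - var E_gh * var g_gh \<in> ?S" "var g_gh * var F_gh - var F_gh * var g_gh \<in> ?S"
    "var g_gh * var K_gh - var K_gh * var g_gh \<in> ?S"
    "var h_gh * var E_gh - var E_gh * var h_gh \<in> ?S" "var h_gh * var F_gh - var F_gh * var h_gh \<in> ?S"
    "var h_gh * var K_gh - var K_gh * var h_gh \<in> ?S"
    "var K_gh * var E_gh * var Kinv_gh - const (q\<^sup>2) * var E_gh \<in> ?S"
    "var K_gh * var F_gh * var Kinv_gh - const (inverse (q\<^sup>2)) * var F_gh \<in> ?S"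
    "var E_gh * var F_gh - (var F_gh * var E_gh + const (inverse (q - inverse q)) * (var K_gh - var Kinv_gh * (var g_gh)\<^sup>2)) \<in> ?S"
    by (simp_all only: gh_relations_unfolded diff_diff_eq[symmetric] insert_iff simp_thms)
  note R = r[THEN act_relation, OF x]
  show "K (Ki x) = x" "Ki (K x) = x" "g (gi x) = x" "gi (g x) = x" "h (hi x) = x" "hi (h x) = x"
    "g (h x) = h (g x)" "g (E x) = E (g x)" "g (F x) = F (g x)" "g (K x) = K (g x)"
    "h (E x) = E (h x)" "h (F x) = F (h x)" "h (K x) = K (h x)"
    "K (E (Ki x)) = sc (q\<^sup>2) (E x)" "K (F (Ki x)) = sc (inverse (q\<^sup>2)) (F x)"
    "E (F x) = F (E x) \<oplus>\<^bsub>X\<^esub> sc (inverse (q - inverse q)) (K x \<ominus>\<^bsub>X\<^esub> Ki (g (g x)))"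
    using R x by (simp_all add: act_mult act_add act_diff power2_eq_square)
qed

lemma KE: "x \<in> carrier X \<Longrightarrow> K (E x) = sc (q\<^sup>2) (E (K x))"
  using gh_rels(14)[of "K x"] gh_rels(2)[of x] by simp

lemma KF: "x \<in> carrier X \<Longrightarrow> K (F x) = sc (inverse (q\<^sup>2)) (F (K x))"
  using gh_rels(15)[of "K x"] gh_rels(2)[of x] by simp

lemma generated: "generated_by (Ugh q) (generator (gh_relations q)) {E_gh, F_gh, K_gh, g_gh, h_gh}"
proof (rule generated_by_generators)
  fix x :: gh_gen assume "x \<notin> {E_gh, F_gh, K_gh, g_gh, h_gh}"
  then show "\<exists>y\<in>{E_gh, F_gh, K_gh, g_gh, h_gh}. var y * var x - 1 \<in> gh_relations q \<and> var x * var y - 1 \<in> gh_relations q"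
    by (cases x) (simp_all add: gh_relations_unfolded)
qed

abbreviation Fpow :: "nat \<Rightarrow> 'x \<Rightarrow> 'x" where "Fpow k x \<equiv> act (var F_gh ^ k) x"

lemma Fpow_Suc: "x \<in> carrier X \<Longrightarrow> Fpow (Suc k) x = F (Fpow k x)"
  by (simp add: act_mult)

lemma g_Fpow: "x \<in> carrier X \<Longrightarrow> g (Fpow k x) = Fpow k (g x)"
  by (induction k) (simp_all add: Fpow_Suc gh_rels del: power_Suc)

lemma h_Fpow: "x \<in> carrier X \<Longrightarrow> h (Fpow k x) = Fpow k (h x)"
  by (induction k) (simp_all add: Fpow_Suc gh_rels del: power_Suc)

end

text \<open>The coefficients that occur when \<open>E\<close> is moved past a power of \<open>F\<close>: on a vector \<open>x\<close> with
  \<open>E x = 0\<close> and \<open>K x = \<epsilon> q\<^sup>n g x + c y\<close>, the number \<open>comA k\<close> is the coefficient of \<open>g F\<^sup>k\<^sup>-\<^sup>1 x\<close> in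
  \<open>E F\<^sup>k x\<close>, and \<open>c * comB k\<close> that of \<open>F\<^sup>k\<^sup>-\<^sup>1 y\<close>.\<close>

definition comA :: "'k::field \<Rightarrow> 'k \<Rightarrow> nat \<Rightarrow> nat \<Rightarrow> 'k" where
  "comA q \<epsilon> n k = (\<Sum>j<k. inverse (q - inverse q) * (weight q \<epsilon> n j - inverse (weight q \<epsilon> n j)))"

definition comB :: "'k::field \<Rightarrow> 'k \<Rightarrow> nat \<Rightarrow> nat \<Rightarrow> 'k" where
  "comB q \<epsilon> n k = (\<Sum>j<k. inverse (q - inverse q) *
     (inverse (q\<^sup>2) ^ j + inverse (q\<^sup>2) ^ j / (weight q \<epsilon> n j)\<^sup>2))"

locale gh_rep = gh_module q X + uq_params q \<epsilon> n
  for q \<epsilon> :: "'k::field" and n :: nat and X :: "((gh_gen, 'k) free_alg set, 'x) module"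
begin

abbreviation "wt \<equiv> weight q \<epsilon> n"

lemma comA_closed: "k \<le> n \<Longrightarrow> comA q \<epsilon> n (Suc k) = \<epsilon> * qint q (n - k) * qint q (Suc k)"
proof (induction k)
  case 0
  then show ?case using qint_commutator[OF q_nz q_inv eps, of 0 n] by (simp add: comA_def)
next
  case (Suc k)
  then show ?case using qint_commutator[OF q_nz q_inv eps, of "Suc k" n]
    by (simp add: comA_def Suc_diff_Suc mult_ac)
qed

text \<open>Both formulas follow by induction on \<open>k\<close>: passing one \<open>F\<close> multiplies the weight by \<open>q\<^sup>-\<^sup>2\<close> and adds one
  commutator \<open>E F - F E\<close>, whose value is known from the action of \<open>K\<close>.\<close>

lemma string:
  assumes x: "x \<in> carrier X" and y: "y \<in> carrier X"
    and Ex: "E x = \<zero>\<^bsub>X\<^esub>" and Kx: "K x = sc (wt 0) (g x) \<oplus>\<^bsub>X\<^esub> sc c y"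
    and Ky: "K y = sc (wt 0) (g y)"
  shows "K (Fpow k x) = sc (wt k) (g (Fpow k x)) \<oplus>\<^bsub>X\<^esub> sc (c * inverse (q\<^sup>2) ^ k) (Fpow k y)"
    and "E (Fpow (Suc k) x) = sc (comA q \<epsilon> n (Suc k)) (g (Fpow k x)) \<oplus>\<^bsub>X\<^esub> sc (c * comB q \<epsilon> n (Suc k)) (Fpow k y)"
proof -
  have wS: "inverse (q\<^sup>2) * wt k = wt (Suc k)" for k
    using weight_Suc[OF q_nz, of \<epsilon> n k] q_nz by simp
  have Ky': "K (Fpow k y) = sc (wt k) (g (Fpow k y))" for k
  proof (induction k)
    case (Suc k)
    have "K (Fpow (Suc k) y) = sc (inverse (q\<^sup>2)) (F (sc (wt k) (g (Fpow k y))))"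
      using y by (simp add: Fpow_Suc KF Suc del: power_Suc)
    also have "\<dots> = sc (wt (Suc k)) (g (Fpow (Suc k) y))"
      using y by (simp add: var_sc sc_simps wS gh_rels Fpow_Suc del: power_Suc)
    finally show ?case .
  qed (use y Ky in simp)
  have Kx': "K (Fpow k x) = sc (wt k) (g (Fpow k x)) \<oplus>\<^bsub>X\<^esub> sc (c * inverse (q\<^sup>2) ^ k) (Fpow k y)" for k
  proof (induction k)
    case (Suc k)
    have "K (Fpow (Suc k) x) = sc (inverse (q\<^sup>2)) (F (sc (wt k) (g (Fpow k x)) \<oplus>\<^bsub>X\<^esub> sc (c * inverse (q\<^sup>2) ^ k) (Fpow k y)))"
      using x by (simp add: Fpow_Suc KF Suc del: power_Suc)
    also have "\<dots> = sc (inverse (q\<^sup>2) * wt k) (g (Fpow (Suc k) x)) \<oplus>\<^bsub>X\<^esub> sc (inverse (q\<^sup>2) * (c * inverse (q\<^sup>2) ^ k)) (Fpow (Suc k) y)"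
      using x y by (simp add: act_linear var_sc sc_simps gh_rels Fpow_Suc del: power_Suc)
    also have "inverse (q\<^sup>2) * (c * inverse (q\<^sup>2) ^ k) = c * inverse (q\<^sup>2) ^ Suc k" by simp
    finally show ?case by (simp only: wS)
  qed (use x y Kx in simp)
  show "K (Fpow k x) = sc (wt k) (g (Fpow k x)) \<oplus>\<^bsub>X\<^esub> sc (c * inverse (q\<^sup>2) ^ k) (Fpow k y)" by (rule Kx')
  let ?d = "inverse (q - inverse q)"
  \<comment> \<open>Applying \<open>K\<^sup>-\<^sup>1\<close> to the formula for \<open>K g F\<^sup>k x\<close> yields \<open>K\<^sup>-\<^sup>1 g\<^sup>2 F\<^sup>k x\<close>.\<close>
  have Ki: "Ki (g (g (Fpow k x))) = sc (inverse (wt k)) (g (Fpow k x)) \<ominus>\<^bsub>X\<^esub>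
      sc (c * inverse (q\<^sup>2) ^ k / (wt k)\<^sup>2) (Fpow k y)" for k
  proof -
    define z u e where "z = Fpow k x" and "u = Fpow k y" and "e = c * inverse (q\<^sup>2) ^ k"
    have zu: "z \<in> carrier X" "u \<in> carrier X" using x y by (simp_all add: z_def u_def)
    have "u = sc (wt k) (Ki (g u))"
      using Ky'[of k, folded u_def] zu gh_rels(2)[of u] var_sc[of "g u" Kinv_gh "wt k"] by simp
    then have ku: "Ki (g u) = sc (inverse (wt k)) u"
      using weight_nz[of k] zu sc_simps(1)[of "Ki (g u)" "inverse (wt k)" "wt k"] sc_simps(2)[of "Ki (g u)"] by simp
    have "g z = Ki (g (K z))" using zu by (simp add: gh_rels)
    also have "\<dots> = sc (wt k) (Ki (g (g z))) \<oplus>\<^bsub>X\<^esub> sc e (Ki (g u))"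
      using zu unfolding z_def u_def e_def Kx'[of k] by (simp add: act_linear var_sc)
    finally have gz: "g z = sc (wt k) (Ki (g (g z))) \<oplus>\<^bsub>X\<^esub> sc e (Ki (g u))" .
    have "sc (inverse (wt k)) (g z) = Ki (g (g z)) \<oplus>\<^bsub>X\<^esub> sc (e / (wt k)\<^sup>2) u"
      using zu weight_nz[of k] by (subst gz) (simp add: act_linear sc_simps ku power2_eq_square divide_inverse mult_ac)
    then show ?thesis
      using zu unfolding z_def[symmetric] u_def[symmetric] e_def[symmetric]
      by (simp add: M.minus_eq M.a_assoc M.r_neg)
  qed
  have step: "E (Fpow (Suc k) x) = sc (comA q \<epsilon> n (Suc k)) (g (Fpow k x)) \<oplus>\<^bsub>X\<^esub> sc (c * comB q \<epsilon> n (Suc k)) (Fpow k y)"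
    if "F (E (Fpow k x)) = sc (comA q \<epsilon> n k) (g (Fpow k x)) \<oplus>\<^bsub>X\<^esub> sc (c * comB q \<epsilon> n k) (Fpow k y)" for k
  proof -
    define z u e where "z = g (Fpow k x)" and "u = Fpow k y" and "e = c * inverse (q\<^sup>2) ^ k"
    have zu: "z \<in> carrier X" "u \<in> carrier X" using x y by (simp_all add: z_def u_def)
    define a b a' b' where "a = comA q \<epsilon> n k" and "b = c * comB q \<epsilon> n k"
      and "a' = ?d * (wt k - inverse (wt k))" and "b' = ?d * (e + e / (wt k)\<^sup>2)"
    have "E (Fpow (Suc k) x) = F (E (Fpow k x)) \<oplus>\<^bsub>X\<^esub>
      sc ?d (K (Fpow k x) \<ominus>\<^bsub>X\<^esub> Ki (g (g (Fpow k x))))"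
      using x by (simp add: Fpow_Suc gh_rels del: power_Suc)
    also have "K (Fpow k x) \<ominus>\<^bsub>X\<^esub> Ki (g (g (Fpow k x))) = sc (wt k - inverse (wt k)) z \<oplus>\<^bsub>X\<^esub> sc (e + e / (wt k)\<^sup>2) u"
      using zu unfolding Kx' Ki unfolding z_def[symmetric] u_def[symmetric] e_def[symmetric]
      by (simp add: sc_simps M.minus_eq M.minus_add M.a_ac)
    also have "sc ?d \<dots> = sc a' z \<oplus>\<^bsub>X\<^esub> sc b' u"
      using zu unfolding a'_def b'_def by (simp add: act_linear sc_simps(1))
    also have "F (E (Fpow k x)) = sc a z \<oplus>\<^bsub>X\<^esub> sc b u" unfolding that a_def b_def z_def u_def ..
    also have "sc a z \<oplus>\<^bsub>X\<^esub> sc b u \<oplus>\<^bsub>X\<^esub> (sc a' z \<oplus>\<^bsub>X\<^esub> sc b' u) = sc (a + a') z \<oplus>\<^bsub>X\<^esub> sc (b + b') u"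
      using zu by (simp add: sc_simps M.a_ac)
    also have "a + a' = comA q \<epsilon> n (Suc k)" by (simp add: a_def a'_def comA_def)
    also have "b + b' = c * comB q \<epsilon> n (Suc k)" by (simp add: b_def b'_def e_def comB_def algebra_simps)
    finally show ?thesis by (simp only: z_def u_def)
  qed
  show "E (Fpow (Suc k) x) = sc (comA q \<epsilon> n (Suc k)) (g (Fpow k x)) \<oplus>\<^bsub>X\<^esub> sc (c * comB q \<epsilon> n (Suc k)) (Fpow k y)"
  proof (induction k)
    case 0
    show ?case by (rule step) (use x y Ex in \<open>simp add: comA_def comB_def sc_simps\<close>)
  next
    case (Suc k)
    show ?case
      by (rule step, subst Suc) (use x y in \<open>simp add: act_linear var_sc gh_rels Fpow_Suc del: power_Suc\<close>)
  qed
qed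

end

subsection \<open>Central elements\<close>

text \<open>The Casimir element of \<open>U\<^sub>g\<^sub>,\<^sub>h\<close>. It is written in the free algebra, for it is applied to elements of
  modules only.\<close>

definition casimir :: "'k::field \<Rightarrow> (gh_gen, 'k) free_alg" where
  "casimir q = (let d = inverse (q - inverse q) in var F_gh * var E_gh + const (d * d * q) * var K_gh +
     const (d * d * inverse q) * (var Kinv_gh * (var g_gh * var g_gh)))"

context gh_module
begin

lemma commuting_hom:
  assumes "\<And>v x. \<lbrakk>v \<in> {E_gh, F_gh, K_gh, g_gh, h_gh}; x \<in> carrier X\<rbrakk> \<Longrightarrow> act p (act (var v) x) = act (var v) (act p x)"
  shows "module_hom (Ugh q) X X (act p)"
  by (rule module_hom_generators[OF kalg_presented_algebra generated left_module_axioms left_module_axioms])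
    (use assms in \<open>auto simp: generator_pres act_linear act_const_commute\<close>)

lemma g_hom: "module_hom (Ugh q) X X g" and h_hom: "module_hom (Ugh q) X X h"
  by (rule commuting_hom; auto simp: gh_rels)+

text \<open>Passing \<open>E\<close> or \<open>F\<close> multiplies \<open>K\<close> and \<open>K\<^sup>-\<^sup>1 g\<^sup>2\<close> by powers of \<open>q\<^sup>2\<close>; the coefficients are those for which
  the changes cancel the commutator of \<open>E\<close> and \<open>F\<close>.\<close>

lemma casimir_hom:
  assumes q: "q \<noteq> 0" "q - inverse q \<noteq> 0"
  shows "module_hom (Ugh q) X X (act (casimir q))"
proof (rule commuting_hom)
  define d where "d = inverse (q - inverse q)"
  define k1 k2 where "k1 = d * d * q" and "k2 = d * d * inverse q"
  have dq: "d * (q - inverse q) = 1" using q by (simp add: d_def)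
  have coeff: "d * q\<^sup>2 + k1 = k1 * q\<^sup>2" "k2 = d * inverse (q\<^sup>2) + k2 * inverse (q\<^sup>2)"
    "k1 = d + k1 * inverse (q\<^sup>2)" "d + k2 = k2 * q\<^sup>2"
  proof -
    have "k1 * q\<^sup>2 - k1 = d * q\<^sup>2 * (d * (q - inverse q))" "k1 - k1 * inverse (q\<^sup>2) = d * (d * (q - inverse q))"
      "k2 - k2 * inverse (q\<^sup>2) = d * inverse (q\<^sup>2) * (d * (q - inverse q))" "k2 * q\<^sup>2 - k2 = d * (d * (q - inverse q))"
      using q(1) by (simp_all add: k1_def k2_def field_simps power2_eq_square)
    then show "d * q\<^sup>2 + k1 = k1 * q\<^sup>2" "k2 = d * inverse (q\<^sup>2) + k2 * inverse (q\<^sup>2)"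
      "k1 = d + k1 * inverse (q\<^sup>2)" "d + k2 = k2 * q\<^sup>2"
      unfolding dq by (simp_all add: algebra_simps)
  qed
  have cas: "act (casimir q) x = F (E x) \<oplus>\<^bsub>X\<^esub> (sc k1 (K x) \<oplus>\<^bsub>X\<^esub> sc k2 (Ki (g (g x))))" if "x \<in> carrier X" for x
    using that by (simp add: casimir_def Let_def act_add act_mult k1_def k2_def d_def M.a_assoc)
  have Kq: "Ki (E x) = sc (inverse (q\<^sup>2)) (E (Ki x))" "Ki (F x) = sc (q\<^sup>2) (F (Ki x))" if "x \<in> carrier X" for x
  proof -
    have "E (Ki x) = Ki (K (E (Ki x)))" "F (Ki x) = Ki (K (F (Ki x)))"
      using that gh_rels(2)[of "E (Ki x)"] gh_rels(2)[of "F (Ki x)"] by simp_all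
    then have "E (Ki x) = sc (q\<^sup>2) (Ki (E x))" "F (Ki x) = sc (inverse (q\<^sup>2)) (Ki (F x))"
      using that by (simp_all add: gh_rels(14,15) var_sc)
    then show "Ki (E x) = sc (inverse (q\<^sup>2)) (E (Ki x))" "Ki (F x) = sc (q\<^sup>2) (F (Ki x))"
      using that q(1) by (simp_all add: sc_simps)
  qed
  have EF: "E (F x) = F (E x) \<oplus>\<^bsub>X\<^esub> (sc d (K x) \<oplus>\<^bsub>X\<^esub> sc (- d) (Ki (g (g x))))" if "x \<in> carrier X" for x
  proof -
    have "E (F x) = F (E x) \<oplus>\<^bsub>X\<^esub> (sc d (K x) \<ominus>\<^bsub>X\<^esub> sc d (Ki (g (g x))))"
      using that gh_rels(16)[of x] by (simp add: d_def[symmetric] act_minus)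
    then show ?thesis using that by (simp add: sc_simps(6) M.minus_eq)
  qed
  fix v x assume v: "v \<in> {E_gh, F_gh, K_gh, g_gh, h_gh}" and x: "x \<in> carrier X"
  have comb: "y \<oplus>\<^bsub>X\<^esub> (sc a u \<oplus>\<^bsub>X\<^esub> sc b w) \<oplus>\<^bsub>X\<^esub> (sc a' u \<oplus>\<^bsub>X\<^esub> sc b' w) = y \<oplus>\<^bsub>X\<^esub> (sc (a + a') u \<oplus>\<^bsub>X\<^esub> sc (b + b') w)"
    if "y \<in> carrier X" "u \<in> carrier X" "w \<in> carrier X" for y u w a b a' b'
    using that by (simp add: sc_simps(4) M.a_ac)
  from v consider "v = E_gh" | "v = F_gh" | "v = K_gh" | "v = g_gh" | "v = h_gh" by blast
  then show "act (casimir q) (act (var v) x) = act (var v) (act (casimir q) x)"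
  proof cases
    case 1
    have "E (act (casimir q) x) = F (E (E x)) \<oplus>\<^bsub>X\<^esub> (sc (d * q\<^sup>2) (E (K x)) \<oplus>\<^bsub>X\<^esub> sc (- d * inverse (q\<^sup>2)) (E (Ki (g (g x)))))
      \<oplus>\<^bsub>X\<^esub> (sc k1 (E (K x)) \<oplus>\<^bsub>X\<^esub> sc k2 (E (Ki (g (g x)))))"
      using x by (simp add: cas act_linear EF KE Kq gh_rels(8) var_sc sc_simps(1))
    also have "\<dots> = F (E (E x)) \<oplus>\<^bsub>X\<^esub> (sc (d * q\<^sup>2 + k1) (E (K x)) \<oplus>\<^bsub>X\<^esub> sc (- d * inverse (q\<^sup>2) + k2) (E (Ki (g (g x)))))"
      using x by (intro comb) simp_all
    also have "- d * inverse (q\<^sup>2) + k2 = k2 * inverse (q\<^sup>2)" by (subst coeff(2)) simp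
    also have "F (E (E x)) \<oplus>\<^bsub>X\<^esub> (sc (d * q\<^sup>2 + k1) (E (K x)) \<oplus>\<^bsub>X\<^esub> sc (k2 * inverse (q\<^sup>2)) (E (Ki (g (g x))))) = act (casimir q) (E x)"
      using x by (simp add: cas KE Kq gh_rels(8) sc_simps(1) coeff(1))
    finally show ?thesis using 1 by simp
  next
    case 2
    have "act (casimir q) (F x) = F (F (E x)) \<oplus>\<^bsub>X\<^esub> (sc d (F (K x)) \<oplus>\<^bsub>X\<^esub> sc (- d) (F (Ki (g (g x)))))
      \<oplus>\<^bsub>X\<^esub> (sc (k1 * inverse (q\<^sup>2)) (F (K x)) \<oplus>\<^bsub>X\<^esub> sc (k2 * q\<^sup>2) (F (Ki (g (g x)))))"
      using x by (simp add: cas act_linear EF KF Kq gh_rels(9) var_sc sc_simps(1))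
    also have "\<dots> = F (F (E x)) \<oplus>\<^bsub>X\<^esub> (sc (d + k1 * inverse (q\<^sup>2)) (F (K x)) \<oplus>\<^bsub>X\<^esub> sc (- d + k2 * q\<^sup>2) (F (Ki (g (g x)))))"
      using x by (intro comb) simp_all
    also have "\<dots> = F (act (casimir q) x)"
      using x coeff(3,4) by (simp add: cas act_linear var_sc flip: coeff(3,4))
    finally show ?thesis using 2 by simp
  next
    case 3
    have "K (F (E x)) = F (E (K x))" using x q(1) by (simp add: KF KE var_sc sc_simps)
    then show ?thesis using 3 x by (simp add: cas act_linear var_sc gh_rels)
  next
    case 4
    have "Ki (g y) = g (Ki y)" if "y \<in> carrier X" for y
      using that gh_rels(10)[of "Ki y"] gh_rels(1)[of y] gh_rels(2)[of "g (Ki y)"] by simp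
    then show ?thesis using 4 x by (simp add: cas act_linear var_sc gh_rels)
  next
    case 5
    have "Ki (h y) = h (Ki y)" if "y \<in> carrier X" for y
      using that gh_rels(13)[of "Ki y"] gh_rels(1)[of y] gh_rels(2)[of "h (Ki y)"] by simp
    then show ?thesis using 5 x by (simp add: cas act_linear var_sc gh_rels)
  qed
qed

text \<open>The vectors on which \<open>p\<close> acts as \<open>c\<close> form a submodule, which contains the generating vector \<open>w\<close>.\<close>

lemma hom_scalar:
  assumes p: "module_hom (Ugh q) X X (act p)" and w: "w \<in> carrier X"
    and span: "module_span (Ugh q) X {w} = carrier X" and pw: "act p w = sc c w" and x: "x \<in> carrier X"
  shows "act p x = sc c x"
proof -
  have "submodule {x \<in> carrier X. act p x = sc c x} (Ugh q) X"
  proof (rule submoduleI)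
    fix a x assume a: "a \<in> carrier (Ugh q)" and x: "x \<in> {x \<in> carrier X. act p x = sc c x}"
    obtain r where r: "a = pres (gh_relations q) r" using a by auto
    show "a \<odot>\<^bsub>X\<^esub> x \<in> {x \<in> carrier X. act p x = sc c x}"
      using x module_homD(3)[OF p a, of x] by (simp add: r act_const_commute)
  qed (auto simp: act_linear)
  then have "module_span (Ugh q) X {w} \<subseteq> {x \<in> carrier X. act p x = sc c x}"
    using w pw by (intro submodule_span(3)[OF left_module_axioms]) auto
  then show ?thesis using x by (auto simp: span)
qed

end

section \<open>The simple modules \<open>V\<^sub>\<epsilon>\<^sub>,\<^sub>n\<^sub>,\<^sub>\<alpha>\<^sub>,\<^sub>\<beta>\<close>\<close>

definition line_space :: "('k::field, 'k) module" where
  "line_space = \<lparr>carrier = UNIV, monoid.mult = undefined, one = undefined, zero = 0, add = (+),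
     smult = (*)\<rparr>"

lemma line_space_simps [simp]:
  "carrier line_space = UNIV" "x \<oplus>\<^bsub>line_space\<^esub> y = x + y" "\<zero>\<^bsub>line_space\<^esub> = 0"
  "c \<odot>\<^bsub>line_space\<^esub> x = c * x"
  by (simp_all add: line_space_def)

lemma vec_line_space: "vec (line_space :: ('k::field, 'k) module)"
  unfolding vec_def
proof (intro left_module.intro left_module_axioms.intro ring_field_ring)
  show "abelian_group (line_space :: ('k, 'k) module)"
    by (rule abelian_groupI) (auto simp: add_ac intro: exI[of _ "- _"])
qed (auto simp: algebra_simps)

lemma finsum_line_space: "finite A \<Longrightarrow> (\<Oplus>\<^bsub>line_space\<^esub>x\<in>A. f x) = (\<Sum>x\<in>A. f x)"
proof -
  interpret vec "line_space :: ('k::field, 'k) module" by (rule vec_line_space)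
  show "finite A \<Longrightarrow> (\<Oplus>\<^bsub>line_space\<^esub>x\<in>A. f x) = (\<Sum>x\<in>A. f x)"
    by (induction A rule: finite_induct) (simp_all add: M.finsum_insert)
qed

lemma K_module_simps [simp]:
  "carrier (K_module \<alpha> \<beta>) = UNIV" "x \<oplus>\<^bsub>K_module \<alpha> \<beta>\<^esub> y = x + y" "\<zero>\<^bsub>K_module \<alpha> \<beta>\<^esub> = 0"
  "Poly_Mapping.single (i, j) c \<odot>\<^bsub>K_module \<alpha> \<beta>\<^esub> x = c * \<alpha> powi i * \<beta> powi j * x"
  by (auto simp: K_module_def)

lemma K_module_single0 [simp]: "Poly_Mapping.single 0 c \<odot>\<^bsub>K_module \<alpha> \<beta>\<^esub> x = c * x"
  unfolding zero_prod_def by simp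

lemma laurent_K_module:
  fixes \<alpha> \<beta> :: "'k::field"
  assumes "\<alpha> \<noteq> 0" "\<beta> \<noteq> 0"
  shows "laurent_module (K_module \<alpha> \<beta>)"
  unfolding laurent_module_def
proof (rule left_module_monoid_algebra[OF vec_line_space, of "\<lambda>(i, j) x. \<alpha> powi i * \<beta> powi j * x"])
  fix k l :: "int \<times> int" and v :: 'k
  show "(case k + l of (i, j) \<Rightarrow> \<lambda>x. \<alpha> powi i * \<beta> powi j * x) v =
    (case k of (i, j) \<Rightarrow> \<lambda>x. \<alpha> powi i * \<beta> powi j * x) ((case l of (i, j) \<Rightarrow> \<lambda>x. \<alpha> powi i * \<beta> powi j * x) v)"
    using assms by (cases k; cases l) (simp add: power_int_add)
next
  fix p :: "'k laurent" and v :: 'k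
  show "p \<odot>\<^bsub>K_module \<alpha> \<beta>\<^esub> v = lin_ext line_space (\<lambda>k. (case k of (i, j) \<Rightarrow> \<lambda>x. \<alpha> powi i * \<beta> powi j * x) v) p"
    by (simp add: K_module_def lin_ext_def finsum_line_space sum_distrib_left split_def mult_ac)
qed (auto simp: linear_map_def zero_prod_def algebra_simps K_module_def fun_eq_iff line_space_def)

lemma submodule_finsum:
  assumes M: "left_module R M" and H: "submodule H R M"
  shows "(\<And>x. x \<in> A \<Longrightarrow> f x \<in> H) \<Longrightarrow> finsum M f A \<in> H"
proof (induction A rule: infinite_finite_induct)
  interpret left_module R M by fact
  note H = submoduleD[OF H]
  {
    case (infinite A)
    then show ?case using H(2) by (simp add: M.finsum_infinite)
  next
    case empty
    then show ?case using H(2) by simp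
  next
    case (insert x A)
    then show ?case using H(1,3) by (subst M.finsum_insert) auto
  }
qed

text \<open>For \<open>N = \<K>\<^sub>\<alpha>\<^sub>,\<^sub>\<beta>\<close> the coordinates are scalars, and \<open>M\<close> is the module \<open>V\<^sub>\<epsilon>\<^sub>,\<^sub>n \<otimes> \<K>\<^sub>\<alpha>\<^sub>,\<^sub>\<beta>\<close>.\<close>

locale gh_std = gh_coords q \<epsilon> n "K_module \<alpha> \<beta>" M \<kappa> + gh_rep q \<epsilon> n M
  for q \<epsilon> :: "'k::field" and n :: nat and \<alpha> \<beta> :: 'k
    and M :: "((gh_gen, 'k) free_alg set, 'm) module" and \<kappa> :: "'m \<Rightarrow> nat \<Rightarrow> 'k" +
  assumes not_root: "k > 0 \<Longrightarrow> q ^ k \<noteq> 1" and \<alpha>_nz: "\<alpha> \<noteq> 0" and \<beta>_nz: "\<beta> \<noteq> 0"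
begin

lemmas \<kappa>_scal' = \<kappa>_scal[simplified]
  and \<kappa>_E' = \<kappa>_E[simplified] and \<kappa>_F' = \<kappa>_F[simplified] and \<kappa>_K' = \<kappa>_K[simplified]
  and \<kappa>_g' = \<kappa>_g[simplified] and \<kappa>_h' = \<kappa>_h[simplified] and \<kappa>_add' = \<kappa>_add[simplified]
  and \<kappa>_above' = \<kappa>_above[simplified]

lemma qint_nz: "k > 0 \<Longrightarrow> qint q k \<noteq> 0"
proof
  assume k: "k > 0" and "qint q k = 0"
  then have "q ^ k = inverse q ^ k" using q_inv by (simp add: qint_def)
  then have "q ^ (k + k) = 1" using q_nz by (simp add: power_add power_inverse field_simps)
  then show False using not_root[of "k + k"] k by simp
qed

lemma eps_nz: "\<epsilon> \<noteq> 0" using eps by auto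

lemma weight_eq_iff: "wt i = wt j \<longleftrightarrow> i = j"
proof -
  have w: "wt k * q ^ (2 * k) = \<epsilon> * q ^ n" for k
  proof (induction k)
    case (Suc k)
    then show ?case using weight_Suc[OF q_nz, of \<epsilon> n k] by (simp add: power2_eq_square algebra_simps)
  qed (simp add: weight_def)
  have "i = j" if eq: "wt i = wt j" and "i \<le> j" for i j
  proof (rule ccontr)
    assume "i \<noteq> j"
    have "wt i * q ^ (2 * i) = wt i * q ^ (2 * j)" using w[of i] w[of j] eq by simp
    then have "q ^ (2 * i) = q ^ (2 * j)" using weight_nz by simp
    moreover have "q ^ (2 * j) = q ^ (2 * i) * q ^ (2 * (j - i))"
      unfolding power_add[symmetric] using \<open>i \<le> j\<close> by (intro arg_cong[of _ _ "\<lambda>k. q ^ k"]) linarith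
    ultimately have "q ^ (2 * (j - i)) = 1" using q_nz by simp
    then show False using not_root[of "2 * (j - i)"] \<open>i \<noteq> j\<close> \<open>i \<le> j\<close> by simp
  qed
  then show ?thesis by (metis nat_le_linear)
qed

lemma weight_neq: "wt i \<noteq> q\<^sup>2 * wt 0"
proof
  assume eq: "wt i = q\<^sup>2 * wt 0"
  have w: "wt k * q ^ (2 * k) = \<epsilon> * q ^ n" for k
  proof (induction k)
    case (Suc k)
    then show ?case using weight_Suc[OF q_nz, of \<epsilon> n k] by (simp add: power2_eq_square algebra_simps)
  qed (simp add: weight_def)
  have "wt 0 * (q ^ (2 * i + 2)) = wt 0" using w[of i] w[of 0] eq by (simp add: power_add power2_eq_square mult_ac)
  then show False using weight_nz[of 0] not_root[of "2 * i + 2"] by simp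
qed

lemma M_nonempty_basis: "\<exists>m\<in>carrier M. \<forall>j. \<kappa> m j = (if j = i then 1 else 0)" if "i \<le> n"
proof -
  obtain m where "m \<in> carrier M" "\<forall>j\<le>n. \<kappa> m j = (if j = i then 1 else 0)"
    using \<kappa>_surj[of "\<lambda>j. if j = i then 1 else 0"] by auto
  then show ?thesis using \<kappa>_above'[of m] that by (intro bexI[of _ m]) (metis not_le, simp)
qed

definition b :: "nat \<Rightarrow> 'm" where
  "b i = (SOME m. m \<in> carrier M \<and> (\<forall>j. \<kappa> m j = (if j = i then 1 else 0)))"

lemma b_props: assumes "i \<le> n" shows "b i \<in> carrier M" "\<kappa> (b i) j = (if j = i then 1 else 0)"
  using someI_ex[of "\<lambda>m. m \<in> carrier M \<and> (\<forall>j. \<kappa> m j = (if j = i then 1 else 0))"]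
    M_nonempty_basis[OF assms] unfolding b_def by blast+

lemma \<kappa>_eqI: "\<lbrakk>m \<in> carrier M; m' \<in> carrier M; \<And>i. i \<le> n \<Longrightarrow> \<kappa> m i = \<kappa> m' i\<rbrakk> \<Longrightarrow> m = m'"
  by (rule \<kappa>_inj)

lemma \<kappa>_zero [simp]: "\<kappa> \<zero>\<^bsub>M\<^esub> i = 0"
  using \<kappa>_scal'[of "\<zero>\<^bsub>M\<^esub>" 0 i] by simp

abbreviation "MV \<equiv> vspace (Ugh q) M"

lemma \<kappa>_linear: "linear_map MV line_space (\<lambda>m. \<kappa> m i)"
  by (auto simp: linear_map_def \<kappa>_add' \<kappa>_scal')

lemma \<kappa>_finsum:
  assumes "finite A" "\<And>x. x \<in> A \<Longrightarrow> f x \<in> carrier M"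
  shows "\<kappa> (\<Oplus>\<^bsub>MV\<^esub>x\<in>A. f x) i = (\<Sum>x\<in>A. \<kappa> (f x) i)"
  using linear_finsum[OF M.vs.vec_axioms vec_line_space \<kappa>_linear, of A f] assms
  by (simp add: finsum_line_space)

lemma combination_closed: "(\<Oplus>\<^bsub>MV\<^esub>i\<in>{..<Suc n}. sc (c i) (b i)) \<in> carrier M"
  using M.vs.M.finsum_closed[of "\<lambda>i. sc (c i) (b i)" "{..<Suc n}"] b_props by auto

lemma \<kappa>_combination:
  assumes "j \<le> n" shows "\<kappa> (\<Oplus>\<^bsub>MV\<^esub>i\<in>{..<Suc n}. sc (c i) (b i)) j = c j"
proof -
  have "\<kappa> (\<Oplus>\<^bsub>MV\<^esub>i\<in>{..<Suc n}. sc (c i) (b i)) j = (\<Sum>i\<in>{..<Suc n}. c i * (if j = i then 1 else 0))"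
    by (subst \<kappa>_finsum) (use b_props in \<open>auto simp: \<kappa>_scal' intro!: sum.cong\<close>)
  also have "\<dots> = (\<Sum>i\<in>{..<Suc n}. if j = i then c i else 0)" by (intro sum.cong) auto
  also have "\<dots> = c j" using assms by (subst sum.delta') auto
  finally show ?thesis .
qed

lemma expand: "m \<in> carrier M \<Longrightarrow> m = (\<Oplus>\<^bsub>MV\<^esub>i\<in>{..<Suc n}. sc (\<kappa> m i) (b i))"
  by (rule \<kappa>_eqI) (simp_all add: combination_closed \<kappa>_combination)

lemma linear_eq:
  assumes U: "vec U" and f: "linear_map MV U f" and f': "linear_map MV U f'"
    and eq: "\<And>i. i \<le> n \<Longrightarrow> f (b i) = f' (b i)" and m: "m \<in> carrier M"
  shows "f m = f' m"
proof -
  interpret U: vec U by fact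
  have bc: "sc (\<kappa> m i) (b i) \<in> carrier MV" if "i \<in> {..<Suc n}" for i using that b_props by simp
  have ex: "f0 m = (\<Oplus>\<^bsub>U\<^esub>i\<in>{..<Suc n}. \<kappa> m i \<odot>\<^bsub>U\<^esub> f0 (b i))" if f0: "linear_map MV U f0" for f0
  proof -
    have "f0 m = (\<Oplus>\<^bsub>U\<^esub>i\<in>{..<Suc n}. f0 (sc (\<kappa> m i) (b i)))"
      by (subst expand[OF m], rule linear_finsum[OF M.vs.vec_axioms U f0 _ bc]) simp_all
    also have "\<dots> = (\<Oplus>\<^bsub>U\<^esub>i\<in>{..<Suc n}. \<kappa> m i \<odot>\<^bsub>U\<^esub> f0 (b i))"
      using linear_mapD[OF f0] b_props by (intro U.M.finsum_cong') auto
    finally show ?thesis .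
  qed
  show ?thesis unfolding ex[OF f] ex[OF f']
    using eq linear_mapD(1)[OF f'] b_props by (intro U.M.finsum_cong') auto
qed

definition lin_of :: "('k, 'u) module \<Rightarrow> (nat \<Rightarrow> 'u) \<Rightarrow> 'm \<Rightarrow> 'u" where
  "lin_of U u m = (\<Oplus>\<^bsub>U\<^esub>i\<in>{..<Suc n}. \<kappa> m i \<odot>\<^bsub>U\<^esub> u i)"

lemma lin_of:
  assumes U: "vec U" and u: "\<And>i. i \<le> n \<Longrightarrow> u i \<in> carrier U"
  shows "linear_map MV U (lin_of U u)" "i \<le> n \<Longrightarrow> lin_of U u (b i) = u i"
proof -
  interpret U: vec U by fact
  show "linear_map MV U (lin_of U u)"
    unfolding lin_of_def[abs_def]
    by (rule linear_finsum_map[OF U])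
      (use u in \<open>auto simp: linear_map_def \<kappa>_add' \<kappa>_scal' U.vl_distr U.vassoc\<close>)
  assume i: "i \<le> n"
  have "lin_of U u (b i) = (\<Oplus>\<^bsub>U\<^esub>j\<in>{..<Suc n}. if i = j then u j else \<zero>\<^bsub>U\<^esub>)"
    unfolding lin_of_def using u i by (intro U.M.finsum_cong') (auto simp: b_props)
  also have "\<dots> = u i" using u i by (intro U.M.add.finprod_singleton) auto
  finally show "lin_of U u (b i) = u i" .
qed

lemma basis_action:
  shows "E (b 0) = \<zero>\<^bsub>M\<^esub>" "i < n \<Longrightarrow> E (b (Suc i)) = sc (\<epsilon> * qint q (n - i) * \<alpha>) (b i)"
    and "i < n \<Longrightarrow> F (b i) = sc (qint q (Suc i)) (b (Suc i))" "F (b n) = \<zero>\<^bsub>M\<^esub>"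
    and "i \<le> n \<Longrightarrow> K (b i) = sc (wt i * \<alpha>) (b i)"
    and g_scalar: "m \<in> carrier M \<Longrightarrow> g m = sc \<alpha> m" and h_scalar: "m \<in> carrier M \<Longrightarrow> h m = sc \<beta> m"
proof -
  have F: "\<kappa> (F m) j = (if j = 0 \<or> j > n then 0 else qint q j * \<kappa> m (j - 1))" if "m \<in> carrier M" for m j
    using that \<kappa>_F0[of m] \<kappa>_F'[of m "j - 1"] \<kappa>_above'[of "F m" j] by auto
  show "E (b 0) = \<zero>\<^bsub>M\<^esub>"
    by (rule \<kappa>_eqI) (simp_all add: b_props \<kappa>_E')
  show "E (b (Suc i)) = sc (\<epsilon> * qint q (n - i) * \<alpha>) (b i)" if "i < n"
    using that by (intro \<kappa>_eqI) (auto simp: b_props \<kappa>_E' \<kappa>_scal')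
  show "F (b i) = sc (qint q (Suc i)) (b (Suc i))" if "i < n"
    using that by (intro \<kappa>_eqI) (auto simp: b_props F \<kappa>_scal')
  show "F (b n) = \<zero>\<^bsub>M\<^esub>" by (intro \<kappa>_eqI) (auto simp: b_props F)
  show "K (b i) = sc (wt i * \<alpha>) (b i)" if "i \<le> n"
    using that by (intro \<kappa>_eqI) (auto simp: b_props \<kappa>_K' \<kappa>_scal')
  show "g m = sc \<alpha> m" "h m = sc \<beta> m" if "m \<in> carrier M"
    using that by (auto intro!: \<kappa>_eqI simp: \<kappa>_g' \<kappa>_h' \<kappa>_scal')
qed

subsection \<open>Simplicity and dimension\<close>

text \<open>Applying \<open>E\<close> lowers the largest index of a nonzero coordinate by one, until only a multiple of \<open>b 0\<close> is
  left.\<close>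

lemma submodule_contains_b0:
  assumes H: "submodule H (Ugh q) M" and m: "m \<in> H" "m \<noteq> \<zero>\<^bsub>M\<^esub>"
  shows "b 0 \<in> H"
proof -
  note H = submoduleD[OF H]
  have main: "b 0 \<in> H" if "m \<in> H" "m \<noteq> \<zero>\<^bsub>M\<^esub>" "\<forall>j>k. \<kappa> m j = 0" for k m
    using that
  proof (induction k arbitrary: m)
    case 0
    have mc: "m \<in> carrier M" using 0 H(1) by blast
    have "m = sc (\<kappa> m 0) (b 0)" using 0(3) mc by (intro \<kappa>_eqI) (auto simp: \<kappa>_scal' b_props)
    moreover have "\<kappa> m 0 \<noteq> 0"
    proof
      assume "\<kappa> m 0 = 0"
      then have "\<kappa> m i = 0" for i using 0(3) by (cases "i = 0") auto
      then have "m = \<zero>\<^bsub>M\<^esub>" using mc by (intro \<kappa>_eqI) auto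
      then show False using 0 by simp
    qed
    ultimately have "b 0 = sc (inverse (\<kappa> m 0)) m"
      using sc_simps(1,2)[of "b 0"] b_props by (metis le0 left_inverse)
    then show ?case using H(5)[of "pres (gh_relations q) (const (inverse (\<kappa> m 0)))"] 0 by simp
  next
    case (Suc k)
    have mc: "m \<in> carrier M" using Suc H(1) by blast
    show ?case
    proof (cases "\<kappa> m (Suc k) = 0")
      case True
      have "\<forall>j>k. \<kappa> m j = 0"
      proof (intro allI impI)
        fix j assume "j > k"
        then show "\<kappa> m j = 0" using True Suc(4) by (cases "j = Suc k") auto
      qed
      then show ?thesis using Suc by blast
    next
      case False
      then have kn: "Suc k \<le> n" using \<kappa>_above'[OF mc, of "Suc k"] by (metis not_le)
      have "\<kappa> (E m) k \<noteq> 0" using False kn qint_nz[of "n - k"] mc \<alpha>_nz eps_nz by (simp add: \<kappa>_E')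
      then have "E m \<noteq> \<zero>\<^bsub>M\<^esub>" by auto
      moreover have "E m \<in> H" using H(5) Suc by simp
      moreover have "\<forall>j>k. \<kappa> (E m) j = 0" using Suc mc by (simp add: \<kappa>_E')
      ultimately show ?thesis using Suc by blast
    qed
  qed
  have "m \<in> carrier M" using m H(1) by blast
  then show ?thesis using main[of m n] m \<kappa>_above' by blast
qed

lemma submodule_b0_full:
  assumes H: "submodule H (Ugh q) M" and b0: "b 0 \<in> H"
  shows "H = carrier M"
proof -
  note D = submoduleD[OF H]
  have b: "b i \<in> H" if "i \<le> n" for i
    using that
  proof (induction i)
    case (Suc i)
    have "b (Suc i) = sc (inverse (qint q (Suc i))) (F (b i))"
      using Suc qint_nz[of "Suc i"] by (simp add: basis_action sc_simps b_props)
    then show ?case using Suc D(5) by simp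
  qed (rule b0)
  have VH: "submodule H field_ring MV"
    using D by (intro M.vs.submoduleI) auto
  have "m \<in> H" if "m \<in> carrier M" for m
    by (subst expand[OF that], rule submodule_finsum[OF M.vs.left_module_axioms VH]) (use b D(5) in auto)
  then show ?thesis using D(1) by blast
qed

lemma is_V_gh: "is_V_gh q \<epsilon> n \<alpha> \<beta> M"
proof -
  have b0: "b 0 \<noteq> \<zero>\<^bsub>M\<^esub>" using b_props(2)[of 0 0] by auto
  have simple: "simple_module (Ugh q) M"
    unfolding simple_module_def
  proof (intro conjI allI impI M.left_module_axioms)
    show "carrier M \<noteq> {\<zero>\<^bsub>M\<^esub>}" using b0 b_props(1)[of 0] by auto
    fix H assume H: "submodule H (Ugh q) M"
    show "H = {\<zero>\<^bsub>M\<^esub>} \<or> H = carrier M"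
      using submodule_contains_b0[OF H] submodule_b0_full[OF H] submoduleD(2)[OF H] by blast
  qed
  have dim: "has_dimension MV (n + 1)"
    unfolding has_dimension_def
  proof (intro bexI[of _ b] ballI)
    show "b \<in> {..<n + 1} \<rightarrow> carrier MV" using b_props by auto
    fix m assume "m \<in> carrier MV"
    then have m: "m \<in> carrier M" by simp
    show "\<exists>!c. c \<in> {..<n + 1} \<rightarrow>\<^sub>E UNIV \<and> m = (\<Oplus>\<^bsub>MV\<^esub>i\<in>{..<n + 1}. c i \<odot>\<^bsub>MV\<^esub> b i)"
    proof (rule ex1I[of _ "restrict (\<kappa> m) {..<n + 1}"])
      have "(\<Oplus>\<^bsub>MV\<^esub>i\<in>{..<Suc n}. sc (restrict (\<kappa> m) {..<Suc n} i) (b i)) = (\<Oplus>\<^bsub>MV\<^esub>i\<in>{..<Suc n}. sc (\<kappa> m i) (b i))"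
        using b_props by (intro M.vs.M.finsum_cong') auto
      then show "restrict (\<kappa> m) {..<n + 1} \<in> {..<n + 1} \<rightarrow>\<^sub>E UNIV \<and>
        m = (\<Oplus>\<^bsub>MV\<^esub>i\<in>{..<n + 1}. restrict (\<kappa> m) {..<n + 1} i \<odot>\<^bsub>MV\<^esub> b i)"
        using expand[OF m] by simp
      fix c assume c: "c \<in> {..<n + 1} \<rightarrow>\<^sub>E UNIV \<and> m = (\<Oplus>\<^bsub>MV\<^esub>i\<in>{..<n + 1}. c i \<odot>\<^bsub>MV\<^esub> b i)"
      then have "\<kappa> m j = c j" if "j \<le> n" for j using \<kappa>_combination[OF that, of c] by simp
      then show "c = restrict (\<kappa> m) {..<n + 1}"
        using c by (auto simp: fun_eq_iff PiE_def extensional_def)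
    qed
  qed
  have span: "module_span (Ugh q) M {b 0} = carrier M"
    using submodule_span[OF M.left_module_axioms, of "{b 0}"] b_props(1)[of 0]
    by (intro submodule_b0_full) auto
  have "wt 0 = \<epsilon> * q ^ n" by (simp add: weight_def)
  then have act: "E (b 0) = \<zero>\<^bsub>M\<^esub>" "K (b 0) = sc (\<epsilon> * \<alpha> * q ^ n) (b 0)" "g (b 0) = sc \<alpha> (b 0)" "h (b 0) = sc \<beta> (b 0)"
    by (simp_all add: basis_action b_props mult_ac)
  show ?thesis
    unfolding is_V_gh_def Let_def generator_pres
    using simple dim span act b0 b_props(1)[of 0] by auto
qed

end

subsection \<open>Strings of length \<open>n\<close>\<close>

definition qfact :: "'k::field \<Rightarrow> nat \<Rightarrow> 'k" where
  "qfact q k = (\<Prod>j\<in>{1..k}. qint q j)"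

context gh_rep
begin

text \<open>The divided powers \<open>F\<^sup>i x / [i]!\<close>. For the highest weight vector of a standard module they are the
  basis vectors \<open>b i\<close>.\<close>

definition xs :: "'x \<Rightarrow> nat \<Rightarrow> 'x" where
  "xs x i = sc (inverse (qfact q i)) (Fpow i x)"

lemma xs_closed [simp]: "x \<in> carrier X \<Longrightarrow> xs x i \<in> carrier X"
  by (simp add: xs_def)

lemma xs_action:
  assumes nz: "\<And>k. k > 0 \<Longrightarrow> qint q k \<noteq> 0" and x: "x \<in> carrier X"
    and Ex: "E x = \<zero>\<^bsub>X\<^esub>" and Kx: "K x = sc (wt 0) (g x)" and Fx: "Fpow (Suc n) x = \<zero>\<^bsub>X\<^esub>"
  shows "xs x 0 = x" "F (xs x i) = sc (qint q (Suc i)) (xs x (Suc i))" "F (xs x n) = \<zero>\<^bsub>X\<^esub>"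
    and "E (xs x 0) = \<zero>\<^bsub>X\<^esub>" "i \<le> n \<Longrightarrow> E (xs x (Suc i)) = sc (\<epsilon> * qint q (n - i)) (g (xs x i))"
    and "K (xs x i) = sc (wt i) (g (xs x i))"
proof -
  have q: "qfact q (Suc i) = qint q (Suc i) * qfact q i" for i
    by (simp add: qfact_def mult.commute)
  have qn: "qfact q i \<noteq> 0" for i using nz by (simp add: qfact_def)
  show x0: "xs x 0 = x" using x by (simp add: xs_def qfact_def sc_simps)
  show "F (xs x i) = sc (qint q (Suc i)) (xs x (Suc i))"
  proof -
    have "inverse (qfact q i) = qint q (Suc i) * inverse (qfact q (Suc i))" using nz[of "Suc i"] by (simp add: q)
    then show ?thesis using x by (simp add: xs_def var_sc sc_simps(1) Fpow_Suc del: power_Suc)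
  qed
  show "F (xs x n) = \<zero>\<^bsub>X\<^esub>"
    using x Fx vs.vr_null by (simp add: xs_def var_sc Fpow_Suc[symmetric] del: power_Suc)
  show "E (xs x 0) = \<zero>\<^bsub>X\<^esub>" using Ex by (simp add: x0)
  have z: "sc c \<zero>\<^bsub>X\<^esub> = \<zero>\<^bsub>X\<^esub>" for c by (rule act_zero_vec)
  have Kx': "K x = sc (wt 0) (g x) \<oplus>\<^bsub>X\<^esub> sc 0 \<zero>\<^bsub>X\<^esub>" using x Kx by (simp add: z)
  have K0: "K \<zero>\<^bsub>X\<^esub> = sc (wt 0) (g \<zero>\<^bsub>X\<^esub>)" by simp
  note S = string[OF x M.zero_closed Ex Kx' K0]
  show "K (xs x i) = sc (wt i) (g (xs x i))"
    using S(1)[of i] x by (simp add: xs_def var_sc sc_simps(1) mult.commute)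
  show "E (xs x (Suc i)) = sc (\<epsilon> * qint q (n - i)) (g (xs x i))" if "i \<le> n"
  proof -
    have "E (xs x (Suc i)) = sc (inverse (qfact q (Suc i)) * (\<epsilon> * qint q (n - i) * qint q (Suc i))) (g (Fpow i x))"
      unfolding xs_def using S(2)[of i] x that by (simp add: var_sc sc_simps(1) comA_closed del: power_Suc)
    also have "inverse (qfact q (Suc i)) * (\<epsilon> * qint q (n - i) * qint q (Suc i)) = \<epsilon> * qint q (n - i) * inverse (qfact q i)"
      using nz[of "Suc i"] by (simp add: q)
    finally show ?thesis using x by (simp add: xs_def var_sc sc_simps(1))
  qed
qed

lemma submoduleI_generators:
  assumes H: "H \<subseteq> carrier X" "\<zero>\<^bsub>X\<^esub> \<in> H" "\<And>z w. \<lbrakk>z \<in> H; w \<in> H\<rbrakk> \<Longrightarrow> z \<oplus>\<^bsub>X\<^esub> w \<in> H"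
    "\<And>c z. z \<in> H \<Longrightarrow> sc c z \<in> H" "\<And>y z. z \<in> H \<Longrightarrow> act (var y) z \<in> H"
  shows "submodule H (Ugh q) X"
proof (rule submoduleI[OF H(1-3)])
  have "\<forall>z\<in>H. act p z \<in> H" for p
    by (induction p rule: free_alg_induct) (use H in \<open>auto simp: act_add act_mult subset_iff\<close>)
  then show "a \<odot>\<^bsub>X\<^esub> x \<in> H" if "a \<in> carrier (Ugh q)" "x \<in> H" for a x using that by auto
qed

text \<open>If \<open>F\<^sup>n\<^sup>+\<^sup>1 w\<close> did not vanish, its images under powers of \<open>F\<close> would span a proper submodule: the
  weights of \<open>K\<close> on it differ from the weight of \<open>w\<close>.\<close>

lemma Fpow_Suc_n_zero:
  assumes simple: "simple_module (Ugh q) X" and w: "w \<in> carrier X" "w \<noteq> \<zero>\<^bsub>X\<^esub>"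
    and wt_inj: "\<And>i j. wt i = wt j \<longleftrightarrow> i = j" and nz: "\<alpha> \<noteq> 0" "\<beta> \<noteq> 0"
    and Ew: "E w = \<zero>\<^bsub>X\<^esub>" and Kw: "K w = sc (wt 0) (g w)"
    and gs: "\<And>x. x \<in> carrier X \<Longrightarrow> g x = sc \<alpha> x" and hs: "\<And>x. x \<in> carrier X \<Longrightarrow> h x = sc \<beta> x"
  shows "Fpow (Suc n) w = \<zero>\<^bsub>X\<^esub>"
proof (rule ccontr)
  define y where "y = Fpow (Suc n) w"
  assume "Fpow (Suc n) w \<noteq> \<zero>\<^bsub>X\<^esub>"
  then have y0: "y \<noteq> \<zero>\<^bsub>X\<^esub>" by (simp add: y_def)
  have y: "y \<in> carrier X" using w by (simp add: y_def)
  have Kw': "K w = sc (wt 0) (g w) \<oplus>\<^bsub>X\<^esub> sc 0 \<zero>\<^bsub>X\<^esub>" using w Kw by simp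
  have K0: "K \<zero>\<^bsub>X\<^esub> = sc (wt 0) (g \<zero>\<^bsub>X\<^esub>)" by simp
  note S = string[OF w(1) M.zero_closed Ew Kw' K0]
  have Ky: "K y = sc (wt (Suc n) * \<alpha>) y"
    using S(1)[of "Suc n"] w by (simp add: y_def gs sc_simps(1) del: power_Suc)
  have Ey: "E y = \<zero>\<^bsub>X\<^esub>"
    using S(2)[of n] w comA_closed[of n] by (simp add: y_def sc_simps(3) del: power_Suc)
  have KiF: "Ki (F x) = sc (q\<^sup>2) (F (Ki x))" if "x \<in> carrier X" for x
  proof -
    have "F (Ki x) = Ki (K (F (Ki x)))" using that by (intro gh_rels(2)[symmetric]) simp
    also have "\<dots> = sc (inverse (q\<^sup>2)) (Ki (F x))" using that by (simp add: gh_rels(15) var_sc)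
    finally have "F (Ki x) = sc (inverse (q\<^sup>2)) (Ki (F x))" .
    then show ?thesis using that q_nz by (simp add: sc_simps)
  qed
  have inv: "gi x = sc (inverse \<alpha>) x" "hi x = sc (inverse \<beta>) x" if "x \<in> carrier X" for x
  proof -
    have "x = sc \<alpha> (gi x)" "x = sc \<beta> (hi x)"
      using that gh_rels(3,5)[of x] gs[of "gi x"] hs[of "hi x"] by simp_all
    then show "gi x = sc (inverse \<alpha>) x" "hi x = sc (inverse \<beta>) x"
      using that nz sc_simps(1)[of "gi x" "inverse \<alpha>" \<alpha>] sc_simps(1)[of "hi x" "inverse \<beta>" \<beta>]
        sc_simps(2)[of "gi x"] sc_simps(2)[of "hi x"] by simp_all
  qed
  \<comment> \<open>\<open>H\<close> is the smallest subspace that contains \<open>y\<close> and is stable under \<open>F\<close>.\<close>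
  define cl where "cl S \<longleftrightarrow> S \<subseteq> carrier X \<and> y \<in> S \<and> \<zero>\<^bsub>X\<^esub> \<in> S \<and> (\<forall>a\<in>S. \<forall>b\<in>S. a \<oplus>\<^bsub>X\<^esub> b \<in> S) \<and>
    (\<forall>c. \<forall>a\<in>S. sc c a \<in> S) \<and> (\<forall>a\<in>S. F a \<in> S)" for S
  define H where "H = \<Inter>{S. cl S}"
  have "cl (carrier X)" using y by (simp add: cl_def)
  then have clH: "cl H" unfolding H_def cl_def by blast
  have ind: "H \<subseteq> S" if "cl S" for S using that by (auto simp: H_def)
  have D: "H \<subseteq> carrier X" "y \<in> H" "\<zero>\<^bsub>X\<^esub> \<in> H" "\<And>a b. \<lbrakk>a \<in> H; b \<in> H\<rbrakk> \<Longrightarrow> a \<oplus>\<^bsub>X\<^esub> b \<in> H"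
    "\<And>c a. a \<in> H \<Longrightarrow> sc c a \<in> H" "\<And>a. a \<in> H \<Longrightarrow> F a \<in> H"
    using clH unfolding cl_def by blast+
  have inX: "a \<in> carrier X" if "a \<in> H" for a using D(1) that by blast
  have KH: "K a \<in> H" if "a \<in> H" for a
  proof -
    have "cl {a \<in> H. K a \<in> H}"
      unfolding cl_def using D inX y by (auto simp: Ky act_linear var_sc KF)
    then show ?thesis using ind that by blast
  qed
  have KiH: "Ki a \<in> H" if "a \<in> H" for a
  proof -
    have "y = sc (wt (Suc n) * \<alpha>) (Ki y)"
      using y gh_rels(2)[of y] by (simp add: Ky var_sc)
    then have "sc (inverse (wt (Suc n) * \<alpha>)) y = sc (inverse (wt (Suc n) * \<alpha>)) (sc (wt (Suc n) * \<alpha>) (Ki y))"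
      by (rule arg_cong)
    moreover have "wt (Suc n) * \<alpha> \<noteq> 0" using weight_nz[of "Suc n"] nz by simp
    ultimately have "Ki y = sc (inverse (wt (Suc n) * \<alpha>)) y"
      using y sc_simps(1,2)[of "Ki y"] left_inverse[of "wt (Suc n) * \<alpha>"] by (metis act_closed)
    then have "cl {a \<in> H. Ki a \<in> H}"
      unfolding cl_def using D inX y by (auto simp: act_linear var_sc KiF)
    then show ?thesis using ind that by blast
  qed
  have minusH: "a \<ominus>\<^bsub>X\<^esub> c \<in> H" if "a \<in> H" "c \<in> H" for a c
    using D(4)[OF that(1) D(5)[OF that(2), of "-1"]] sc_simps(6)[of c 1] sc_simps(2)[of c] inX[OF that(2)]
    by (simp add: M.minus_eq)
  have EH: "E a \<in> H" if "a \<in> H" for a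
  proof -
    have "cl {a \<in> H. E a \<in> H}"
      unfolding cl_def using D inX KH KiH minusH by (auto simp: Ey act_linear var_sc gh_rels(16) gs)
    then show ?thesis using ind that by blast
  qed
  have "act (var v) a \<in> H" if "a \<in> H" for v a
    using EH KH KiH D(5,6) inX that by (cases v) (auto simp: gs hs inv)
  then have sub: "submodule H (Ugh q) X"
    using D inX by (intro submoduleI_generators) auto
  then have "H = carrier X"
    using simple D(2) y0 unfolding simple_module_def by blast
  then have wH: "w \<in> H" using w by simp
  \<comment> \<open>Every element of \<open>H\<close> is killed by a product of factors \<open>K - wt k * \<alpha>\<close> with \<open>k > n\<close>.\<close>
  define op where "op k a = K a \<ominus>\<^bsub>X\<^esub> sc (wt k * \<alpha>) a" for k a
  define opl where "opl ks a = foldr op ks a" for ks a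
  have opc: "op k a \<in> carrier X" if "a \<in> carrier X" for k a using that by (simp add: op_def)
  have oplc: "opl ks a \<in> carrier X" if "a \<in> carrier X" for ks a
    using that by (induction ks) (auto simp: opl_def opc)
  have op_act: "op k a = act (var K_gh - const (wt k * \<alpha>)) a" if "a \<in> carrier X" for k a
    using that by (simp add: op_def act_diff)
  have op_lin: "op k (a \<oplus>\<^bsub>X\<^esub> c) = op k a \<oplus>\<^bsub>X\<^esub> op k c" "op k (sc s a) = sc s (op k a)"
    if "a \<in> carrier X" "c \<in> carrier X" for k a c s
    using that by (simp_all add: op_act act_linear act_const_commute[of _ "var K_gh - const (wt k * \<alpha>)"])
  have opl_lin: "opl ks (a \<oplus>\<^bsub>X\<^esub> c) = opl ks a \<oplus>\<^bsub>X\<^esub> opl ks c" "opl ks (sc s a) = sc s (opl ks a)"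
    if "a \<in> carrier X" "c \<in> carrier X" for ks a c s
    using that by (induction ks) (simp_all add: opl_def op_lin oplc[unfolded opl_def])
  have opl0: "opl ks \<zero>\<^bsub>X\<^esub> = \<zero>\<^bsub>X\<^esub>" for ks
    using opl_lin(2)[of "\<zero>\<^bsub>X\<^esub>" "\<zero>\<^bsub>X\<^esub>" ks 0] oplc[of "\<zero>\<^bsub>X\<^esub>" ks] by (simp add: sc_simps(3))
  have op_comm: "op k (op l a) = op l (op k a)" if "a \<in> carrier X" for k l a
  proof -
    have "(var K_gh - const (wt k * \<alpha>)) * (var K_gh - const (wt l * \<alpha>)) =
      (var K_gh - const (wt l * \<alpha>)) * (var K_gh - const (wt k * \<alpha>))"
      using const_commute[of "wt k * \<alpha>" "var K_gh"] const_commute[of "wt l * \<alpha>" "var K_gh"]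
        const_commute[of "wt k * \<alpha>" "const (wt l * \<alpha>)"] by (simp add: algebra_simps)
    then show ?thesis using that opc by (simp add: op_act act_mult[symmetric])
  qed
  have op_opl: "op k (opl ls a) = opl ls (op k a)" if "a \<in> carrier X" for k ls a
    using that by (induction ls) (simp_all add: opl_def op_comm[OF oplc[unfolded opl_def]])
  have opl_comm: "opl ks (opl ls a) = opl ls (opl ks a)" if "a \<in> carrier X" for ks ls a
  proof (induction ks)
    case (Cons k ks)
    have "opl (k # ks) (opl ls a) = op k (opl ls (opl ks a))" using Cons by (simp add: opl_def)
    also have "\<dots> = opl ls (op k (opl ks a))" using that by (simp add: op_opl oplc)
    finally show ?case by (simp add: opl_def)
  qed (simp add: opl_def)
  have opF: "op (Suc k) (F a) = sc (inverse (q\<^sup>2)) (F (op k a))" if "a \<in> carrier X" for k a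
  proof -
    have eq: "wt (Suc k) * \<alpha> = inverse (q\<^sup>2) * (wt k * \<alpha>)" using weight_Suc[OF q_nz, of \<epsilon> n k] q_nz by simp
    show ?thesis
      using that unfolding op_def eq by (simp add: KF act_minus var_sc sc_simps(1))
  qed
  have oplF: "\<exists>c. opl (map Suc ks) (F a) = sc c (F (opl ks a))" if "a \<in> carrier X" for ks a
  proof (induction ks)
    case Nil
    show ?case using that by (intro exI[of _ 1]) (simp add: opl_def sc_simps)
  next
    case (Cons k ks)
    then obtain c where "opl (map Suc ks) (F a) = sc c (F (opl ks a))" by blast
    then have "opl (map Suc (k # ks)) (F a) = sc c (sc (inverse (q\<^sup>2)) (F (opl (k # ks) a)))"
      using that op_lin(2)[of "F (opl ks a)" "F (opl ks a)"] by (simp add: opl_def opF oplc[unfolded opl_def])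
    then show ?case using that oplc by (auto simp: sc_simps(1))
  qed
  let ?S = "{a \<in> carrier X. \<exists>ks. (\<forall>k\<in>set ks. k > n) \<and> opl ks a = \<zero>\<^bsub>X\<^esub>}"
  have "cl ?S"
    unfolding cl_def
  proof (intro conjI ballI allI)
    show "?S \<subseteq> carrier X" by blast
    have "op (Suc n) y = \<zero>\<^bsub>X\<^esub>" using y Ky by (simp add: op_def M.minus_eq M.r_neg)
    then show "y \<in> ?S" using y by (auto simp: opl_def intro!: exI[of _ "[Suc n]"])
    show "\<zero>\<^bsub>X\<^esub> \<in> ?S" using opl0 by (auto intro!: exI[of _ "[]"])
    fix a assume "a \<in> ?S"
    then obtain ks where a: "a \<in> carrier X" and ks: "\<forall>k\<in>set ks. k > n" "opl ks a = \<zero>\<^bsub>X\<^esub>" by blast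
    show "sc c a \<in> ?S" for c using a ks opl_lin(2)[OF a a] by auto
    obtain c where "opl (map Suc ks) (F a) = sc c (F (opl ks a))" using oplF[OF a] by blast
    moreover have "\<forall>k\<in>set (map Suc ks). k > n" using ks(1) by (auto simp: less_Suc_eq)
    ultimately show "F a \<in> ?S" using a ks(2) by (auto intro!: exI[of _ "map Suc ks"])
    fix a' assume "a' \<in> ?S"
    then obtain ls where a': "a' \<in> carrier X" and ls: "\<forall>k\<in>set ls. k > n" "opl ls a' = \<zero>\<^bsub>X\<^esub>" by blast
    have "opl (ks @ ls) (a \<oplus>\<^bsub>X\<^esub> a') = opl ls (opl ks a) \<oplus>\<^bsub>X\<^esub> opl ks (opl ls a')"
      using opl_lin(1)[OF a a', of "ks @ ls"] opl_comm[OF a, of ks ls] by (simp add: opl_def)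
    then have "opl (ks @ ls) (a \<oplus>\<^bsub>X\<^esub> a') = \<zero>\<^bsub>X\<^esub>" using ks ls opl0 by simp
    then show "a \<oplus>\<^bsub>X\<^esub> a' \<in> ?S" using a a' ks ls by (auto intro!: exI[of _ "ks @ ls"])
  qed
  then obtain ks where ks: "\<forall>k\<in>set ks. k > n" "opl ks w = \<zero>\<^bsub>X\<^esub>" using ind wH by blast
  have "\<exists>c. c \<noteq> 0 \<and> opl ks w = sc c w" using ks(1)
  proof (induction ks)
    case Nil
    show ?case using w by (intro exI[of _ 1]) (simp add: opl_def sc_simps)
  next
    case (Cons k ks)
    then obtain c where c: "c \<noteq> 0" "opl ks w = sc c w" by auto
    have "opl (k # ks) w = sc c (op k w)" using c op_lin(2)[OF w(1) w(1)] by (simp add: opl_def)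
    also have "op k w = sc ((wt 0 - wt k) * \<alpha>) w"
      using w by (simp add: op_def Kw gs sc_simps(1,5) left_diff_distrib)
    finally have "opl (k # ks) w = sc (c * ((wt 0 - wt k) * \<alpha>)) w" using w by (simp add: sc_simps(1))
    moreover have "wt 0 - wt k \<noteq> 0" using wt_inj[of 0 k] Cons by auto
    ultimately show ?case using c nz by (intro exI[of _ "c * ((wt 0 - wt k) * \<alpha>)"]) auto
  qed
  then obtain c where c: "c \<noteq> 0" "opl ks w = sc c w" by blast
  then have "w = sc (inverse c) (opl ks w)" using w by (simp add: sc_simps)
  then show False using ks w by simp
qed

end

text \<open>The divided powers of \<open>F\<close> applied to the highest weight vector \<open>w\<close> of \<open>W\<close> obey the formulas for the
  basis \<open>b\<close> of \<open>M\<close>, so that matching them with this basis is a module map. It is injective since every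
  nonzero submodule of \<open>M\<close> contains \<open>b 0\<close>, and surjective since \<open>w\<close> generates \<open>W\<close>.\<close>

lemma (in gh_std) isomorphic_if_is_V_gh:
  assumes W: "is_V_gh q \<epsilon> n \<alpha> \<beta> W"
  shows "isomorphic_modules (Ugh q) M W"
proof -
  have simple: "simple_module (Ugh q) W" using W by (simp add: is_V_gh_def)
  then have Wm: "left_module (Ugh q) W" by (simp add: simple_module_def)
  interpret W: gh_rep q \<epsilon> n W
    by (intro gh_rep.intro gh_module.intro pres_module.intro Wm uq_params_axioms)
  obtain w where w: "w \<in> carrier W" "w \<noteq> \<zero>\<^bsub>W\<^esub>" and span: "module_span (Ugh q) W {w} = carrier W"
    and Ew: "W.E w = \<zero>\<^bsub>W\<^esub>" and Kw: "W.K w = W.sc (\<epsilon> * \<alpha> * q ^ n) w"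
    and gw: "W.g w = W.sc \<alpha> w" and hw: "W.h w = W.sc \<beta> w"
    using W unfolding is_V_gh_def Let_def generator_pres by auto
  note gs = W.hom_scalar[OF W.g_hom w(1) span gw] and hs = W.hom_scalar[OF W.h_hom w(1) span hw]
  have Kw': "W.K w = W.sc (wt 0) (W.g w)"
    using w by (simp add: Kw gw W.sc_simps(1) weight_def mult_ac)
  have Fw: "W.Fpow (Suc n) w = \<zero>\<^bsub>W\<^esub>"
    by (rule W.Fpow_Suc_n_zero[OF simple w weight_eq_iff \<alpha>_nz \<beta>_nz Ew Kw' gs hs])
  note A = W.xs_action[OF qint_nz w(1) Ew Kw' Fw]
  let ?U = "vspace (Ugh q) W" and ?x = "W.xs w"
  have xc: "?x i \<in> carrier ?U" for i using w by simp
  define f where "f = lin_of ?U ?x"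
  have f: "linear_map MV ?U f" and fb: "\<And>i. i \<le> n \<Longrightarrow> f (b i) = ?x i"
    using lin_of[OF W.vs.vec_axioms, of ?x] xc unfolding f_def by auto
  note L = linear_mapD[OF f, simplified]
  have lin: "linear_map MV ?U (\<lambda>m. f (M.act p m))" "linear_map MV ?U (\<lambda>m. W.act p (f m))" for p
    using linear_comp[OF M.linear_act f] linear_comp[OF f W.linear_act] by simp_all
  have comm: "f (M.act (var v) m) = W.act (var v) (f m)"
    if v: "v \<in> {E_gh, F_gh, K_gh, g_gh, h_gh}" and m: "m \<in> carrier M" for v m
  proof (rule linear_eq[OF W.vs.vec_axioms lin _ m])
    fix i assume i: "i \<le> n"
    have f0: "f \<zero>\<^bsub>M\<^esub> = \<zero>\<^bsub>W\<^esub>" using linear_map_zero[OF M.vs.vec_axioms W.vs.vec_axioms f] by simp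
    have wc: "?x i \<in> carrier W" for i using w by simp
    from v consider "v = E_gh" | "v = F_gh" | "v = K_gh" | "v = g_gh" | "v = h_gh" by blast
    then show "f (M.act (var v) (b i)) = W.act (var v) (f (b i))"
    proof cases
      case 1
      show ?thesis
      proof (cases i)
        case 0
        then show ?thesis using 1 fb[of 0] A by (simp add: basis_action f0)
      next
        case (Suc j)
        then show ?thesis using 1 i fb[of "Suc j"] fb[of j] A(5)[of j] wc
          by (simp add: basis_action L(3) b_props gs W.sc_simps(1))
      qed
    next
      case 2
      show ?thesis
      proof (cases "i = n")
        case True
        then show ?thesis using 2 fb[of n] A(3) by (simp add: basis_action f0)
      next
        case False
        then show ?thesis using 2 i fb[of "Suc i"] fb[of i] A(2)[of i] by (simp add: basis_action L(3) b_props)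
      qed
    next
      case 3
      then show ?thesis using i fb[of i] A(6)[of i] wc by (simp add: basis_action L(3) b_props gs W.sc_simps(1))
    next
      case 4
      then show ?thesis using i fb[of i] wc by (simp add: basis_action L(3) b_props gs)
    next
      case 5
      then show ?thesis using i fb[of i] wc by (simp add: basis_action L(3) b_props hs)
    qed
  qed
  have hom: "module_hom (Ugh q) M W f"
    by (rule module_hom_generators[OF kalg_presented_algebra generated M.left_module_axioms Wm])
      (use L comm in \<open>auto simp: generator_pres\<close>)
  note Z = module_hom_zero_minus[OF M.left_module_axioms Wm hom]
  have ker: "submodule {m \<in> carrier M. f m = \<zero>\<^bsub>W\<^esub>} (Ugh q) M"
    by (rule M.submoduleI) (auto simp: L Z module_homD[OF hom] M.lsmult_closed W.lsmult_r_null)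
  have fb0: "f (b 0) = w" using fb[of 0] A(1) by simp
  have inj0: "m = \<zero>\<^bsub>M\<^esub>" if "m \<in> carrier M" "f m = \<zero>\<^bsub>W\<^esub>" for m
  proof (rule ccontr)
    assume "m \<noteq> \<zero>\<^bsub>M\<^esub>"
    then have "b 0 \<in> {m \<in> carrier M. f m = \<zero>\<^bsub>W\<^esub>}" using that by (intro submodule_contains_b0[OF ker, of m]) auto
    then show False using fb0 w by simp
  qed
  have "inj_on f (carrier M)"
  proof (rule inj_onI)
    fix m m' assume m: "m \<in> carrier M" "m' \<in> carrier M" "f m = f m'"
    then have "f (m \<ominus>\<^bsub>M\<^esub> m') = \<zero>\<^bsub>W\<^esub>" using L(1) by (simp add: Z(3) W.diff_eq_zero_iff)
    then have "m \<ominus>\<^bsub>M\<^esub> m' = \<zero>\<^bsub>M\<^esub>" using m inj0 by simp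
    then show "m = m'" using m M.diff_eq_zero_iff by simp
  qed
  moreover have "f ` carrier M = carrier W"
  proof -
    have "submodule (f ` carrier M) (Ugh q) W"
    proof (rule W.submoduleI)
      show "f ` carrier M \<subseteq> carrier W" using L(1) by auto
      show "\<zero>\<^bsub>W\<^esub> \<in> f ` carrier M" using Z(1) by (metis M.M.zero_closed imageI)
      show "x \<oplus>\<^bsub>W\<^esub> y \<in> f ` carrier M" if xy: "x \<in> f ` carrier M" "y \<in> f ` carrier M" for x y
      proof -
        obtain m m' where "m \<in> carrier M" "m' \<in> carrier M" "x = f m" "y = f m'" using xy by blast
        then show ?thesis by (intro image_eqI[of _ _ "m \<oplus>\<^bsub>M\<^esub> m'"]) (simp_all add: L)
      qed
      show "a \<odot>\<^bsub>W\<^esub> x \<in> f ` carrier M" if ax: "a \<in> carrier (Ugh q)" "x \<in> f ` carrier M" for a x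
      proof -
        obtain m where "m \<in> carrier M" "x = f m" using ax by blast
        then show ?thesis using ax(1)
          by (intro image_eqI[of _ _ "a \<odot>\<^bsub>M\<^esub> m"]) (simp_all only: module_homD[OF hom] M.lsmult_closed)
      qed
    qed
    moreover have "{w} \<subseteq> f ` carrier M" using fb0 b_props(1)[of 0] by auto
    ultimately have "module_span (Ugh q) W {w} \<subseteq> f ` carrier M"
      using w by (intro submodule_span(3)[OF Wm]) auto
    then have "carrier W \<subseteq> f ` carrier M" by (simp only: span)
    then show ?thesis using L(1) by auto
  qed
  ultimately show ?thesis
    using hom by (auto simp: isomorphic_modules_def module_iso_def bij_betw_def)
qed

section \<open>Extensions of \<open>V\<^sub>\<epsilon>\<^sub>,\<^sub>n\<^sub>,\<^sub>\<alpha>\<^sub>'\<^sub>,\<^sub>\<beta>\<^sub>'\<close> by \<open>V\<^sub>\<epsilon>\<^sub>,\<^sub>n\<^sub>,\<^sub>\<alpha>\<^sub>,\<^sub>\<beta>\<close>\<close>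

context gh_std
begin

lemma qfact_nz: "qfact q k \<noteq> 0"
  using qint_nz by (simp add: qfact_def)

lemma qfact_Suc: "qfact q (Suc k) = qint q (Suc k) * qfact q k"
  by (simp add: qfact_def mult.commute)

lemma Fpow_b0: "k \<le> n \<Longrightarrow> Fpow k (b 0) = sc (qfact q k) (b k)"
proof (induction k)
  case 0
  then show ?case by (simp add: qfact_def b_props sc_simps)
next
  case (Suc k)
  then show ?case
    by (simp add: Fpow_Suc b_props var_sc basis_action sc_simps(1) qfact_Suc mult.commute del: power_Suc)
qed

lemma Fpow_Suc_n_b0: "Fpow (Suc n) (b 0) = \<zero>\<^bsub>M\<^esub>"
  by (simp add: Fpow_Suc b_props Fpow_b0 var_sc basis_action del: power_Suc)

lemma xs_b0: "i \<le> n \<Longrightarrow> xs (b 0) i = b i"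
  using qfact_nz[of i] by (simp add: xs_def Fpow_b0 sc_simps b_props)

lemma eigenvector_zero:
  assumes m: "m \<in> carrier M" "K m = sc (\<mu> * \<alpha>) m" and \<mu>: "\<And>i. i \<le> n \<Longrightarrow> wt i \<noteq> \<mu>"
  shows "m = \<zero>\<^bsub>M\<^esub>"
proof (rule \<kappa>_eqI)
  fix i assume "i \<le> n"
  have "wt i * \<alpha> * \<kappa> m i = \<mu> * \<alpha> * \<kappa> m i"
    using arg_cong[OF m(2), of "\<lambda>z. \<kappa> z i"] m(1) by (auto simp: \<kappa>_K' \<kappa>_scal')
  then show "\<kappa> m i = \<kappa> \<zero>\<^bsub>M\<^esub> i" using \<alpha>_nz \<mu>[OF \<open>i \<le> n\<close>] by simp
qed (use m in auto)

lemma eigenvector_b0: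
  assumes m: "m \<in> carrier M" "K m = sc (wt 0 * \<alpha>) m"
  shows "m = sc (\<kappa> m 0) (b 0)"
proof (rule \<kappa>_eqI)
  fix i assume "i \<le> n"
  have "wt i * \<alpha> * \<kappa> m i = wt 0 * \<alpha> * \<kappa> m i"
    using arg_cong[OF m(2), of "\<lambda>z. \<kappa> z i"] m(1) by (auto simp: \<kappa>_K' \<kappa>_scal')
  then have "i = 0 \<or> \<kappa> m i = 0" using \<alpha>_nz weight_eq_iff[of i 0] by auto
  then show "\<kappa> m i = \<kappa> (sc (\<kappa> m 0) (b 0)) i" by (auto simp: \<kappa>_scal' b_props)
qed (use m b_props in auto)

text \<open>The number in question is a nonzero multiple of \<open>1 + q\<^sup>-\<^sup>2 + \<dots> + q\<^sup>-\<^sup>2\<^sup>n\<close>, which vanishes only if \<open>q\<close> is a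
  root of unity.\<close>

lemma comB_nz:
  assumes two: "(2::'k) \<noteq> 0"
  shows "comB q \<epsilon> n (Suc n) \<noteq> 0"
proof -
  define r where "r = inverse (q\<^sup>2)"
  have w: "wt k * q ^ (2 * k) = \<epsilon> * q ^ n" for k
  proof (induction k)
    case (Suc k)
    then show ?case using weight_Suc[OF q_nz, of \<epsilon> n k] by (simp add: power2_eq_square algebra_simps)
  qed (simp add: weight_def)
  have rk: "r ^ k * q ^ (2 * k) = 1" for k
    using q_nz by (simp add: r_def power_mult power_inverse)
  have "r ^ j / (wt j)\<^sup>2 = r ^ (n - j)" if "j \<le> n" for j
  proof -
    have "(wt j)\<^sup>2 * (q ^ (2 * j))\<^sup>2 = q ^ (2 * n)"
      using arg_cong[OF w[of j], of "\<lambda>z. z\<^sup>2"] eps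
      by (simp add: power_mult_distrib power2_eq_square[of \<epsilon>] power_mult mult.commute[of 2 n])
    also have "q ^ (2 * n) = q ^ (2 * (n - j)) * q ^ (2 * j)" using that by (simp add: power_add[symmetric] flip: distrib_left)
    finally have "((wt j)\<^sup>2 * q ^ (2 * j) - q ^ (2 * (n - j))) * q ^ (2 * j) = 0"
      by (simp add: algebra_simps power2_eq_square)
    then have e: "(wt j)\<^sup>2 * q ^ (2 * j) = q ^ (2 * (n - j))" using q_nz by simp
    have "r ^ (n - j) * (wt j)\<^sup>2 * q ^ (2 * j) = r ^ j * q ^ (2 * j)"
      using rk[of "n - j"] rk[of j] e by (simp add: mult.assoc)
    then have "r ^ (n - j) * (wt j)\<^sup>2 = r ^ j" using q_nz by simp
    then show ?thesis using weight_nz[of j] by (simp add: field_simps)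
  qed
  then have "comB q \<epsilon> n (Suc n) = inverse (q - inverse q) * ((\<Sum>j<Suc n. r ^ j) + (\<Sum>j<Suc n. r ^ (n - j)))"
    unfolding comB_def r_def[symmetric] by (simp add: sum_distrib_left[symmetric] sum.distrib[symmetric])
  also have "(\<Sum>j<Suc n. r ^ (n - j)) = (\<Sum>j<Suc n. r ^ j)"
    using sum.nat_diff_reindex[of "\<lambda>j. r ^ j" "Suc n"] by simp
  finally have eq: "comB q \<epsilon> n (Suc n) = inverse (q - inverse q) * (2 * (\<Sum>j<Suc n. r ^ j))" by simp
  have "(1 - r) * (\<Sum>j<Suc n. r ^ j) = 1 - r ^ Suc n" by (rule one_diff_power_eq[symmetric])
  moreover have "r ^ Suc n \<noteq> 1"
    using rk[of "Suc n"] not_root[of "2 * Suc n"] by (metis mult_1 nat_0_less_mult_iff zero_less_Suc zero_less_numeral)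
  ultimately have "(\<Sum>j<Suc n. r ^ j) \<noteq> 0" by auto
  then show ?thesis unfolding eq using two q_inv by (simp del: sum.lessThan_Suc)
qed

end

locale gh_pair = M: gh_std q \<epsilon> n \<alpha> \<beta> M \<kappa> + M': gh_std q \<epsilon> n \<alpha>' \<beta>' M' \<kappa>'
  for q \<epsilon> :: "'k::field" and n :: nat and \<alpha> \<beta> and M :: "((gh_gen, 'k) free_alg set, 'm) module" and \<kappa>
    and \<alpha>' \<beta>' and M' :: "((gh_gen, 'k) free_alg set, 'p) module" and \<kappa>' +
  assumes two: "(2::'k) \<noteq> 0"
begin

abbreviation "\<gamma> \<equiv> generator (gh_relations q)"
abbreviation "I \<equiv> {E_gh, F_gh, K_gh, g_gh, h_gh}"

sublocale es: ext_setting "Ugh q" \<gamma> I M' M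
  by (intro ext_setting.intro ext_setting_axioms.intro kalg_presented_algebra M.generated
      M.M.left_module_axioms M'.M.left_module_axioms)

text \<open>\<open>basis_match\<close> is the linear bijection of \<open>M'\<close> with \<open>M\<close> that matches the bases, and \<open>gh_cochain a a2\<close> the
  cocycle of an extension on which \<open>g\<close> and \<open>h\<close> have off-diagonal entries \<open>a\<close> and \<open>a2\<close>. On \<open>E\<close> and \<open>K\<close> it is
  induced by that of \<open>g\<close>, since these act as \<open>E' \<otimes> g\<close> and \<open>K' \<otimes> g\<close>; the factor \<open>1 / \<alpha>'\<close> removes the
  action of \<open>g\<close> on \<open>M'\<close>.\<close>

definition basis_match :: "'p \<Rightarrow> 'm" where
  "basis_match = M'.lin_of (vspace (Ugh q) M) M.b"

definition gh_cochain :: "'k \<Rightarrow> 'k \<Rightarrow> gh_gen \<Rightarrow> 'p \<Rightarrow> 'm" where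
  "gh_cochain a a2 v t = (case v of
     E_gh \<Rightarrow> M.sc (a / \<alpha>') (basis_match (M'.E t)) | K_gh \<Rightarrow> M.sc (a / \<alpha>') (basis_match (M'.K t))
   | g_gh \<Rightarrow> M.sc a (basis_match t) | h_gh \<Rightarrow> M.sc a2 (basis_match t) | _ \<Rightarrow> \<zero>\<^bsub>M\<^esub>)"

lemma basis_match_linear: "linear_map M'.MV M.MV basis_match" and basis_match_b: "i \<le> n \<Longrightarrow> basis_match (M'.b i) = M.b i"
  unfolding basis_match_def using M'.lin_of[OF M.M.vs.vec_axioms, of M.b] M.b_props by auto

lemmas basis_match_simps = linear_mapD[OF basis_match_linear, simplified]

lemma basis_match_coord: "m \<in> carrier M' \<Longrightarrow> \<kappa> (basis_match m) i = \<kappa>' m i"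
proof (rule M'.linear_eq[OF vec_line_space linear_comp[OF basis_match_linear M.\<kappa>_linear] M'.\<kappa>_linear])
  show "\<kappa> (basis_match (M'.b j)) i = \<kappa>' (M'.b j) i" if "j \<le> n" for j
    using that by (simp add: basis_match_b M.b_props M'.b_props)
qed

lemma gh_cochain_closed: "t \<in> carrier M' \<Longrightarrow> gh_cochain a a2 v t \<in> carrier M"
  by (cases v) (auto simp: gh_cochain_def basis_match_simps)

lemma gh_cochain_add: "t \<in> carrier M' \<Longrightarrow> gh_cochain (a + c) (a2 + c2) v t = gh_cochain a a2 v t \<oplus>\<^bsub>M\<^esub> gh_cochain c c2 v t"
  by (cases v) (auto simp: gh_cochain_def basis_match_simps M.sc_simps(4) add_divide_distrib)

lemma gh_cochain_scale: "t \<in> carrier M' \<Longrightarrow> gh_cochain a a2 v (M'.sc c t) = gh_cochain (c * a) (c * a2) v t"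
  by (cases v) (auto simp: gh_cochain_def basis_match_simps M.sc_simps(1) M'.var_sc mult.commute)

lemma gh_cochain_linear: "linear_map M'.MV M.MV (gh_cochain a a2 v)"
proof -
  have "linear_map M'.MV M.MV (\<lambda>t. M.M.act (const c) (basis_match (M'.M.act p t)))" for c p
    using linear_comp[OF linear_comp[OF M'.M.linear_act basis_match_linear] M.M.linear_act] .
  moreover have "linear_map M'.MV M.MV (\<lambda>t. M.sc c (basis_match t))" for c
    using linear_comp[OF basis_match_linear M.M.linear_act] .
  moreover have "linear_map M'.MV M.MV (\<lambda>_. \<zero>\<^bsub>M\<^esub>)"
    by (auto simp: linear_map_def)
  ultimately show ?thesis by (cases v) (simp_all add: gh_cochain_def[abs_def])
qed

end

locale gh_ext = gh_pair q \<epsilon> n \<alpha> \<beta> M \<kappa> \<alpha>' \<beta>' M' \<kappa>'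
  for q \<epsilon> :: "'k::field" and n :: nat and \<alpha> \<beta> and M :: "((gh_gen, 'k) free_alg set, 'm) module" and \<kappa>
    and \<alpha>' \<beta>' and M' :: "((gh_gen, 'k) free_alg set, 'p) module" and \<kappa>' +
  fixes X :: "((gh_gen, 'k) free_alg set, 'x) module" and \<phi> :: "'m \<Rightarrow> 'x" and \<psi> :: "'x \<Rightarrow> 'p"
  assumes ext: "is_extension (Ugh q) M' M (X, \<phi>, \<psi>)"
begin

lemmas D = is_extensionD[OF ext]

sublocale X: gh_rep q \<epsilon> n X
  by (intro gh_rep.intro gh_module.intro pres_module.intro D(1) M.uq_params_axioms)

lemmas f1 = module_homD(1)[OF D(2)] and p1 = module_homD(1)[OF D(3)]
  and fz = module_hom_zero_minus[OF M.M.left_module_axioms D(1,2)]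
  and pz = module_hom_zero_minus[OF D(1) M'.M.left_module_axioms D(3)]

lemma fh: "m \<in> carrier M \<Longrightarrow> \<phi> (M.M.act p m) = X.act p (\<phi> m)"
  using module_homD(3)[OF D(2), of "pres (gh_relations q) p" m] by simp

lemma ph: "x \<in> carrier X \<Longrightarrow> \<psi> (X.act p x) = M'.M.act p (\<psi> x)"
  using module_homD(3)[OF D(3), of "pres (gh_relations q) p" x] by simp

lemma finj: "\<lbrakk>\<phi> m = \<phi> m'; m \<in> carrier M; m' \<in> carrier M\<rbrakk> \<Longrightarrow> m = m'"
  using inj_onD[OF D(4)] by blast

lemma gf: "m \<in> carrier M \<Longrightarrow> X.g (\<phi> m) = X.sc \<alpha> (\<phi> m)"
  and hf: "m \<in> carrier M \<Longrightarrow> X.h (\<phi> m) = X.sc \<beta> (\<phi> m)"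
  by (simp_all add: fh[symmetric] M.g_scalar M.h_scalar)

text \<open>A vector of \<open>X\<close> over the highest weight vector of \<open>M'\<close> is corrected by a vector of \<open>M\<close> so that
  only a multiple \<open>c\<close> of the highest weight vector of \<open>M\<close> obstructs its being an eigenvector. The images of
  the corrected vector under \<open>E\<close> and \<open>F\<^sup>n\<^sup>+\<^sup>1\<close> lie in \<open>M\<close> and have weights that do not occur there, so both
  vanish. Then \<open>E F\<^sup>n\<^sup>+\<^sup>1\<close> kills it as well, which forces \<open>c = 0\<close>.\<close>

lemma highest_weight_lift:
  "\<exists>x\<in>carrier X. \<psi> x = M'.b 0 \<and> X.E x = \<zero>\<^bsub>X\<^esub> \<and> X.K x = X.sc (weight q \<epsilon> n 0) (X.g x) \<and>
    X.Fpow (Suc n) x = \<zero>\<^bsub>X\<^esub>"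
proof -
  let ?l = "weight q \<epsilon> n 0"
  obtain x0 where x0: "x0 \<in> carrier X" "\<psi> x0 = M'.b 0" using D(7)[of "M'.b 0"] M'.b_props(1)[of 0] by auto
  have "\<psi> (X.K x0 \<ominus>\<^bsub>X\<^esub> X.sc ?l (X.g x0)) = \<zero>\<^bsub>M'\<^esub>"
    using x0 M'.b_props(1)[of 0] by (simp add: pz(3) ph M'.basis_action M'.sc_simps(1) M'.M.diff_eq_zero_iff)
  then obtain m where m: "m \<in> carrier M" "X.K x0 \<ominus>\<^bsub>X\<^esub> X.sc ?l (X.g x0) = \<phi> m"
    using D(6)[of "X.K x0 \<ominus>\<^bsub>X\<^esub> X.sc ?l (X.g x0)"] x0 by auto
  \<comment> \<open>The vector \<open>t\<close> solves \<open>K t - wt 0 g t = m\<close> in all coordinates but the first, where the operator is \<open>0\<close>.\<close>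
  obtain t where t: "t \<in> carrier M" "\<forall>i\<le>n. \<kappa> t i = (if i = 0 then 0 else \<kappa> m i / (\<alpha> * (weight q \<epsilon> n i - ?l)))"
    using M.\<kappa>_surj[of "\<lambda>i. if i = 0 then 0 else \<kappa> m i / (\<alpha> * (weight q \<epsilon> n i - ?l))"] by auto
  define c y where "c = \<kappa> m 0" and "y = \<phi> (M.b 0)"
  have mt: "m = (M.K t \<ominus>\<^bsub>M\<^esub> M.sc ?l (M.g t)) \<oplus>\<^bsub>M\<^esub> M.sc c (M.b 0)"
  proof (rule M.\<kappa>_eqI[OF m(1)])
    have "M.K t \<ominus>\<^bsub>M\<^esub> M.sc ?l (M.g t) = M.K t \<oplus>\<^bsub>M\<^esub> M.sc (- ?l) (M.g t)"
      using t by (simp add: M.sc_simps(6) M.M.M.minus_eq)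
    moreover fix i assume i: "i \<le> n"
    moreover have "weight q \<epsilon> n i * (\<alpha> * \<kappa> t i) = ?l * (\<alpha> * \<kappa> t i) + (if i = 0 then 0 else \<kappa> m i)"
    proof (cases "i = 0")
      case False
      then have "\<alpha> * (weight q \<epsilon> n i - ?l) \<noteq> 0" using M.weight_eq_iff[of i 0] M.\<alpha>_nz by simp
      then have "\<alpha> * (weight q \<epsilon> n i - ?l) * \<kappa> t i = \<kappa> m i" using False t i by simp
      then show ?thesis using False by (simp add: algebra_simps)
    qed simp
    ultimately show "\<kappa> m i = \<kappa> (M.K t \<ominus>\<^bsub>M\<^esub> M.sc ?l (M.g t) \<oplus>\<^bsub>M\<^esub> M.sc c (M.b 0)) i"
      using t M.\<alpha>_nz M.b_props[of 0]
      by (simp add: M.\<kappa>_add' M.\<kappa>_K' M.\<kappa>_scal' M.\<kappa>_g' c_def mult.assoc)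
  qed (use t M.b_props in auto)
  define x where "x = x0 \<ominus>\<^bsub>X\<^esub> \<phi> t"
  have x: "x \<in> carrier X" using x0 f1 t by (simp add: x_def)
  have y: "y \<in> carrier X" using f1 M.b_props by (simp add: y_def)
  have px: "\<psi> x = M'.b 0"
    using x0 t f1 M'.b_props(1)[of 0] by (simp add: x_def pz(3) D(5) M'.M.M.minus_eq M'.M.minus_zero')
  have Kx: "X.K x = X.sc ?l (X.g x) \<oplus>\<^bsub>X\<^esub> X.sc c y"
  proof -
    have K0: "X.K x0 = X.sc ?l (X.g x0) \<oplus>\<^bsub>X\<^esub> \<phi> m"
      using X.add_diff_cancel[of "X.sc ?l (X.g x0)" "X.K x0"] m x0 by simp
    have "\<phi> m = (X.K (\<phi> t) \<ominus>\<^bsub>X\<^esub> X.sc ?l (X.g (\<phi> t))) \<oplus>\<^bsub>X\<^esub> X.sc c y"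
      using arg_cong[OF mt, of \<phi>] t M.b_props(1)[of 0]
      by (simp add: module_homD(2)[OF D(2)] fz(3) fh y_def)
    moreover have "(a \<oplus>\<^bsub>X\<^esub> ((k \<ominus>\<^bsub>X\<^esub> d) \<oplus>\<^bsub>X\<^esub> e)) \<ominus>\<^bsub>X\<^esub> k = (a \<ominus>\<^bsub>X\<^esub> d) \<oplus>\<^bsub>X\<^esub> e"
      if "a \<in> carrier X" "k \<in> carrier X" "d \<in> carrier X" "e \<in> carrier X" for a k d e
    proof -
      have "a \<oplus>\<^bsub>X\<^esub> ((k \<ominus>\<^bsub>X\<^esub> d) \<oplus>\<^bsub>X\<^esub> e) = ((a \<ominus>\<^bsub>X\<^esub> d) \<oplus>\<^bsub>X\<^esub> e) \<oplus>\<^bsub>X\<^esub> k"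
        using that by (simp add: X.M.minus_eq X.M.a_ac)
      then show ?thesis using that by (simp add: X.M.minus_eq X.M.a_assoc X.M.r_neg)
    qed
    ultimately show ?thesis
      using x0 y f1[OF t(1)] unfolding x_def by (simp add: X.act_minus K0)
  qed
  have Ky: "X.K y = X.sc ?l (X.g y)"
    using M.b_props(1)[of 0] f1 unfolding y_def
    by (simp add: gf fh[symmetric] M.basis_action M.sc_simps(1))
  have Ex: "X.E x = \<zero>\<^bsub>X\<^esub>"
  proof -
    have "\<psi> (X.E x) = \<zero>\<^bsub>M'\<^esub>" using x px by (simp add: ph M'.basis_action)
    then obtain e where e: "e \<in> carrier M" "X.E x = \<phi> e" using D(6)[of "X.E x"] x by auto
    have Ey: "X.E y = \<zero>\<^bsub>X\<^esub>" using fh[of "M.b 0" "var E_gh"] M.b_props fz by (simp add: y_def M.basis_action)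
    have "X.K (X.E x) = X.sc (q\<^sup>2) (X.sc ?l (X.g (X.E x)))"
      using x y Ey by (simp add: X.KE Kx X.act_linear X.var_sc X.gh_rels)
    then have "\<phi> (M.K e) = \<phi> (M.sc (q\<^sup>2 * ?l * \<alpha>) e)"
      using e f1 by (simp add: fh gf X.sc_simps(1) mult.assoc)
    then have "M.K e = M.sc (q\<^sup>2 * ?l * \<alpha>) e" using e by (intro finj) auto
    then have "e = \<zero>\<^bsub>M\<^esub>" using e M.weight_neq by (intro M.eigenvector_zero[of e "q\<^sup>2 * ?l"]) auto
    then show ?thesis using e fz by simp
  qed
  note S = X.string[OF x y Ex Kx Ky]
  have Fy: "X.Fpow (Suc n) y = \<zero>\<^bsub>X\<^esub>"
    using fh[of "M.b 0" "var F_gh ^ Suc n"] M.b_props(1)[of 0] M.Fpow_Suc_n_b0 fz unfolding y_def by simp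
  have Fx: "X.Fpow (Suc n) x = \<zero>\<^bsub>X\<^esub>"
  proof -
    have "\<psi> (X.Fpow (Suc n) x) = \<zero>\<^bsub>M'\<^esub>" using ph[OF x] px M'.Fpow_Suc_n_b0 by simp
    then obtain e where e: "e \<in> carrier M" "X.Fpow (Suc n) x = \<phi> e" using D(6)[of "X.Fpow (Suc n) x"] x by auto
    have "X.K (\<phi> e) = X.sc (weight q \<epsilon> n (Suc n)) (X.g (\<phi> e))"
      using S(1)[of "Suc n"] x f1 e unfolding Fy e by simp
    then have "\<phi> (M.K e) = \<phi> (M.sc (weight q \<epsilon> n (Suc n) * \<alpha>) e)"
      using e f1 by (simp add: fh gf X.sc_simps(1))
    then have "M.K e = M.sc (weight q \<epsilon> n (Suc n) * \<alpha>) e" using e by (intro finj) auto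
    then have "e = \<zero>\<^bsub>M\<^esub>" using e M.weight_eq_iff by (intro M.eigenvector_zero[of e]) auto
    then show ?thesis using e fz by simp
  qed
  have "X.sc (c * comB q \<epsilon> n (Suc n)) (X.Fpow n y) = \<zero>\<^bsub>X\<^esub>"
  proof -
    have "comA q \<epsilon> n (Suc n) = 0" using M.comA_closed[of n] by simp
    then have "X.E (X.Fpow (Suc n) x) = X.sc (c * comB q \<epsilon> n (Suc n)) (X.Fpow n y)"
      using S(2)[of n] x y by (simp add: X.sc_simps(3) del: power_Suc)
    then show ?thesis unfolding Fx by simp
  qed
  then have "X.sc (c * comB q \<epsilon> n (Suc n) * qfact q n) (\<phi> (M.b n)) = \<zero>\<^bsub>X\<^esub>"
    using fh[of "M.b 0" "var F_gh ^ n"] M.b_props(1)[of 0] M.b_props(1)[of n] M.Fpow_b0[of n] f1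
      X.sc_simps(1)[of "\<phi> (M.b n)" "c * comB q \<epsilon> n (Suc n)" "qfact q n", symmetric]
    by (simp add: y_def fh)
  then have "\<phi> (M.sc (c * comB q \<epsilon> n (Suc n) * qfact q n) (M.b n)) = \<phi> \<zero>\<^bsub>M\<^esub>"
    using M.b_props(1)[of n] by (simp add: fh fz)
  then have "M.sc (c * comB q \<epsilon> n (Suc n) * qfact q n) (M.b n) = \<zero>\<^bsub>M\<^esub>"
    using M.b_props(1)[of n] by (intro finj) auto
  from arg_cong[OF this, of "\<lambda>z. \<kappa> z n"] have "c * comB q \<epsilon> n (Suc n) * qfact q n = 0"
    using M.b_props[of n] by (simp only: M.\<kappa>_scal' M.\<kappa>_zero le_refl simp_thms if_True mult_1_right)
  then have "c = 0" using M.comB_nz[OF two] M.qfact_nz by simp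
  then have "X.K x = X.sc ?l (X.g x)" using Kx x y by (simp add: X.sc_simps(3))
  then show ?thesis using x px Ex Fx by blast
qed

text \<open>The section takes the highest weight vector of \<open>M'\<close> to a vector from whose images under \<open>g\<close> and \<open>h\<close> the
  pair \<open>(a, a2)\<close> can be read off.\<close>

lemma cocycle_highest_weight_vector:
  assumes c: "has_cocycle (Ugh q) \<gamma> I M' M (gh_cochain a a2) (X, \<phi>, \<psi>)"
  obtains x where "x \<in> carrier X" "\<psi> x = M'.b 0" "X.K x = X.sc (weight q \<epsilon> n 0) (X.g x)"
    and "X.g x = X.sc \<alpha>' x \<oplus>\<^bsub>X\<^esub> \<phi> (M.sc a (M.b 0))" and "X.h x = X.sc \<beta>' x \<oplus>\<^bsub>X\<^esub> \<phi> (M.sc a2 (M.b 0))"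
proof -
  obtain s where s: "linear_section (Ugh q) M' X \<psi> s"
    and sg: "\<forall>i\<in>I. \<forall>p\<in>carrier M'. \<gamma> i \<odot>\<^bsub>X\<^esub> s p = s (\<gamma> i \<odot>\<^bsub>M'\<^esub> p) \<oplus>\<^bsub>X\<^esub> \<phi> (gh_cochain a a2 i p)"
    by (rule has_cocycleE[OF c])
  note S = linear_sectionD[OF s]
  have b: "M'.b 0 \<in> carrier M'" "M.b 0 \<in> carrier M" using M'.b_props M.b_props by auto
  have sv: "X.act (var v) (s (M'.b 0)) = s (M'.M.act (var v) (M'.b 0)) \<oplus>\<^bsub>X\<^esub> \<phi> (gh_cochain a a2 v (M'.b 0))" if "v \<in> I" for v
    using sg that b by (auto simp: generator_pres)
  have ss: "s (M'.sc k (M'.b 0)) = X.sc k (s (M'.b 0))" for k using S(3)[of "M'.b 0" k] b by simp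
  have x: "s (M'.b 0) \<in> carrier X" "\<psi> (s (M'.b 0)) = M'.b 0" using S b by auto
  have g: "X.g (s (M'.b 0)) = X.sc \<alpha>' (s (M'.b 0)) \<oplus>\<^bsub>X\<^esub> \<phi> (M.sc a (M.b 0))"
    and h: "X.h (s (M'.b 0)) = X.sc \<beta>' (s (M'.b 0)) \<oplus>\<^bsub>X\<^esub> \<phi> (M.sc a2 (M.b 0))"
    using sv[of g_gh] sv[of h_gh] b by (simp_all add: M'.g_scalar M'.h_scalar ss gh_cochain_def basis_match_b)
  have "X.K (s (M'.b 0)) = X.sc (weight q \<epsilon> n 0 * \<alpha>') (s (M'.b 0)) \<oplus>\<^bsub>X\<^esub> \<phi> (M.sc (a * weight q \<epsilon> n 0) (M.b 0))"
    using sv[of K_gh] b M'.\<alpha>_nz by (simp add: M'.basis_action ss gh_cochain_def basis_match_simps basis_match_b M.sc_simps(1) mult.commute)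
  also have "\<dots> = X.sc (weight q \<epsilon> n 0) (X.g (s (M'.b 0)))"
    using x b f1 by (simp add: g X.act_linear X.sc_simps(1) fh mult.commute)
  finally show thesis using that x g h by blast
qed

text \<open>This compares \<open>g h x\<close> with \<open>h g x\<close>, where \<open>x\<close> lies over the highest weight vector of \<open>M'\<close>.\<close>

lemma cocycle_relation:
  assumes c: "has_cocycle (Ugh q) \<gamma> I M' M (gh_cochain a a2) (X, \<phi>, \<psi>)"
  shows "(\<beta>' - \<beta>) * a = (\<alpha>' - \<alpha>) * a2"
proof -
  obtain x where x: "x \<in> carrier X" and gx: "X.g x = X.sc \<alpha>' x \<oplus>\<^bsub>X\<^esub> \<phi> (M.sc a (M.b 0))"
    and hx: "X.h x = X.sc \<beta>' x \<oplus>\<^bsub>X\<^esub> \<phi> (M.sc a2 (M.b 0))" by (rule cocycle_highest_weight_vector[OF c])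
  have b: "M.b 0 \<in> carrier M" "\<phi> (M.b 0) \<in> carrier X" using M.b_props f1 by auto
  let ?y = "\<phi> (M.b 0)"
  have "X.g (X.h x) = X.sc (\<beta>' * \<alpha>') x \<oplus>\<^bsub>X\<^esub> X.sc (\<beta>' * a + \<alpha> * a2) ?y"
    using x b by (simp add: hx X.act_linear X.var_sc gx fh gf X.sc_simps(1,4) X.M.a_ac mult.commute)
  moreover have "X.h (X.g x) = X.sc (\<beta>' * \<alpha>') x \<oplus>\<^bsub>X\<^esub> X.sc (\<alpha>' * a2 + \<beta> * a) ?y"
    using x b by (simp add: gx X.act_linear X.var_sc hx fh hf X.sc_simps(1,4) X.M.a_ac mult.commute)
  ultimately have "X.sc (\<beta>' * a + \<alpha> * a2) ?y = X.sc (\<alpha>' * a2 + \<beta> * a) ?y"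
    using X.gh_rels(7)[OF x] x b by simp
  then have "M.sc (\<beta>' * a + \<alpha> * a2) (M.b 0) = M.sc (\<alpha>' * a2 + \<beta> * a) (M.b 0)"
    using b by (intro finj) (simp_all add: fh)
  from arg_cong[OF this, of "\<lambda>z. \<kappa> z 0"] have "\<beta>' * a + \<alpha> * a2 = \<alpha>' * a2 + \<beta> * a"
    using M.b_props[of 0] by (simp add: M.\<kappa>_scal')
  then show ?thesis by (simp add: algebra_simps)
qed

text \<open>Two eigenvectors over the highest weight vector of \<open>M'\<close> differ by a multiple \<open>t\<close> of the highest weight
  vector of \<open>M\<close>, on which \<open>g\<close> and \<open>h\<close> act as \<open>\<alpha>\<close> and \<open>\<beta>\<close> instead of \<open>\<alpha>'\<close> and \<open>\<beta>'\<close>.\<close>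

lemma cocycle_unique:
  assumes c: "has_cocycle (Ugh q) \<gamma> I M' M (gh_cochain a a2) (X, \<phi>, \<psi>)"
    and c': "has_cocycle (Ugh q) \<gamma> I M' M (gh_cochain c c2) (X, \<phi>, \<psi>)"
  shows "\<exists>t. c = a + t * (\<alpha> - \<alpha>') \<and> c2 = a2 + t * (\<beta> - \<beta>')"
proof -
  obtain x where x: "x \<in> carrier X" "\<psi> x = M'.b 0" "X.K x = X.sc (weight q \<epsilon> n 0) (X.g x)"
    "X.g x = X.sc \<alpha>' x \<oplus>\<^bsub>X\<^esub> \<phi> (M.sc a (M.b 0))" "X.h x = X.sc \<beta>' x \<oplus>\<^bsub>X\<^esub> \<phi> (M.sc a2 (M.b 0))"
    by (rule cocycle_highest_weight_vector[OF c])
  obtain z where z: "z \<in> carrier X" "\<psi> z = M'.b 0" "X.K z = X.sc (weight q \<epsilon> n 0) (X.g z)"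
    "X.g z = X.sc \<alpha>' z \<oplus>\<^bsub>X\<^esub> \<phi> (M.sc c (M.b 0))" "X.h z = X.sc \<beta>' z \<oplus>\<^bsub>X\<^esub> \<phi> (M.sc c2 (M.b 0))"
    by (rule cocycle_highest_weight_vector[OF c'])
  have b: "M.b 0 \<in> carrier M" "\<phi> (M.b 0) \<in> carrier X" using M.b_props f1 by auto
  have "\<psi> (z \<ominus>\<^bsub>X\<^esub> x) = \<zero>\<^bsub>M'\<^esub>" using x z M'.b_props(1)[of 0] by (simp add: pz(3) M'.M.diff_eq_zero_iff)
  then obtain m where m: "m \<in> carrier M" "z \<ominus>\<^bsub>X\<^esub> x = \<phi> m" using D(6)[of "z \<ominus>\<^bsub>X\<^esub> x"] x z by auto
  have "X.K (z \<ominus>\<^bsub>X\<^esub> x) = X.sc (weight q \<epsilon> n 0) (X.g (z \<ominus>\<^bsub>X\<^esub> x))"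
    using x(1,3) z(1,3) by (simp only: X.act_minus X.act_closed)
  then have "\<phi> (M.K m) = \<phi> (M.sc (weight q \<epsilon> n 0 * \<alpha>) m)"
    using m f1 by (simp add: fh gf X.sc_simps(1))
  then have "M.K m = M.sc (weight q \<epsilon> n 0 * \<alpha>) m" using m by (intro finj) auto
  then obtain t where t: "m = M.sc t (M.b 0)" using M.eigenvector_b0 m by blast
  let ?y = "\<phi> (M.b 0)"
  have zx: "z = x \<oplus>\<^bsub>X\<^esub> X.sc t ?y"
    using X.add_diff_cancel[OF x(1) z(1)] m b by (simp add: t fh)
  have eqs: "X.sc (k + t * l) ?y = X.sc (t * l' + k') ?y \<Longrightarrow> k' = k + t * (l - l')" for k k' l l'
  proof -
    assume "X.sc (k + t * l) ?y = X.sc (t * l' + k') ?y"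
    then have "M.sc (k + t * l) (M.b 0) = M.sc (t * l' + k') (M.b 0)" using b by (intro finj) (simp_all add: fh)
    from arg_cong[OF this, of "\<lambda>z. \<kappa> z 0"] have "k + t * l = t * l' + k'"
      using M.b_props[of 0] by (simp add: M.\<kappa>_scal')
    then show ?thesis by (simp add: algebra_simps)
  qed
  have gz: "X.sc \<alpha>' x \<oplus>\<^bsub>X\<^esub> X.sc (a + t * \<alpha>) ?y = X.sc \<alpha>' x \<oplus>\<^bsub>X\<^esub> X.sc (t * \<alpha>' + c) ?y"
    using z(4) x(1) b unfolding zx
    by (simp add: X.act_linear X.var_sc x(4) gf fh X.sc_simps(1,4) X.M.a_assoc mult.commute)
  have hz: "X.sc \<beta>' x \<oplus>\<^bsub>X\<^esub> X.sc (a2 + t * \<beta>) ?y = X.sc \<beta>' x \<oplus>\<^bsub>X\<^esub> X.sc (t * \<beta>' + c2) ?y"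
    using z(5) x(1) b unfolding zx
    by (simp add: X.act_linear X.var_sc x(5) hf fh X.sc_simps(1,4) X.M.a_assoc mult.commute)
  have "X.sc (a + t * \<alpha>) ?y = X.sc (t * \<alpha>' + c) ?y" "X.sc (a2 + t * \<beta>) ?y = X.sc (t * \<beta>' + c2) ?y"
    using gz hz x(1) b by simp_all
  then show ?thesis using eqs by blast
qed

text \<open>A highest weight vector over that of \<open>M'\<close> generates a section that commutes with \<open>E g\<^sup>-\<^sup>1\<close>, \<open>F\<close> and
  \<open>K g\<^sup>-\<^sup>1\<close>. Its failure to commute with \<open>g\<close> and \<open>h\<close> sends the highest weight vector of \<open>M'\<close> to a vector of
  the same weight in \<open>M\<close>, that is, to a multiple of \<open>b 0\<close>; the two multiples are \<open>a\<close> and \<open>a2\<close>.\<close>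

lemma cocycle_exists: "\<exists>a a2. has_cocycle (Ugh q) \<gamma> I M' M (gh_cochain a a2) (X, \<phi>, \<psi>)"
proof -
  obtain x where x: "x \<in> carrier X" "\<psi> x = M'.b 0" "X.E x = \<zero>\<^bsub>X\<^esub>"
    "X.K x = X.sc (weight q \<epsilon> n 0) (X.g x)" "X.Fpow (Suc n) x = \<zero>\<^bsub>X\<^esub>"
    using highest_weight_lift by blast
  note A = X.xs_action[OF M.qint_nz x(1,3,4,5)]
  have bM: "M.b 0 \<in> carrier M" and bM': "M'.b 0 \<in> carrier M'" using M.b_props M'.b_props by auto
  have diff: "\<exists>a. X.act (var v) x = X.sc l x \<oplus>\<^bsub>X\<^esub> \<phi> (M.sc a (M.b 0))"
    if v: "v \<in> {g_gh, h_gh}" and lv: "M'.M.act (var v) (M'.b 0) = M'.sc l (M'.b 0)" for v l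
  proof -
    let ?d = "X.act (var v) x \<ominus>\<^bsub>X\<^esub> X.sc l x"
    have "\<psi> ?d = \<zero>\<^bsub>M'\<^esub>" using x bM' lv by (simp add: pz(3) ph M'.M.diff_eq_zero_iff)
    then obtain m where m: "m \<in> carrier M" "?d = \<phi> m" using D(6)[of ?d] x by auto
    have vK: "X.act (var v) (X.K z) = X.K (X.act (var v) z)" "X.act (var v) (X.g z) = X.g (X.act (var v) z)"
      if "z \<in> carrier X" for z using v X.gh_rels[OF that] by auto
    have "X.K (X.act (var v) x) = X.sc (weight q \<epsilon> n 0) (X.g (X.act (var v) x))"
    proof -
      have "X.K (X.act (var v) x) = X.act (var v) (X.K x)" using vK(1)[OF x(1)] by simp
      also have "\<dots> = X.sc (weight q \<epsilon> n 0) (X.act (var v) (X.g x))" using x(1) by (simp add: x(4) X.var_sc)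
      finally show ?thesis unfolding vK(2)[OF x(1)] .
    qed
    moreover have "X.K (X.sc l x) = X.sc (weight q \<epsilon> n 0) (X.g (X.sc l x))"
      using x(1) by (simp add: X.var_sc x(4) X.sc_simps(1) mult.commute)
    ultimately have "X.K ?d = X.sc (weight q \<epsilon> n 0) (X.g ?d)" using x(1) by (simp only: X.act_minus X.act_closed)
    then have "\<phi> (M.K m) = \<phi> (M.sc (weight q \<epsilon> n 0 * \<alpha>) m)"
      using m f1 by (simp add: fh gf X.sc_simps(1))
    then have "M.K m = M.sc (weight q \<epsilon> n 0 * \<alpha>) m" using m by (intro finj) auto
    then obtain a where "m = M.sc a (M.b 0)" using M.eigenvector_b0 m by blast
    then show ?thesis using X.add_diff_cancel[of "X.sc l x" "X.act (var v) x"] m x(1)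
      by (intro exI[of _ a]) simp
  qed
  obtain a where gx: "X.g x = X.sc \<alpha>' x \<oplus>\<^bsub>X\<^esub> \<phi> (M.sc a (M.b 0))"
    using diff[of g_gh \<alpha>'] M'.g_scalar[OF bM'] by blast
  obtain a2 where hx: "X.h x = X.sc \<beta>' x \<oplus>\<^bsub>X\<^esub> \<phi> (M.sc a2 (M.b 0))"
    using diff[of h_gh \<beta>'] M'.h_scalar[OF bM'] by blast
  let ?x = "X.xs x"
  have xc: "?x i \<in> carrier X" for i using x by simp
  have fb: "M.b i \<in> carrier M" "\<phi> (M.b i) \<in> carrier X" if "i \<le> n" for i using that M.b_props f1 by auto
  have fx: "X.xs (\<phi> (M.b 0)) i = \<phi> (M.b i)" if "i \<le> n" for i
    using M.xs_b0[OF that] bM f1 by (simp add: X.xs_def M.xs_def fh[symmetric])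
  have xg: "X.g (?x i) = X.sc \<alpha>' (?x i) \<oplus>\<^bsub>X\<^esub> X.sc a (\<phi> (M.b i))"
    and xh: "X.h (?x i) = X.sc \<beta>' (?x i) \<oplus>\<^bsub>X\<^esub> X.sc a2 (\<phi> (M.b i))" if "i \<le> n" for i
    using x(1) bM f1[OF bM] fx[OF that, symmetric]
    by (simp_all add: X.xs_def X.var_sc X.g_Fpow X.h_Fpow gx hx fh X.act_linear X.act_const_commute[of _ "var F_gh ^ i"]
        X.sc_simps(1) mult.commute)
  define s where "s = M'.lin_of (vspace (Ugh q) X) ?x"
  have s: "linear_map M'.MV (vspace (Ugh q) X) s" and sb: "\<And>i. i \<le> n \<Longrightarrow> s (M'.b i) = ?x i"
    unfolding s_def using M'.lin_of[OF X.vs.vec_axioms, of ?x] xc by auto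
  note L = linear_mapD[OF s, simplified]
  have psx: "\<psi> (?x i) = M'.b i" if "i \<le> n" for i
    using M'.xs_b0[OF that] x by (simp add: X.xs_def M'.xs_def ph)
  have psi_lin: "linear_map (vspace (Ugh q) X) M'.MV \<psi>"
    using module_homD[OF D(3)] by (auto simp: linear_map_def)
  have phi_lin: "linear_map M.MV (vspace (Ugh q) X) \<phi>"
    using module_homD[OF D(2)] by (auto simp: linear_map_def)
  have ps: "\<psi> (s t) = t" if "t \<in> carrier M'" for t
    using M'.linear_eq[OF M'.M.vs.vec_axioms linear_comp[OF s psi_lin] _ _ that, of "\<lambda>t. t"] psx sb
    by (simp add: linear_map_def)
  have sec: "linear_section (Ugh q) M' X \<psi> s"
    using L ps by (auto simp: linear_section_def)
  have s0: "s \<zero>\<^bsub>M'\<^esub> = \<zero>\<^bsub>X\<^esub>" using linear_map_zero[OF M'.M.vs.vec_axioms X.vs.vec_axioms s] by simp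
  have basis_match0: "basis_match \<zero>\<^bsub>M'\<^esub> = \<zero>\<^bsub>M\<^esub>" using linear_map_zero[OF M'.M.vs.vec_axioms M.M.vs.vec_axioms basis_match_linear] by simp
  have main: "X.act (var v) (s t) = s (M'.M.act (var v) t) \<oplus>\<^bsub>X\<^esub> \<phi> (gh_cochain a a2 v t)"
    if v: "v \<in> I" and t: "t \<in> carrier M'" for v t
  proof (rule M'.linear_eq[OF X.vs.vec_axioms linear_comp[OF s X.linear_act] _ _ t])
    have "linear_map M'.MV (vspace (Ugh q) X) (\<lambda>t. s (M'.M.act (var v) t))"
      "linear_map M'.MV (vspace (Ugh q) X) (\<lambda>t. \<phi> (gh_cochain a a2 v t))"
      using linear_comp[OF M'.M.linear_act s] linear_comp[OF gh_cochain_linear phi_lin] by auto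
    note ll = linear_mapD[OF this(1), simplified] linear_mapD[OF this(2), simplified]
    show "linear_map M'.MV (vspace (Ugh q) X) (\<lambda>t. s (M'.M.act (var v) t) \<oplus>\<^bsub>X\<^esub> \<phi> (gh_cochain a a2 v t))"
      using ll by (auto simp: linear_map_def X.M.a_ac X.act_linear)
    fix i assume i: "i \<le> n"
    have b': "M'.b i \<in> carrier M'" using M'.b_props i by auto
    from v consider "v = E_gh" | "v = F_gh" | "v = K_gh" | "v = g_gh" | "v = h_gh" by blast
    then show "X.act (var v) (s (M'.b i)) = s (M'.M.act (var v) (M'.b i)) \<oplus>\<^bsub>X\<^esub> \<phi> (gh_cochain a a2 v (M'.b i))"
    proof cases
      case 1
      show ?thesis
      proof (cases i)
        case 0
        then show ?thesis using 1 sb[of 0] A by (simp add: M'.basis_action s0 gh_cochain_def basis_match0 fz)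
      next
        case (Suc j)
        then have j: "j < n" "j \<le> n" using i by auto
        have bj: "M'.b j \<in> carrier M'" using j M'.b_props by auto
        let ?c = "\<epsilon> * qint q (n - j)"
        have "X.E (s (M'.b i)) = X.sc ?c (X.sc \<alpha>' (?x j) \<oplus>\<^bsub>X\<^esub> X.sc a (\<phi> (M.b j)))"
          using Suc sb[OF i] A(5)[of j] j xg[OF j(2)] by simp
        also have "\<dots> = X.sc (?c * \<alpha>') (?x j) \<oplus>\<^bsub>X\<^esub> X.sc (?c * a) (\<phi> (M.b j))"
          using xc fb[OF j(2)] by (simp add: X.act_linear X.sc_simps(1))
        also have "X.sc (?c * \<alpha>') (?x j) = s (M'.E (M'.b i))"
          using Suc j bj sb[OF j(2)] by (simp add: M'.basis_action L(3))
        also have "X.sc (?c * a) (\<phi> (M.b j)) = \<phi> (gh_cochain a a2 E_gh (M'.b i))"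
          using Suc j bj fb[OF j(2)] M'.\<alpha>_nz basis_match_b[OF j(2)]
          by (simp add: M'.basis_action gh_cochain_def basis_match_simps M.sc_simps(1) fh mult.commute)
        finally show ?thesis using 1 by simp
      qed
    next
      case 2
      show ?thesis
      proof (cases "i = n")
        case True
        then show ?thesis using 2 sb[of n] A(3) by (simp add: M'.basis_action s0 gh_cochain_def fz)
      next
        case False
        then show ?thesis using 2 i sb[of "Suc i"] sb[of i] A(2)[of i] xc
          by (simp add: M'.basis_action L(3) M'.b_props gh_cochain_def fz)
      qed
    next
      case 3
      have "X.K (s (M'.b i)) = X.sc (weight q \<epsilon> n i * \<alpha>') (?x i) \<oplus>\<^bsub>X\<^esub> X.sc (weight q \<epsilon> n i * a) (\<phi> (M.b i))"
        using sb[OF i] A(6)[of i] xg[OF i] xc fb[OF i] by (simp add: X.act_linear X.sc_simps(1))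
      also have "X.sc (weight q \<epsilon> n i * \<alpha>') (?x i) = s (M'.K (M'.b i))"
        using i b' sb[OF i] by (simp add: M'.basis_action L(3))
      also have "X.sc (weight q \<epsilon> n i * a) (\<phi> (M.b i)) = \<phi> (gh_cochain a a2 K_gh (M'.b i))"
        using i b' fb[OF i] M'.\<alpha>_nz basis_match_b[OF i]
        by (simp add: M'.basis_action gh_cochain_def basis_match_simps M.sc_simps(1) fh mult.commute)
      finally show ?thesis using 3 by simp
    next
      case 4
      then show ?thesis using b' sb[OF i] xg[OF i] fb[OF i] basis_match_b[OF i]
        by (simp add: M'.g_scalar L(3) gh_cochain_def fh)
    next
      case 5
      then show ?thesis using b' sb[OF i] xh[OF i] fb[OF i] basis_match_b[OF i]
        by (simp add: M'.h_scalar L(3) gh_cochain_def fh)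
    qed
  qed
  have "has_cocycle (Ugh q) \<gamma> I M' M (gh_cochain a a2) (X, \<phi>, \<psi>)"
    unfolding has_cocycle_def prod.case
    by (rule exI[of _ s]) (use sec main gh_cochain_closed in \<open>simp add: generator_pres\<close>)
  then show ?thesis by blast
qed

end

section \<open>Extensions of one-dimensional modules over the Laurent polynomials\<close>

text \<open>The generators are indexed by \<open>gh_gen\<close>, so that the cocycles over the Laurent polynomials and those over
  \<open>U\<^sub>g\<^sub>,\<^sub>h\<close> have the same index type.\<close>

fun lgen :: "gh_gen \<Rightarrow> 'k::field laurent" where
  "lgen h_gh = laurent_monom 0 1"
| "lgen _ = laurent_monom 1 0"

lemma generated_by_lgen: "generated_by monoid_algebra (lgen :: gh_gen \<Rightarrow> 'k::field laurent) {g_gh, h_gh}"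
  unfolding generated_by_def
proof (intro conjI allI impI)
  fix H :: "'k laurent set"
  assume H: "lgen ` {g_gh, h_gh} \<subseteq> H" "range (scal monoid_algebra) \<subseteq> H"
    "\<forall>a\<in>H. \<forall>b\<in>H. a \<oplus>\<^bsub>monoid_algebra\<^esub> b \<in> H \<and> a \<otimes>\<^bsub>monoid_algebra\<^esub> b \<in> H"
    "\<forall>a\<in>H. \<forall>b\<in>carrier monoid_algebra. a \<otimes>\<^bsub>monoid_algebra\<^esub> b = \<one>\<^bsub>monoid_algebra\<^esub> \<longrightarrow>
      b \<otimes>\<^bsub>monoid_algebra\<^esub> a = \<one>\<^bsub>monoid_algebra\<^esub> \<longrightarrow> b \<in> H"
  have mult: "a * b \<in> H" if "a \<in> H" "b \<in> H" for a b using H(3) that by simp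
  have c: "Poly_Mapping.single 0 c \<in> H" for c using H(2) by auto
  have one: "(1 :: 'k laurent) \<in> H" using c[of 1] by simp
  have gh: "laurent_monom 1 0 \<in> H" "laurent_monom 0 1 \<in> H" using H(1) by simp_all
  have inv: "laurent_monom (- 1) 0 \<in> H" "laurent_monom 0 (- 1) \<in> H"
    using H(4)[rule_format, OF gh(1), of "laurent_monom (- 1) 0"]
      H(4)[rule_format, OF gh(2), of "laurent_monom 0 (- 1)"]
    by (simp_all add: mult_single flip: zero_prod_def)
  have i: "laurent_monom i 0 \<in> H" for i
  proof (induction i rule: int_induct[where k = 0])
    case base
    show ?case using one by (simp flip: zero_prod_def)
  next
    case (step1 i)
    then show ?case using mult[OF step1(2) gh(1)] by (simp add: mult_single)
  next
    case (step2 i)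
    then show ?case using mult[OF step2(2) inv(1)] by (simp add: mult_single)
  qed
  have j: "laurent_monom 0 j \<in> H" for j
  proof (induction j rule: int_induct[where k = 0])
    case base
    show ?case using one by (simp flip: zero_prod_def)
  next
    case (step1 j)
    then show ?case using mult[OF step1(2) gh(2)] by (simp add: mult_single)
  next
    case (step2 j)
    then show ?case using mult[OF step2(2) inv(2)] by (simp add: mult_single)
  qed
  have "Poly_Mapping.single k d \<in> H" for k :: "int \<times> int" and d :: 'k
    using mult[OF c[of d] mult[OF i[of "fst k"] j[of "snd k"]]] by (simp add: mult_single)
  then have "p \<in> H" for p
    by (induction p rule: poly_mapping_add_induct) (use H(3) c[of 0] in auto)
  then show "H = carrier monoid_algebra" by auto
qed auto

definition laurent_cochain :: "'k::field \<Rightarrow> 'k \<Rightarrow> gh_gen \<Rightarrow> 'k \<Rightarrow> 'k" where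
  "laurent_cochain a a2 v t = (if v = h_gh then a2 * t else a * t)"

locale laurent_pair =
  fixes \<alpha> \<beta> \<alpha>' \<beta>' :: "'k::field"
  assumes nz: "\<alpha> \<noteq> 0" "\<beta> \<noteq> 0" "\<alpha>' \<noteq> 0" "\<beta>' \<noteq> 0"
begin

abbreviation "N \<equiv> K_module \<alpha> \<beta>"
abbreviation "N' \<equiv> K_module \<alpha>' \<beta>'"
abbreviation "IL \<equiv> {g_gh, h_gh}"

sublocale N: laurent_module N by (rule laurent_K_module[OF nz(1,2)])
sublocale N': laurent_module N' by (rule laurent_K_module[OF nz(3,4)])

sublocale el: ext_setting "monoid_algebra :: ('k, 'k laurent) kalgebra" lgen IL N' N
  by (intro ext_setting.intro ext_setting_axioms.intro kalg_monoid_algebra generated_by_lgen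
      N.left_module_axioms N'.left_module_axioms)

lemma laurent_cocycleI:
  assumes "linear_section monoid_algebra N' X \<psi> s"
    and "\<And>t. laurent_monom 1 0 \<odot>\<^bsub>X\<^esub> s t = s (\<alpha>' * t) \<oplus>\<^bsub>X\<^esub> \<phi> (a * t)"
    and "\<And>t. laurent_monom 0 1 \<odot>\<^bsub>X\<^esub> s t = s (\<beta>' * t) \<oplus>\<^bsub>X\<^esub> \<phi> (a2 * t)"
  shows "has_cocycle monoid_algebra lgen IL N' N (laurent_cochain a a2) (X, \<phi>, \<psi>)"
  using assms unfolding has_cocycle_def prod.case by (intro exI[of _ s]) (auto simp: laurent_cochain_def)

lemma laurent_cocycleE:
  assumes "has_cocycle monoid_algebra lgen IL N' N (laurent_cochain a a2) (X, \<phi>, \<psi>)"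
  obtains s where "linear_section monoid_algebra N' X \<psi> s"
    and "\<And>t. laurent_monom 1 0 \<odot>\<^bsub>X\<^esub> s t = s (\<alpha>' * t) \<oplus>\<^bsub>X\<^esub> \<phi> (a * t)"
    and "\<And>t. laurent_monom 0 1 \<odot>\<^bsub>X\<^esub> s t = s (\<beta>' * t) \<oplus>\<^bsub>X\<^esub> \<phi> (a2 * t)"
  using assms unfolding has_cocycle_def prod.case by (auto simp: laurent_cochain_def)

text \<open>The linear section that sends \<open>1\<close> to a chosen preimage \<open>x\<close> has this form, with \<open>a\<close> and \<open>a2\<close> the defects
  of \<open>g\<close> and \<open>h\<close> at \<open>x\<close>.\<close>

lemma laurent_cocycle_exists:
  assumes ext: "is_extension monoid_algebra N' N (X, \<phi>, \<psi>)"
  shows "\<exists>a a2. has_cocycle monoid_algebra lgen IL N' N (laurent_cochain a a2) (X, \<phi>, \<psi>)"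
proof -
  note D = is_extensionD[OF ext]
  interpret X: laurent_module X by (rule laurent_module.intro[OF D(1)])
  obtain x where x: "x \<in> carrier X" "\<psi> x = 1" using D(7)[of 1] by auto
  let ?s = "\<lambda>c. Poly_Mapping.single 0 c \<odot>\<^bsub>X\<^esub> x"
  note v = X.vs.vclosed[of x] X.vs.vl_distr[of x] X.vs.vassoc[of x] X.vs.vone[of x]
  have psi: "\<psi> (Poly_Mapping.single 0 c \<odot>\<^bsub>X\<^esub> y) = c * \<psi> y" if "y \<in> carrier X" for c y
    using module_homD(3)[OF D(3), of "Poly_Mapping.single 0 c" y] that by simp
  have phi: "\<phi> (c * t) = Poly_Mapping.single 0 c \<odot>\<^bsub>X\<^esub> \<phi> t" for c t
    using module_homD(3)[OF D(2), of "Poly_Mapping.single 0 c" t] by simp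
  have sec: "linear_section monoid_algebra N' X \<psi> ?s"
    using x v psi by (auto simp: linear_section_def)
  have L: "X.L i j (?s t) = Poly_Mapping.single 0 t \<odot>\<^bsub>X\<^esub> X.L i j x" for i j t
    using linear_mapD(3)[OF X.linear_L, of x] x by simp
  have diff: "\<exists>a. X.L i j x = ?s k \<oplus>\<^bsub>X\<^esub> \<phi> a" if k: "laurent_monom i j \<odot>\<^bsub>N'\<^esub> 1 = k" for i j k
  proof -
    have "\<psi> (X.L i j x \<ominus>\<^bsub>X\<^esub> ?s k) = \<psi> (X.L i j x) \<ominus>\<^bsub>N'\<^esub> \<psi> (?s k)"
      using x v by (intro module_hom_zero_minus(3)[OF D(1) N'.left_module_axioms D(3)]) auto
    also have "\<psi> (X.L i j x) = \<psi> (?s k)"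
      using module_homD(3)[OF D(3), of "laurent_monom i j" x] x psi[of x] k by simp
    finally have "\<psi> (X.L i j x \<ominus>\<^bsub>X\<^esub> ?s k) = \<zero>\<^bsub>N'\<^esub>"
      using N'.diff_eq_zero_iff by simp
    then obtain a where "X.L i j x \<ominus>\<^bsub>X\<^esub> ?s k = \<phi> a"
      using D(6)[of "X.L i j x \<ominus>\<^bsub>X\<^esub> ?s k"] x v by auto
    then show ?thesis using X.add_diff_cancel[of "?s k" "X.L i j x"] x v by (intro exI[of _ a]) simp
  qed
  obtain a where g: "X.L 1 0 x = ?s \<alpha>' \<oplus>\<^bsub>X\<^esub> \<phi> a" using diff[of 1 0 \<alpha>'] by auto
  obtain a2 where h: "X.L 0 1 x = ?s \<beta>' \<oplus>\<^bsub>X\<^esub> \<phi> a2" using diff[of 0 1 \<beta>'] by auto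
  have st: "Poly_Mapping.single 0 t \<odot>\<^bsub>X\<^esub> (?s k \<oplus>\<^bsub>X\<^esub> \<phi> b) = ?s (k * t) \<oplus>\<^bsub>X\<^esub> \<phi> (b * t)" for t k b
    using X.vs.vr_distr[of "?s k" "\<phi> b" t] x v module_homD(1)[OF D(2)] phi[of t b]
    by (simp add: mult.commute)
  have "has_cocycle monoid_algebra lgen IL N' N (laurent_cochain a a2) (X, \<phi>, \<psi>)"
    by (rule laurent_cocycleI[OF sec]) (simp_all only: L g h st)
  then show ?thesis by blast
qed

text \<open>The shift comes from replacing a section \<open>s\<close> by \<open>s + t \<phi>\<close>.\<close>

lemma laurent_cocycle_shift:
  assumes ext: "is_extension monoid_algebra N' N (X, \<phi>, \<psi>)"
    and c: "has_cocycle monoid_algebra lgen IL N' N (laurent_cochain a a2) (X, \<phi>, \<psi>)"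
  shows "has_cocycle monoid_algebra lgen IL N' N (laurent_cochain (a + t * (\<alpha> - \<alpha>')) (a2 + t * (\<beta> - \<beta>'))) (X, \<phi>, \<psi>)"
proof -
  note D = is_extensionD[OF ext]
  interpret X: laurent_module X by (rule laurent_module.intro[OF D(1)])
  obtain s where s: "linear_section monoid_algebra N' X \<psi> s"
    and g: "\<And>t. X.L 1 0 (s t) = s (\<alpha>' * t) \<oplus>\<^bsub>X\<^esub> \<phi> (a * t)"
    and h: "\<And>t. X.L 0 1 (s t) = s (\<beta>' * t) \<oplus>\<^bsub>X\<^esub> \<phi> (a2 * t)" using laurent_cocycleE[OF c] by metis
  note S = linear_sectionD[OF s, simplified] and F = module_homD[OF D(2), simplified]
  have FL: "X.L i j (\<phi> z) = \<phi> (\<alpha> powi i * \<beta> powi j * z)" for i j z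
    using F(3)[of "laurent_monom i j" z] by simp
  have Fs: "\<phi> (k * z) = Poly_Mapping.single 0 k \<odot>\<^bsub>X\<^esub> \<phi> z" for k z
    using F(3)[of "Poly_Mapping.single 0 k" z] by simp
  let ?s = "\<lambda>z. s z \<oplus>\<^bsub>X\<^esub> \<phi> (t * z)"
  have psi: "\<psi> (?s z) = z" for z
    using module_homD(2)[OF D(3), of "s z" "\<phi> (t * z)"] S F D(5)[of "t * z"] by simp
  have lin: "?s (k * z) = Poly_Mapping.single 0 k \<odot>\<^bsub>X\<^esub> ?s z" for k z
    using X.vs.vr_distr[of "s z" "\<phi> (t * z)" k] S F Fs[of k "t * z"] by (simp add: mult.left_commute)
  have "linear_section monoid_algebra N' X \<psi> ?s"
    using S F lin psi by (auto simp: linear_section_def distrib_left X.M.a_ac)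
  moreover have "X.L i j (?s z) = ?s (k * z) \<oplus>\<^bsub>X\<^esub> \<phi> ((b + t * (l - k)) * z)"
    if "\<And>z. X.L i j (s z) = s (k * z) \<oplus>\<^bsub>X\<^esub> \<phi> (b * z)" "\<And>z. X.L i j (\<phi> z) = \<phi> (l * z)" for i j k b l z
  proof -
    have "X.L i j (?s z) = s (k * z) \<oplus>\<^bsub>X\<^esub> \<phi> (b * z + l * (t * z))"
      using linear_mapD(2)[OF X.linear_L, of "s z" "\<phi> (t * z)"] S(1) F(1,2)
      by (simp add: that X.M.a_assoc)
    also have "b * z + l * (t * z) = t * (k * z) + (b + t * (l - k)) * z" by (simp add: algebra_simps)
    finally show ?thesis using S(1) F(1,2) by (simp add: X.M.a_assoc)
  qed
  ultimately show ?thesis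
    using g h FL by (intro laurent_cocycleI[of _ _ ?s]) simp_all
qed

text \<open>If \<open>(\<alpha>, \<beta>) \<noteq> (\<alpha>', \<beta>')\<close>, the relation makes the pair a multiple of \<open>(\<alpha> - \<alpha>', \<beta> - \<beta>')\<close>, which is a
  cocycle of the split extension. Otherwise \<open>g\<close> and \<open>h\<close> act by the commuting triangular matrices with
  diagonals \<open>\<alpha>\<close>, \<open>\<beta>\<close> and upper entries \<open>a\<close>, \<open>a2\<close>.\<close>

lemma laurent_cocycle_realized:
  assumes rel: "(\<beta>' - \<beta>) * a = (\<alpha>' - \<alpha>) * a2"
  shows "\<exists>\<xi> :: ('k laurent, 'k, 'k \<times> 'k, 'k) ses. is_extension monoid_algebra N' N \<xi> \<and>
    has_cocycle monoid_algebra lgen IL N' N (laurent_cochain a a2) \<xi>"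
proof (cases "\<alpha> = \<alpha>' \<and> \<beta> = \<beta>'")
  case False
  have split: "is_extension monoid_algebra N' N (split_ext N' N)" by (rule el.split_ext_is_extension)
  have "has_cocycle monoid_algebra lgen IL N' N (laurent_cochain 0 0) (split_ext N' N)"
    unfolding split_ext_def
    by (rule laurent_cocycleI[of _ _ "\<lambda>t. (0, t)"]) (auto simp: linear_section_def direct_sum_def)
  then have c: "has_cocycle monoid_algebra lgen IL N' N (laurent_cochain (0 + t * (\<alpha> - \<alpha>')) (0 + t * (\<beta> - \<beta>'))) (split_ext N' N)" for t
    using laurent_cocycle_shift split unfolding split_ext_def by blast
  have "\<exists>t. a = t * (\<alpha> - \<alpha>') \<and> a2 = t * (\<beta> - \<beta>')"
  proof (cases "\<alpha> = \<alpha>'")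
    case True
    then have "\<beta> - \<beta>' \<noteq> 0" using False by simp
    moreover from this have "a = 0" using rel True by auto
    ultimately show ?thesis using True by (intro exI[of _ "a2 / (\<beta> - \<beta>')"]) simp
  next
    case False
    then have "\<alpha> - \<alpha>' \<noteq> 0" by simp
    moreover have "(\<beta> - \<beta>') * a = (\<alpha> - \<alpha>') * a2" using rel by (simp add: algebra_simps)
    ultimately show ?thesis by (intro exI[of _ "a / (\<alpha> - \<alpha>')"]) (simp add: field_simps)
  qed
  then obtain t where "a = t * (\<alpha> - \<alpha>')" "a2 = t * (\<beta> - \<beta>')" by blast
  then show ?thesis using c[of t] split by (intro exI[of _ "split_ext N' N"]) simp
next
  case True
  define W :: "('k, 'k \<times> 'k) module" where "W = direct_sum line_space line_space"
  have W: "vec W" unfolding W_def vec_def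
    by (intro left_module_direct_sum) (use vec_line_space in \<open>simp_all add: vec_def\<close>)
  interpret W: vec W by (rule W)
  have Ws: "carrier W = UNIV" "(x, y) \<oplus>\<^bsub>W\<^esub> (x', y') = (x + x', y + y')" "\<zero>\<^bsub>W\<^esub> = (0, 0)"
    "c \<odot>\<^bsub>W\<^esub> (x, y) = (c * x, c * y)" for x y x' y' c
    by (simp_all add: W_def direct_sum_def)
  \<comment> \<open>The matrix of \<open>g\<^sup>i h\<^sup>j\<close> is \<open>m (i, j)\<close> times the unipotent matrix with upper entry \<open>u (i, j)\<close>, and \<open>u\<close> is additive.\<close>
  define m where "m = (\<lambda>(i, j). \<alpha> powi i * \<beta> powi j)"
  define u where "u = (\<lambda>(i, j). of_int i * a / \<alpha> + of_int j * a2 / \<beta>)"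
  define \<rho> where "\<rho> = (\<lambda>k (z, t). (m k * (z + u k * t), m k * t))"
  have m: "m 0 = 1" "m (k + l) = m k * m l" and u: "u 0 = 0" "u (k + l) = u k + u l" for k l
    using nz by (auto simp: m_def u_def zero_prod_def power_int_add split_def add_divide_distrib distrib_right)
  define X :: "('k laurent, 'k \<times> 'k) module" where
    "X = \<lparr>carrier = UNIV, monoid.mult = undefined, one = undefined, zero = (0, 0), add = add W,
      smult = (\<lambda>p v. lin_ext W (\<lambda>k. \<rho> k v) p)\<rparr>"
  have \<rho>_lin: "linear_map W W (\<rho> k)" for k
    by (auto simp: linear_map_def Ws \<rho>_def algebra_simps)
  have \<rho>0: "\<rho> 0 v = v" and \<rho>add: "\<rho> (k + l) v = \<rho> k (\<rho> l v)" for k l v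
    by (cases v; simp add: \<rho>_def m u algebra_simps)+
  have X: "left_module monoid_algebra X"
    by (rule left_module_monoid_algebra[OF W \<rho>_lin \<rho>0 \<rho>add]) (simp_all add: X_def Ws)
  have Xs: "carrier X = UNIV" "(x, y) \<oplus>\<^bsub>X\<^esub> (x', y') = (x + x', y + y')" "\<zero>\<^bsub>X\<^esub> = (0, 0)"
    "p \<odot>\<^bsub>X\<^esub> v = lin_ext W (\<lambda>k. \<rho> k v) p" for x y x' y' p v
    by (simp_all add: X_def Ws)
  have single: "Poly_Mapping.single k c \<odot>\<^bsub>X\<^esub> v = c \<odot>\<^bsub>W\<^esub> \<rho> k v" for k c v
    using W.lin_ext_single[of "\<lambda>k. \<rho> k v" k c] by (simp add: Xs Ws)
  have act_K: "p \<odot>\<^bsub>N\<^esub> z = lin_ext line_space (\<lambda>k. m k * z) p" for p z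
    by (simp add: K_module_def lin_ext_def finsum_line_space m_def split_def sum_distrib_right mult.assoc)
  have hom1: "module_hom monoid_algebra N X (\<lambda>z. (z, 0))"
  proof -
    have "linear_map line_space W (\<lambda>z. (z, 0))" by (simp add: linear_map_def Ws)
    from linear_lin_ext[OF vec_line_space W this, of _ "\<lambda>k. m k * _"]
    show ?thesis by (auto simp: module_hom_def Xs act_K \<rho>_def)
  qed
  have hom2: "module_hom monoid_algebra X N snd"
  proof -
    have "linear_map W line_space snd" by (auto simp: linear_map_def Ws)
    from linear_lin_ext[OF W vec_line_space this, of _ "\<lambda>k. \<rho> k _"]
    show ?thesis by (auto simp: module_hom_def Xs act_K \<rho>_def Ws)
  qed
  have ext: "is_extension monoid_algebra N' N (X, \<lambda>z. (z, 0), snd)"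
    using True hom1 hom2 by (intro is_extensionI X) (auto simp: Xs inj_on_def)
  have "has_cocycle monoid_algebra lgen IL N' N (laurent_cochain a a2) (X, \<lambda>z. (z, 0), snd)"
    by (rule laurent_cocycleI[of _ _ "\<lambda>t. (0, t)"])
      (use True nz in \<open>auto simp: linear_section_def Xs(1-3) single Ws \<rho>_def m u zero_prod_def[symmetric]\<close>,
        simp_all add: m_def u_def Xs)
  with ext show ?thesis by blast
qed

end

section \<open>The functor \<open>V \<otimes> -\<close> on extensions\<close>

text \<open>The actions of the generators on coordinates only involve scalars and the action of \<open>g\<close> and \<open>h\<close> on the
  components, with which \<open>\<phi>\<close> commutes.\<close>

lemma componentwise_module_hom:
  assumes C1: "gh_coords q \<epsilon> n N1 M1 \<kappa>1" and C2: "gh_coords q \<epsilon> n N2 M2 \<kappa>2"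
    and f: "linear_map (vspace (Ugh q) M1) (vspace (Ugh q) M2) f"
    and \<phi>: "module_hom monoid_algebra N1 N2 \<phi>"
    and comp: "\<And>m i. m \<in> carrier M1 \<Longrightarrow> \<kappa>2 (f m) i = \<phi> (\<kappa>1 m i)"
  shows "module_hom (Ugh q) M1 M2 f"
proof -
  interpret A: gh_coords q \<epsilon> n N1 M1 \<kappa>1 by fact
  interpret B: gh_coords q \<epsilon> n N2 M2 \<kappa>2 by fact
  interpret X: gh_module q M1 by (intro gh_module.intro A.M.pres_module_axioms)
  note L = linear_mapD[OF f, simplified] and P = module_homD[OF \<phi>]
  have sP: "\<phi> (Poly_Mapping.single k c \<odot>\<^bsub>N1\<^esub> z) = Poly_Mapping.single k c \<odot>\<^bsub>N2\<^esub> \<phi> z"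
    if "z \<in> carrier N1" for k c z using P(3)[of "Poly_Mapping.single k c" z] that by simp
  have pz: "\<phi> \<zero>\<^bsub>N1\<^esub> = \<zero>\<^bsub>N2\<^esub>"
    by (rule module_hom_zero_minus(1)[OF A.N.left_module_axioms B.N.left_module_axioms \<phi>])
  have Nc: "Poly_Mapping.single k c \<odot>\<^bsub>N1\<^esub> z \<in> carrier N1" if "z \<in> carrier N1" for k c z
    using A.N.lsmult_closed[of "Poly_Mapping.single k c" z] that by simp
  have gen: "f (A.M.act (var v) m) = B.M.act (var v) (f m)"
    if v: "v \<in> {E_gh, F_gh, K_gh, g_gh, h_gh}" and m: "m \<in> carrier M1" for v m
  proof (rule B.\<kappa>_inj)
    show "f (A.M.act (var v) m) \<in> carrier M2" "B.M.act (var v) (f m) \<in> carrier M2" using m L by simp_all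
    fix i assume i: "i \<le> n"
    from v consider "v = E_gh" | "v = F_gh" | "v = K_gh" | "v = g_gh" | "v = h_gh" by blast
    then show "\<kappa>2 (f (A.M.act (var v) m)) i = \<kappa>2 (B.M.act (var v) (f m)) i"
    proof cases
      case 2
      show ?thesis
      proof (cases i)
        case 0
        then show ?thesis using 2 m L by (simp add: comp A.\<kappa>_F0 B.\<kappa>_F0 pz)
      next
        case (Suc j)
        then show ?thesis using 2 m L i by (simp add: comp A.\<kappa>_F B.\<kappa>_F sP)
      qed
    qed (use m L in \<open>simp_all add: comp A.\<kappa>_E B.\<kappa>_E A.\<kappa>_K B.\<kappa>_K A.\<kappa>_g B.\<kappa>_g A.\<kappa>_h B.\<kappa>_h sP Nc\<close>)
  qed
  show ?thesis
    by (rule module_hom_generators[OF kalg_presented_algebra X.generated A.M.left_module_axioms B.M.left_module_axioms])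
      (use L gen in \<open>auto simp: generator_pres\<close>)
qed

locale tensor_pair = uq_params q \<epsilon> n + laurent_pair \<alpha> \<beta> \<alpha>' \<beta>'
  for q \<epsilon> :: "'k::field" and n :: nat and \<alpha> \<beta> \<alpha>' \<beta>' :: 'k +
  assumes not_root: "k > 0 \<Longrightarrow> q ^ k \<noteq> 1" and two: "(2::'k) \<noteq> 0"
begin

abbreviation "V \<equiv> V_module q \<epsilon> n"
abbreviation "Mt \<equiv> tensor_module q V N"
abbreviation "Mt' \<equiv> tensor_module q V N'"
abbreviation "\<kappa> \<equiv> gh_V.coord N"
abbreviation "\<kappa>' \<equiv> gh_V.coord N'"

lemma gh_V: "laurent_module X \<Longrightarrow> gh_V q \<epsilon> X"
  by (intro gh_V.intro uq_params_axioms)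

lemma coords_pair: "gh_coords q \<epsilon> n N Mt \<kappa>" "gh_coords q \<epsilon> n N' Mt' \<kappa>'"
  by (intro gh_V.gh_coords gh_V N.laurent_module_axioms N'.laurent_module_axioms)+

lemma gh_std_pair: "gh_std q \<epsilon> n \<alpha> \<beta> Mt \<kappa>" "gh_std q \<epsilon> n \<alpha>' \<beta>' Mt' \<kappa>'"
proof -
  interpret A: gh_coords q \<epsilon> n N Mt \<kappa> by (rule coords_pair)
  interpret B: gh_coords q \<epsilon> n N' Mt' \<kappa>' by (rule coords_pair)
  show "gh_std q \<epsilon> n \<alpha> \<beta> Mt \<kappa>" "gh_std q \<epsilon> n \<alpha>' \<beta>' Mt' \<kappa>'"
    by (intro gh_std.intro gh_std_axioms.intro gh_rep.intro gh_module.intro coords_pair uq_params_axioms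
        A.M.pres_module_axioms B.M.pres_module_axioms nz not_root; assumption)+
qed

sublocale gp: gh_pair q \<epsilon> n \<alpha> \<beta> Mt \<kappa> \<alpha>' \<beta>' Mt' \<kappa>'
  by (intro gh_pair.intro gh_pair_axioms.intro gh_std_pair two)

context
  fixes X :: "('k laurent, 'x) module" and \<phi> \<psi>
  assumes ext: "is_extension monoid_algebra N' N (X, \<phi>, \<psi>)"
begin

interpretation X: laurent_module X
  by (rule laurent_module.intro[OF is_extensionD(1)[OF ext]])

interpretation T: gh_coords q \<epsilon> n X "tensor_module q V X" "gh_V.coord X"
  by (intro gh_V.gh_coords gh_V X.laurent_module_axioms)

lemma module_hom_linear_map:
  "module_hom monoid_algebra L1 L2 f \<Longrightarrow> linear_map (vspace monoid_algebra L1) (vspace monoid_algebra L2) f"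
  by (auto simp: module_hom_def linear_map_def)

text \<open>In coordinates the maps are \<open>\<phi>\<close> and \<open>\<psi>\<close> applied to every component, so exactness is inherited.\<close>

lemma tensor_ses_extension:
  "is_extension (Ugh q) Mt' Mt (tensor_ses q V N' N (X, \<phi>, \<psi>))"
proof -
  note D = is_extensionD[OF ext]
  let ?t = "tensor_map (vspace (Uq q) V) (vspace Laurent X) id \<phi>"
  let ?u = "tensor_map (vspace (Uq q) V) (vspace Laurent N') id \<psi>"
  note t = coord_tensor_map[OF gh_V[OF N.laurent_module_axioms] gh_V[OF X.laurent_module_axioms] module_hom_linear_map[OF D(2)]]
  note u = coord_tensor_map[OF gh_V[OF X.laurent_module_axioms] gh_V[OF N'.laurent_module_axioms] module_hom_linear_map[OF D(3)]]
  have t_lin: "linear_map (vspace (Ugh q) Mt) (vspace (Ugh q) (tensor_module q V X)) ?t"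
    by (rule t(3)[of "\<zero>\<^bsub>Mt\<^esub>"]) (rule gp.M.M.M.zero_closed)
  have u_lin: "linear_map (vspace (Ugh q) (tensor_module q V X)) (vspace (Ugh q) Mt') ?u"
    by (rule u(3)[of "\<zero>\<^bsub>tensor_module q V X\<^esub>"]) (rule T.M.M.zero_closed)
  have t_hom: "module_hom (Ugh q) Mt (tensor_module q V X) ?t"
    by (rule componentwise_module_hom[OF coords_pair(1) T.gh_coords_axioms t_lin D(2) t(2)])
  have u_hom: "module_hom (Ugh q) (tensor_module q V X) Mt' ?u"
    by (rule componentwise_module_hom[OF T.gh_coords_axioms coords_pair(2) u_lin D(3) u(2)])
  have Tz: "gh_V.coord X \<zero>\<^bsub>tensor_module q V X\<^esub> i = \<zero>\<^bsub>X\<^esub>" for i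
    using T.\<kappa>_scal[OF T.M.M.zero_closed, of 0 i] T.\<kappa>_closed[OF T.M.M.zero_closed, of i] X.vs.vzero T.M.vs.vr_null[of 0] by simp
  show ?thesis
    unfolding tensor_ses_def prod.case
  proof (rule is_extensionI[OF T.M.left_module_axioms t_hom u_hom])
    show "inj_on ?t (carrier Mt)"
    proof (rule inj_onI)
      fix m m' assume m: "m \<in> carrier Mt" "m' \<in> carrier Mt" "?t m = ?t m'"
      show "m = m'"
      proof (rule gp.M.\<kappa>_eqI[OF m(1,2)])
        fix i have "\<phi> (\<kappa> m i) = \<phi> (\<kappa> m' i)" using t(2)[OF m(1), of i] t(2)[OF m(2), of i] m(3) by simp
        then show "\<kappa> m i = \<kappa> m' i" using inj_onD[OF D(4)] by simp
      qed
    qed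
    show "?u (?t m) = \<zero>\<^bsub>Mt'\<^esub>" if m: "m \<in> carrier Mt" for m
    proof (rule gp.M'.\<kappa>_eqI)
      show "?u (?t m) \<in> carrier Mt'" by (rule u(1), rule t(1)[OF m])
      show "\<kappa>' (?u (?t m)) i = \<kappa>' \<zero>\<^bsub>Mt'\<^esub> i" for i
        using u(2)[OF t(1)[OF m], of i] t(2)[OF m, of i] D(5)[of "\<kappa> m i"] gp.M'.\<kappa>_zero[of i] by simp
    qed (rule gp.M'.M.M.zero_closed)
    show "\<exists>m\<in>carrier Mt. x = ?t m" if x: "x \<in> carrier (tensor_module q V X)" "?u x = \<zero>\<^bsub>Mt'\<^esub>" for x
    proof -
      have "\<psi> (gh_V.coord X x i) = \<zero>\<^bsub>N'\<^esub>" for i using u(2)[OF x(1), of i] gp.M'.\<kappa>_zero[of i] by (simp add: x(2))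
      then have "\<exists>z. gh_V.coord X x i = \<phi> z" for i using D(6)[OF T.\<kappa>_closed[OF x(1), of i]] by auto
      then obtain z where z: "\<And>i. gh_V.coord X x i = \<phi> (z i)" by metis
      obtain m where m: "m \<in> carrier Mt" "\<forall>i\<le>n. \<kappa> m i = z i" using gp.M.\<kappa>_surj[of z] by auto
      have "x = ?t m" by (rule T.\<kappa>_inj[OF x(1) t(1)[OF m(1)]]) (simp add: z t(2)[OF m(1)] m(2))
      then show ?thesis using m(1) by blast
    qed
    show "\<exists>x\<in>carrier (tensor_module q V X). ?u x = p" if p: "p \<in> carrier Mt'" for p
    proof -
      have "\<exists>x. x \<in> carrier X \<and> \<psi> x = \<kappa>' p i" for i using D(7)[of "\<kappa>' p i"] by auto
      then obtain f where f: "\<And>i. f i \<in> carrier X \<and> \<psi> (f i) = \<kappa>' p i" by metis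
      obtain x where x: "x \<in> carrier (tensor_module q V X)" "\<forall>i\<le>n. gh_V.coord X x i = f i"
        using T.\<kappa>_surj[of f] f by auto
      have "?u x = p" by (rule gp.M'.\<kappa>_eqI[OF u(1)[OF x(1)] p]) (simp add: u(2)[OF x(1)] x(2) f)
      then show ?thesis using x(1) by blast
    qed
  qed
qed

text \<open>If \<open>s\<close> is a section of the given extension, then \<open>id \<otimes> s\<close> is a section of the tensored one. Componentwise
  it fails to commute with \<open>g\<close> and \<open>h\<close> as \<open>s\<close> does, and with \<open>E\<close> and \<open>K\<close> through the factor \<open>g\<close> in their
  action.\<close>

lemma tensor_ses_cocycle:
  assumes c: "has_cocycle monoid_algebra lgen IL N' N (laurent_cochain a a2) (X, \<phi>, \<psi>)"
  shows "has_cocycle (Ugh q) gp.\<gamma> gp.I Mt' Mt (gp.gh_cochain a a2) (tensor_ses q V N' N (X, \<phi>, \<psi>))"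
proof -
  note D = is_extensionD[OF ext]
  let ?TX = "tensor_module q V X"
  let ?cX = "gh_V.coord X"
  let ?t = "tensor_map (vspace (Uq q) V) (vspace Laurent X) id \<phi>"
  let ?u = "tensor_map (vspace (Uq q) V) (vspace Laurent N') id \<psi>"
  note t = coord_tensor_map[OF gh_V[OF N.laurent_module_axioms] gh_V[OF X.laurent_module_axioms] module_hom_linear_map[OF D(2)]]
  note u = coord_tensor_map[OF gh_V[OF X.laurent_module_axioms] gh_V[OF N'.laurent_module_axioms] module_hom_linear_map[OF D(3)]]
  obtain s where s: "linear_section monoid_algebra N' X \<psi> s"
    and g: "\<And>t. X.L 1 0 (s t) = s (\<alpha>' * t) \<oplus>\<^bsub>X\<^esub> \<phi> (a * t)"
    and h: "\<And>t. X.L 0 1 (s t) = s (\<beta>' * t) \<oplus>\<^bsub>X\<^esub> \<phi> (a2 * t)" using laurent_cocycleE[OF c] by metis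
  note S = linear_sectionD[OF s, simplified] and F = module_homD[OF D(2), simplified]
  have Fs: "\<phi> (k * z) = Poly_Mapping.single 0 k \<odot>\<^bsub>X\<^esub> \<phi> z" for k z
    using F(3)[of "Poly_Mapping.single 0 k" z] by simp
  have s_lin: "linear_map (vspace monoid_algebra N') (vspace monoid_algebra X) s"
    using S by (auto simp: linear_map_def)
  let ?s = "tensor_map (vspace (Uq q) V) (vspace Laurent X) id s"
  note st = coord_tensor_map[OF gh_V[OF N'.laurent_module_axioms] gh_V[OF X.laurent_module_axioms] s_lin]
  note sl = linear_mapD[OF st(3), simplified]
  have c0: "\<zero>\<^bsub>Mt'\<^esub> \<in> carrier Mt'" by (rule gp.M'.M.M.zero_closed)
  have us: "?u (?s p) = p" if p: "p \<in> carrier Mt'" for p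
    by (rule gp.M'.\<kappa>_eqI[OF u(1)[OF st(1)[OF p]] p]) (simp add: u(2)[OF st(1)[OF p]] st(2)[OF p] S)
  have sec: "linear_section (Ugh q) Mt' ?TX ?u ?s"
    unfolding linear_section_def
  proof (intro conjI ballI allI Pi_I)
    fix p k assume p: "p \<in> carrier Mt'"
    show "?s p \<in> carrier ?TX" by (rule st(1)[OF p])
    show "?s (scal (Ugh q) k \<odot>\<^bsub>Mt'\<^esub> p) = scal (Ugh q) k \<odot>\<^bsub>?TX\<^esub> ?s p"
      using linear_mapD(3)[OF st(3)[OF p], of p k] p by simp
    show "?u (?s p) = p" by (rule us[OF p])
    show "?s (p \<oplus>\<^bsub>Mt'\<^esub> p') = ?s p \<oplus>\<^bsub>?TX\<^esub> ?s p'" if "p' \<in> carrier Mt'" for p'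
      using linear_mapD(2)[OF st(3)[OF p], of p p'] p that by simp
  qed
  have lin: "Poly_Mapping.single 0 k \<odot>\<^bsub>X\<^esub> (s (l * z) \<oplus>\<^bsub>X\<^esub> \<phi> (b * z)) = s (k * l * z) \<oplus>\<^bsub>X\<^esub> \<phi> (k * b * z)" for k l b z
    using X.vs.vr_distr[of "s (l * z)" "\<phi> (b * z)" k] S(1) F(1) S(3)[of k "l * z"] Fs[of k "b * z"]
    by (simp add: mult.assoc)
  have kd: "\<kappa> (gp.gh_cochain a a2 v p) i = (case v of
      E_gh \<Rightarrow> \<epsilon> * qint q (n - i) * a * \<kappa>' p (Suc i) | K_gh \<Rightarrow> weight q \<epsilon> n i * a * \<kappa>' p i
    | g_gh \<Rightarrow> a * \<kappa>' p i | h_gh \<Rightarrow> a2 * \<kappa>' p i | _ \<Rightarrow> 0)" if p: "p \<in> carrier Mt'" for v p i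
    using gp.M'.M.act_closed[OF p] gp.basis_match_simps(1) nz p
    by (cases v) (simp_all add: gp.gh_cochain_def gp.M.\<kappa>_scal' gp.basis_match_coord gp.M'.\<kappa>_E' gp.M'.\<kappa>_K')
  have dc: "gp.gh_cochain a a2 v p \<in> carrier Mt" if "p \<in> carrier Mt'" for v p by (rule gp.gh_cochain_closed[OF that])
  have main: "T.M.act (var v) (?s p) = ?s (gp.M'.M.act (var v) p) \<oplus>\<^bsub>?TX\<^esub> ?t (gp.gh_cochain a a2 v p)"
    if v: "v \<in> gp.I" and p: "p \<in> carrier Mt'" for v p
  proof (rule T.\<kappa>_inj)
    have pc: "gp.M'.M.act (var v) p \<in> carrier Mt'" by (rule gp.M'.M.act_closed[OF p])
    note sp = st(1)[OF p] and spc = st(1)[OF pc] and td = t(1)[OF dc[OF p, of v]]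
    show "T.M.act (var v) (?s p) \<in> carrier ?TX" by (rule T.M.act_closed[OF sp])
    show "?s (gp.M'.M.act (var v) p) \<oplus>\<^bsub>?TX\<^esub> ?t (gp.gh_cochain a a2 v p) \<in> carrier ?TX"
      by (rule T.M.M.a_closed[OF spc td])
    fix i assume i: "i \<le> n"
    have rhs: "?cX (?s (gp.M'.M.act (var v) p) \<oplus>\<^bsub>?TX\<^esub> ?t (gp.gh_cochain a a2 v p)) i =
      s (\<kappa>' (gp.M'.M.act (var v) p) i) \<oplus>\<^bsub>X\<^esub> \<phi> (\<kappa> (gp.gh_cochain a a2 v p) i)"
      using T.\<kappa>_add[OF spc td] st(2)[OF pc] t(2)[OF dc[OF p, of v]] by simp
    have phi0: "\<phi> 0 = \<zero>\<^bsub>X\<^esub>" using Fs[of 0 0] X.vs.vzero[of "\<phi> 0"] F(1) by simp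
    have s0: "s 0 = \<zero>\<^bsub>X\<^esub>" using S(3)[of 0 0] X.vs.vzero[of "s 0"] S(1) by simp
    from v consider "v = E_gh" | "v = F_gh" | "v = K_gh" | "v = g_gh" | "v = h_gh" by blast
    then have "?cX (T.M.act (var v) (?s p)) i = s (\<kappa>' (gp.M'.M.act (var v) p) i) \<oplus>\<^bsub>X\<^esub> \<phi> (case v of
        E_gh \<Rightarrow> \<epsilon> * qint q (n - i) * a * \<kappa>' p (Suc i) | K_gh \<Rightarrow> weight q \<epsilon> n i * a * \<kappa>' p i
        | g_gh \<Rightarrow> a * \<kappa>' p i | h_gh \<Rightarrow> a2 * \<kappa>' p i | _ \<Rightarrow> 0)"
    proof cases
      case 1
      then show ?thesis
        using T.\<kappa>_E[OF sp, of i] st(2)[OF p, of "Suc i"] gp.M'.\<kappa>_E'[OF p, of i] lin g by (simp add: mult.assoc)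
    next
      case 2
      show ?thesis
      proof (cases i)
        case 0
        then show ?thesis using 2 T.\<kappa>_F0[OF sp] gp.M'.\<kappa>_F0[OF p] by (simp add: phi0 s0)
      next
        case (Suc j)
        then show ?thesis using 2 i T.\<kappa>_F[OF sp, of j] gp.M'.\<kappa>_F'[OF p, of j] st(2)[OF p, of j] S X.vs.vclosed
          by (simp add: phi0)
      qed
    next
      case 3
      then show ?thesis
        using T.\<kappa>_K[OF sp, of i] st(2)[OF p, of i] gp.M'.\<kappa>_K'[OF p, of i] lin g by (simp add: mult.assoc)
    next
      case 4
      then show ?thesis
        using T.\<kappa>_g[OF sp, of i] st(2)[OF p, of i] gp.M'.\<kappa>_g'[OF p, of i] g by simp
    next
      case 5
      then show ?thesis
        using T.\<kappa>_h[OF sp, of i] st(2)[OF p, of i] gp.M'.\<kappa>_h'[OF p, of i] h by simp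
    qed
    then show "?cX (T.M.act (var v) (?s p)) i = ?cX (?s (gp.M'.M.act (var v) p) \<oplus>\<^bsub>?TX\<^esub> ?t (gp.gh_cochain a a2 v p)) i"
      unfolding rhs kd[OF p] .
  qed
  show ?thesis
    unfolding has_cocycle_def tensor_ses_def prod.case
    by (rule exI[of _ ?s]) (use sec main dc in \<open>simp add: generator_pres\<close>)
qed

end

end

section \<open>The isomorphism of extension spaces\<close>

context tensor_pair
begin

abbreviation "T \<equiv> tensor_ses q V N' N"

lemma tensor_ses_props:
  assumes "is_extension monoid_algebra N' N \<xi>"
  shows "is_extension (Ugh q) Mt' Mt (T \<xi>)"
    and "has_cocycle monoid_algebra lgen IL N' N (laurent_cochain a a2) \<xi> \<Longrightarrow>
      has_cocycle (Ugh q) gp.\<gamma> gp.I Mt' Mt (gp.gh_cochain a a2) (T \<xi>)"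
  using assms tensor_ses_extension tensor_ses_cocycle by (cases \<xi>, blast)+

lemma laurent_cocycle:
  assumes "is_extension monoid_algebra N' N \<xi>"
  obtains a a2 where "has_cocycle monoid_algebra lgen IL N' N (laurent_cochain a a2) \<xi>"
  using assms laurent_cocycle_exists by (cases \<xi>) blast

lemma tensor_ext_class:
  assumes xi: "is_extension monoid_algebra N' N \<xi>"
  shows "tensor_ext q V N' N (ext_class monoid_algebra N' N \<xi>) = ext_class (Ugh q) Mt' Mt (T \<xi>)"
proof -
  obtain a a2 where c: "has_cocycle monoid_algebra lgen IL N' N (laurent_cochain a a2) \<xi>" by (rule laurent_cocycle[OF xi])
  have "ext_class (Ugh q) Mt' Mt (T \<eta>) = ext_class (Ugh q) Mt' Mt (T \<xi>)"
    if "\<eta> \<in> ext_class monoid_algebra N' N \<xi>" for \<eta>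
  proof -
    note M = el.ext_class_memberD[OF xi that]
    show ?thesis
      by (rule gp.es.ext_class_eqI[OF tensor_ses_props(1)[OF M(1)] tensor_ses_props(1)[OF xi]
          tensor_ses_props(2)[OF M(1) M(3)[OF c]] tensor_ses_props(2)[OF xi c]]) (rule refl)
  qed
  then show ?thesis using el.ext_class_inhabited[OF xi] by (simp add: tensor_ext_def)
qed

text \<open>The relation between \<open>a\<close> and \<open>a2\<close> that holds for every extension over \<open>U\<^sub>g\<^sub>,\<^sub>h\<close> is the one under which
  the pair is realised over the Laurent polynomials.\<close>

lemma tensor_ext_surj:
  assumes z: "is_extension (Ugh q) Mt' Mt (Y, \<phi>, \<psi>)"
  shows "\<exists>C\<in>carrier (Ext1 (monoid_algebra :: ('k, 'k laurent) kalgebra) N' N).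
    tensor_ext q V N' N C = ext_class (Ugh q) Mt' Mt (Y, \<phi>, \<psi>)"
proof -
  let ?L = "monoid_algebra :: ('k, 'k laurent) kalgebra"
  interpret ge: gh_ext q \<epsilon> n \<alpha> \<beta> Mt \<kappa> \<alpha>' \<beta>' Mt' \<kappa>' Y \<phi> \<psi>
    by (intro gh_ext.intro gh_ext_axioms.intro gp.gh_pair_axioms z)
  obtain a a2 where c: "has_cocycle (Ugh q) gp.\<gamma> gp.I Mt' Mt (gp.gh_cochain a a2) (Y, \<phi>, \<psi>)"
    using ge.cocycle_exists by blast
  obtain \<xi> :: "('k laurent, 'k, 'k \<times> 'k, 'k) ses" where xi: "is_extension ?L N' N \<xi>"
    and cx: "has_cocycle ?L lgen IL N' N (laurent_cochain a a2) \<xi>"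
    using laurent_cocycle_realized[OF ge.cocycle_relation[OF c]] by blast
  have "tensor_ext q V N' N (ext_class ?L N' N \<xi>) = ext_class (Ugh q) Mt' Mt (Y, \<phi>, \<psi>)"
    unfolding tensor_ext_class[OF xi]
    by (rule gp.es.ext_class_eqI[OF tensor_ses_props(1)[OF xi] z tensor_ses_props(2)[OF xi cx] c]) (rule refl)
  then show ?thesis using el.Ext1_carrier[OF xi] by blast
qed

text \<open>On both sides a class is given by a pair \<open>(a, a2)\<close>, subject to the same relation and determined up to
  multiples of \<open>(\<alpha> - \<alpha>', \<beta> - \<beta>')\<close>; the functor preserves the pair, and the operations act on it linearly.\<close>

lemma tensor_ext_iso:
  "module_iso field_ring (Ext1 (monoid_algebra :: ('k, 'k laurent) kalgebra) N' N) (Ext1 (Ugh q) Mt' Mt) (tensor_ext q V N' N)"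
proof -
  let ?L = "monoid_algebra :: ('k, 'k laurent) kalgebra"
  let ?E = "Ext1 ?L N' N" and ?F = "Ext1 (Ugh q) Mt' Mt" and ?t = "tensor_ext q V N' N"
  let ?cl = "ext_class ?L N' N" and ?cu = "ext_class (Ugh q) Mt' Mt"
  have rep: "\<exists>\<xi> a a2. is_extension ?L N' N \<xi> \<and> C = ?cl \<xi> \<and>
      has_cocycle ?L lgen IL N' N (laurent_cochain a a2) (\<xi> :: ('k laurent, 'k, 'k \<times> 'k, 'k) ses)"
    if C: "C \<in> carrier ?E" for C
  proof -
    obtain \<xi> :: "('k laurent, 'k, 'k \<times> 'k, 'k) ses" where xi: "is_extension ?L N' N \<xi>" "C = ?cl \<xi>"
      using C by (force simp: Ext1_def)
    show ?thesis by (rule laurent_cocycle[OF xi(1)]) (use xi in blast)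
  qed
  have closed: "?t C \<in> carrier ?F" if C: "C \<in> carrier ?E" for C
  proof -
    obtain \<xi> :: "('k laurent, 'k, 'k \<times> 'k, 'k) ses" where xi: "is_extension ?L N' N \<xi>" "C = ?cl \<xi>"
      using rep[OF C] by blast
    show ?thesis unfolding xi(2) tensor_ext_class[OF xi(1)]
      by (rule gp.es.Ext1_carrier[OF tensor_ses_props(1)[OF xi(1)]])
  qed
  have add: "?t (C \<oplus>\<^bsub>?E\<^esub> C') = ?t C \<oplus>\<^bsub>?F\<^esub> ?t C'" if CC: "C \<in> carrier ?E" "C' \<in> carrier ?E" for C C'
  proof -
    obtain \<xi> :: "('k laurent, 'k, 'k \<times> 'k, 'k) ses" and a a2 where xi: "is_extension ?L N' N \<xi>" "C = ?cl \<xi>"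
      and c: "has_cocycle ?L lgen IL N' N (laurent_cochain a a2) \<xi>" using rep[OF CC(1)] by blast
    obtain \<eta> :: "('k laurent, 'k, 'k \<times> 'k, 'k) ses" and b b2 where eta: "is_extension ?L N' N \<eta>" "C' = ?cl \<eta>"
      and c': "has_cocycle ?L lgen IL N' N (laurent_cochain b b2) \<eta>" using rep[OF CC(2)] by blast
    note B = el.baer_sum_cocycle[OF xi(1) eta(1)]
    note Tx = tensor_ses_props(1)[OF xi(1)] tensor_ses_props(2)[OF xi(1) c]
    note Te = tensor_ses_props(1)[OF eta(1)] tensor_ses_props(2)[OF eta(1) c']
    have cB: "has_cocycle ?L lgen IL N' N (laurent_cochain (a + b) (a2 + b2)) (baer_sum N \<xi> \<eta>)"
      by (rule has_cocycle_cong[OF B(2)[OF c c']]) (auto simp: laurent_cochain_def distrib_right)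
    have "?t (C \<oplus>\<^bsub>?E\<^esub> C') = ?cu (T (baer_sum N \<xi> \<eta>))"
      unfolding xi(2) eta(2) el.Ext1_add[OF xi(1) eta(1) c c'] by (rule tensor_ext_class[OF B(1)])
    also have "\<dots> = ?cu (baer_sum Mt (T \<xi>) (T \<eta>))"
      by (rule gp.es.ext_class_eqI[OF tensor_ses_props(1)[OF B(1)] gp.es.baer_sum_cocycle(1)[OF Tx(1) Te(1)]
            tensor_ses_props(2)[OF B(1) cB] gp.es.baer_sum_cocycle(2)[OF Tx(1) Te(1) Tx(2) Te(2)]])
        (rule gp.gh_cochain_add)
    also have "\<dots> = ?t C \<oplus>\<^bsub>?F\<^esub> ?t C'"
      unfolding xi(2) eta(2) tensor_ext_class[OF xi(1)] tensor_ext_class[OF eta(1)]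
      by (rule gp.es.Ext1_add[OF Tx(1) Te(1) Tx(2) Te(2), symmetric])
    finally show ?thesis .
  qed
  have smult: "?t (k \<odot>\<^bsub>?E\<^esub> C) = k \<odot>\<^bsub>?F\<^esub> ?t C" if C: "C \<in> carrier ?E" for k C
  proof -
    obtain \<xi> :: "('k laurent, 'k, 'k \<times> 'k, 'k) ses" and a a2 where xi: "is_extension ?L N' N \<xi>" "C = ?cl \<xi>"
      and c: "has_cocycle ?L lgen IL N' N (laurent_cochain a a2) \<xi>" using rep[OF C] by blast
    note B = el.ext_scale_cocycle[OF xi(1), where c=k]
    note Tx = tensor_ses_props(1)[OF xi(1)] tensor_ses_props(2)[OF xi(1) c]
    have cB: "has_cocycle ?L lgen IL N' N (laurent_cochain (k * a) (k * a2)) (ext_scale ?L N' k \<xi>)"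
      by (rule has_cocycle_cong[OF B(2)[OF c]]) (auto simp: laurent_cochain_def)
    have "?t (k \<odot>\<^bsub>?E\<^esub> C) = ?cu (T (ext_scale ?L N' k \<xi>))"
      unfolding xi(2) el.Ext1_smult[OF xi(1) c] by (rule tensor_ext_class[OF B(1)])
    also have "\<dots> = ?cu (ext_scale (Ugh q) Mt' k (T \<xi>))"
      by (rule gp.es.ext_class_eqI[OF tensor_ses_props(1)[OF B(1)] gp.es.ext_scale_cocycle(1)[OF Tx(1)]
            tensor_ses_props(2)[OF B(1) cB] gp.es.ext_scale_cocycle(2)[OF Tx]])
        (simp add: gp.gh_cochain_scale)
    also have "\<dots> = k \<odot>\<^bsub>?F\<^esub> ?t C"
      unfolding xi(2) tensor_ext_class[OF xi(1)] by (rule gp.es.Ext1_smult[OF Tx, symmetric])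
    finally show ?thesis .
  qed
  have inj: "inj_on ?t (carrier ?E)"
  proof (rule inj_onI)
    fix C C' assume CC: "C \<in> carrier ?E" "C' \<in> carrier ?E" and eq: "?t C = ?t C'"
    obtain \<xi> :: "('k laurent, 'k, 'k \<times> 'k, 'k) ses" and a a2 where xi: "is_extension ?L N' N \<xi>" "C = ?cl \<xi>"
      and c: "has_cocycle ?L lgen IL N' N (laurent_cochain a a2) \<xi>" using rep[OF CC(1)] by blast
    obtain \<eta> :: "('k laurent, 'k, 'k \<times> 'k, 'k) ses" and b b2 where eta: "is_extension ?L N' N \<eta>" "C' = ?cl \<eta>"
      and c': "has_cocycle ?L lgen IL N' N (laurent_cochain b b2) \<eta>" using rep[OF CC(2)] by blast
    note Tx = tensor_ses_props(1)[OF xi(1)] tensor_ses_props(2)[OF xi(1) c]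
    note Te = tensor_ses_props(1)[OF eta(1)] tensor_ses_props(2)[OF eta(1) c']
    have same: "?cu (T \<xi>) = ?cu (T \<eta>)"
      using eq unfolding xi(2) eta(2) tensor_ext_class[OF xi(1)] tensor_ext_class[OF eta(1)] .
    obtain \<zeta> where z: "\<zeta> \<in> ?cu (T \<xi>)" using gp.es.ext_class_inhabited[OF Tx(1)] by auto
    note Z = gp.es.ext_class_memberD[OF Tx(1) z] gp.es.ext_class_memberD[OF Te(1) z[unfolded same]]
    obtain Y \<phi> \<psi> where [simp]: "\<zeta> = (Y, \<phi>, \<psi>)" by (metis prod_cases3)
    interpret ge: gh_ext q \<epsilon> n \<alpha> \<beta> Mt \<kappa> \<alpha>' \<beta>' Mt' \<kappa>' Y \<phi> \<psi>
      by (intro gh_ext.intro gh_ext_axioms.intro gp.gh_pair_axioms) (use Z(1) in simp)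
    obtain t where t: "b = a + t * (\<alpha> - \<alpha>')" "b2 = a2 + t * (\<beta> - \<beta>')"
      using ge.cocycle_unique[of a a2 b b2] Z(3)[OF Tx(2)] Z(6)[OF Te(2)] by auto
    obtain X f g where e: "\<xi> = (X, f, g)" by (metis prod_cases3)
    have "has_cocycle ?L lgen IL N' N (laurent_cochain b b2) \<xi>"
      using laurent_cocycle_shift[OF xi(1)[unfolded e] c[unfolded e], of t] by (simp add: t e)
    then show "C = C'"
      unfolding xi(2) eta(2) by (rule el.ext_class_eqI[OF xi(1) eta(1) _ c']) (rule refl)
  qed
  have surj: "\<exists>C\<in>carrier ?E. ?t C = D" if "D \<in> carrier ?F" for D
    using that tensor_ext_surj unfolding Ext1_def[of "Ugh q"] by auto
  have "?t ` carrier ?E = carrier ?F"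
    using closed surj by (intro subset_antisym image_subsetI subsetI) (blast, metis imageI)
  then show ?thesis
    unfolding module_iso_def module_hom_def bij_betw_def
    using closed add smult inj by (simp add: Pi_iff)
qed

end

section \<open>Vanishing of extension groups\<close>

text \<open>The operator \<open>(p - b) / (a - b)\<close> kills \<open>Q\<close> and induces the identity of \<open>P\<close>.\<close>

lemma split_if_different_scalars:
  assumes P: "gh_module q P" and Q: "gh_module q Q"
    and xi: "is_extension (Ugh q) P Q (X, \<phi>, \<psi>)"
    and p: "module_hom (Ugh q) X X (\<lambda>x. pres (gh_relations q) p \<odot>\<^bsub>X\<^esub> x)"
    and sP: "\<And>x. x \<in> carrier P \<Longrightarrow> pres (gh_relations q) p \<odot>\<^bsub>P\<^esub> x = pres (gh_relations q) (const a) \<odot>\<^bsub>P\<^esub> x"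
    and sQ: "\<And>x. x \<in> carrier Q \<Longrightarrow> pres (gh_relations q) p \<odot>\<^bsub>Q\<^esub> x = pres (gh_relations q) (const b) \<odot>\<^bsub>Q\<^esub> x"
    and ab: "a \<noteq> b"
  shows "ext_equiv (Ugh q) P Q (split_ext P Q) (X, \<phi>, \<psi>)"
proof -
  note D = is_extensionD[OF xi]
  interpret P: gh_module q P by (rule P)
  interpret Q: gh_module q Q by (rule Q)
  interpret X: gh_module q X by (intro gh_module.intro pres_module.intro D(1))
  interpret ext_setting "Ugh q" "generator (gh_relations q)" "{E_gh, F_gh, K_gh, g_gh, h_gh}" P Q
    by (intro ext_setting.intro ext_setting_axioms.intro kalg_presented_algebra P.generated
        P.left_module_axioms Q.left_module_axioms)
  note F = module_homD[OF D(2)] and G = module_homD[OF D(3)]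
  have fh: "\<phi> (Q.act r z) = X.act r (\<phi> z)" if "z \<in> carrier Q" for r z
    using F(3)[of "pres (gh_relations q) r" z] that by simp
  have gh: "\<psi> (X.act r x) = P.act r (\<psi> x)" if "x \<in> carrier X" for r x
    using G(3)[of "pres (gh_relations q) r" x] that by simp
  let ?T = "\<lambda>x. X.sc (inverse (a - b)) (X.act p x \<ominus>\<^bsub>X\<^esub> X.sc b x)"
  have T: "module_hom (Ugh q) X X ?T"
    unfolding module_hom_def
  proof (intro conjI ballI Pi_I)
    fix x assume x: "x \<in> carrier X"
    show "?T x \<in> carrier X" using x by simp
    show "?T (x \<oplus>\<^bsub>X\<^esub> y) = ?T x \<oplus>\<^bsub>X\<^esub> ?T y" if "y \<in> carrier X" for y
      using x that by (simp add: X.act_linear X.M.minus_eq X.M.minus_add X.M.a_ac)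
    show "?T (u \<odot>\<^bsub>X\<^esub> x) = u \<odot>\<^bsub>X\<^esub> ?T x" if u: "u \<in> carrier (Ugh q)" for u
    proof -
      obtain r where r: "u = pres (gh_relations q) r" using u by auto
      have "X.act p (X.act r x) = X.act r (X.act p x)" using module_homD(3)[OF p u, of x] x by (simp add: r)
      then show ?thesis using x by (simp add: r X.act_const_commute[of _ r] X.act_minus)
    qed
  qed
  show ?thesis
  proof (rule split_if_retraction[OF xi T])
    fix z assume z: "z \<in> carrier Q"
    have "X.act p (\<phi> z) = X.sc b (\<phi> z)" using sQ[OF z] z by (simp flip: fh)
    then show "?T (\<phi> z) = \<zero>\<^bsub>X\<^esub>" using F(1)[OF z] by (simp add: X.M.minus_eq X.M.r_neg)
  next
    fix x assume x: "x \<in> carrier X"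
    have px: "\<psi> x \<in> carrier P" using G(1) x by simp
    have "\<psi> (?T x) = P.sc (inverse (a - b)) (P.act p (\<psi> x) \<ominus>\<^bsub>P\<^esub> P.sc b (\<psi> x))"
      using x by (simp add: gh module_hom_zero_minus(3)[OF D(1) P.left_module_axioms D(3)])
    also have "\<dots> = P.sc (inverse (a - b)) (P.sc (a - b) (\<psi> x))"
      using px sP[OF px] by (simp add: P.sc_simps(5))
    also have "\<dots> = \<psi> x" using px ab P.sc_simps(1)[OF px, of "inverse (a - b)" "a - b"] P.sc_simps(2)[OF px] by simp
    finally show "\<psi> (?T x) = \<psi> x" .
  qed
qed

text \<open>Since \<open>g\<close>, \<open>h\<close> and the Casimir element act as module maps, their scalars can be computed at the
  highest weight vector.\<close>

lemma V_gh_scalars: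
  assumes W: "is_V_gh q \<epsilon> n \<alpha> \<beta> W" and x: "x \<in> carrier W"
    and q: "q \<noteq> 0" "q - inverse q \<noteq> 0" and eps: "\<epsilon> * \<epsilon> = 1" and nz: "\<alpha> \<noteq> 0"
  defines "a \<equiv> \<lambda>p. pres (gh_relations q) p \<odot>\<^bsub>W\<^esub> x"
  shows "gh_module q W" "a (var g_gh) = a (const \<alpha>)" "a (var h_gh) = a (const \<beta>)"
    and "a (casimir q) = a (const (\<alpha> * (inverse (q - inverse q))\<^sup>2 * (\<epsilon> * q ^ Suc n + inverse (\<epsilon> * q ^ Suc n))))"
proof -
  have "left_module (Ugh q) W" using W by (simp add: is_V_gh_def simple_module_def)
  then show "gh_module q W" by (intro gh_module.intro pres_module.intro)
  then interpret gh_module q W .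
  obtain w where w: "w \<in> carrier W" and span: "module_span (Ugh q) W {w} = carrier W"
    and Ew: "E w = \<zero>\<^bsub>W\<^esub>" and Kw: "K w = sc (\<epsilon> * \<alpha> * q ^ n) w"
    and gw: "g w = sc \<alpha> w" and hw: "h w = sc \<beta> w"
    using W unfolding is_V_gh_def Let_def generator_pres by auto
  show "a (var g_gh) = a (const \<alpha>)" "a (var h_gh) = a (const \<beta>)"
    unfolding a_def by (rule hom_scalar[OF g_hom w span gw x], rule hom_scalar[OF h_hom w span hw x])
  have e0: "\<epsilon> \<noteq> 0" "inverse \<epsilon> = \<epsilon>" using eps by (auto intro: inverse_unique)
  have Kiw: "Ki w = sc (inverse (\<epsilon> * \<alpha> * q ^ n)) w"
  proof -
    have "w = sc (\<epsilon> * \<alpha> * q ^ n) (Ki w)" using w gh_rels(2)[of w] by (simp add: Kw var_sc)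
    then have "sc (inverse (\<epsilon> * \<alpha> * q ^ n)) w = sc (inverse (\<epsilon> * \<alpha> * q ^ n)) (sc (\<epsilon> * \<alpha> * q ^ n) (Ki w))"
      by (rule arg_cong)
    moreover have "\<epsilon> * \<alpha> * q ^ n \<noteq> 0" using e0 nz q by simp
    ultimately show ?thesis using w sc_simps(1,2)[of "Ki w"] by (metis act_closed left_inverse)
  qed
  let ?d = "inverse (q - inverse q)"
  have "act (casimir q) w = sc (?d * ?d * q * (\<epsilon> * \<alpha> * q ^ n) + ?d * ?d * inverse q * (\<alpha> * \<alpha> * inverse (\<epsilon> * \<alpha> * q ^ n))) w"
    using w by (simp add: casimir_def Let_def act_add act_mult Ew Kw gw Kiw var_sc sc_simps(1) sc_simps(4) mult.assoc)
  also have "?d * ?d * q * (\<epsilon> * \<alpha> * q ^ n) + ?d * ?d * inverse q * (\<alpha> * \<alpha> * inverse (\<epsilon> * \<alpha> * q ^ n)) =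
    \<alpha> * ?d\<^sup>2 * (\<epsilon> * q ^ Suc n + inverse (\<epsilon> * q ^ Suc n))"
    using nz q(1) e0(1) by (simp add: power2_eq_square distrib_left mult_ac)
  finally have "act (casimir q) w = sc (\<alpha> * ?d\<^sup>2 * (\<epsilon> * q ^ Suc n + inverse (\<epsilon> * q ^ Suc n))) w" .
  then show "a (casimir q) = a (const (\<alpha> * ?d\<^sup>2 * (\<epsilon> * q ^ Suc n + inverse (\<epsilon> * q ^ Suc n))))"
    unfolding a_def by (rule hom_scalar[OF casimir_hom[OF q] w span _ x])
qed

text \<open>The equation \<open>u + u\<^sup>-\<^sup>1 = v + v\<^sup>-\<^sup>1\<close> means \<open>u = v\<close> or \<open>u v = 1\<close>. Squaring removes the signs, and then the
  second possibility makes \<open>q\<close> a root of unity.\<close>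

lemma casimir_value_injective:
  fixes q :: "'k::field"
  assumes q: "q \<noteq> 0" "\<And>k. k > 0 \<Longrightarrow> q ^ k \<noteq> 1" and eps: "\<epsilon> * \<epsilon> = 1" "\<epsilon>' * \<epsilon>' = 1"
    and eq: "\<epsilon> * q ^ Suc m + inverse (\<epsilon> * q ^ Suc m) = \<epsilon>' * q ^ Suc n + inverse (\<epsilon>' * q ^ Suc n)"
  shows "\<epsilon> = \<epsilon>' \<and> m = n"
proof -
  define u v where "u = \<epsilon> * q ^ Suc m" and "v = \<epsilon>' * q ^ Suc n"
  have nz: "u \<noteq> 0" "v \<noteq> 0" using q eps by (auto simp: u_def v_def)
  have u2: "u * u = q ^ (2 * Suc m)" and v2: "v * v = q ^ (2 * Suc n)"
  proof -
    have "u * u = (\<epsilon> * \<epsilon>) * (q ^ Suc m * q ^ Suc m)" "v * v = (\<epsilon>' * \<epsilon>') * (q ^ Suc n * q ^ Suc n)"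
      unfolding u_def v_def by (simp_all only: mult_ac)
    then show "u * u = q ^ (2 * Suc m)" "v * v = q ^ (2 * Suc n)"
      unfolding eps mult_2 power_add by simp_all
  qed
  have e: "u + inverse u = v + inverse v" using eq by (simp only: u_def v_def)
  have "(u - v) * (u * v - 1) = (u + inverse u - (v + inverse v)) * (u * v)"
    using nz by (simp add: algebra_simps)
  then have "u = v \<or> u * v = 1" by (simp add: e)
  then show ?thesis
  proof
    assume uv: "u = v"
    have le: "i = j" if "q ^ (2 * Suc i) = q ^ (2 * Suc j)" "i \<le> j" for i j
    proof (rule ccontr)
      assume "i \<noteq> j"
      have "q ^ (2 * Suc j) = q ^ (2 * Suc i) * q ^ (2 * (j - i))"
        unfolding power_add[symmetric] using that(2) by (intro arg_cong[of _ _ "\<lambda>k. q ^ k"]) arith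
      then have "q ^ (2 * (j - i)) = 1" using that(1) q(1) by simp
      then show False using q(2)[of "2 * (j - i)"] \<open>i \<noteq> j\<close> that(2) by simp
    qed
    have "m = n" using le[of m n] le[of n m] u2 v2 uv by (metis nat_le_linear)
    moreover from this have "\<epsilon> = \<epsilon>'" using uv q(1) by (simp add: u_def v_def)
    ultimately show ?thesis by simp
  next
    assume uv: "u * v = 1"
    have "q ^ (2 * Suc m + 2 * Suc n) = (u * v) * (u * v)"
      unfolding power_add u2[symmetric] v2[symmetric] by (simp only: mult_ac)
    then show ?thesis using uv q(2)[of "2 * Suc m + 2 * Suc n"] by simp
  qed
qed

text \<open>Different simple modules are separated by the scalars of \<open>g\<close>, of \<open>h\<close>, or of the Casimir element.\<close>

lemma Ext1_different_simples_zero: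
  fixes q :: "'k::field"
  assumes q: "q \<noteq> 0" "q - inverse q \<noteq> 0" "\<And>k. k > 0 \<Longrightarrow> q ^ k \<noteq> 1" and eps: "\<epsilon> * \<epsilon> = 1" "\<epsilon>' * \<epsilon>' = 1"
    and nz: "\<alpha> \<noteq> 0" "\<alpha>' \<noteq> 0"
    and P: "is_V_gh q \<epsilon> m \<alpha> \<beta> P" and Q: "is_V_gh q \<epsilon>' n \<alpha>' \<beta>' Q"
    and neq: "(\<epsilon>, m, \<alpha>, \<beta>) \<noteq> (\<epsilon>', n, \<alpha>', \<beta>')"
  shows "carrier (Ext1 (Ugh q) P Q) = {\<zero>\<^bsub>Ext1 (Ugh q) P Q\<^esub>}"
proof -
  note sP = V_gh_scalars[OF P _ q(1,2) eps(1) nz(1)] and sQ = V_gh_scalars[OF Q _ q(1,2) eps(2) nz(2)]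
  have "left_module (Ugh q) P" "left_module (Ugh q) Q" using P Q by (auto simp: is_V_gh_def simple_module_def)
  then have PQ: "gh_module q P" "gh_module q Q" by (auto intro: gh_module.intro pres_module.intro)
  interpret P: gh_module q P by (rule PQ)
  interpret Q: gh_module q Q by (rule PQ)
  interpret ext_setting "Ugh q" "generator (gh_relations q)" "{E_gh, F_gh, K_gh, g_gh, h_gh}" P Q
    by (intro ext_setting.intro ext_setting_axioms.intro kalg_presented_algebra P.generated
        P.left_module_axioms Q.left_module_axioms)
  have "ext_class (Ugh q) P Q \<xi> = ext_class (Ugh q) P Q (split_ext P Q)" if xi: "is_extension (Ugh q) P Q \<xi>" for \<xi>
  proof -
    obtain X \<phi> \<psi> where e: "\<xi> = (X, \<phi>, \<psi>)" by (metis prod_cases3)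
    note xi' = xi[unfolded e]
    interpret X: gh_module q X by (intro gh_module.intro pres_module.intro is_extensionD(1)[OF xi'])
    note split = split_if_different_scalars[OF PQ xi']
    consider "\<alpha> \<noteq> \<alpha>'" | "\<beta> \<noteq> \<beta>'" | "\<alpha> = \<alpha>'" "\<epsilon> \<noteq> \<epsilon>' \<or> m \<noteq> n" using neq by auto
    then have "ext_equiv (Ugh q) P Q (split_ext P Q) (X, \<phi>, \<psi>)"
    proof cases
      case 1
      show ?thesis by (rule split[OF X.g_hom sP(2) sQ(2) 1])
    next
      case 2
      show ?thesis by (rule split[OF X.h_hom sP(3) sQ(3) 2])
    next
      case 3
      have "\<epsilon> * q ^ Suc m + inverse (\<epsilon> * q ^ Suc m) \<noteq> \<epsilon>' * q ^ Suc n + inverse (\<epsilon>' * q ^ Suc n)"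
        using casimir_value_injective[OF q(1,3) eps] 3(2) by blast
      moreover have "\<alpha>' * (inverse (q - inverse q))\<^sup>2 \<noteq> 0" using nz q(2) by simp
      ultimately have ne: "\<alpha> * (inverse (q - inverse q))\<^sup>2 * (\<epsilon> * q ^ Suc m + inverse (\<epsilon> * q ^ Suc m)) \<noteq>
        \<alpha>' * (inverse (q - inverse q))\<^sup>2 * (\<epsilon>' * q ^ Suc n + inverse (\<epsilon>' * q ^ Suc n))"
        unfolding 3(1) mult_cancel_left by blast
      show ?thesis by (rule split[OF X.casimir_hom[OF q(1,2)] sP(4) sQ(4) ne])
    qed
    then show ?thesis unfolding e by (rule ext_class_eq[OF split_ext_is_extension xi', symmetric])
  qed
  then have "carrier (Ext1 (Ugh q) P Q) \<subseteq> {\<zero>\<^bsub>Ext1 (Ugh q) P Q\<^esub>}" by (auto simp: Ext1_def)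
  moreover have "\<zero>\<^bsub>Ext1 (Ugh q) P Q\<^esub> \<in> carrier (Ext1 (Ugh q) P Q)"
    using Ext1_carrier[OF split_ext_is_extension] by (simp add: Ext1_def)
  ultimately show ?thesis by blast
qed

theorem theorem3p10:
  fixes q :: "'k::{alg_closed_field, field_char_0}"
  assumes q_nonzero: "q \<noteq> 0"
    and q_square: "q\<^sup>2 \<noteq> 1"
    and q_not_root_of_unity: "\<forall>k::nat. k > 0 \<longrightarrow> q ^ k \<noteq> 1"
  shows
    "(\<forall>\<epsilon> n \<alpha> \<beta> \<alpha>' \<beta>'.
        \<epsilon> \<in> {1, -1} \<and> \<alpha> \<noteq> 0 \<and> \<beta> \<noteq> 0 \<and> \<alpha>' \<noteq> 0 \<and> \<beta>' \<noteq> 0 \<longrightarrow>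
        (let V = V_module q \<epsilon> n;
             N = K_module \<alpha> \<beta>; N' = K_module \<alpha>' \<beta>';
             M = tensor_module q V N; M' = tensor_module q V N'
         in is_V_gh q \<epsilon> n \<alpha> \<beta> M \<and>
            is_V_gh q \<epsilon> n \<alpha>' \<beta>' M' \<and>
            (\<forall>W :: ((gh_gen, 'k) free_alg set, 'w) module.
               (is_V_gh q \<epsilon> n \<alpha> \<beta> W \<longrightarrow> isomorphic_modules (Ugh q) M W) \<and>
               (is_V_gh q \<epsilon> n \<alpha>' \<beta>' W \<longrightarrow> isomorphic_modules (Ugh q) M' W)) \<and>
            (\<forall>\<xi> :: ('k laurent, 'k, 'k \<times> 'k, 'k) ses. is_extension Laurent N' N \<xi> \<longrightarrow>
               tensor_ext q V N' N (ext_class Laurent N' N \<xi>) =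
               ext_class (Ugh q) M' M (tensor_ses q V N' N \<xi>)) \<and>
            module_iso field_ring (Ext1 Laurent N' N) (Ext1 (Ugh q) M' M) (tensor_ext q V N' N)))
     \<and>
     (\<forall>\<epsilon> \<epsilon>' m n \<alpha> \<beta> \<alpha>' \<beta>'
        (P :: ((gh_gen, 'k) free_alg set, 'p) module) (Q :: ((gh_gen, 'k) free_alg set, 'r) module).
        \<epsilon> \<in> {1, -1} \<and> \<epsilon>' \<in> {1, -1} \<and> \<alpha> \<noteq> 0 \<and> \<beta> \<noteq> 0 \<and> \<alpha>' \<noteq> 0 \<and> \<beta>' \<noteq> 0 \<and>
        is_V_gh q \<epsilon> m \<alpha> \<beta> P \<and> is_V_gh q \<epsilon>' n \<alpha>' \<beta>' Q \<and>
        (\<epsilon>, m, \<alpha>, \<beta>) \<noteq> (\<epsilon>', n, \<alpha>', \<beta>') \<longrightarrow>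
        carrier (Ext1 (Ugh q) P Q) = {\<zero>\<^bsub>Ext1 (Ugh q) P Q\<^esub>})"
proof -
  have qi: "q - inverse q \<noteq> 0"
  proof
    assume "q - inverse q = 0"
    then have "q * q = 1" using q_nonzero by (simp add: field_simps)
    then show False using q_square by (simp add: power2_eq_square)
  qed
  have nr: "q ^ k \<noteq> 1" if "k > 0" for k :: nat using q_not_root_of_unity that by blast
  have eps: "\<epsilon> * \<epsilon> = 1" if "\<epsilon> \<in> {1, -1}" for \<epsilon> :: 'k using that by auto
  show ?thesis
  proof (intro conjI allI impI, goal_cases)
    case (1 \<epsilon> n \<alpha> \<beta> \<alpha>' \<beta>')
    interpret tensor_pair q \<epsilon> n \<alpha> \<beta> \<alpha>' \<beta>'
      by (intro tensor_pair.intro uq_params.intro laurent_pair.intro tensor_pair_axioms.intro)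
        (use 1 q_nonzero qi eps nr in auto)
    show ?case
      unfolding Let_def
      using gp.M.is_V_gh gp.M'.is_V_gh gp.M.isomorphic_if_is_V_gh gp.M'.isomorphic_if_is_V_gh
        tensor_ext_class tensor_ext_iso by blast
  next
    case (2 \<epsilon> \<epsilon>' m n \<alpha> \<beta> \<alpha>' \<beta>' P Q)
    then show ?case
      using Ext1_different_simples_zero[OF q_nonzero qi nr eps eps] by metis
  qed
qed

end
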